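(* Let $K$ be a countable field, and let $\mathfrak{M}$ be either the variety $\mathcal{L}_K$ of Lie $K$-algebras, or (when $\operatorname{char}K\neq 2$) the variety $\mathcal{SJ}_K$ generated by the special Jordan $K$-algebras. Then there exist a $K$-algebra $A$ in $\mathfrak{M}$ and a field extension $F$ of $K$ such that $A$ does not contain a free $K$-algebra in $\mathfrak{M}$ on at least two free generators, but $F\otimes_K A$ contains a free $K$-algebra in $\mathfrak{M}$ on at least two free generators.
   Context: For a variety $\mathfrak{M}$ of $K$-algebras, the free $K$-algebra in $\mathfrak{M}$ with set of free generators $Y$ is the algebra in $\mathfrak{M}$ containing $Y$ such that every map from $Y$ to an algebra $B\in\mathfrak{M}$ extends uniquely to a $K$-algebra homomorphism into $B$. A $K$-algebra "contains a free $K$-algebra in $\mathfrak{M}$ on at least two free generators" if some $K$-subalgebra of it is a free algebra in $\mathfrak{M}$ with a set of free generators having at least two elements. For $\operatorname{char}K\ne 2$ and an associative $K$-algebra $B$, $B^{(+)}$ denotes the vector space $B$ with the product $x\circ y=\frac12(xy+yx)$. A special Jordan $K$-algebra is a subspace of some associative $K$-algebra $B$ that is closed under $\circ$, with product $\circ$. The variety $\mathcal{SJ}_K$ is the variety generated by all special Jordan $K$-algebras; it consists of all homomorphic images of special Jordan $K$-algebras. The free algebra on $Y$ in $\mathcal{SJ}_K$ is the subalgebra of $K\langle Y\rangle^{(+)}$ generated by $Y$, where $K\langle Y\rangle$ is the free associative $K$-algebra on $Y$. *)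

theory Defs
  imports "HOL-Algebra.QuotRing" "HOL-Algebra.Module" "HOL-Library.Countable_Set"
begin

section \<open>Algebras over a field\<close>

text \<open>
  Algebras are neither associative nor unital in general. They are carried by the record type of
  modules from the library, whose product component is unused there; the component \<open>one\<close>
  is never referred to.
\<close>

locale nonassoc_algebra = module K A + field K for K (structure) and A (structure) +
  assumes mult_closed:
      "\<lbrakk>x \<in> carrier A; y \<in> carrier A\<rbrakk> \<Longrightarrow> x \<otimes>\<^bsub>A\<^esub> y \<in> carrier A"
    and mult_l_distr:
      "\<lbrakk>x \<in> carrier A; y \<in> carrier A; z \<in> carrier A\<rbrakk> \<Longrightarrow>
        (x \<oplus>\<^bsub>A\<^esub> y) \<otimes>\<^bsub>A\<^esub> z = x \<otimes>\<^bsub>A\<^esub> z \<oplus>\<^bsub>A\<^esub> y \<otimes>\<^bsub>A\<^esub> z"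
    and mult_r_distr:
      "\<lbrakk>x \<in> carrier A; y \<in> carrier A; z \<in> carrier A\<rbrakk> \<Longrightarrow>
        x \<otimes>\<^bsub>A\<^esub> (y \<oplus>\<^bsub>A\<^esub> z) = x \<otimes>\<^bsub>A\<^esub> y \<oplus>\<^bsub>A\<^esub> x \<otimes>\<^bsub>A\<^esub> z"
    and smult_mult_l:
      "\<lbrakk>c \<in> carrier K; x \<in> carrier A; y \<in> carrier A\<rbrakk> \<Longrightarrow>
        (c \<odot>\<^bsub>A\<^esub> x) \<otimes>\<^bsub>A\<^esub> y = c \<odot>\<^bsub>A\<^esub> (x \<otimes>\<^bsub>A\<^esub> y)"
    and smult_mult_r:
      "\<lbrakk>c \<in> carrier K; x \<in> carrier A; y \<in> carrier A\<rbrakk> \<Longrightarrow>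
        x \<otimes>\<^bsub>A\<^esub> (c \<odot>\<^bsub>A\<^esub> y) = c \<odot>\<^bsub>A\<^esub> (x \<otimes>\<^bsub>A\<^esub> y)"

locale assoc_algebra = nonassoc_algebra +
  assumes mult_assoc:
      "\<lbrakk>x \<in> carrier A; y \<in> carrier A; z \<in> carrier A\<rbrakk> \<Longrightarrow>
        (x \<otimes>\<^bsub>A\<^esub> y) \<otimes>\<^bsub>A\<^esub> z = x \<otimes>\<^bsub>A\<^esub> (y \<otimes>\<^bsub>A\<^esub> z)"

definition alg_hom ::
    "'k ring \<Rightarrow> ('k, 'a) module \<Rightarrow> ('k, 'b) module \<Rightarrow> ('a \<Rightarrow> 'b) set" where
  "alg_hom K A B = {h \<in> carrier A \<rightarrow> carrier B.
     (\<forall>x\<in>carrier A. \<forall>y\<in>carrier A. h (x \<oplus>\<^bsub>A\<^esub> y) = h x \<oplus>\<^bsub>B\<^esub> h y) \<and>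
     (\<forall>x\<in>carrier A. \<forall>y\<in>carrier A. h (x \<otimes>\<^bsub>A\<^esub> y) = h x \<otimes>\<^bsub>B\<^esub> h y) \<and>
     (\<forall>c\<in>carrier K. \<forall>x\<in>carrier A. h (c \<odot>\<^bsub>A\<^esub> x) = c \<odot>\<^bsub>B\<^esub> h x)}"

definition is_subalgebra :: "'k ring \<Rightarrow> 'a set \<Rightarrow> ('k, 'a) module \<Rightarrow> bool" where
  "is_subalgebra K S A \<longleftrightarrow>
     submodule S K A \<and> (\<forall>x\<in>S. \<forall>y\<in>S. x \<otimes>\<^bsub>A\<^esub> y \<in> S)"


section \<open>Varieties\<close>

text \<open>
  A variety is given by a set of terms, representing nonassociative polynomials without constant
  term; an algebra belongs to it when all these polynomials vanish identically on the algebra.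
\<close>

datatype (scalars: 'k) na_poly =
    Var nat
  | Add "'k na_poly" "'k na_poly"
  | Scale 'k "'k na_poly"
  | Mult "'k na_poly" "'k na_poly"

primrec na_eval :: "('k, 'a) module \<Rightarrow> (nat \<Rightarrow> 'a) \<Rightarrow> 'k na_poly \<Rightarrow> 'a" where
  "na_eval A \<sigma> (Var i) = \<sigma> i"
| "na_eval A \<sigma> (Add s t) = na_eval A \<sigma> s \<oplus>\<^bsub>A\<^esub> na_eval A \<sigma> t"
| "na_eval A \<sigma> (Scale c t) = c \<odot>\<^bsub>A\<^esub> na_eval A \<sigma> t"
| "na_eval A \<sigma> (Mult s t) = na_eval A \<sigma> s \<otimes>\<^bsub>A\<^esub> na_eval A \<sigma> t"

definition satisfies_identity :: "('k, 'a) module \<Rightarrow> 'k na_poly \<Rightarrow> bool" where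
  "satisfies_identity A t \<longleftrightarrow>
     (\<forall>\<sigma>. (\<forall>i. \<sigma> i \<in> carrier A) \<longrightarrow> na_eval A \<sigma> t = \<zero>\<^bsub>A\<^esub>)"

definition in_variety :: "'k ring \<Rightarrow> 'k na_poly set \<Rightarrow> ('k, 'a) module \<Rightarrow> bool" where
  "in_variety K V A \<longleftrightarrow> nonassoc_algebra K A \<and> (\<forall>t\<in>V. satisfies_identity A t)"

definition lie_identities :: "'k na_poly set" where
  "lie_identities =
     {Mult (Var 0) (Var 0),
      Add (Mult (Var 0) (Mult (Var 1) (Var 2)))
        (Add (Mult (Var 1) (Mult (Var 2) (Var 0))) (Mult (Var 2) (Mult (Var 0) (Var 1))))}"

lemma in_lie_variety_iff:
  "in_variety K lie_identities A \<longleftrightarrow>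
     nonassoc_algebra K A \<and>
     (\<forall>x\<in>carrier A. x \<otimes>\<^bsub>A\<^esub> x = \<zero>\<^bsub>A\<^esub>) \<and>
     (\<forall>x\<in>carrier A. \<forall>y\<in>carrier A. \<forall>z\<in>carrier A.
        x \<otimes>\<^bsub>A\<^esub> (y \<otimes>\<^bsub>A\<^esub> z) \<oplus>\<^bsub>A\<^esub>
          (y \<otimes>\<^bsub>A\<^esub> (z \<otimes>\<^bsub>A\<^esub> x) \<oplus>\<^bsub>A\<^esub> z \<otimes>\<^bsub>A\<^esub> (x \<otimes>\<^bsub>A\<^esub> y)) = \<zero>\<^bsub>A\<^esub>)"
  (is "?L \<longleftrightarrow> ?alg \<and> ?sq \<and> ?jac")
proof
  assume L: ?L
  have sq: "x \<otimes>\<^bsub>A\<^esub> x = \<zero>\<^bsub>A\<^esub>" if "x \<in> carrier A" for x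
    using L that unfolding in_variety_def lie_identities_def satisfies_identity_def
    by (auto dest!: spec[where x = "\<lambda>_. x"])
  have jac: "x \<otimes>\<^bsub>A\<^esub> (y \<otimes>\<^bsub>A\<^esub> z) \<oplus>\<^bsub>A\<^esub>
      (y \<otimes>\<^bsub>A\<^esub> (z \<otimes>\<^bsub>A\<^esub> x) \<oplus>\<^bsub>A\<^esub> z \<otimes>\<^bsub>A\<^esub> (x \<otimes>\<^bsub>A\<^esub> y)) = \<zero>\<^bsub>A\<^esub>"
    if "x \<in> carrier A" "y \<in> carrier A" "z \<in> carrier A" for x y z
    using L that unfolding in_variety_def lie_identities_def satisfies_identity_def
    by (auto dest!: spec[where x = "\<lambda>i. if i = 0 then x else if i = 1 then y else z"])
  show "?alg \<and> ?sq \<and> ?jac"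
    using L sq jac by (simp add: in_variety_def)
qed (auto simp: in_variety_def lie_identities_def satisfies_identity_def)

definition jordan_plus :: "'k ring \<Rightarrow> ('k, 'a) module \<Rightarrow> ('k, 'a) module" where
  "jordan_plus K B = B\<lparr>mult := \<lambda>x y.
     inv\<^bsub>K\<^esub> (\<one>\<^bsub>K\<^esub> \<oplus>\<^bsub>K\<^esub> \<one>\<^bsub>K\<^esub>) \<odot>\<^bsub>B\<^esub> (x \<otimes>\<^bsub>B\<^esub> y \<oplus>\<^bsub>B\<^esub> y \<otimes>\<^bsub>B\<^esub> x)\<rparr>"

definition special_jordan :: "'k ring \<Rightarrow> ('k, 'a) module \<Rightarrow> bool" where
  "special_jordan K J \<longleftrightarrow>
     (\<exists>B S. assoc_algebra K B \<and> is_subalgebra K S (jordan_plus K B) \<and>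
        J = (jordan_plus K B)\<lparr>carrier := S\<rparr>)"

text \<open>
  The variety generated by the special Jordan algebras is the class of algebras satisfying all
  identities common to the special Jordan algebras. Only special Jordan algebras carried by one type
  are inspected. This is no restriction, since an identity failing in some special Jordan
  algebra fails in the one generated by countably many free generators \<open>X\<close> inside the free
  associative algebra on \<open>X\<close>, and the latter lives in finitely supported functions
  from words over \<open>nat\<close> to scalars.
\<close>

definition special_jordan_identities :: "'k ring \<Rightarrow> 'k na_poly set" where
  "special_jordan_identities K =
     {t. scalars t \<subseteq> carrier K \<and>
         (\<forall>J :: ('k, nat list \<Rightarrow> 'k) module. special_jordan K J \<longrightarrow> satisfies_identity J t)}"


section \<open>Free algebras of a variety\<close>

text \<open>
  The universal property of a candidate \<open>S\<close> carried by \<open>'a\<close> is tested on the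
  algebras carried by \<open>'a list \<Rightarrow> 'k\<close>. This is equivalent to testing it on all
  algebras \<open>B\<close> of the variety: existence of the extension of a map on \<open>Y\<close>, and
  equality of two homomorphisms out of \<open>S\<close>, only depend on a subalgebra of \<open>B\<close> generated by
  at most as many elements as there are in \<open>'a\<close>, and such a subalgebra has a copy on
  \<open>'a list \<Rightarrow> 'k\<close>, an infinite type at least as large as \<open>'a\<close> and \<open>'k\<close>.
  Homomorphisms are taken extensional so that uniqueness means uniqueness on the carrier.
\<close>

definition free_in_variety ::
    "'k ring \<Rightarrow> 'k na_poly set \<Rightarrow> ('k, 'a) module \<Rightarrow> 'a set \<Rightarrow> bool" where
  "free_in_variety K V S Y \<longleftrightarrow>
     in_variety K V S \<and> Y \<subseteq> carrier S \<and>
     (\<forall>(B :: ('k, 'a list \<Rightarrow> 'k) module) f.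
        in_variety K V B \<and> f \<in> Y \<rightarrow> carrier B \<longrightarrow>
        (\<exists>!h. h \<in> alg_hom K S B \<and> h \<in> extensional (carrier S) \<and> (\<forall>y\<in>Y. h y = f y)))"

definition contains_free :: "'k ring \<Rightarrow> 'k na_poly set \<Rightarrow> ('k, 'a) module \<Rightarrow> bool" where
  "contains_free K V A \<longleftrightarrow>
     (\<exists>S Y. is_subalgebra K S A \<and> free_in_variety K V (A\<lparr>carrier := S\<rparr>) Y \<and>
        (\<exists>y\<in>Y. \<exists>z\<in>Y. y \<noteq> z))"


section \<open>Tensor products and extension of scalars\<close>

text \<open>
  The vector space with basis \<open>X\<close>, as finitely supported functions, with the bilinear
  product that extends a binary operation on \<open>X\<close>.
\<close>

definition magma_algebra :: "'k ring \<Rightarrow> 'x set \<Rightarrow> ('x \<Rightarrow> 'x \<Rightarrow> 'x) \<Rightarrow> ('k, 'x \<Rightarrow> 'k) module" where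
  "magma_algebra K X m =
     \<lparr>carrier = {u. (\<forall>x. u x \<in> carrier K) \<and> (\<forall>x. x \<notin> X \<longrightarrow> u x = \<zero>\<^bsub>K\<^esub>) \<and>
                    finite {x. u x \<noteq> \<zero>\<^bsub>K\<^esub>}},
      mult = \<lambda>u v z. finsum K (\<lambda>(x, y). u x \<otimes>\<^bsub>K\<^esub> v y)
               {(x, y). u x \<noteq> \<zero>\<^bsub>K\<^esub> \<and> v y \<noteq> \<zero>\<^bsub>K\<^esub> \<and> m x y = z},
      one = undefined,
      zero = \<lambda>_. \<zero>\<^bsub>K\<^esub>,
      add = \<lambda>u v x. u x \<oplus>\<^bsub>K\<^esub> v x,
      smult = \<lambda>c u x. c \<otimes>\<^bsub>K\<^esub> u x\<rparr>"

definition basis_vec :: "'k ring \<Rightarrow> 'x \<Rightarrow> 'x \<Rightarrow> 'k" where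
  "basis_vec K x = (\<lambda>y. if y = x then \<one>\<^bsub>K\<^esub> else \<zero>\<^bsub>K\<^esub>)"

definition generated_submodule :: "'k ring \<Rightarrow> ('k, 'a) module \<Rightarrow> 'a set \<Rightarrow> 'a set" where
  "generated_submodule K M G = \<Inter>{N. submodule N K M \<and> G \<subseteq> N}"

definition quotient_algebra :: "('k, 'a) module \<Rightarrow> 'a set \<Rightarrow> ('k, 'a set) module" where
  "quotient_algebra A I =
     \<lparr>carrier = a_rcosets\<^bsub>A\<^esub> I,
      mult = rcoset_mult A I,
      one = undefined,
      zero = I,
      add = set_add A,
      smult = \<lambda>c X. \<Union>x\<in>X. I +>\<^bsub>A\<^esub> (c \<odot>\<^bsub>A\<^esub> x)\<rparr>"

text \<open>
  \<open>B \<otimes>\<^sub>K C\<close> is the vector space with basis \<open>B \<times> C\<close> modulo the bilinearity relations,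
  with product determined by \<open>(b \<otimes> c) (b' \<otimes> c') = b b' \<otimes> c c'\<close>.
\<close>

definition pair_algebra ::
    "'k ring \<Rightarrow> ('k, 'b) module \<Rightarrow> ('k, 'c) module \<Rightarrow> ('k, 'b \<times> 'c \<Rightarrow> 'k) module" where
  "pair_algebra K B C = magma_algebra K (carrier B \<times> carrier C)
     (\<lambda>(b, c) (b', c'). (b \<otimes>\<^bsub>B\<^esub> b', c \<otimes>\<^bsub>C\<^esub> c'))"

definition tensor_relations ::
    "'k ring \<Rightarrow> ('k, 'b) module \<Rightarrow> ('k, 'c) module \<Rightarrow> ('b \<times> 'c \<Rightarrow> 'k) set" where
  "tensor_relations K B C = (let P = pair_algebra K B C; e = (\<lambda>b c. basis_vec K (b, c)) in
     {e (b \<oplus>\<^bsub>B\<^esub> b') c \<ominus>\<^bsub>P\<^esub> (e b c \<oplus>\<^bsub>P\<^esub> e b' c) | b b' c.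
        b \<in> carrier B \<and> b' \<in> carrier B \<and> c \<in> carrier C} \<union>
     {e b (c \<oplus>\<^bsub>C\<^esub> c') \<ominus>\<^bsub>P\<^esub> (e b c \<oplus>\<^bsub>P\<^esub> e b c') | b c c'.
        b \<in> carrier B \<and> c \<in> carrier C \<and> c' \<in> carrier C} \<union>
     {e (k \<odot>\<^bsub>B\<^esub> b) c \<ominus>\<^bsub>P\<^esub> k \<odot>\<^bsub>P\<^esub> e b c | k b c.
        k \<in> carrier K \<and> b \<in> carrier B \<and> c \<in> carrier C} \<union>
     {e b (k \<odot>\<^bsub>C\<^esub> c) \<ominus>\<^bsub>P\<^esub> k \<odot>\<^bsub>P\<^esub> e b c | k b c.
        k \<in> carrier K \<and> b \<in> carrier B \<and> c \<in> carrier C})"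

definition tensor_algebra ::
    "'k ring \<Rightarrow> ('k, 'b) module \<Rightarrow> ('k, 'c) module \<Rightarrow> ('k, ('b \<times> 'c \<Rightarrow> 'k) set) module" where
  "tensor_algebra K B C = quotient_algebra (pair_algebra K B C)
     (generated_submodule K (pair_algebra K B C) (tensor_relations K B C))"

text \<open>A field extension of \<open>K\<close> is a field \<open>F\<close> with a ring homomorphism \<open>\<phi>\<close> from \<open>K\<close> to \<open>F\<close>.\<close>

definition extension_algebra :: "'f ring \<Rightarrow> ('k \<Rightarrow> 'f) \<Rightarrow> ('k, 'f) module" where
  "extension_algebra F \<phi> =
     \<lparr>carrier = carrier F, mult = mult F, one = one F, zero = zero F, add = add F,
      smult = \<lambda>c x. \<phi> c \<otimes>\<^bsub>F\<^esub> x\<rparr>"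

text \<open>
  An algebra \<open>A\<close> over a countable field with a free subalgebra on two generators in
  \<open>F \<otimes>\<^sub>K A\<close> but none in \<open>A\<close> can be replaced by the countable subalgebra generated by the
  finitely many elements of \<open>A\<close> occurring in the two generators, and similarly for \<open>F\<close>. Hence
  asserting the existence of \<open>A\<close> and \<open>F\<close> on any fixed infinite types involves no restriction.
\<close>

end

theory Submission
  imports Defs "HOL-Library.Multiset" "HOL-Algebra.Weak_Morphisms"
begin

text \<open>
  Both varieties consist of algebras that come from associative ones with the product \<open>\<alpha> x y + \<beta> y x\<close>:
  the commutator for Lie algebras, the symmetrized product for special Jordan algebras, and \<open>\<alpha> \<noteq> 0\<close> is all
  that matters. So it suffices to find an associative algebra that is nil over \<open>K\<close> and that acquires free elements
  after an extension of scalars.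

  Over \<open>K\<close>: let \<open>A\<close> be a quotient of the free associative algebra without unit on countably many letters, with the
  twisted product. If all elements of the quotient are nilpotent, \<open>p\<^sup>N = 0\<close>, then each associative word occurring
  in \<open>p (p (\<dots> (p q)))\<close> with \<open>2 N\<close> factors \<open>p\<close> contains \<open>p\<^sup>N\<close>, so that this product vanishes
  (\<open>iterated_nil\<close>). It does not vanish identically on the variety (\<open>iterated_nonzero\<close>), hence no two elements
  of \<open>A\<close> are free generators (\<open>not_contains_freeI\<close>).

  Over \<open>F\<close>: let \<open>F\<close> contain \<open>s\<close> and \<open>t\<close> whose monomials are linearly independent over \<open>K\<close>; iterated Laurent
  series are such a field. The quotient is chosen so that the elements
  \<open>x\<^bsub>3\<kappa>\<^esub> + s x\<^bsub>3\<kappa>+1\<^esub> + t x\<^bsub>3\<kappa>+2\<^esub>\<close> of \<open>F \<otimes>\<^sub>K A\<close> satisfy no associative relation over \<open>K\<close>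
  (\<open>relation_cf_zero\<close>). Nilpotency is not inherited by them, because it was imposed only on polynomials with
  coefficients in \<open>K\<close>.

  The quotient is described dually, by functionals on words. As \<open>K\<close> is countable, the polynomials can be enumerated,
  and they are treated one at a time (\<open>stage_exists\<close>). The functionals of each stage have degree \<open>n\<close>, and they are
  indexed by patterns: a pattern of length \<open>n\<close> is the word in the generic elements that the functional is meant to
  detect. The functionals of the next stage are concatenations, whose first part is a linear combination of \<open>g\<^sup>2\<close>
  products of \<open>2 g\<close> functionals of the old stage. It has to annihilate the powers of the next polynomial, with
  prefixes and suffixes of its words attached. Only the exponents up to \<open>2 g n\<close> matter, so the number of
  conditions is linear in \<open>g\<close>, and there is a nontrivial solution. Choosing among the weights \<open>1\<close>, \<open>s\<close>, \<open>t\<close> in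
  the products makes its coefficients the coefficients of different monomials \<open>s\<^sup>a t\<^sup>b\<close> in the value of the
  new functional on the pattern, which is therefore nonzero.

  To see that \<open>F \<otimes>\<^sub>K A\<close> lies in the variety and to test relations in it, it is embedded into the operators on a space of
  functions from words to \<open>F\<close> on which the letters act by left quotients (\<open>tensor_algebra_embeds\<close>).
  It remains that a nonassociative polynomial whose expansion into associative words vanishes is an identity of the
  variety. For special Jordan algebras this is the definition (\<open>special_jordan_identities_iff\<close>); for Lie algebras it
  says that the free Lie algebra embeds into the free associative algebra, which is shown by Lazard elimination
  (\<open>lie_identity\<close>).
\<close>


section \<open>Sums over lists\<close>

primrec lsum :: "('a, 'm) ring_scheme \<Rightarrow> ('x \<Rightarrow> 'a) \<Rightarrow> 'x list \<Rightarrow> 'a" where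
  "lsum G f [] = \<zero>\<^bsub>G\<^esub>"
| "lsum G f (x # xs) = f x \<oplus>\<^bsub>G\<^esub> lsum G f xs"

lemma lsum_cong:
  "(\<And>x. x \<in> set xs \<Longrightarrow> f x = g x) \<Longrightarrow> lsum G f xs = lsum G g xs"
  by (induction xs) auto

lemma lsum_map: "lsum G f (map h xs) = lsum G (\<lambda>x. f (h x)) xs"
  by (induction xs) auto

context abelian_monoid
begin

lemma lsum_closed: "(\<And>x. x \<in> set xs \<Longrightarrow> f x \<in> carrier G) \<Longrightarrow> lsum G f xs \<in> carrier G"
  by (induction xs) auto

lemma lsum_append:
  assumes "\<And>x. x \<in> set xs \<union> set ys \<Longrightarrow> f x \<in> carrier G"
  shows "lsum G f (xs @ ys) = lsum G f xs \<oplus> lsum G f ys"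
  using assms by (induction xs) (auto simp: a_assoc lsum_closed)

lemma lsum_zero: "(\<And>x. x \<in> set xs \<Longrightarrow> f x = \<zero>) \<Longrightarrow> lsum G f xs = \<zero>"
  by (induction xs) auto

lemma lsum_add:
  assumes "\<And>x. x \<in> set xs \<Longrightarrow> f x \<in> carrier G" "\<And>x. x \<in> set xs \<Longrightarrow> g x \<in> carrier G"
  shows "lsum G (\<lambda>x. f x \<oplus> g x) xs = lsum G f xs \<oplus> lsum G g xs"
  using assms by (induction xs) (auto simp: a_ac lsum_closed)

lemma lsum_swap:
  assumes "\<And>x y. x \<in> set xs \<Longrightarrow> y \<in> set ys \<Longrightarrow> f x y \<in> carrier G"
  shows "lsum G (\<lambda>x. lsum G (f x) ys) xs = lsum G (\<lambda>y. lsum G (\<lambda>x. f x y) xs) ys"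
  using assms
proof (induction xs)
  case Nil
  then show ?case by (simp add: lsum_zero)
next
  case (Cons x xs)
  then show ?case by (simp add: lsum_add lsum_closed)
qed

lemma lsum_split:
  assumes "\<And>x. x \<in> set xs \<Longrightarrow> f x \<in> carrier G"
  shows "lsum G f xs = lsum G f (filter P xs) \<oplus> lsum G f (filter (\<lambda>x. \<not> P x) xs)"
  using assms
proof (induction xs)
  case (Cons x xs)
  have "lsum G f (filter Q xs) \<in> carrier G" for Q
    using Cons.prems by (intro lsum_closed) auto
  then show ?case
    using Cons by (simp add: a_ac)
qed simp

lemma lsum_filter:
  assumes "\<And>x. x \<in> set xs \<Longrightarrow> f x \<in> carrier G"
  shows "lsum G f (filter P xs) = lsum G (\<lambda>x. if P x then f x else \<zero>) xs"
  using assms by (induction xs) (auto simp: lsum_closed)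

lemma lsum_group_zero:
  assumes "\<And>x. x \<in> set xs \<Longrightarrow> f x \<in> carrier G"
    and "\<And>k. lsum G f (filter (\<lambda>x. key x = k) xs) = \<zero>"
  shows "lsum G f xs = \<zero>"
  using assms
proof (induction "length xs" arbitrary: xs rule: less_induct)
  case less
  show ?case
  proof (cases xs)
    case (Cons x ys)
    let ?P = "\<lambda>y. key y = key x"
    let ?zs = "filter (\<lambda>y. \<not> ?P y) xs"
    have "lsum G f ?zs = \<zero>"
    proof (rule less.hyps)
      show "length ?zs < length xs"
        using Cons by (simp add: le_imp_less_Suc)
      fix k
      have "filter (\<lambda>y. key y = k) ?zs = (if k = key x then [] else filter (\<lambda>y. key y = k) xs)"
        by (auto simp: filter_empty_conv intro!: filter_cong)
      then show "lsum G f (filter (\<lambda>y. key y = k) ?zs) = \<zero>"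
        using less.prems(2) by simp
    qed (use less.prems in auto)
    then show ?thesis
      using lsum_split[of xs f ?P] less.prems by simp
  qed simp
qed

lemma lsum_remove1:
  assumes "\<And>x. x \<in> set xs \<Longrightarrow> f x \<in> carrier G" "y \<in> set xs"
  shows "lsum G f xs = f y \<oplus> lsum G f (remove1 y xs)"
  using assms
proof (induction xs)
  case (Cons x xs)
  show ?case
  proof (cases "y = x")
    case False
    then have y: "y \<in> set xs"
      using Cons.prems by auto
    have cl: "f x \<in> carrier G" "f y \<in> carrier G" "lsum G f (remove1 y xs) \<in> carrier G"
      using Cons.prems set_remove1_subset[of y xs] by (auto intro!: lsum_closed)
    show ?thesis
      using Cons.IH[OF Cons.prems(1) y] False cl by (simp add: a_ac)
  qed simp
qed simp

lemma lsum_delta: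
  assumes "distinct xs" "y \<in> set xs" "f y \<in> carrier G"
  shows "lsum G (\<lambda>x. if x = y then f x else \<zero>) xs = f y"
  using assms
proof (induction xs)
  case (Cons x xs)
  show ?case
  proof (cases "x = y")
    case True
    then have "lsum G (\<lambda>z. if z = y then f z else \<zero>) xs = \<zero>"
      using Cons.prems by (intro lsum_zero) auto
    then show ?thesis
      using True Cons.prems by simp
  qed (use Cons in auto)
qed simp

lemma lsum_finsum:
  assumes "distinct xs" "\<And>x. x \<in> set xs \<Longrightarrow> f x \<in> carrier G"
  shows "lsum G f xs = finsum G f (set xs)"
  using assms by (induction xs) (auto simp: Pi_def)

end

lemma lsum_hom:
  assumes "abelian_monoid G" "\<And>x. x \<in> set xs \<Longrightarrow> f x \<in> carrier G"
    and "h \<zero>\<^bsub>G\<^esub> = \<zero>\<^bsub>H\<^esub>"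
    and "\<And>x y. x \<in> carrier G \<Longrightarrow> y \<in> carrier G \<Longrightarrow> h (x \<oplus>\<^bsub>G\<^esub> y) = h x \<oplus>\<^bsub>H\<^esub> h y"
  shows "h (lsum G f xs) = lsum H (\<lambda>x. h (f x)) xs"
  using assms(2) by (induction xs) (auto simp: assms(3,4) abelian_monoid.lsum_closed[OF assms(1)])

lemma (in semiring) lsum_rdistr:
  assumes "a \<in> carrier R" "\<And>x. x \<in> set xs \<Longrightarrow> f x \<in> carrier R"
  shows "a \<otimes> lsum R f xs = lsum R (\<lambda>x. a \<otimes> f x) xs"
  using assms by (induction xs) (auto simp: r_distr lsum_closed)

lemma (in semiring) lsum_ldistr:
  assumes "a \<in> carrier R" "\<And>x. x \<in> set xs \<Longrightarrow> f x \<in> carrier R"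
  shows "lsum R f xs \<otimes> a = lsum R (\<lambda>x. f x \<otimes> a) xs"
  using assms by (induction xs) (auto simp: l_distr lsum_closed)


section \<open>Linear combinations as lists of pairs\<close>

definition lcomb :: "('k, 'a, 'm) module_scheme \<Rightarrow> ('x \<Rightarrow> 'a) \<Rightarrow> ('k \<times> 'x) list \<Rightarrow> 'a" where
  "lcomb A f l = lsum A (\<lambda>p. fst p \<odot>\<^bsub>A\<^esub> f (snd p)) l"

definition cf :: "('k, 'r) ring_scheme \<Rightarrow> ('k \<times> 'x) list \<Rightarrow> 'x \<Rightarrow> 'k" where
  "cf K l = (\<lambda>w. lsum K (\<lambda>p. if snd p = w then fst p else \<zero>\<^bsub>K\<^esub>) l)"

definition scl :: "('k, 'r) ring_scheme \<Rightarrow> 'k \<Rightarrow> ('k \<times> 'x) list \<Rightarrow> ('k \<times> 'x) list" where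
  "scl K c l = map (\<lambda>p. (c \<otimes>\<^bsub>K\<^esub> fst p, snd p)) l"

definition lprod :: "('k, 'r) ring_scheme \<Rightarrow> ('x \<Rightarrow> 'y \<Rightarrow> 'z) \<Rightarrow> ('k \<times> 'x) list \<Rightarrow> ('k \<times> 'y) list \<Rightarrow> ('k \<times> 'z) list"
  where "lprod K m u v =
    concat (map (\<lambda>p. map (\<lambda>q. (fst p \<otimes>\<^bsub>K\<^esub> fst q, m (snd p) (snd q))) v) u)"

text \<open>The substitution of linear combinations for the symbols of a linear combination.\<close>

definition lbind :: "('k, 'r) ring_scheme \<Rightarrow> ('k \<times> 'x) list \<Rightarrow> ('x \<Rightarrow> ('k \<times> 'y) list) \<Rightarrow> ('k \<times> 'y) list" where
  "lbind K l f = concat (map (\<lambda>p. scl K (fst p) (f (snd p))) l)"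

lemma lcomb_Nil [simp]: "lcomb A f [] = \<zero>\<^bsub>A\<^esub>"
  by (simp add: lcomb_def)

lemma lcomb_Cons [simp]: "lcomb A f ((c, x) # l) = c \<odot>\<^bsub>A\<^esub> f x \<oplus>\<^bsub>A\<^esub> lcomb A f l"
  by (simp add: lcomb_def)

lemma lcomb_cong:
  "(\<And>c x. (c, x) \<in> set l \<Longrightarrow> f x = g x) \<Longrightarrow> lcomb A f l = lcomb A g l"
  unfolding lcomb_def by (rule lsum_cong) auto

lemma scl_Nil [simp]: "scl K c [] = []"
  by (simp add: scl_def)

lemma scl_Cons [simp]: "scl K c ((d, x) # l) = (c \<otimes>\<^bsub>K\<^esub> d, x) # scl K c l"
  by (simp add: scl_def)

lemma lprod_Nil [simp]: "lprod K m [] v = []"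
  by (simp add: lprod_def)

lemma lprod_Cons [simp]:
  "lprod K m ((c, x) # u) v = map (\<lambda>q. (c \<otimes>\<^bsub>K\<^esub> fst q, m x (snd q))) v @ lprod K m u v"
  by (simp add: lprod_def)

lemma lbind_Nil [simp]: "lbind K [] f = []"
  by (simp add: lbind_def)

lemma lbind_Cons [simp]: "lbind K ((c, x) # l) f = scl K c (f x) @ lbind K l f"
  by (simp add: lbind_def)

context cring
begin

lemma scl_set: "c \<in> carrier R \<Longrightarrow> set l \<subseteq> carrier R \<times> X \<Longrightarrow> set (scl R c l) \<subseteq> carrier R \<times> X"
  by (auto simp: scl_def)

lemma lprod_set:
  assumes "set u \<subseteq> carrier R \<times> X" "set v \<subseteq> carrier R \<times> Y"
    and "\<And>x y. x \<in> X \<Longrightarrow> y \<in> Y \<Longrightarrow> m x y \<in> Z"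
  shows "set (lprod R m u v) \<subseteq> carrier R \<times> Z"
  using assms by (fastforce simp: lprod_def)

lemma lbind_set:
  assumes "set l \<subseteq> carrier R \<times> X" "\<And>x. x \<in> X \<Longrightarrow> set (f x) \<subseteq> carrier R \<times> Y"
  shows "set (lbind R l f) \<subseteq> carrier R \<times> Y"
  using assms by (fastforce simp: lbind_def scl_def)

lemma cf_closed: "set l \<subseteq> carrier R \<times> X \<Longrightarrow> cf R l w \<in> carrier R"
  unfolding cf_def by (rule lsum_closed) auto

lemma cf_append:
  "set l \<subseteq> carrier R \<times> X \<Longrightarrow> set l' \<subseteq> carrier R \<times> X \<Longrightarrow>
    cf R (l @ l') w = cf R l w \<oplus> cf R l' w"
  unfolding cf_def by (rule lsum_append) auto

lemma cf_scl:
  assumes "c \<in> carrier R" "set l \<subseteq> carrier R \<times> X"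
  shows "cf R (scl R c l) w = c \<otimes> cf R l w"
proof -
  have "c \<otimes> cf R l w = lsum R (\<lambda>p. c \<otimes> (if snd p = w then fst p else \<zero>)) l"
    unfolding cf_def using assms by (intro lsum_rdistr) auto
  also have "\<dots> = cf R (scl R c l) w"
    unfolding cf_def scl_def lsum_map using assms by (intro lsum_cong) auto
  finally show ?thesis
    by simp
qed

end

lemma cf_Nil [simp]: "cf K [] w = \<zero>\<^bsub>K\<^esub>"
  by (simp add: cf_def)

lemma cf_Cons: "cf K ((c, x) # l) w = (if x = w then c else \<zero>\<^bsub>K\<^esub>) \<oplus>\<^bsub>K\<^esub> cf K l w"
  by (simp add: cf_def)

context module
begin

lemma lcomb_closed:
  assumes "set l \<subseteq> carrier R \<times> X" "\<And>x. x \<in> X \<Longrightarrow> f x \<in> carrier M"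
  shows "lcomb M f l \<in> carrier M"
  unfolding lcomb_def using assms by (intro M.lsum_closed) auto

lemma lcomb_append:
  assumes "set l \<subseteq> carrier R \<times> X" "set l' \<subseteq> carrier R \<times> X" "\<And>x. x \<in> X \<Longrightarrow> f x \<in> carrier M"
  shows "lcomb M f (l @ l') = lcomb M f l \<oplus>\<^bsub>M\<^esub> lcomb M f l'"
  unfolding lcomb_def using assms by (intro M.lsum_append) auto

lemma lcomb_scl:
  assumes "c \<in> carrier R" "set l \<subseteq> carrier R \<times> X" "\<And>x. x \<in> X \<Longrightarrow> f x \<in> carrier M"
  shows "lcomb M f (scl R c l) = c \<odot>\<^bsub>M\<^esub> lcomb M f l"
  using assms(2)
proof (induction l)
  case (Cons p l)
  obtain d x where p: "p = (d, x)"
    by force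
  have "lcomb M f l \<in> carrier M"
    using Cons.prems assms(3) by (intro lcomb_closed[where X = X]) auto
  then show ?case
    using Cons assms by (auto simp: p smult_r_distr smult_assoc1)
qed (use assms in simp)

lemma lcomb_lbind:
  assumes "set l \<subseteq> carrier R \<times> X" "\<And>x. x \<in> X \<Longrightarrow> set (g x) \<subseteq> carrier R \<times> Y"
    and "\<And>y. y \<in> Y \<Longrightarrow> f y \<in> carrier M"
  shows "lcomb M f (lbind R l g) = lcomb M (\<lambda>x. lcomb M f (g x)) l"
  using assms(1)
proof (induction l)
  case (Cons p l)
  obtain d x where p: "p = (d, x)"
    by force
  have "set (lbind R l g) \<subseteq> carrier R \<times> Y"
    using Cons.prems assms(2) by (intro lbind_set[where X = X]) auto
  moreover have "set (scl R d (g x)) \<subseteq> carrier R \<times> Y"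
    using Cons.prems assms(2)[of x] by (intro scl_set) (auto simp: p)
  ultimately show ?case
    using Cons assms by (auto simp: p lcomb_append[where X = Y] lcomb_scl[where X = Y])
qed simp

text \<open>The coefficients of a list of pairs determine its linear combination: grouping equal symbols
  turns the combination into one with coefficients \<open>cf\<close>.\<close>

lemma lcomb_cf_zero:
  assumes l: "set l \<subseteq> carrier R \<times> X" and f: "\<And>x. x \<in> X \<Longrightarrow> f x \<in> carrier M"
    and z: "\<And>w. cf R l w = \<zero>"
  shows "lcomb M f l = \<zero>\<^bsub>M\<^esub>"
  unfolding lcomb_def
proof (rule M.lsum_group_zero[where key = snd])
  fix p assume "p \<in> set l"
  then show "fst p \<odot>\<^bsub>M\<^esub> f (snd p) \<in> carrier M"
    using l f by auto
next
  fix k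
  have *: "k' \<in> X \<Longrightarrow> set l' \<subseteq> carrier R \<times> X \<Longrightarrow>
    lsum M (\<lambda>p. fst p \<odot>\<^bsub>M\<^esub> f (snd p)) (filter (\<lambda>x. snd x = k') l') = cf R l' k' \<odot>\<^bsub>M\<^esub> f k'" for l' k'
  proof (induction l')
    case Nil
    then show ?case
      using f by (simp add: cf_def)
  next
    case (Cons p l')
    have "cf R l' k' \<in> carrier R"
      using Cons.prems by (intro cf_closed[where X = X]) auto
    then show ?case
      using Cons f by (cases p) (auto simp: cf_Cons smult_l_distr)
  qed
  show "lsum M (\<lambda>p. fst p \<odot>\<^bsub>M\<^esub> f (snd p)) (filter (\<lambda>x. snd x = k) l) = \<zero>\<^bsub>M\<^esub>"
  proof (cases "k \<in> X")
    case True
    then show ?thesis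
      using *[OF True l] z f by simp
  next
    case False
    then have "filter (\<lambda>x. snd x = k) l = []"
      using l by (auto simp: filter_empty_conv)
    then show ?thesis by simp
  qed
qed

lemma lcomb_cf_cong:
  assumes l: "set l \<subseteq> carrier R \<times> X" "set l' \<subseteq> carrier R \<times> X" and f: "\<And>x. x \<in> X \<Longrightarrow> f x \<in> carrier M"
    and z: "\<And>w. cf R l w = cf R l' w"
  shows "lcomb M f l = lcomb M f l'"
proof -
  let ?m = "scl R (\<ominus> \<one>) l'"
  have m: "set ?m \<subseteq> carrier R \<times> X"
    using l by (intro scl_set) auto
  have cl: "lcomb M f l \<in> carrier M" "lcomb M f l' \<in> carrier M"
    using l f by (auto intro: lcomb_closed[where X = X])
  have "lcomb M f (l @ ?m) = \<zero>\<^bsub>M\<^esub>"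
  proof (rule lcomb_cf_zero)
    show "cf R (l @ ?m) w = \<zero>" for w
      using l m cf_closed[OF l(2), of w]
      by (simp add: cf_append[where X = X] cf_scl[where X = X] z R.l_minus R.r_neg)
  qed (use l m f in auto)
  moreover have "lcomb M f ?m = \<ominus>\<^bsub>M\<^esub> lcomb M f l'"
    using l f cl by (simp add: lcomb_scl[where X = X] smult_l_minus)
  ultimately have "lcomb M f l \<oplus>\<^bsub>M\<^esub> \<ominus>\<^bsub>M\<^esub> lcomb M f l' = \<zero>\<^bsub>M\<^esub>"
    using lcomb_append[OF l(1) m f] by simp
  then show ?thesis
    using cl by (metis M.add.inv_closed M.add.inv_inv M.minus_equality M.a_comm)
qed

lemma lcomb_zero_fun:
  assumes "set l \<subseteq> carrier R \<times> X" "\<And>x. x \<in> X \<Longrightarrow> f x = \<zero>\<^bsub>M\<^esub>"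
  shows "lcomb M f l = \<zero>\<^bsub>M\<^esub>"
  unfolding lcomb_def using assms by (intro M.lsum_zero) auto

end

lemma lcomb_hom:
  assumes "module K A" "set l \<subseteq> carrier K \<times> X" "\<And>x. x \<in> X \<Longrightarrow> f x \<in> carrier A"
    and "h \<zero>\<^bsub>A\<^esub> = \<zero>\<^bsub>B\<^esub>"
    and "\<And>x y. x \<in> carrier A \<Longrightarrow> y \<in> carrier A \<Longrightarrow> h (x \<oplus>\<^bsub>A\<^esub> y) = h x \<oplus>\<^bsub>B\<^esub> h y"
    and "\<And>c x. c \<in> carrier K \<Longrightarrow> x \<in> carrier A \<Longrightarrow> h (c \<odot>\<^bsub>A\<^esub> x) = c \<odot>\<^bsub>B\<^esub> h x"
  shows "h (lcomb A f l) = lcomb B (\<lambda>x. h (f x)) l"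
proof -
  interpret module K A by fact
  have "h (lcomb A f l) = lsum B (\<lambda>p. h (fst p \<odot>\<^bsub>A\<^esub> f (snd p))) l"
    unfolding lcomb_def
    by (rule lsum_hom) (use assms M.abelian_monoid_axioms in auto)
  also have "\<dots> = lcomb B (\<lambda>x. h (f x)) l"
    unfolding lcomb_def by (rule lsum_cong) (use assms in auto)
  finally show ?thesis .
qed

lemma (in nonassoc_algebra) mult_l_zero: "x \<in> carrier A \<Longrightarrow> \<zero>\<^bsub>A\<^esub> \<otimes>\<^bsub>A\<^esub> x = \<zero>\<^bsub>A\<^esub>"
  using smult_mult_l[of "\<zero>" "\<zero>\<^bsub>A\<^esub>" x] mult_closed by simp

lemma (in nonassoc_algebra) mult_r_zero: "x \<in> carrier A \<Longrightarrow> x \<otimes>\<^bsub>A\<^esub> \<zero>\<^bsub>A\<^esub> = \<zero>\<^bsub>A\<^esub>"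
  using smult_mult_r[of "\<zero>" x "\<zero>\<^bsub>A\<^esub>"] mult_closed by simp

lemma (in nonassoc_algebra) lcomb_lprod:
  assumes u: "set u \<subseteq> carrier K \<times> X" and v: "set v \<subseteq> carrier K \<times> Y"
    and f: "\<And>x. x \<in> X \<Longrightarrow> f x \<in> carrier A" and g: "\<And>y. y \<in> Y \<Longrightarrow> g y \<in> carrier A"
    and h: "\<And>x y. x \<in> X \<Longrightarrow> y \<in> Y \<Longrightarrow> h (m x y) = f x \<otimes>\<^bsub>A\<^esub> g y"
  shows "lcomb A h (lprod K m u v) = lcomb A f u \<otimes>\<^bsub>A\<^esub> lcomb A g v"
  using u
proof (induction u)
  case Nil
  then show ?case
    using mult_l_zero[OF lcomb_closed[OF v g]] by simp
next
  case (Cons p u)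
  obtain c x where p: "p = (c, x)"
    by force
  have cx: "c \<in> carrier K" "x \<in> X"
    using Cons.prems p by auto
  have v': "lcomb A g v \<in> carrier A"
    using v g by (rule lcomb_closed)
  have "set l \<subseteq> carrier K \<times> Y \<Longrightarrow> lcomb A h (map (\<lambda>q. (c \<otimes> fst q, m x (snd q))) l) =
    (c \<odot>\<^bsub>A\<^esub> f x) \<otimes>\<^bsub>A\<^esub> lcomb A g l" for l
  proof (induction l)
    case Nil
    then show ?case
      using f cx by (simp add: mult_r_zero)
  next
    case (Cons q l)
    obtain d y where q: "q = (d, y)"
      by force
    have dy: "d \<in> carrier K" "y \<in> Y" and l: "set l \<subseteq> carrier K \<times> Y"
      using Cons.prems q by auto
    show ?case
      using Cons.IH[OF l] dy cx f g h lcomb_closed[OF l g]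
      by (simp add: q mult_r_distr smult_mult_l smult_mult_r mult_closed m_comm flip: smult_assoc1)
  qed
  note 1 = this[OF v]
  have 2: "set (map (\<lambda>q. (c \<otimes> fst q, m x (snd q))) v) \<subseteq> carrier K \<times> {z. \<exists>x y. x \<in> X \<and> y \<in> Y \<and> z = m x y}"
    using v cx by fastforce
  have 3: "set (lprod K m u v) \<subseteq> carrier K \<times> {z. \<exists>x y. x \<in> X \<and> y \<in> Y \<and> z = m x y}"
    using Cons.prems v by (intro lprod_set[where X = X and Y = Y]) auto
  have 4: "h z \<in> carrier A" if "z \<in> {z. \<exists>x y. x \<in> X \<and> y \<in> Y \<and> z = m x y}" for z
    using that h f g mult_closed by auto
  have "lcomb A h (lprod K m (p # u) v) =
    (c \<odot>\<^bsub>A\<^esub> f x) \<otimes>\<^bsub>A\<^esub> lcomb A g v \<oplus>\<^bsub>A\<^esub> lcomb A h (lprod K m u v)"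
    using lcomb_append[OF 2 3 4] by (simp add: p 1)
  also have "\<dots> = lcomb A f (p # u) \<otimes>\<^bsub>A\<^esub> lcomb A g v"
    using Cons cx f v' lcomb_closed[of u X f] by (auto simp: p mult_l_distr)
  finally show ?case .
qed


section \<open>Algebras and their identities\<close>

lemma lsum_record: "zero A = zero B \<Longrightarrow> add A = add B \<Longrightarrow> lsum A f xs = lsum B f xs"
  by (induction xs) auto

text \<open>The two locales of algebras, with the types fixed to those of the records that they are
  applied to.\<close>

locale na_algebra = nonassoc_algebra K A for K :: "'k ring" (structure)
  and A :: "('k, 'a) module" (structure)

locale as_algebra = assoc_algebra K A for K :: "'k ring" (structure)
  and A :: "('k, 'a) module" (structure)

sublocale as_algebra \<subseteq> na_algebra ..

lemma (in na_algebra) na_eval_closed: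
  "scalars t \<subseteq> carrier K \<Longrightarrow> (\<And>i. \<sigma> i \<in> carrier A) \<Longrightarrow> na_eval A \<sigma> t \<in> carrier A"
  by (induction t) (auto simp: mult_closed)

lemma na_eval_hom:
  fixes K :: "'k ring" and A :: "('k, 'a) module" and B :: "('k, 'b) module"
  assumes "nonassoc_algebra K A" "scalars t \<subseteq> carrier K" "\<And>i. \<sigma> i \<in> carrier A"
    and add: "\<And>x y. x \<in> carrier A \<Longrightarrow> y \<in> carrier A \<Longrightarrow> h (x \<oplus>\<^bsub>A\<^esub> y) = h x \<oplus>\<^bsub>B\<^esub> h y"
    and mult: "\<And>x y. x \<in> carrier A \<Longrightarrow> y \<in> carrier A \<Longrightarrow> h (x \<otimes>\<^bsub>A\<^esub> y) = h x \<otimes>\<^bsub>B\<^esub> h y"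
    and smult: "\<And>c x. c \<in> carrier K \<Longrightarrow> x \<in> carrier A \<Longrightarrow> h (c \<odot>\<^bsub>A\<^esub> x) = c \<odot>\<^bsub>B\<^esub> h x"
  shows "h (na_eval A \<sigma> t) = na_eval B (\<lambda>i. h (\<sigma> i)) t"
  using assms(2)
  by (induction t) (auto simp: assms na_algebra.na_eval_closed[OF na_algebra.intro[OF assms(1)]])

text \<open>All axioms of algebras, and all identities, can be checked after an injective homomorphism;
  additive inverses are multiples by \<open>-1\<close>.\<close>

lemma algebra_pullback:
  fixes K :: "'k ring" and A :: "('k, 'a) module" and R :: "('k, 'b) module"
  assumes R: "nonassoc_algebra K R" and inj: "inj_on h (carrier A)"
    and h: "\<And>x. x \<in> carrier A \<Longrightarrow> h x \<in> carrier R"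
    and cl: "\<zero>\<^bsub>A\<^esub> \<in> carrier A"
      "\<And>x y. x \<in> carrier A \<Longrightarrow> y \<in> carrier A \<Longrightarrow> x \<oplus>\<^bsub>A\<^esub> y \<in> carrier A"
      "\<And>x y. x \<in> carrier A \<Longrightarrow> y \<in> carrier A \<Longrightarrow> x \<otimes>\<^bsub>A\<^esub> y \<in> carrier A"
      "\<And>c x. c \<in> carrier K \<Longrightarrow> x \<in> carrier A \<Longrightarrow> c \<odot>\<^bsub>A\<^esub> x \<in> carrier A"
    and hom: "h \<zero>\<^bsub>A\<^esub> = \<zero>\<^bsub>R\<^esub>"
      "\<And>x y. x \<in> carrier A \<Longrightarrow> y \<in> carrier A \<Longrightarrow> h (x \<oplus>\<^bsub>A\<^esub> y) = h x \<oplus>\<^bsub>R\<^esub> h y"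
      "\<And>x y. x \<in> carrier A \<Longrightarrow> y \<in> carrier A \<Longrightarrow> h (x \<otimes>\<^bsub>A\<^esub> y) = h x \<otimes>\<^bsub>R\<^esub> h y"
      "\<And>c x. c \<in> carrier K \<Longrightarrow> x \<in> carrier A \<Longrightarrow> h (c \<odot>\<^bsub>A\<^esub> x) = c \<odot>\<^bsub>R\<^esub> h x"
  shows "nonassoc_algebra K A"
proof -
  interpret R: na_algebra K R by (rule na_algebra.intro) fact
  have eqI: "x = y" if "h x = h y" "x \<in> carrier A" "y \<in> carrier A" for x y
    using inj that by (auto dest: inj_onD)
  have ab: "abelian_group A"
  proof (rule abelian_groupI)
    fix x assume x: "x \<in> carrier A"
    have "\<ominus>\<^bsub>K\<^esub> \<one>\<^bsub>K\<^esub> \<odot>\<^bsub>A\<^esub> x \<oplus>\<^bsub>A\<^esub> x = \<zero>\<^bsub>A\<^esub>"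
      by (rule eqI) (use x h in \<open>auto simp: hom cl R.smult_l_minus R.M.l_neg\<close>)
    then show "\<exists>y\<in>carrier A. y \<oplus>\<^bsub>A\<^esub> x = \<zero>\<^bsub>A\<^esub>"
      using cl(4)[OF _ x] by blast
  qed (auto intro!: eqI simp: hom cl h R.M.a_ac)
  have md: "module K A"
    by (rule moduleI[OF R.is_cring ab])
      (auto intro!: eqI simp: hom cl h R.smult_l_distr R.smult_r_distr R.smult_assoc1)
  show ?thesis
    by (intro nonassoc_algebra.intro nonassoc_algebra_axioms.intro md R.field_axioms)
      (auto intro!: eqI simp: hom cl h R.mult_l_distr R.mult_r_distr R.smult_mult_l R.smult_mult_r)
qed

lemma identity_pullback:
  fixes K :: "'k ring" and A :: "('k, 'a) module" and R :: "('k, 'b) module"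
  assumes A: "nonassoc_algebra K A" and inj: "inj_on h (carrier A)"
    and h: "\<And>x. x \<in> carrier A \<Longrightarrow> h x \<in> carrier R"
    and hom: "h \<zero>\<^bsub>A\<^esub> = \<zero>\<^bsub>R\<^esub>"
      "\<And>x y. x \<in> carrier A \<Longrightarrow> y \<in> carrier A \<Longrightarrow> h (x \<oplus>\<^bsub>A\<^esub> y) = h x \<oplus>\<^bsub>R\<^esub> h y"
      "\<And>x y. x \<in> carrier A \<Longrightarrow> y \<in> carrier A \<Longrightarrow> h (x \<otimes>\<^bsub>A\<^esub> y) = h x \<otimes>\<^bsub>R\<^esub> h y"
      "\<And>c x. c \<in> carrier K \<Longrightarrow> x \<in> carrier A \<Longrightarrow> h (c \<odot>\<^bsub>A\<^esub> x) = c \<odot>\<^bsub>R\<^esub> h x"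
    and t: "scalars t \<subseteq> carrier K" "satisfies_identity R t"
  shows "satisfies_identity A t"
  unfolding satisfies_identity_def
proof (intro allI impI)
  interpret na_algebra K A by (rule na_algebra.intro) fact
  fix \<sigma> :: "nat \<Rightarrow> 'a" assume \<sigma>: "\<forall>i. \<sigma> i \<in> carrier A"
  have "h (na_eval A \<sigma> t) = na_eval R (\<lambda>i. h (\<sigma> i)) t"
    by (rule na_eval_hom[OF A]) (use \<sigma> t hom in auto)
  also have "\<dots> = h \<zero>\<^bsub>A\<^esub>"
    using t(2) \<sigma> h hom(1) unfolding satisfies_identity_def by auto
  finally show "na_eval A \<sigma> t = \<zero>\<^bsub>A\<^esub>"
    using inj na_eval_closed[OF t(1)] \<sigma> by (auto dest: inj_onD)
qed


section \<open>Nonassociative polynomials in twisted associative algebras\<close>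

text \<open>Both cases of the theorem are instances of one construction on associative algebras: the
  product \<open>\<alpha> x y + \<beta> y x\<close>, which is the commutator for \<open>\<alpha> = 1\<close>, \<open>\<beta> = -1\<close> and the Jordan
  product for \<open>\<alpha> = \<beta> = 1/2\<close>.\<close>

definition twist :: "'k \<Rightarrow> 'k \<Rightarrow> ('k, 'a) module \<Rightarrow> ('k, 'a) module" where
  "twist \<alpha> \<beta> B =
     B\<lparr>mult := \<lambda>x y. \<alpha> \<odot>\<^bsub>B\<^esub> (x \<otimes>\<^bsub>B\<^esub> y) \<oplus>\<^bsub>B\<^esub> \<beta> \<odot>\<^bsub>B\<^esub> (y \<otimes>\<^bsub>B\<^esub> x)\<rparr>"

lemma twist_simps [simp]:
  "carrier (twist \<alpha> \<beta> B) = carrier B" "zero (twist \<alpha> \<beta> B) = zero B" "add (twist \<alpha> \<beta> B) = add B"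
  "smult (twist \<alpha> \<beta> B) = smult B"
  "x \<otimes>\<^bsub>twist \<alpha> \<beta> B\<^esub> y = \<alpha> \<odot>\<^bsub>B\<^esub> (x \<otimes>\<^bsub>B\<^esub> y) \<oplus>\<^bsub>B\<^esub> \<beta> \<odot>\<^bsub>B\<^esub> (y \<otimes>\<^bsub>B\<^esub> x)"
  by (simp_all add: twist_def)

lemma lcomb_twist [simp]: "lcomb (twist \<alpha> \<beta> B) f l = lcomb B f l"
  unfolding lcomb_def by (simp add: lsum_record[of "twist \<alpha> \<beta> B" B])

lemma (in na_algebra) twist_algebra:
  assumes "\<alpha> \<in> carrier K" "\<beta> \<in> carrier K"
  shows "nonassoc_algebra K (twist \<alpha> \<beta> A)"
proof -
  have "add_monoid (twist \<alpha> \<beta> A) = add_monoid A"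
    by (simp add: twist_def)
  then have ab: "abelian_group (twist \<alpha> \<beta> A)"
    using M.abelian_group_axioms
    by (simp add: abelian_group_def abelian_monoid_def abelian_group_axioms_def)
  have "module K (twist \<alpha> \<beta> A)"
    by (rule moduleI[OF is_cring ab])
      (auto simp: smult_l_distr smult_r_distr smult_assoc1)
  then show ?thesis
    by (intro nonassoc_algebra.intro nonassoc_algebra_axioms.intro field_axioms)
      (use assms in \<open>auto simp: mult_closed mult_l_distr mult_r_distr smult_mult_l smult_mult_r
        smult_r_distr m_comm M.a_ac simp flip: smult_assoc1\<close>)
qed

datatype tree = Leaf nat | Node tree tree

primrec leaves :: "tree \<Rightarrow> nat multiset" where
  "leaves (Leaf i) = {#i#}"
| "leaves (Node s t) = leaves s + leaves t"

primrec tree_eval :: "('k, 'a) module \<Rightarrow> (nat \<Rightarrow> 'a) \<Rightarrow> tree \<Rightarrow> 'a" where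
  "tree_eval A \<sigma> (Leaf i) = \<sigma> i"
| "tree_eval A \<sigma> (Node s t) = tree_eval A \<sigma> s \<otimes>\<^bsub>A\<^esub> tree_eval A \<sigma> t"

primrec monomials :: "('k, 'r) ring_scheme \<Rightarrow> 'k na_poly \<Rightarrow> ('k \<times> tree) list" where
  "monomials K (Var i) = [(\<one>\<^bsub>K\<^esub>, Leaf i)]"
| "monomials K (Add s t) = monomials K s @ monomials K t"
| "monomials K (Scale c t) = scl K c (monomials K t)"
| "monomials K (Mult s t) = lprod K Node (monomials K s) (monomials K t)"

lemma (in cring) monomials_set:
  "scalars t \<subseteq> carrier R \<Longrightarrow> set (monomials R t) \<subseteq> carrier R \<times> UNIV"
  by (induction t) (auto dest!: subsetD[OF scl_set[where X = UNIV], rotated -1]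
    subsetD[OF lprod_set[where X = UNIV and Y = UNIV and Z = UNIV], rotated -1])

lemma (in na_algebra) tree_eval_closed:
  "(\<And>i. \<sigma> i \<in> carrier A) \<Longrightarrow> tree_eval A \<sigma> t \<in> carrier A"
  by (induction t) (auto simp: mult_closed)

lemma (in na_algebra) na_eval_monomials:
  assumes "scalars t \<subseteq> carrier K" and \<sigma>: "\<And>i. \<sigma> i \<in> carrier A"
  shows "na_eval A \<sigma> t = lcomb A (tree_eval A \<sigma>) (monomials K t)"
  using assms(1)
proof (induction t)
  case (Add s t)
  then show ?case
    using \<sigma> by (simp add: monomials_set tree_eval_closed lcomb_append[where X = UNIV])
next
  case (Scale c t)
  then show ?case
    using \<sigma> by (simp add: monomials_set tree_eval_closed lcomb_scl[where X = UNIV])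
next
  case (Mult s t)
  then show ?case
    using \<sigma> lcomb_lprod[of "monomials K s" UNIV "monomials K t" UNIV "tree_eval A \<sigma>"
      "tree_eval A \<sigma>" "tree_eval A \<sigma>" Node]
    by (simp add: monomials_set tree_eval_closed)
qed (use \<sigma> in auto)

fun word_eval :: "('k, 'a) module \<Rightarrow> (nat \<Rightarrow> 'a) \<Rightarrow> nat list \<Rightarrow> 'a" where
  "word_eval A \<sigma> [] = \<zero>\<^bsub>A\<^esub>"
| "word_eval A \<sigma> [i] = \<sigma> i"
| "word_eval A \<sigma> (i # j # w) = \<sigma> i \<otimes>\<^bsub>A\<^esub> word_eval A \<sigma> (j # w)"

lemma word_eval_Cons: "w \<noteq> [] \<Longrightarrow> word_eval A \<sigma> (i # w) = \<sigma> i \<otimes>\<^bsub>A\<^esub> word_eval A \<sigma> w"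
  by (cases w) auto

lemma (in na_algebra) word_eval_closed:
  "(\<And>i. \<sigma> i \<in> carrier A) \<Longrightarrow> word_eval A \<sigma> w \<in> carrier A"
  by (induction w rule: induct_list012) (auto simp: mult_closed)

lemma (in as_algebra) word_eval_append:
  assumes "\<And>i. \<sigma> i \<in> carrier A" "u \<noteq> []" "v \<noteq> []"
  shows "word_eval A \<sigma> (u @ v) = word_eval A \<sigma> u \<otimes>\<^bsub>A\<^esub> word_eval A \<sigma> v"
  using assms(2)
proof (induction u rule: induct_list012)
  case (2 i)
  then show ?case
    using assms by (simp add: word_eval_Cons)
next
  case (3 i j u)
  then show ?case
    using assms by (simp add: word_eval_closed mult_assoc)
qed simp

text \<open>The expansion of a monomial into words, with respect to the twisted product.\<close>

primrec words :: "('k, 'r) ring_scheme \<Rightarrow> 'k \<Rightarrow> 'k \<Rightarrow> tree \<Rightarrow> ('k \<times> nat list) list" where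
  "words K \<alpha> \<beta> (Leaf i) = [(\<one>\<^bsub>K\<^esub>, [i])]"
| "words K \<alpha> \<beta> (Node s t) =
     scl K \<alpha> (lprod K (@) (words K \<alpha> \<beta> s) (words K \<alpha> \<beta> t)) @
     scl K \<beta> (lprod K (@) (words K \<alpha> \<beta> t) (words K \<alpha> \<beta> s))"

lemma leaves_nonempty: "leaves t \<noteq> {#}"
  by (induction t) auto

lemma (in cring) words_set:
  assumes "\<alpha> \<in> carrier R" "\<beta> \<in> carrier R"
  shows "set (words R \<alpha> \<beta> t) \<subseteq> carrier R \<times> {w. mset w = leaves t}"
proof (induction t)
  case (Node s t)
  have "set (lprod R (@) (words R \<alpha> \<beta> s) (words R \<alpha> \<beta> t)) \<subseteq> carrier R \<times> {w. mset w = leaves (Node s t)}"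
    by (rule lprod_set[OF Node.IH]) auto
  moreover have "set (lprod R (@) (words R \<alpha> \<beta> t) (words R \<alpha> \<beta> s)) \<subseteq> carrier R \<times> {w. mset w = leaves (Node s t)}"
    by (rule lprod_set[OF Node.IH(2,1)]) auto
  ultimately show ?case
    unfolding words.simps set_append by (intro Un_least scl_set assms)
qed simp

lemma (in cring) words_set':
  assumes "\<alpha> \<in> carrier R" "\<beta> \<in> carrier R"
  shows "set (words R \<alpha> \<beta> t) \<subseteq> carrier R \<times> {w. w \<noteq> []}"
  using words_set[OF assms, of t] leaves_nonempty[of t] by fastforce

lemma (in as_algebra) tree_eval_twist:
  assumes ab: "\<alpha> \<in> carrier K" "\<beta> \<in> carrier K" and \<sigma>: "\<And>i. \<sigma> i \<in> carrier A"
  shows "tree_eval (twist \<alpha> \<beta> A) \<sigma> t = lcomb A (word_eval A \<sigma>) (words K \<alpha> \<beta> t)"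
proof (induction t)
  case (Leaf i)
  then show ?case using \<sigma> by simp
next
  case (Node s t)
  let ?N = "{w :: nat list. w \<noteq> []}"
  have S: "set (words K \<alpha> \<beta> t) \<subseteq> carrier K \<times> ?N" for t
    by (rule words_set'[OF ab])
  have P: "set (lprod K (@) (words K \<alpha> \<beta> s) (words K \<alpha> \<beta> t)) \<subseteq> carrier K \<times> ?N" for s t
    by (rule lprod_set[OF S S]) auto
  have E: "lcomb A (word_eval A \<sigma>) (lprod K (@) (words K \<alpha> \<beta> s) (words K \<alpha> \<beta> t)) =
    lcomb A (word_eval A \<sigma>) (words K \<alpha> \<beta> s) \<otimes>\<^bsub>A\<^esub> lcomb A (word_eval A \<sigma>) (words K \<alpha> \<beta> t)" for s t
    by (rule lcomb_lprod[OF S S]) (use \<sigma> in \<open>auto simp: word_eval_closed word_eval_append\<close>)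
  show ?case
    using Node \<sigma> ab
    by (simp add: lcomb_append[where X = ?N] lcomb_scl[where X = ?N] scl_set P word_eval_closed E)
qed

definition word_poly :: "('k, 'r) ring_scheme \<Rightarrow> 'k \<Rightarrow> 'k \<Rightarrow> 'k na_poly \<Rightarrow> ('k \<times> nat list) list" where
  "word_poly K \<alpha> \<beta> t = lbind K (monomials K t) (words K \<alpha> \<beta>)"

lemma (in cring) word_poly_set:
  assumes "\<alpha> \<in> carrier R" "\<beta> \<in> carrier R" "scalars t \<subseteq> carrier R"
  shows "set (word_poly R \<alpha> \<beta> t) \<subseteq> carrier R \<times> {w. w \<noteq> []}"
  unfolding word_poly_def
  using assms by (intro lbind_set[where X = UNIV] monomials_set words_set') auto

lemma (in as_algebra) lcomb_tree_eval_twist: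
  assumes ab: "\<alpha> \<in> carrier K" "\<beta> \<in> carrier K" and \<sigma>: "\<And>i. \<sigma> i \<in> carrier A"
    and l: "set l \<subseteq> carrier K \<times> UNIV"
  shows "lcomb A (tree_eval (twist \<alpha> \<beta> A) \<sigma>) l = lcomb A (word_eval A \<sigma>) (lbind K l (words K \<alpha> \<beta>))"
proof -
  have "lcomb A (word_eval A \<sigma>) (lbind K l (words K \<alpha> \<beta>)) =
    lcomb A (\<lambda>t. lcomb A (word_eval A \<sigma>) (words K \<alpha> \<beta> t)) l"
    by (rule lcomb_lbind[OF l words_set'[OF ab]]) (use \<sigma> in \<open>auto simp: word_eval_closed\<close>)
  then show ?thesis
    using \<sigma> by (simp add: tree_eval_twist[OF ab] cong: lcomb_cong)
qed

lemma (in as_algebra) na_eval_twist: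
  assumes ab: "\<alpha> \<in> carrier K" "\<beta> \<in> carrier K" and \<sigma>: "\<And>i. \<sigma> i \<in> carrier A"
    and t: "scalars t \<subseteq> carrier K"
  shows "na_eval (twist \<alpha> \<beta> A) \<sigma> t = lcomb A (word_eval A \<sigma>) (word_poly K \<alpha> \<beta> t)"
  using na_algebra.na_eval_monomials[OF na_algebra.intro[OF twist_algebra[OF ab]] t, of \<sigma>] \<sigma>
    lcomb_tree_eval_twist[OF ab \<sigma> monomials_set[OF t]]
  by (simp add: word_poly_def)

text \<open>Hence a polynomial whose expansion into words has vanishing coefficients is an identity of
  every twisted associative algebra.\<close>

lemma (in as_algebra) na_eval_twist_zero:
  assumes ab: "\<alpha> \<in> carrier K" "\<beta> \<in> carrier K" and \<sigma>: "\<And>i. \<sigma> i \<in> carrier A"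
    and t: "scalars t \<subseteq> carrier K" and z: "\<And>w. cf K (word_poly K \<alpha> \<beta> t) w = \<zero>"
  shows "na_eval (twist \<alpha> \<beta> A) \<sigma> t = \<zero>\<^bsub>A\<^esub>"
  unfolding na_eval_twist[OF ab \<sigma> t]
  by (rule lcomb_cf_zero[OF word_poly_set[OF ab t]]) (use \<sigma> z in \<open>auto simp: word_eval_closed\<close>)


section \<open>Magma algebras\<close>

text \<open>The field as a module over itself makes coefficients into linear combinations.\<close>

abbreviation self_mod :: "'k ring \<Rightarrow> ('k, 'k) module" where
  "self_mod K \<equiv> extension_algebra K (\<lambda>c. c)"

lemma (in module) lcomb_add_fun:
  assumes "set l \<subseteq> carrier R \<times> X" "\<And>x. x \<in> X \<Longrightarrow> f x \<in> carrier M" "\<And>x. x \<in> X \<Longrightarrow> g x \<in> carrier M"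
  shows "lcomb M (\<lambda>x. f x \<oplus>\<^bsub>M\<^esub> g x) l = lcomb M f l \<oplus>\<^bsub>M\<^esub> lcomb M g l"
  using assms(1)
proof (induction l)
  case (Cons p l)
  obtain c x where p: "p = (c, x)" by force
  have "lcomb M f l \<in> carrier M" "lcomb M g l \<in> carrier M"
    using Cons.prems assms by (auto intro!: lcomb_closed[where X = X])
  then show ?case
    using Cons assms by (auto simp: p smult_r_distr M.a_ac)
qed simp

lemma (in module) lcomb_smult_fun:
  assumes "set l \<subseteq> carrier R \<times> X" "\<And>x. x \<in> X \<Longrightarrow> f x \<in> carrier M" "c \<in> carrier R"
  shows "lcomb M (\<lambda>x. c \<odot>\<^bsub>M\<^esub> f x) l = c \<odot>\<^bsub>M\<^esub> lcomb M f l"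
  using assms(1)
proof (induction l)
  case (Cons p l)
  obtain d x where p: "p = (d, x)" by force
  have "lcomb M f l \<in> carrier M"
    using Cons.prems assms by (auto intro!: lcomb_closed[where X = X])
  moreover have "d \<odot>\<^bsub>M\<^esub> (c \<odot>\<^bsub>M\<^esub> f x) = c \<odot>\<^bsub>M\<^esub> (d \<odot>\<^bsub>M\<^esub> f x)"
    using Cons.prems assms by (auto simp: p m_comm simp flip: smult_assoc1)
  ultimately show ?case
    using Cons assms by (auto simp: p smult_r_distr)
qed (use assms in simp)

lemma (in module) lcomb_lprod_iter:
  assumes u: "set u \<subseteq> carrier R \<times> X" and v: "set v \<subseteq> carrier R \<times> Y"
    and h: "\<And>x y. x \<in> X \<Longrightarrow> y \<in> Y \<Longrightarrow> h (m x y) \<in> carrier M"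
  shows "lcomb M h (lprod R m u v) = lcomb M (\<lambda>x. lcomb M (\<lambda>y. h (m x y)) v) u"
  using u
proof (induction u)
  case (Cons p u)
  obtain c x where p: "p = (c, x)" by force
  have cx: "c \<in> carrier R" "x \<in> X"
    using Cons.prems p by auto
  let ?Z = "{z. \<exists>x y. x \<in> X \<and> y \<in> Y \<and> z = m x y}"
  let ?v = "map (\<lambda>q. (c \<otimes> fst q, m x (snd q))) v"
  have "set v \<subseteq> carrier R \<times> Y \<Longrightarrow> lcomb M h (map (\<lambda>q. (c \<otimes> fst q, m x (snd q))) v) =
    c \<odot>\<^bsub>M\<^esub> lcomb M (\<lambda>y. h (m x y)) v" for v
  proof (induction v)
    case (Cons q v)
    obtain d y where q: "q = (d, y)" by force
    have "lcomb M (\<lambda>y. h (m x y)) v \<in> carrier M"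
      using Cons.prems h cx by (auto intro!: lcomb_closed[where X = Y])
    then show ?case
      using Cons h cx by (auto simp: q smult_r_distr smult_assoc1)
  qed (use cx in simp)
  note 1 = this[OF v]
  have 2: "set ?v \<subseteq> carrier R \<times> ?Z"
    using v cx by fastforce
  have 3: "set (lprod R m u v) \<subseteq> carrier R \<times> ?Z"
    using Cons.prems v by (intro lprod_set[where X = X and Y = Y]) auto
  have "lcomb M h (?v @ lprod R m u v) = lcomb M h ?v \<oplus>\<^bsub>M\<^esub> lcomb M h (lprod R m u v)"
    by (rule lcomb_append[OF 2 3]) (use h in auto)
  then show ?case
    using Cons by (simp add: p 1)
qed simp

lemma extension_algebra_simps [simp]:
  "carrier (extension_algebra F \<phi>) = carrier F" "monoid.mult (extension_algebra F \<phi>) = monoid.mult F"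
  "zero (extension_algebra F \<phi>) = zero F" "add (extension_algebra F \<phi>) = add F"
  "c \<odot>\<^bsub>extension_algebra F \<phi>\<^esub> x = \<phi> c \<otimes>\<^bsub>F\<^esub> x"
  by (simp_all add: extension_algebra_def)

locale kfield = field K for K :: "'k ring" (structure)

lemma extension_abelian_group:
  fixes F :: "'f ring" assumes "ring F"
  shows "abelian_group (extension_algebra F \<phi>)"
proof -
  interpret ring F by fact
  show ?thesis
    by (rule abelian_groupI) (auto simp: a_ac intro: bexI[of _ "\<ominus>\<^bsub>F\<^esub> x" for x] l_neg)
qed

context kfield
begin

lemma self_module: "module K (self_mod K)"
  by (rule moduleI[OF is_cring extension_abelian_group[OF ring_axioms]]) (auto simp: m_assoc l_distr r_distr)

interpretation S: module K "self_mod K"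
  by (rule self_module)

lemma cf_lcomb: 
  assumes "set l \<subseteq> carrier K \<times> X"
  shows "cf K l w = lcomb (self_mod K) (\<lambda>x. if x = w then \<one> else \<zero>) l"
  unfolding cf_def lcomb_def lsum_record[OF extension_algebra_simps(3,4)]
  by (rule lsum_cong) (use assms in auto)

lemma cf_lprod:
  assumes "set u \<subseteq> carrier K \<times> X" "set v \<subseteq> carrier K \<times> Y"
  shows "cf K (lprod K m u v) z =
    lcomb (self_mod K) (\<lambda>x. lcomb (self_mod K) (\<lambda>y. if m x y = z then \<one> else \<zero>) v) u"
proof -
  have "set (lprod K m u v) \<subseteq> carrier K \<times> UNIV"
    using assms by (intro lprod_set[where X = X and Y = Y]) auto
  then show ?thesis
    using assms by (simp add: cf_lcomb S.lcomb_lprod_iter[where X = X and Y = Y])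
qed

lemma cf_lprod_cong:
  assumes u: "set u \<subseteq> carrier K \<times> X" "set u' \<subseteq> carrier K \<times> X" "cf K u = cf K u'"
    and v: "set v \<subseteq> carrier K \<times> Y" "set v' \<subseteq> carrier K \<times> Y" "cf K v = cf K v'"
  shows "cf K (lprod K m u v) z = cf K (lprod K m u' v') z"
proof -
  let ?h = "\<lambda>x y. if m x y = z then \<one> else \<zero>"
  have "lcomb (self_mod K) (?h x) v = lcomb (self_mod K) (?h x) v'" for x
    by (rule S.lcomb_cf_cong[where X = Y]) (use v in auto)
  moreover have "lcomb (self_mod K) (\<lambda>x. lcomb (self_mod K) (?h x) v') u =
     lcomb (self_mod K) (\<lambda>x. lcomb (self_mod K) (?h x) v') u'"
    by (rule S.lcomb_cf_cong[where X = X])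
      (use u v S.lcomb_closed[of v' Y] in auto)
  ultimately show ?thesis
    using u v by (simp add: cf_lprod[where X = X and Y = Y])
qed

end

lemma magma_algebra_simps:
  "carrier (magma_algebra K X m) = {u. (\<forall>x. u x \<in> carrier K) \<and> (\<forall>x. x \<notin> X \<longrightarrow> u x = \<zero>\<^bsub>K\<^esub>) \<and>
                    finite {x. u x \<noteq> \<zero>\<^bsub>K\<^esub>}}"
  "zero (magma_algebra K X m) = (\<lambda>_. \<zero>\<^bsub>K\<^esub>)"
  "u \<oplus>\<^bsub>magma_algebra K X m\<^esub> v = (\<lambda>x. u x \<oplus>\<^bsub>K\<^esub> v x)"
  "c \<odot>\<^bsub>magma_algebra K X m\<^esub> u = (\<lambda>x. c \<otimes>\<^bsub>K\<^esub> u x)"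
  by (simp_all add: magma_algebra_def)

context kfield
begin

interpretation S: module K "self_mod K"
  by (rule self_module)

lemma cf_in_magma:
  assumes "set l \<subseteq> carrier K \<times> X"
  shows "cf K l \<in> carrier (magma_algebra K X m)"
proof -
  have z: "cf K l x = \<zero>" if "x \<notin> snd ` set l" for x
    unfolding cf_def using that by (intro lsum_zero) auto
  then have "{x. cf K l x \<noteq> \<zero>} \<subseteq> snd ` set l"
    by auto
  moreover have "x \<notin> X \<Longrightarrow> cf K l x = \<zero>" for x
    using assms by (intro z) auto
  ultimately show ?thesis
    using assms by (auto simp: magma_algebra_simps intro: cf_closed finite_subset)
qed

lemma magma_ex_cf:
  assumes u: "u \<in> carrier (magma_algebra K X m)"
  obtains xs where "distinct xs" "set xs = {x. u x \<noteq> \<zero>}"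
    "set (map (\<lambda>x. (u x, x)) xs) \<subseteq> carrier K \<times> X" "cf K (map (\<lambda>x. (u x, x)) xs) = u"
proof -
  have "finite {x. u x \<noteq> \<zero>}" using u by (simp add: magma_algebra_simps)
  then obtain xs where xs: "set xs = {x. u x \<noteq> \<zero>}" "distinct xs"
    using finite_distinct_list by blast
  have uc: "u x \<in> carrier K" for x
    using u by (simp add: magma_algebra_simps)
  have "cf K (map (\<lambda>x. (u x, x)) xs) w = u w" for w
  proof (cases "w \<in> set xs")
    case True
    then show ?thesis
      using lsum_delta[OF xs(2) True, of u] uc by (simp add: cf_def lsum_map cong: if_cong)
  next
    case False
    then have "cf K (map (\<lambda>x. (u x, x)) xs) w = \<zero>"
      unfolding cf_def lsum_map by (intro lsum_zero) auto
    then show ?thesis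
      using False xs by auto
  qed
  moreover have "set (map (\<lambda>x. (u x, x)) xs) \<subseteq> carrier K \<times> X"
    using u xs by (auto simp: magma_algebra_simps)
  ultimately show ?thesis
    using that xs by blast
qed

lemma magma_mult_cf:
  assumes l: "set l \<subseteq> carrier K \<times> X" and l': "set l' \<subseteq> carrier K \<times> X"
  shows "cf K l \<otimes>\<^bsub>magma_algebra K X m\<^esub> cf K l' = cf K (lprod K m l l')"
proof
  fix z
  let ?u = "cf K l" and ?v = "cf K l'"
  obtain xs where xs: "distinct xs" "set xs = {x. ?u x \<noteq> \<zero>}"
    "set (map (\<lambda>x. (?u x, x)) xs) \<subseteq> carrier K \<times> X" "cf K (map (\<lambda>x. (?u x, x)) xs) = ?u"
    using magma_ex_cf[OF cf_in_magma[OF l]] .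
  obtain ys where ys: "distinct ys" "set ys = {x. ?v x \<noteq> \<zero>}"
    "set (map (\<lambda>x. (?v x, x)) ys) \<subseteq> carrier K \<times> X" "cf K (map (\<lambda>x. (?v x, x)) ys) = ?v"
    using magma_ex_cf[OF cf_in_magma[OF l']] .
  have uc: "?u x \<in> carrier K" and vc: "?v x \<in> carrier K" for x
    using cf_closed[OF l] cf_closed[OF l'] by auto
  let ?zs = "filter (\<lambda>(x, y). m x y = z) (List.product xs ys)"
  have "cf K (lprod K m l l') z = cf K (lprod K m (map (\<lambda>x. (?u x, x)) xs) (map (\<lambda>x. (?v x, x)) ys)) z"
    by (rule cf_lprod_cong[where X = X and Y = X]) (use l l' xs ys in auto)
  also have "lprod K m (map (\<lambda>x. (f x, x)) xs) (map (\<lambda>x. (g x, x)) ys) =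
      map (\<lambda>p. (f (fst p) \<otimes> g (snd p), m (fst p) (snd p))) (List.product xs ys)" for f g
    by (induction xs) (auto simp: comp_def)
  also have "cf K (map (\<lambda>p. (?u (fst p) \<otimes> ?v (snd p), m (fst p) (snd p))) (List.product xs ys)) z =
      lsum K (\<lambda>p. if m (fst p) (snd p) = z then ?u (fst p) \<otimes> ?v (snd p) else \<zero>) (List.product xs ys)"
    by (simp add: cf_def[of K "map h l" for h l] lsum_map cong: if_cong)
  also have "\<dots> = lsum K (\<lambda>p. ?u (fst p) \<otimes> ?v (snd p)) ?zs"
    by (subst lsum_filter) (auto intro!: lsum_cong simp: uc vc)
  also have "\<dots> = finsum K (\<lambda>p. ?u (fst p) \<otimes> ?v (snd p)) (set ?zs)"
    by (rule lsum_finsum) (use xs ys uc vc in \<open>auto simp: distinct_product\<close>)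
  also have "set ?zs = {(x, y). ?u x \<noteq> \<zero> \<and> ?v y \<noteq> \<zero> \<and> m x y = z}"
    using xs ys by auto
  finally show "(?u \<otimes>\<^bsub>magma_algebra K X m\<^esub> ?v) z = cf K (lprod K m l l') z"
    by (simp add: magma_algebra_def case_prod_beta')
qed

lemma magma_module: "module K (magma_algebra K X m)"
proof (rule moduleI[OF is_cring])
  show "abelian_group (magma_algebra K X m)"
  proof (rule abelian_groupI)
    fix u assume u: "u \<in> carrier (magma_algebra K X m)"
    have "(\<lambda>x. \<ominus> u x) \<in> carrier (magma_algebra K X m)"
    proof -
      have "{x. \<ominus> u x \<noteq> \<zero>} \<subseteq> {x. u x \<noteq> \<zero>}"
        by auto
      then show ?thesis
        using u by (auto simp: magma_algebra_simps intro: finite_subset)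
    qed
    moreover have "(\<lambda>x. \<ominus> u x) \<oplus>\<^bsub>magma_algebra K X m\<^esub> u = \<zero>\<^bsub>magma_algebra K X m\<^esub>"
      using u by (simp add: magma_algebra_simps l_neg)
    ultimately show "\<exists>y\<in>carrier (magma_algebra K X m). y \<oplus>\<^bsub>magma_algebra K X m\<^esub> u = \<zero>\<^bsub>magma_algebra K X m\<^esub>"
      by blast
  next
    fix u v assume "u \<in> carrier (magma_algebra K X m)" "v \<in> carrier (magma_algebra K X m)"
    moreover have "{x. u x \<oplus> v x \<noteq> \<zero>} \<subseteq> {x. u x \<noteq> \<zero>} \<union> {x. v x \<noteq> \<zero>}"
      by auto
    ultimately show "u \<oplus>\<^bsub>magma_algebra K X m\<^esub> v \<in> carrier (magma_algebra K X m)"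
      by (auto simp: magma_algebra_simps intro: finite_subset)
  qed (auto simp: magma_algebra_simps a_ac)
next
  fix c u assume "c \<in> carrier K" "u \<in> carrier (magma_algebra K X m)"
  moreover from this have "{x. c \<otimes> u x \<noteq> \<zero>} \<subseteq> {x. u x \<noteq> \<zero>}"
    by auto
  ultimately show "c \<odot>\<^bsub>magma_algebra K X m\<^esub> u \<in> carrier (magma_algebra K X m)"
    by (auto simp: magma_algebra_simps intro: finite_subset)
qed (auto simp: magma_algebra_simps l_distr r_distr m_assoc)

lemma cf_append_fun:
  "set l \<subseteq> carrier K \<times> X \<Longrightarrow> set l' \<subseteq> carrier K \<times> X \<Longrightarrow>
    cf K (l @ l') = cf K l \<oplus>\<^bsub>magma_algebra K X m\<^esub> cf K l'"
  by (simp add: magma_algebra_simps cf_append fun_eq_iff)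

lemma cf_scl_fun:
  "c \<in> carrier K \<Longrightarrow> set l \<subseteq> carrier K \<times> X \<Longrightarrow> cf K (scl K c l) = c \<odot>\<^bsub>magma_algebra K X m\<^esub> cf K l"
  by (simp add: magma_algebra_simps cf_scl fun_eq_iff)

lemma magma_assoc_algebra:
  assumes m: "\<And>x y. x \<in> X \<Longrightarrow> y \<in> X \<Longrightarrow> m x y \<in> X"
    and ma: "\<And>x y z. x \<in> X \<Longrightarrow> y \<in> X \<Longrightarrow> z \<in> X \<Longrightarrow> m (m x y) z = m x (m y z)"
  shows "assoc_algebra K (magma_algebra K X m)" (is "assoc_algebra K ?A")
proof -
  interpret M: module K ?A by (rule magma_module)
  let ?L = "\<lambda>l. set l \<subseteq> carrier K \<times> X"
  have P: "?L a \<Longrightarrow> ?L b \<Longrightarrow> ?L (lprod K m a b)" for a b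
    by (rule lprod_set[OF _ _ m])
  have ex: "\<exists>l. ?L l \<and> u = cf K l" if "u \<in> carrier ?A" for u
    using magma_ex_cf[OF that] by metis
  have cl: "u \<otimes>\<^bsub>?A\<^esub> v \<in> carrier ?A" if u: "u \<in> carrier ?A" "v \<in> carrier ?A" for u v
  proof -
    obtain a b where ab: "?L a" "?L b" "u = cf K a" "v = cf K b"
      using ex u by metis
    then show ?thesis
      by (simp add: magma_mult_cf cf_in_magma P)
  qed
  have inner: "lcomb (self_mod K) (\<lambda>y. if m x y = z then \<one> else \<zero>) b \<in> carrier K" if "?L b" for x z b
    using S.lcomb_closed[OF that, of "\<lambda>y. if m x y = z then \<one> else \<zero>"] by auto
  show ?thesis
  proof (intro assoc_algebra.intro assoc_algebra_axioms.intro nonassoc_algebra.intro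
      nonassoc_algebra_axioms.intro magma_module field_axioms cl)
    fix u v w assume "u \<in> carrier ?A" "v \<in> carrier ?A" "w \<in> carrier ?A"
    then obtain a b c where abc: "?L a" "?L b" "?L c" "u = cf K a" "v = cf K b" "w = cf K c"
      using ex by metis
    have L: "?L (a @ b)" "?L (b @ c)"
      using abc by auto
    have "(u \<oplus>\<^bsub>?A\<^esub> v) \<otimes>\<^bsub>?A\<^esub> w = cf K (lprod K m (a @ b) c)"
      using abc L by (simp add: magma_mult_cf flip: cf_append_fun)
    also have "\<dots> = cf K (lprod K m a c @ lprod K m b c)"
      by (simp add: lprod_def)
    also have "\<dots> = u \<otimes>\<^bsub>?A\<^esub> w \<oplus>\<^bsub>?A\<^esub> v \<otimes>\<^bsub>?A\<^esub> w"
      using abc by (simp add: magma_mult_cf P cf_append_fun[where X = X and m = m])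
    finally show "(u \<oplus>\<^bsub>?A\<^esub> v) \<otimes>\<^bsub>?A\<^esub> w = u \<otimes>\<^bsub>?A\<^esub> w \<oplus>\<^bsub>?A\<^esub> v \<otimes>\<^bsub>?A\<^esub> w" .
    have "u \<otimes>\<^bsub>?A\<^esub> (v \<oplus>\<^bsub>?A\<^esub> w) = cf K (lprod K m a (b @ c))"
      using abc L by (simp add: magma_mult_cf flip: cf_append_fun)
    also have "\<dots> = cf K (lprod K m a b @ lprod K m a c)"
    proof
      fix z
      let ?h = "\<lambda>x y. if m x y = z then \<one> else \<zero>"
      have "lcomb (self_mod K) (?h x) (b @ c) =
          lcomb (self_mod K) (?h x) b \<oplus>\<^bsub>self_mod K\<^esub> lcomb (self_mod K) (?h x) c" for x
        by (rule S.lcomb_append[where X = X]) (use abc in auto)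
      moreover have "lcomb (self_mod K) (\<lambda>x. lcomb (self_mod K) (?h x) b \<oplus>\<^bsub>self_mod K\<^esub> lcomb (self_mod K) (?h x) c) a
        = lcomb (self_mod K) (\<lambda>x. lcomb (self_mod K) (?h x) b) a \<oplus>\<^bsub>self_mod K\<^esub>
          lcomb (self_mod K) (\<lambda>x. lcomb (self_mod K) (?h x) c) a"
        by (rule S.lcomb_add_fun[where X = X]) (use abc inner in auto)
      ultimately show "cf K (lprod K m a (b @ c)) z = cf K (lprod K m a b @ lprod K m a c) z"
        using abc L by (simp add: cf_append[where X = X] P cf_lprod[where X = X and Y = X])
    qed
    also have "\<dots> = u \<otimes>\<^bsub>?A\<^esub> v \<oplus>\<^bsub>?A\<^esub> u \<otimes>\<^bsub>?A\<^esub> w"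
      using abc by (simp add: magma_mult_cf P cf_append_fun[where X = X and m = m])
    finally show "u \<otimes>\<^bsub>?A\<^esub> (v \<oplus>\<^bsub>?A\<^esub> w) = u \<otimes>\<^bsub>?A\<^esub> v \<oplus>\<^bsub>?A\<^esub> u \<otimes>\<^bsub>?A\<^esub> w" .
    have "cf K (lprod K m (lprod K m a b) c) z = cf K (lprod K m a (lprod K m b c)) z" for z
    proof -
      have "cf K (lprod K m (lprod K m a b) c) z = lcomb (self_mod K) (\<lambda>x. lcomb (self_mod K) (\<lambda>y.
         lcomb (self_mod K) (\<lambda>w. if m (m x y) w = z then \<one> else \<zero>) c) b) a"
        using abc by (simp add: cf_lprod[where X = X and Y = X] P
           S.lcomb_lprod_iter[where X = X and Y = X] inner)
      also have "\<dots> = lcomb (self_mod K) (\<lambda>x. lcomb (self_mod K) (\<lambda>y.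
         lcomb (self_mod K) (\<lambda>w. if m x (m y w) = z then \<one> else \<zero>) c) b) a"
        using abc(1-3) ma by (intro lcomb_cong) (auto dest!: subsetD)
      also have "\<dots> = cf K (lprod K m a (lprod K m b c)) z"
        using abc by (simp add: cf_lprod[where X = X and Y = X] P
           S.lcomb_lprod_iter[where X = X and Y = X])
      finally show ?thesis .
    qed
    then show "u \<otimes>\<^bsub>?A\<^esub> v \<otimes>\<^bsub>?A\<^esub> w = u \<otimes>\<^bsub>?A\<^esub> (v \<otimes>\<^bsub>?A\<^esub> w)"
      unfolding abc by (simp add: magma_mult_cf P abc(1-3)) (rule ext, simp)
  next
    fix k u v assume "u \<in> carrier ?A" "v \<in> carrier ?A" and k: "k \<in> carrier K"
    then obtain a b where abc: "?L a" "?L b" "u = cf K a" "v = cf K b"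
      using ex by metis
    note Sc = scl_set[OF k]
    have "cf K (lprod K m (scl K k a) b) z = cf K (scl K k (lprod K m a b)) z" for z
    proof -
      let ?f = "\<lambda>x. lcomb (self_mod K) (\<lambda>y. if m x y = z then \<one> else \<zero>) b"
      have "lcomb (self_mod K) ?f (scl K k a) = k \<odot>\<^bsub>self_mod K\<^esub> lcomb (self_mod K) ?f a"
        by (rule S.lcomb_scl[where X = X]) (use abc k inner in auto)
      then show ?thesis
        using abc k by (simp add: P Sc cf_scl[where X = X] cf_lprod[where X = X and Y = X])
    qed
    then show "(k \<odot>\<^bsub>?A\<^esub> u) \<otimes>\<^bsub>?A\<^esub> v = k \<odot>\<^bsub>?A\<^esub> (u \<otimes>\<^bsub>?A\<^esub> v)"
      using k unfolding abc by (simp add: magma_mult_cf P Sc abc(1,2) flip: cf_scl_fun) (rule ext, simp)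
    have "cf K (lprod K m a (scl K k b)) z = cf K (scl K k (lprod K m a b)) z" for z
    proof -
      let ?h = "\<lambda>x y. if m x y = z then \<one> else \<zero>"
      have "lcomb (self_mod K) (?h x) (scl K k b) = k \<odot>\<^bsub>self_mod K\<^esub> lcomb (self_mod K) (?h x) b" for x
        by (rule S.lcomb_scl[where X = X]) (use abc k in auto)
      moreover have "lcomb (self_mod K) (\<lambda>x. k \<odot>\<^bsub>self_mod K\<^esub> lcomb (self_mod K) (?h x) b) a =
          k \<odot>\<^bsub>self_mod K\<^esub> lcomb (self_mod K) (\<lambda>x. lcomb (self_mod K) (?h x) b) a"
        by (rule S.lcomb_smult_fun[where X = X]) (use abc k inner in auto)
      ultimately show ?thesis
        using abc k by (simp add: P Sc cf_scl[where X = X] cf_lprod[where X = X and Y = X])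
    qed
    then show "u \<otimes>\<^bsub>?A\<^esub> (k \<odot>\<^bsub>?A\<^esub> v) = k \<odot>\<^bsub>?A\<^esub> (u \<otimes>\<^bsub>?A\<^esub> v)"
      using k unfolding abc by (simp add: magma_mult_cf P Sc abc(1,2) flip: cf_scl_fun) (rule ext, simp)
  qed
qed

end


section \<open>Algebras of operators on function spaces\<close>

locale field_ext = K: field K + F: field F for K :: "'k ring" and F :: "'f ring" +
  fixes \<phi> :: "'k \<Rightarrow> 'f"
  assumes \<phi>: "\<phi> \<in> ring_hom K F"
begin

lemma \<phi>_simps [simp]:
  "c \<in> carrier K \<Longrightarrow> \<phi> c \<in> carrier F"
  "c \<in> carrier K \<Longrightarrow> d \<in> carrier K \<Longrightarrow> \<phi> (c \<otimes>\<^bsub>K\<^esub> d) = \<phi> c \<otimes>\<^bsub>F\<^esub> \<phi> d"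
  "c \<in> carrier K \<Longrightarrow> d \<in> carrier K \<Longrightarrow> \<phi> (c \<oplus>\<^bsub>K\<^esub> d) = \<phi> c \<oplus>\<^bsub>F\<^esub> \<phi> d"
  "\<phi> \<one>\<^bsub>K\<^esub> = \<one>\<^bsub>F\<^esub>" "\<phi> \<zero>\<^bsub>K\<^esub> = \<zero>\<^bsub>F\<^esub>"
  using \<phi> ring_hom_zero[OF \<phi> K.ring_axioms F.ring_axioms] by (auto simp: ring_hom_def)

lemma \<phi>_minus [simp]: "c \<in> carrier K \<Longrightarrow> \<phi> (\<ominus>\<^bsub>K\<^esub> c) = \<ominus>\<^bsub>F\<^esub> \<phi> c"
proof -
  assume c: "c \<in> carrier K"
  then have "\<phi> (\<ominus>\<^bsub>K\<^esub> c) \<oplus>\<^bsub>F\<^esub> \<phi> c = \<zero>\<^bsub>F\<^esub>"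
    by (simp add: K.l_neg flip: \<phi>_simps(3))
  then show ?thesis
    using c F.minus_equality by auto
qed

lemma \<phi>_eq_zero: "c \<in> carrier K \<Longrightarrow> \<phi> c = \<zero>\<^bsub>F\<^esub> \<Longrightarrow> c = \<zero>\<^bsub>K\<^esub>"
proof (rule ccontr)
  assume c: "c \<in> carrier K" "\<phi> c = \<zero>\<^bsub>F\<^esub>" "c \<noteq> \<zero>\<^bsub>K\<^esub>"
  then have i: "inv\<^bsub>K\<^esub> c \<in> carrier K" "c \<otimes>\<^bsub>K\<^esub> inv\<^bsub>K\<^esub> c = \<one>\<^bsub>K\<^esub>"
    using K.field_Units by auto
  have "\<phi> \<one>\<^bsub>K\<^esub> = \<phi> c \<otimes>\<^bsub>F\<^esub> \<phi> (inv\<^bsub>K\<^esub> c)"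
    using \<phi>_simps(2)[OF c(1) i(1)] i(2) by simp
  then show False
    using c(2) i(1) F.one_not_zero by simp
qed

lemma lsum_\<phi>:
  "(\<And>x. x \<in> set xs \<Longrightarrow> f x \<in> carrier K) \<Longrightarrow> \<phi> (lsum K f xs) = lsum F (\<lambda>x. \<phi> (f x)) xs"
  by (rule lsum_hom) (use K.abelian_monoid_axioms in auto)

end

text \<open>The linear operators on a space \<open>S\<close> of functions with values in \<open>F\<close>. The product applies the
  left factor first, since words will act by left quotients.\<close>

definition operators :: "'f ring \<Rightarrow> ('k \<Rightarrow> 'f) \<Rightarrow> ('x \<Rightarrow> 'f) set \<Rightarrow> ('k, ('x \<Rightarrow> 'f) \<Rightarrow> 'x \<Rightarrow> 'f) module" where
  "operators F \<phi> S =
     \<lparr>carrier = {T \<in> extensional S. T \<in> S \<rightarrow> S \<and>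
        (\<forall>g\<in>S. \<forall>h\<in>S. T (\<lambda>x. g x \<oplus>\<^bsub>F\<^esub> h x) = (\<lambda>x. T g x \<oplus>\<^bsub>F\<^esub> T h x)) \<and>
        (\<forall>a\<in>carrier F. \<forall>g\<in>S. T (\<lambda>x. a \<otimes>\<^bsub>F\<^esub> g x) = (\<lambda>x. a \<otimes>\<^bsub>F\<^esub> T g x))},
      monoid.mult = \<lambda>T U. \<lambda>g\<in>S. U (T g),
      one = undefined,
      zero = \<lambda>g\<in>S. \<lambda>x. \<zero>\<^bsub>F\<^esub>,
      add = \<lambda>T U. \<lambda>g\<in>S. \<lambda>x. T g x \<oplus>\<^bsub>F\<^esub> U g x,
      smult = \<lambda>c T. \<lambda>g\<in>S. \<lambda>x. \<phi> c \<otimes>\<^bsub>F\<^esub> T g x\<rparr>"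

locale function_space = field_ext +
  fixes S :: "('x \<Rightarrow> 'b) set"
  assumes range: "g \<in> S \<Longrightarrow> g x \<in> carrier F"
    and S_zero [simp]: "(\<lambda>x. \<zero>\<^bsub>F\<^esub>) \<in> S"
    and S_add [simp]: "g \<in> S \<Longrightarrow> h \<in> S \<Longrightarrow> (\<lambda>x. g x \<oplus>\<^bsub>F\<^esub> h x) \<in> S"
    and S_smult [simp]: "a \<in> carrier F \<Longrightarrow> g \<in> S \<Longrightarrow> (\<lambda>x. a \<otimes>\<^bsub>F\<^esub> g x) \<in> S"
begin

abbreviation "E \<equiv> operators F \<phi> S"

lemma operators_simps:
  "T \<in> carrier E \<longleftrightarrow> T \<in> extensional S \<and> (\<forall>g\<in>S. T g \<in> S) \<and>
        (\<forall>g\<in>S. \<forall>h\<in>S. T (\<lambda>x. g x \<oplus>\<^bsub>F\<^esub> h x) = (\<lambda>x. T g x \<oplus>\<^bsub>F\<^esub> T h x)) \<and>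
        (\<forall>a\<in>carrier F. \<forall>g\<in>S. T (\<lambda>x. a \<otimes>\<^bsub>F\<^esub> g x) = (\<lambda>x. a \<otimes>\<^bsub>F\<^esub> T g x))"
  "T \<otimes>\<^bsub>E\<^esub> U = (\<lambda>g\<in>S. U (T g))"
  "\<zero>\<^bsub>E\<^esub> = (\<lambda>g\<in>S. \<lambda>x. \<zero>\<^bsub>F\<^esub>)"
  "T \<oplus>\<^bsub>E\<^esub> U = (\<lambda>g\<in>S. \<lambda>x. T g x \<oplus>\<^bsub>F\<^esub> U g x)"
  "c \<odot>\<^bsub>E\<^esub> T = (\<lambda>g\<in>S. \<lambda>x. \<phi> c \<otimes>\<^bsub>F\<^esub> T g x)"
  by (auto simp: operators_def)

lemma operator_range: "T \<in> carrier E \<Longrightarrow> g \<in> S \<Longrightarrow> T g x \<in> carrier F"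
  using range by (auto simp: operators_simps)

lemma operator_eqI:
  "T \<in> extensional S \<Longrightarrow> U \<in> extensional S \<Longrightarrow> (\<And>g x. g \<in> S \<Longrightarrow> T g x = U g x) \<Longrightarrow> T = U"
  by (rule extensionalityI[where A = S]) (auto simp: fun_eq_iff)

lemma operator_smult:
  assumes "T \<in> carrier E" "a \<in> carrier F"
  shows "(\<lambda>g\<in>S. \<lambda>x. a \<otimes>\<^bsub>F\<^esub> T g x) \<in> carrier E"
  using assms by (auto simp: operators_simps F.r_distr range F.m_lcomm)

lemma operators_algebra: "assoc_algebra K E"
proof -
  have ext: "T \<in> extensional S" if "T \<in> carrier E" for T
    using that by (simp add: operators_simps)
  have add: "T \<oplus>\<^bsub>E\<^esub> U \<in> carrier E" if "T \<in> carrier E" "U \<in> carrier E" for T U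
    using that by (auto simp: operators_simps F.a_ac range F.r_distr)
  have smult: "c \<odot>\<^bsub>E\<^esub> T \<in> carrier E" if "T \<in> carrier E" "c \<in> carrier K" for T c
    using operator_smult[of T "\<phi> c"] that by (simp add: operators_simps(5))
  have mult: "T \<otimes>\<^bsub>E\<^esub> U \<in> carrier E" if "T \<in> carrier E" "U \<in> carrier E" for T U
    using that by (auto simp: operators_simps)
  have S: "T g \<in> S" if "T \<in> carrier E" "g \<in> S" for T g
    using that by (simp add: operators_simps)
  have ab: "abelian_group E"
  proof (rule abelian_groupI)
    show "\<zero>\<^bsub>E\<^esub> \<in> carrier E"
      by (auto simp: operators_simps)
    fix T assume T: "T \<in> carrier E"
    have "\<ominus>\<^bsub>K\<^esub> \<one>\<^bsub>K\<^esub> \<odot>\<^bsub>E\<^esub> T \<oplus>\<^bsub>E\<^esub> T = \<zero>\<^bsub>E\<^esub>"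
      by (rule operator_eqI) (use operator_range[OF T] in \<open>auto simp: operators_simps(2-) F.l_minus F.l_neg\<close>)
    then show "\<exists>U\<in>carrier E. U \<oplus>\<^bsub>E\<^esub> T = \<zero>\<^bsub>E\<^esub>"
      using smult[OF T] by blast
  qed (rule add operator_eqI; auto simp: operators_simps(2-) operator_range F.a_ac ext)+
  have md: "module K E"
    by (rule moduleI[OF K.is_cring ab])
      (rule smult operator_eqI;
        auto simp: operators_simps(2-) operator_range ext F.l_distr F.r_distr F.m_assoc)+
  show ?thesis
  proof (intro assoc_algebra.intro assoc_algebra_axioms.intro nonassoc_algebra.intro
      nonassoc_algebra_axioms.intro md K.field_axioms mult)
    fix T U V assume "T \<in> carrier E" "U \<in> carrier E" "V \<in> carrier E"
    then show "(T \<oplus>\<^bsub>E\<^esub> U) \<otimes>\<^bsub>E\<^esub> V = T \<otimes>\<^bsub>E\<^esub> V \<oplus>\<^bsub>E\<^esub> U \<otimes>\<^bsub>E\<^esub> V"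
      "T \<otimes>\<^bsub>E\<^esub> (U \<oplus>\<^bsub>E\<^esub> V) = T \<otimes>\<^bsub>E\<^esub> U \<oplus>\<^bsub>E\<^esub> T \<otimes>\<^bsub>E\<^esub> V"
      "T \<otimes>\<^bsub>E\<^esub> U \<otimes>\<^bsub>E\<^esub> V = T \<otimes>\<^bsub>E\<^esub> (U \<otimes>\<^bsub>E\<^esub> V)"
      by (auto intro!: operator_eqI simp: operators_simps)
  next
    fix c T U assume "c \<in> carrier K" "T \<in> carrier E" "U \<in> carrier E"
    then show "(c \<odot>\<^bsub>E\<^esub> T) \<otimes>\<^bsub>E\<^esub> U = c \<odot>\<^bsub>E\<^esub> (T \<otimes>\<^bsub>E\<^esub> U)"
      "T \<otimes>\<^bsub>E\<^esub> (c \<odot>\<^bsub>E\<^esub> U) = c \<odot>\<^bsub>E\<^esub> (T \<otimes>\<^bsub>E\<^esub> U)"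
      by (auto intro!: operator_eqI simp: operators_simps)
  qed
qed

sublocale E: as_algebra K E
  by (rule as_algebra.intro) (rule operators_algebra)

lemma lcomb_operator:
  assumes "set l \<subseteq> carrier K \<times> X" "\<And>x. x \<in> X \<Longrightarrow> f x \<in> carrier E" "g \<in> S"
  shows "lcomb E f l g y = lsum F (\<lambda>p. \<phi> (fst p) \<otimes>\<^bsub>F\<^esub> f (snd p) g y) l"
  using assms(1)
proof (induction l)
  case (Cons p l)
  then show ?case
    using assms by (cases p) (simp add: operators_simps)
qed (use assms in \<open>simp add: operators_simps\<close>)

lemma lsum_operator:
  assumes "\<And>x. x \<in> set l \<Longrightarrow> f x \<in> carrier E" "g \<in> S"
  shows "lsum E f l g y = lsum F (\<lambda>x. f x g y) l"
  using assms by (induction l) (auto simp: operators_simps)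

end


section \<open>Extension of scalars\<close>

text \<open>A criterion for a balanced biadditive multiplicative map \<open>\<Psi>\<close> from \<open>F \<times> A\<close> to an algebra \<open>R\<close> to
  embed \<open>F \<otimes>\<^sub>K A\<close> into \<open>R\<close>. The functions \<open>co\<close> are coordinates on \<open>A\<close>, and a vanishing sum of
  values of \<open>\<Psi>\<close> is supposed to be seen by them.\<close>

locale tensor_embedding = field_ext K F \<phi> + A: na_algebra K A + R: na_algebra K R
  for K :: "'k ring" and F :: "'f ring" and \<phi> :: "'k \<Rightarrow> 'f"
    and A :: "('k, 'a) module" and R :: "('k, 'r) module" +
  fixes \<Psi> :: "'f \<times> 'a \<Rightarrow> 'r" and co :: "'a \<Rightarrow> 'i \<Rightarrow> 'k"
  assumes \<Psi>_closed: "f \<in> carrier F \<Longrightarrow> a \<in> carrier A \<Longrightarrow> \<Psi> (f, a) \<in> carrier R"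
    and \<Psi>_add1: "f \<in> carrier F \<Longrightarrow> f' \<in> carrier F \<Longrightarrow> a \<in> carrier A \<Longrightarrow>
      \<Psi> (f \<oplus>\<^bsub>F\<^esub> f', a) = \<Psi> (f, a) \<oplus>\<^bsub>R\<^esub> \<Psi> (f', a)"
    and \<Psi>_add2: "f \<in> carrier F \<Longrightarrow> a \<in> carrier A \<Longrightarrow> a' \<in> carrier A \<Longrightarrow>
      \<Psi> (f, a \<oplus>\<^bsub>A\<^esub> a') = \<Psi> (f, a) \<oplus>\<^bsub>R\<^esub> \<Psi> (f, a')"
    and \<Psi>_smult1: "c \<in> carrier K \<Longrightarrow> f \<in> carrier F \<Longrightarrow> a \<in> carrier A \<Longrightarrow>
      \<Psi> (\<phi> c \<otimes>\<^bsub>F\<^esub> f, a) = c \<odot>\<^bsub>R\<^esub> \<Psi> (f, a)"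
    and \<Psi>_smult2: "c \<in> carrier K \<Longrightarrow> f \<in> carrier F \<Longrightarrow> a \<in> carrier A \<Longrightarrow>
      \<Psi> (f, c \<odot>\<^bsub>A\<^esub> a) = c \<odot>\<^bsub>R\<^esub> \<Psi> (f, a)"
    and \<Psi>_mult: "f \<in> carrier F \<Longrightarrow> f' \<in> carrier F \<Longrightarrow> a \<in> carrier A \<Longrightarrow> a' \<in> carrier A \<Longrightarrow>
      \<Psi> (f \<otimes>\<^bsub>F\<^esub> f', a \<otimes>\<^bsub>A\<^esub> a') = \<Psi> (f, a) \<otimes>\<^bsub>R\<^esub> \<Psi> (f', a')"
    and co_closed: "a \<in> carrier A \<Longrightarrow> co a i \<in> carrier K"
    and co_add: "a \<in> carrier A \<Longrightarrow> a' \<in> carrier A \<Longrightarrow> co (a \<oplus>\<^bsub>A\<^esub> a') i = co a i \<oplus>\<^bsub>K\<^esub> co a' i"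
    and co_smult: "c \<in> carrier K \<Longrightarrow> a \<in> carrier A \<Longrightarrow> co (c \<odot>\<^bsub>A\<^esub> a) i = c \<otimes>\<^bsub>K\<^esub> co a i"
    and co_inj: "a \<in> carrier A \<Longrightarrow> (\<And>i. co a i = \<zero>\<^bsub>K\<^esub>) \<Longrightarrow> a = \<zero>\<^bsub>A\<^esub>"
    and separation: "set L \<subseteq> carrier F \<times> carrier A \<Longrightarrow> lsum R \<Psi> L = \<zero>\<^bsub>R\<^esub> \<Longrightarrow>
      lsum F (\<lambda>p. fst p \<otimes>\<^bsub>F\<^esub> \<phi> (co (snd p) i)) L = \<zero>\<^bsub>F\<^esub>"
begin

abbreviation "X \<equiv> carrier F \<times> carrier A"
abbreviation "P \<equiv> pair_algebra K (extension_algebra F \<phi>) A"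
abbreviation "e \<equiv> (\<lambda>z :: 'f \<times> 'a. basis_vec K z)"
abbreviation "I \<equiv> generated_submodule K P (tensor_relations K (extension_algebra F \<phi>) A)"
abbreviation "T \<equiv> tensor_algebra K (extension_algebra F \<phi>) A"
abbreviation "pmult \<equiv> (\<lambda>(b, c) (b', c'). (b \<otimes>\<^bsub>F\<^esub> b', c \<otimes>\<^bsub>A\<^esub> c')) :: 'f \<times> 'a \<Rightarrow> 'f \<times> 'a \<Rightarrow> 'f \<times> 'a"

lemma P_def: "P = magma_algebra K X pmult"
  by (simp add: pair_algebra_def)

interpretation KF: kfield K
  by (rule kfield.intro) (rule K.field_axioms)

interpretation P: module K P
  unfolding P_def by (rule KF.magma_module)

lemma pmult_closed: "x \<in> X \<Longrightarrow> y \<in> X \<Longrightarrow> pmult x y \<in> X"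
  by (auto simp: A.mult_closed)

lemma \<Psi>_X: "x \<in> X \<Longrightarrow> \<Psi> x \<in> carrier R"
  by (auto simp: \<Psi>_closed)

definition \<Phi> :: "('f \<times> 'a \<Rightarrow> 'k) \<Rightarrow> 'r" where
  "\<Phi> u = lcomb R \<Psi> (SOME l. set l \<subseteq> carrier K \<times> X \<and> cf K l = u)"

lemma \<Phi>_cf: "set l \<subseteq> carrier K \<times> X \<Longrightarrow> \<Phi> (cf K l) = lcomb R \<Psi> l"
proof -
  assume l: "set l \<subseteq> carrier K \<times> X"
  define l' where "l' = (SOME l'. set l' \<subseteq> carrier K \<times> X \<and> cf K l' = cf K l)"
  have "set l' \<subseteq> carrier K \<times> X \<and> cf K l' = cf K l"
    unfolding l'_def by (rule someI[of _ l]) (use l in simp)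
  then show ?thesis
    unfolding \<Phi>_def l'_def[symmetric] using l
    by (intro R.lcomb_cf_cong[where X = X]) (auto simp: \<Psi>_closed)
qed

lemma P_ex: "u \<in> carrier P \<Longrightarrow> \<exists>l. set l \<subseteq> carrier K \<times> X \<and> u = cf K l"
proof -
  assume "u \<in> carrier P"
  then have u: "u \<in> carrier (magma_algebra K X pmult)"
    by (simp only: P_def)
  show ?thesis
    by (rule KF.magma_ex_cf[OF u], rule exI, rule conjI, assumption, erule sym)
qed

lemma cf_P: "set l \<subseteq> carrier K \<times> X \<Longrightarrow> cf K l \<in> carrier P"
  unfolding P_def by (rule KF.cf_in_magma)

lemma \<Phi>_closed: "u \<in> carrier P \<Longrightarrow> \<Phi> u \<in> carrier R"
  by (drule P_ex) (auto simp: \<Phi>_cf intro!: R.lcomb_closed[where X = X] \<Psi>_closed)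

lemma \<Phi>_add: "u \<in> carrier P \<Longrightarrow> v \<in> carrier P \<Longrightarrow> \<Phi> (u \<oplus>\<^bsub>P\<^esub> v) = \<Phi> u \<oplus>\<^bsub>R\<^esub> \<Phi> v"
proof -
  assume "u \<in> carrier P" "v \<in> carrier P"
  then obtain l l' where l: "set l \<subseteq> carrier K \<times> X" "set l' \<subseteq> carrier K \<times> X" "u = cf K l" "v = cf K l'"
    using P_ex by blast
  have "u \<oplus>\<^bsub>P\<^esub> v = cf K (l @ l')"
    unfolding l P_def by (rule KF.cf_append_fun[symmetric, where X = X]) (use l in auto)
  moreover have "set (l @ l') \<subseteq> carrier K \<times> X"
    using l by auto
  ultimately show ?thesis
    using l(1,2) R.lcomb_append[OF l(1,2) \<Psi>_X] by (simp add: \<Phi>_cf l(3,4))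
qed

lemma \<Phi>_smult: "c \<in> carrier K \<Longrightarrow> u \<in> carrier P \<Longrightarrow> \<Phi> (c \<odot>\<^bsub>P\<^esub> u) = c \<odot>\<^bsub>R\<^esub> \<Phi> u"
proof -
  assume "c \<in> carrier K" "u \<in> carrier P"
  then obtain l where l: "set l \<subseteq> carrier K \<times> X" "u = cf K l" and c: "c \<in> carrier K"
    using P_ex by blast
  have "c \<odot>\<^bsub>P\<^esub> u = cf K (scl K c l)"
    unfolding l P_def by (rule KF.cf_scl_fun[symmetric, where X = X]) (use l c in auto)
  then show ?thesis
    using l(1) c R.lcomb_scl[OF c l(1) \<Psi>_X] K.scl_set[OF c l(1)] by (simp add: \<Phi>_cf l(2))
qed

lemma P_mult_cf:
  "set l \<subseteq> carrier K \<times> X \<Longrightarrow> set l' \<subseteq> carrier K \<times> X \<Longrightarrow> cf K l \<otimes>\<^bsub>P\<^esub> cf K l' = cf K (lprod K pmult l l')"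
  unfolding P_def by (rule KF.magma_mult_cf)

lemma lprod_X:
  "set l \<subseteq> carrier K \<times> X \<Longrightarrow> set l' \<subseteq> carrier K \<times> X \<Longrightarrow> set (lprod K pmult l l') \<subseteq> carrier K \<times> X"
  by (rule K.lprod_set[OF _ _ pmult_closed])

lemma P_mult_closed: "u \<in> carrier P \<Longrightarrow> v \<in> carrier P \<Longrightarrow> u \<otimes>\<^bsub>P\<^esub> v \<in> carrier P"
proof -
  assume "u \<in> carrier P" "v \<in> carrier P"
  then obtain l l' where l: "set l \<subseteq> carrier K \<times> X" "set l' \<subseteq> carrier K \<times> X" "u = cf K l" "v = cf K l'"
    using P_ex by blast
  show ?thesis
    unfolding l(3,4) P_mult_cf[OF l(1,2)] by (rule cf_P[OF lprod_X[OF l(1,2)]])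
qed

lemma \<Phi>_mult: "u \<in> carrier P \<Longrightarrow> v \<in> carrier P \<Longrightarrow> \<Phi> (u \<otimes>\<^bsub>P\<^esub> v) = \<Phi> u \<otimes>\<^bsub>R\<^esub> \<Phi> v"
proof -
  assume "u \<in> carrier P" "v \<in> carrier P"
  then obtain l l' where l: "set l \<subseteq> carrier K \<times> X" "set l' \<subseteq> carrier K \<times> X" "u = cf K l" "v = cf K l'"
    using P_ex by blast
  have "\<Psi> (pmult x y) = \<Psi> x \<otimes>\<^bsub>R\<^esub> \<Psi> y" if "x \<in> X" "y \<in> X" for x y
    using that by (auto simp: \<Psi>_mult)
  then have "lcomb R \<Psi> (lprod K pmult l l') = lcomb R \<Psi> l \<otimes>\<^bsub>R\<^esub> lcomb R \<Psi> l'"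
    by (intro R.lcomb_lprod[OF l(1,2)] \<Psi>_X)
  then show ?thesis
    using lprod_X[OF l(1,2)] l(1,2) by (simp add: l(3,4) P_mult_cf \<Phi>_cf)
qed

lemma e_cf: "z \<in> X \<Longrightarrow> e z = cf K [(\<one>\<^bsub>K\<^esub>, z)]"
  by (auto simp: cf_Cons basis_vec_def fun_eq_iff)

lemma e_closed: "z \<in> X \<Longrightarrow> e z \<in> carrier P"
  using cf_P[of "[(\<one>\<^bsub>K\<^esub>, z)]"] by (simp add: e_cf)

lemma \<Phi>_e: "z \<in> X \<Longrightarrow> \<Phi> (e z) = \<Psi> z"
  using \<Phi>_cf[of "[(\<one>\<^bsub>K\<^esub>, z)]"] \<Psi>_X[of z] by (simp add: e_cf)

lemma \<Phi>_zero: "\<Phi> \<zero>\<^bsub>P\<^esub> = \<zero>\<^bsub>R\<^esub>"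
  using \<Phi>_smult[of "\<zero>\<^bsub>K\<^esub>" "\<zero>\<^bsub>P\<^esub>"] \<Phi>_closed[of "\<zero>\<^bsub>P\<^esub>"] by simp

lemma \<Phi>_uminus: "u \<in> carrier P \<Longrightarrow> \<Phi> (\<ominus>\<^bsub>P\<^esub> u) = \<ominus>\<^bsub>R\<^esub> \<Phi> u"
proof -
  assume u: "u \<in> carrier P"
  have "\<Phi> (\<ominus>\<^bsub>K\<^esub> \<one>\<^bsub>K\<^esub> \<odot>\<^bsub>P\<^esub> u) = \<ominus>\<^bsub>K\<^esub> \<one>\<^bsub>K\<^esub> \<odot>\<^bsub>R\<^esub> \<Phi> u"
    using u by (simp add: \<Phi>_smult)
  then show ?thesis
    using u by (simp add: P.smult_l_minus R.smult_l_minus \<Phi>_closed)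
qed

lemma relations_closed: "tensor_relations K (extension_algebra F \<phi>) A \<subseteq> carrier P"
  unfolding tensor_relations_def Let_def by (auto intro!: P.M.minus_closed P.M.a_closed e_closed P.smult_closed)

lemma kernel_submodule: "submodule {u \<in> carrier P. \<Phi> u = \<zero>\<^bsub>R\<^esub>} K P"
  by (rule P.submoduleI) (auto simp: \<Phi>_zero \<Phi>_uminus \<Phi>_add \<Phi>_smult)

lemma relations_kernel:
  "u \<in> tensor_relations K (extension_algebra F \<phi>) A \<Longrightarrow> \<Phi> u = \<zero>\<^bsub>R\<^esub>"
  unfolding tensor_relations_def Let_def
  by (auto simp: \<Phi>_add \<Phi>_e e_closed \<Psi>_add1 \<Psi>_add2 \<Psi>_smult1 \<Psi>_smult2 \<Phi>_smult \<Phi>_uminus \<Psi>_closed a_minus_def R.M.r_neg)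

lemma I_submodule: "submodule I K P"
proof (rule P.submoduleI)
  show "I \<subseteq> carrier P"
    unfolding generated_submodule_def using P.carrier_is_submodule relations_closed by blast
  show "\<zero>\<^bsub>P\<^esub> \<in> I"
    unfolding generated_submodule_def using subgroup.one_closed[OF submodule.axioms(1)] by fastforce
  show "\<ominus>\<^bsub>P\<^esub> u \<in> I" if "u \<in> I" for u
    using that unfolding generated_submodule_def by (blast dest: P.submoduleE(3))
  show "u \<oplus>\<^bsub>P\<^esub> v \<in> I" if "u \<in> I" "v \<in> I" for u v
    using that unfolding generated_submodule_def by (blast dest: P.submoduleE(5))
  show "c \<odot>\<^bsub>P\<^esub> v \<in> I" if "c \<in> carrier K" "v \<in> I" for c v
    using that unfolding generated_submodule_def by (blast dest: P.submoduleE(4))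
qed

lemma relations_I: "tensor_relations K (extension_algebra F \<phi>) A \<subseteq> I"
  unfolding generated_submodule_def by blast

lemma I_closed: "u \<in> I \<Longrightarrow> u \<in> carrier P"
  using P.submoduleE(1)[OF I_submodule] by blast

definition eqv (infix "\<approx>" 50) where "u \<approx> v \<longleftrightarrow> u \<in> carrier P \<and> v \<in> carrier P \<and> u \<ominus>\<^bsub>P\<^esub> v \<in> I"

lemma I_zero: "\<zero>\<^bsub>P\<^esub> \<in> I"
  using subgroup.one_closed[OF submodule.axioms(1)[OF I_submodule]] by simp

lemma eqv_refl: "u \<in> carrier P \<Longrightarrow> u \<approx> u"
  using I_zero by (simp add: eqv_def a_minus_def P.M.r_neg)

lemma eqv_sym: "u \<approx> v \<Longrightarrow> v \<approx> u"
  using P.submoduleE(3)[OF I_submodule, of "u \<ominus>\<^bsub>P\<^esub> v"]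
  by (auto simp: eqv_def a_minus_def P.M.minus_add P.M.a_comm)

lemma eqv_add: "u \<approx> v \<Longrightarrow> u' \<approx> v' \<Longrightarrow> u \<oplus>\<^bsub>P\<^esub> u' \<approx> v \<oplus>\<^bsub>P\<^esub> v'"
  using P.submoduleE(5)[OF I_submodule, of "u \<ominus>\<^bsub>P\<^esub> v" "u' \<ominus>\<^bsub>P\<^esub> v'"]
  by (auto simp: eqv_def a_minus_def P.M.minus_add P.M.a_ac)

lemma eqv_trans [trans]: "u \<approx> v \<Longrightarrow> v \<approx> w \<Longrightarrow> u \<approx> w"
proof -
  assume a: "u \<approx> v" "v \<approx> w"
  then have "(u \<ominus>\<^bsub>P\<^esub> v) \<oplus>\<^bsub>P\<^esub> (v \<ominus>\<^bsub>P\<^esub> w) \<in> I"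
    using P.submoduleE(5)[OF I_submodule] by (auto simp: eqv_def)
  moreover have "(u \<ominus>\<^bsub>P\<^esub> v) \<oplus>\<^bsub>P\<^esub> (v \<ominus>\<^bsub>P\<^esub> w) = u \<ominus>\<^bsub>P\<^esub> w"
    using a by (auto simp: eqv_def a_minus_def P.M.a_assoc P.M.r_neg2 P.M.r_neg1)
  ultimately show ?thesis
    using a by (auto simp: eqv_def)
qed

lemma eq_eqv_trans [trans]: "u = v \<Longrightarrow> v \<approx> w \<Longrightarrow> u \<approx> w" "u \<approx> v \<Longrightarrow> v = w \<Longrightarrow> u \<approx> w"
  by auto

lemma eqv_zero: "u \<approx> \<zero>\<^bsub>P\<^esub> \<longleftrightarrow> u \<in> I"
proof -
  have "\<ominus>\<^bsub>P\<^esub> \<zero>\<^bsub>P\<^esub> = \<zero>\<^bsub>P\<^esub>"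
    by (rule P.M.minus_equality) auto
  then have "u \<ominus>\<^bsub>P\<^esub> \<zero>\<^bsub>P\<^esub> = u" if "u \<in> carrier P"
    unfolding a_minus_def by (simp only: P.M.r_zero that)
  then show ?thesis
    using I_closed by (auto simp: eqv_def)
qed

lemma eqv_I: "u \<approx> v \<Longrightarrow> v \<in> I \<Longrightarrow> u \<in> I"
  using eqv_trans eqv_zero by blast

lemma relation_eqv:
  "u \<ominus>\<^bsub>P\<^esub> v \<in> tensor_relations K (extension_algebra F \<phi>) A \<Longrightarrow> u \<in> carrier P \<Longrightarrow> v \<in> carrier P \<Longrightarrow> u \<approx> v"
  using relations_I by (auto simp: eqv_def)

lemma eqv_e:
  "f \<in> carrier F \<Longrightarrow> f' \<in> carrier F \<Longrightarrow> a \<in> carrier A \<Longrightarrow> e (f \<oplus>\<^bsub>F\<^esub> f', a) \<approx> e (f, a) \<oplus>\<^bsub>P\<^esub> e (f', a)"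
  "f \<in> carrier F \<Longrightarrow> a \<in> carrier A \<Longrightarrow> a' \<in> carrier A \<Longrightarrow> e (f, a \<oplus>\<^bsub>A\<^esub> a') \<approx> e (f, a) \<oplus>\<^bsub>P\<^esub> e (f, a')"
  "c \<in> carrier K \<Longrightarrow> f \<in> carrier F \<Longrightarrow> a \<in> carrier A \<Longrightarrow> e (\<phi> c \<otimes>\<^bsub>F\<^esub> f, a) \<approx> c \<odot>\<^bsub>P\<^esub> e (f, a)"
  "c \<in> carrier K \<Longrightarrow> f \<in> carrier F \<Longrightarrow> a \<in> carrier A \<Longrightarrow> e (f, c \<odot>\<^bsub>A\<^esub> a) \<approx> c \<odot>\<^bsub>P\<^esub> e (f, a)"
  by (rule relation_eqv,
      unfold tensor_relations_def Let_def extension_algebra_simps, blast,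
      simp_all add: e_closed P.smult_closed)+

lemma eqv_e_smult:
  "c \<in> carrier K \<Longrightarrow> f \<in> carrier F \<Longrightarrow> a \<in> carrier A \<Longrightarrow> e (f, c \<odot>\<^bsub>A\<^esub> a) \<approx> e (\<phi> c \<otimes>\<^bsub>F\<^esub> f, a)"
  by (rule eqv_trans[OF eqv_e(4) eqv_sym[OF eqv_e(3)]])

lemma eqv_e_zero1: "a \<in> carrier A \<Longrightarrow> e (\<zero>\<^bsub>F\<^esub>, a) \<approx> \<zero>\<^bsub>P\<^esub>"
  using eqv_e(3)[of "\<zero>\<^bsub>K\<^esub>" "\<zero>\<^bsub>F\<^esub>" a] e_closed[of "(\<zero>\<^bsub>F\<^esub>, a)"] by simp

lemma eqv_e_zero2: "f \<in> carrier F \<Longrightarrow> e (f, \<zero>\<^bsub>A\<^esub>) \<approx> \<zero>\<^bsub>P\<^esub>"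
  using eqv_e(4)[of "\<zero>\<^bsub>K\<^esub>" f "\<zero>\<^bsub>A\<^esub>"] e_closed[of "(f, \<zero>\<^bsub>A\<^esub>)"] by simp

lemma lsum_eqv:
  "(\<And>x. x \<in> set L \<Longrightarrow> u x \<approx> v x) \<Longrightarrow> lsum P u L \<approx> lsum P v L"
  by (induction L) (auto intro: eqv_add eqv_refl)

lemma lsum_e_eqv:
  assumes "a \<in> carrier A" "\<And>x. x \<in> set L \<Longrightarrow> f x \<in> carrier F"
  shows "e (lsum F f L, a) \<approx> lsum P (\<lambda>x. e (f x, a)) L"
  using assms(2)
proof (induction L)
  case Nil
  then show ?case using eqv_e_zero1[OF assms(1)] by simp
next
  case (Cons x L)
  have "e (lsum F f (x # L), a) \<approx> e (f x, a) \<oplus>\<^bsub>P\<^esub> e (lsum F f L, a)"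
    using Cons.prems assms by (auto intro!: eqv_e F.lsum_closed)
  also have "\<dots> \<approx> lsum P (\<lambda>x. e (f x, a)) (x # L)"
    using Cons assms by (auto intro!: eqv_add eqv_refl e_closed)
  finally show ?case .
qed

text \<open>Elimination: a coordinate that does not vanish on the second factor of a tensor expresses its
  first factor through the other ones, so that a sum of tensors without coordinates gets shorter.\<close>

lemma elimination:
  assumes "set L \<subseteq> X" "\<And>i. lsum F (\<lambda>p. fst p \<otimes>\<^bsub>F\<^esub> \<phi> (co (snd p) i)) L = \<zero>\<^bsub>F\<^esub>"
  shows "lsum P e L \<in> I"
  using assms
proof (induction "length L" arbitrary: L)
  case 0
  then show ?case using I_zero by simp
next
  case (Suc len)
  then obtain p L' where L: "L = p # L'" "length L' = len"
    by (metis Suc_length_conv)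
  obtain f a where p: "p = (f, a)" by force
  have f: "f \<in> carrier F" and a: "a \<in> carrier A" and L': "set L' \<subseteq> X"
    using Suc.prems L p by auto
  have L'2: "fst q \<in> carrier F" "snd q \<in> carrier A" if "q \<in> set L'" for q
    using that L' by auto
  show ?case
  proof (cases "\<forall>i. co a i = \<zero>\<^bsub>K\<^esub>")
    case True
    then have a0: "a = \<zero>\<^bsub>A\<^esub>"
      using co_inj[OF a] by blast
    have "lsum F (\<lambda>p. fst p \<otimes>\<^bsub>F\<^esub> \<phi> (co (snd p) i)) L' = \<zero>\<^bsub>F\<^esub>" for i
    proof -
      have "lsum F (\<lambda>p. fst p \<otimes>\<^bsub>F\<^esub> \<phi> (co (snd p) i)) L' \<in> carrier F"
        by (intro F.lsum_closed F.m_closed) (use L'2 co_closed in auto)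
      then show ?thesis
        using Suc.prems(2)[of i] True f by (simp add: L p)
    qed
    then have IH: "lsum P e L' \<in> I"
      using Suc.hyps L L' by auto
    have "e p \<in> I"
      using eqv_e_zero2[OF f] by (simp add: p a0 eqv_zero)
    then show ?thesis
      using P.submoduleE(5)[OF I_submodule _ IH] by (simp add: L)
  next
    case False
    then obtain i0 where i0: "co a i0 \<noteq> \<zero>\<^bsub>K\<^esub>" by blast
    define d where "d = inv\<^bsub>K\<^esub> (co a i0)"
    have d: "d \<in> carrier K" "co a i0 \<otimes>\<^bsub>K\<^esub> d = \<one>\<^bsub>K\<^esub>"
      using i0 co_closed[OF a] K.field_Units by (auto simp: d_def)
    define n where "n = (\<lambda>q :: 'f \<times> 'a. \<ominus>\<^bsub>K\<^esub> (co (snd q) i0 \<otimes>\<^bsub>K\<^esub> d))"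
    have n: "n q \<in> carrier K" if "q \<in> set L'" for q
      using that L'2 d co_closed by (simp add: n_def)
    let ?L = "map (\<lambda>q. (fst q, snd q \<oplus>\<^bsub>A\<^esub> n q \<odot>\<^bsub>A\<^esub> a)) L'"
    have f_eq: "f = lsum F (\<lambda>q. \<phi> (n q) \<otimes>\<^bsub>F\<^esub> fst q) L'"
    proof -
      let ?s = "lsum F (\<lambda>q. fst q \<otimes>\<^bsub>F\<^esub> \<phi> (co (snd q) i0)) L'"
      have s: "?s \<in> carrier F"
        by (intro F.lsum_closed F.m_closed) (use L'2 co_closed in auto)
      have c: "\<phi> (co a i0) \<in> carrier F"
        using co_closed[OF a] by simp
      have "f \<otimes>\<^bsub>F\<^esub> \<phi> (co a i0) \<oplus>\<^bsub>F\<^esub> ?s = \<zero>\<^bsub>F\<^esub>"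
        using Suc.prems(2)[of i0] by (simp add: L p)
      then have "f \<otimes>\<^bsub>F\<^esub> \<phi> (co a i0) = \<ominus>\<^bsub>F\<^esub> ?s"
        using F.minus_equality f s c by simp
      then have "f \<otimes>\<^bsub>F\<^esub> \<phi> (co a i0) \<otimes>\<^bsub>F\<^esub> \<phi> d = ?s \<otimes>\<^bsub>F\<^esub> \<phi> (\<ominus>\<^bsub>K\<^esub> d)"
        using d s by (simp add: F.l_minus F.r_minus)
      also have "\<dots> = lsum F (\<lambda>q. fst q \<otimes>\<^bsub>F\<^esub> \<phi> (co (snd q) i0) \<otimes>\<^bsub>F\<^esub> \<phi> (\<ominus>\<^bsub>K\<^esub> d)) L'"
        by (rule F.lsum_ldistr) (use d L'2 co_closed in auto)
      also have "\<dots> = lsum F (\<lambda>q. \<phi> (n q) \<otimes>\<^bsub>F\<^esub> fst q) L'"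
        by (rule lsum_cong) (use d L'2 co_closed in \<open>auto simp: n_def F.m_ac F.r_minus F.l_minus\<close>)
      finally show ?thesis
        using d f c by (simp add: F.m_assoc co_closed[OF a] flip: \<phi>_simps(2))
    qed
    have na: "n q \<odot>\<^bsub>A\<^esub> a \<in> carrier A" "\<phi> (n q) \<otimes>\<^bsub>F\<^esub> fst q \<in> carrier F" if "q \<in> set L'" for q
      using n[OF that] a L'2[OF that] by auto
    have L_in: "lsum P e ?L \<in> I"
    proof (rule Suc.hyps(1))
      show "len = length ?L"
        using L by simp
      show "set ?L \<subseteq> X"
        using L'2 na by auto
      fix i
      let ?t = "\<lambda>q. fst q \<otimes>\<^bsub>F\<^esub> \<phi> (co (snd q) i)"
      have t: "?t q \<in> carrier F" if "q \<in> set L'" for q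
        using L'2[OF that] co_closed by simp
      have c: "\<phi> (co a i) \<in> carrier F"
        using co_closed[OF a] by simp
      have "lsum F ?t ?L = lsum F (\<lambda>q. ?t q \<oplus>\<^bsub>F\<^esub> \<phi> (n q) \<otimes>\<^bsub>F\<^esub> fst q \<otimes>\<^bsub>F\<^esub> \<phi> (co a i)) L'"
        unfolding lsum_map
        by (rule lsum_cong) (use L'2 n na a in \<open>auto simp: co_add co_smult co_closed F.r_distr F.m_ac\<close>)
      also have "\<dots> = lsum F ?t L' \<oplus>\<^bsub>F\<^esub> lsum F (\<lambda>q. \<phi> (n q) \<otimes>\<^bsub>F\<^esub> fst q \<otimes>\<^bsub>F\<^esub> \<phi> (co a i)) L'"
        by (rule F.lsum_add) (use t na c in auto)
      also have "lsum F (\<lambda>q. \<phi> (n q) \<otimes>\<^bsub>F\<^esub> fst q \<otimes>\<^bsub>F\<^esub> \<phi> (co a i)) L' = f \<otimes>\<^bsub>F\<^esub> \<phi> (co a i)"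
        by (subst f_eq, rule F.lsum_ldistr[symmetric]) (use na c in auto)
      finally show "lsum F ?t ?L = \<zero>\<^bsub>F\<^esub>"
        using Suc.prems(2)[of i] F.lsum_closed[of L' ?t] t c f by (simp add: L p F.a_comm)
    qed
    have "lsum P e L = e (f, a) \<oplus>\<^bsub>P\<^esub> lsum P e L'"
      by (simp add: L p)
    also have "\<dots> \<approx> lsum P (\<lambda>q. e (\<phi> (n q) \<otimes>\<^bsub>F\<^esub> fst q, a)) L' \<oplus>\<^bsub>P\<^esub> lsum P e L'"
      by (rule eqv_add)
        (use lsum_e_eqv[OF a, of L' "\<lambda>q. \<phi> (n q) \<otimes>\<^bsub>F\<^esub> fst q"] na L'
          in \<open>auto simp flip: f_eq intro!: eqv_refl P.M.lsum_closed e_closed\<close>)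
    also have "\<dots> = lsum P (\<lambda>q. e (\<phi> (n q) \<otimes>\<^bsub>F\<^esub> fst q, a) \<oplus>\<^bsub>P\<^esub> e q) L'"
      by (rule P.M.lsum_add[symmetric]) (use na a L' in \<open>auto intro!: e_closed\<close>)
    also have "\<dots> \<approx> lsum P (\<lambda>q. e (fst q, snd q \<oplus>\<^bsub>A\<^esub> n q \<odot>\<^bsub>A\<^esub> a)) L'"
    proof (rule lsum_eqv)
      fix q assume q: "q \<in> set L'"
      have "e (fst q, n q \<odot>\<^bsub>A\<^esub> a) \<approx> e (\<phi> (n q) \<otimes>\<^bsub>F\<^esub> fst q, a)"
        using q n L'2 a by (intro eqv_e_smult) auto
      then have "e (\<phi> (n q) \<otimes>\<^bsub>F\<^esub> fst q, a) \<oplus>\<^bsub>P\<^esub> e q \<approx> e (fst q, n q \<odot>\<^bsub>A\<^esub> a) \<oplus>\<^bsub>P\<^esub> e q"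
        using q L' by (intro eqv_add eqv_refl e_closed) (auto intro: eqv_sym)
      also have "\<dots> = e q \<oplus>\<^bsub>P\<^esub> e (fst q, n q \<odot>\<^bsub>A\<^esub> a)"
        using q L' L'2 na by (intro P.M.a_comm e_closed) auto
      also have "\<dots> \<approx> e (fst q, snd q \<oplus>\<^bsub>A\<^esub> n q \<odot>\<^bsub>A\<^esub> a)"
        using eqv_sym[OF eqv_e(2)[of "fst q" "snd q" "n q \<odot>\<^bsub>A\<^esub> a"]] q L'2 na by simp
      finally show "e (\<phi> (n q) \<otimes>\<^bsub>F\<^esub> fst q, a) \<oplus>\<^bsub>P\<^esub> e q \<approx> e (fst q, snd q \<oplus>\<^bsub>A\<^esub> n q \<odot>\<^bsub>A\<^esub> a)" .
    qed
    also have "\<dots> = lsum P e ?L"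
      by (simp add: lsum_map)
    finally show ?thesis
      using L_in by (rule eqv_I)
  qed
qed

text \<open>Elimination shows that a combination with vanishing image reduces to zero modulo the bilinearity relations; the
  converse inclusion holds because the kernel is a submodule that contains these relations.\<close>

lemma kernel_eq: "I = {u \<in> carrier P. \<Phi> u = \<zero>\<^bsub>R\<^esub>}"
proof (intro equalityI subsetI)
  fix u assume "u \<in> I"
  moreover have "tensor_relations K (extension_algebra F \<phi>) A \<subseteq> {u \<in> carrier P. \<Phi> u = \<zero>\<^bsub>R\<^esub>}"
    using relations_closed relations_kernel by auto
  ultimately show "u \<in> {u \<in> carrier P. \<Phi> u = \<zero>\<^bsub>R\<^esub>}"
    using kernel_submodule unfolding generated_submodule_def by blast
next
  fix u assume "u \<in> {u \<in> carrier P. \<Phi> u = \<zero>\<^bsub>R\<^esub>}"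
  then obtain l where l: "set l \<subseteq> carrier K \<times> X" "u = cf K l" and 0: "\<Phi> u = \<zero>\<^bsub>R\<^esub>"
    using P_ex by auto
  define L where "L = map (\<lambda>p. (\<phi> (fst p) \<otimes>\<^bsub>F\<^esub> fst (snd p), snd (snd p))) l"
  have LX: "set L \<subseteq> X"
    using l by (auto simp: L_def)
  have "set l \<subseteq> carrier K \<times> X \<Longrightarrow>
      cf K l \<approx> lsum P e (map (\<lambda>p. (\<phi> (fst p) \<otimes>\<^bsub>F\<^esub> fst (snd p), snd (snd p))) l)" for l
  proof (induction l)
    case Nil
    then show ?case
      using eqv_refl[OF P.M.zero_closed] by (simp add: P_def magma_algebra_simps cf_def)
  next
    case (Cons p l)
    obtain c f a where p: "p = (c, f, a)" by (cases p) auto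
    have c: "c \<in> carrier K" "f \<in> carrier F" "a \<in> carrier A" and l: "set l \<subseteq> carrier K \<times> X"
      using Cons.prems by (auto simp: p)
    have "cf K (p # l) = c \<odot>\<^bsub>P\<^esub> e (f, a) \<oplus>\<^bsub>P\<^esub> cf K l"
      using c by (auto simp: p cf_Cons P_def magma_algebra_simps basis_vec_def fun_eq_iff)
    also have "\<dots> \<approx> e (\<phi> c \<otimes>\<^bsub>F\<^esub> f, a) \<oplus>\<^bsub>P\<^esub>
        lsum P e (map (\<lambda>p. (\<phi> (fst p) \<otimes>\<^bsub>F\<^esub> fst (snd p), snd (snd p))) l)"
      by (intro eqv_add Cons.IH l eqv_sym[OF eqv_e(3)] c)
    finally show ?case
      by (simp add: p)
  qed
  from this[OF l(1)] have eq: "u \<approx> lsum P e L"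
    by (simp add: L_def l(2))
  have "lsum R \<Psi> L = lcomb R \<Psi> l"
    unfolding L_def lsum_map lcomb_def
    by (rule lsum_cong) (use l in \<open>auto simp: \<Psi>_smult1\<close>)
  then have "lsum R \<Psi> L = \<zero>\<^bsub>R\<^esub>"
    using 0 l by (simp add: \<Phi>_cf)
  then have "lsum P e L \<in> I"
    using elimination[OF LX] separation[OF LX] by blast
  then show "u \<in> I"
    using eq eqv_I by blast
qed

abbreviation "cls r \<equiv> {u \<in> carrier P. \<Phi> u = r}"

lemma coset_eq: "u \<in> carrier P \<Longrightarrow> I +>\<^bsub>P\<^esub> u = cls (\<Phi> u)"
proof (intro equalityI subsetI)
  fix v assume u: "u \<in> carrier P" "v \<in> cls (\<Phi> u)"
  then have "v \<ominus>\<^bsub>P\<^esub> u \<in> I"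
    unfolding kernel_eq using \<Phi>_closed by (auto simp: \<Phi>_uminus \<Phi>_add a_minus_def R.M.r_neg)
  moreover have "v = (v \<ominus>\<^bsub>P\<^esub> u) \<oplus>\<^bsub>P\<^esub> u"
    using u by (simp add: a_minus_def P.M.a_assoc P.M.l_neg)
  ultimately show "v \<in> I +>\<^bsub>P\<^esub> u"
    unfolding a_r_coset_def' by blast
next
  fix v assume "u \<in> carrier P" "v \<in> I +>\<^bsub>P\<^esub> u"
  then show "v \<in> cls (\<Phi> u)"
    unfolding a_r_coset_def' kernel_eq using \<Phi>_closed by (auto simp: \<Phi>_add)
qed

lemma T_carrier: "carrier T = (\<lambda>u. cls (\<Phi> u)) ` carrier P"
  by (auto simp: tensor_algebra_def quotient_algebra_def A_RCOSETS_def' coset_eq)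

lemma T_zero: "\<zero>\<^bsub>T\<^esub> = cls \<zero>\<^bsub>R\<^esub>"
  by (simp add: tensor_algebra_def quotient_algebra_def kernel_eq)

lemma T_add: "u \<in> carrier P \<Longrightarrow> v \<in> carrier P \<Longrightarrow>
  cls (\<Phi> u) \<oplus>\<^bsub>T\<^esub> cls (\<Phi> v) = cls (\<Phi> (u \<oplus>\<^bsub>P\<^esub> v))"
proof -
  assume uv: "u \<in> carrier P" "v \<in> carrier P"
  have "w \<in> cls (\<Phi> u) <+>\<^bsub>P\<^esub> cls (\<Phi> v)" if w: "w \<in> cls (\<Phi> (u \<oplus>\<^bsub>P\<^esub> v))" for w
  proof -
    have "\<Phi> v \<oplus>\<^bsub>R\<^esub> \<ominus>\<^bsub>R\<^esub> \<Phi> u = \<ominus>\<^bsub>R\<^esub> \<Phi> u \<oplus>\<^bsub>R\<^esub> \<Phi> v"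
      using uv \<Phi>_closed by (intro R.M.a_comm) auto
    then have "w \<ominus>\<^bsub>P\<^esub> u \<in> cls (\<Phi> v)"
      using w uv \<Phi>_closed by (auto simp: \<Phi>_uminus \<Phi>_add a_minus_def R.M.a_assoc R.M.r_neg2)
    moreover have "w = u \<oplus>\<^bsub>P\<^esub> (w \<ominus>\<^bsub>P\<^esub> u)"
    proof -
      have "w \<oplus>\<^bsub>P\<^esub> \<ominus>\<^bsub>P\<^esub> u = \<ominus>\<^bsub>P\<^esub> u \<oplus>\<^bsub>P\<^esub> w"
        using w uv by (intro P.M.a_comm) auto
      then show ?thesis
        using w uv by (simp add: a_minus_def P.M.r_neg2)
    qed
    ultimately show ?thesis
      unfolding set_add_def' using uv by blast
  qed
  moreover have "cls (\<Phi> u) <+>\<^bsub>P\<^esub> cls (\<Phi> v) \<subseteq> cls (\<Phi> (u \<oplus>\<^bsub>P\<^esub> v))"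
    unfolding set_add_def' using uv by (auto simp: \<Phi>_add)
  ultimately show ?thesis
    unfolding tensor_algebra_def quotient_algebra_def by auto
qed

lemma T_mult: "u \<in> carrier P \<Longrightarrow> v \<in> carrier P \<Longrightarrow>
  cls (\<Phi> u) \<otimes>\<^bsub>T\<^esub> cls (\<Phi> v) = cls (\<Phi> (u \<otimes>\<^bsub>P\<^esub> v))"
proof -
  assume uv: "u \<in> carrier P" "v \<in> carrier P"
  have "I +>\<^bsub>P\<^esub> (x \<otimes>\<^bsub>P\<^esub> y) = cls (\<Phi> (u \<otimes>\<^bsub>P\<^esub> v))" if "x \<in> cls (\<Phi> u)" "y \<in> cls (\<Phi> v)" for x y
    using that uv by (simp add: coset_eq P_mult_closed \<Phi>_mult)
  then have "rcoset_mult P I (cls (\<Phi> u)) (cls (\<Phi> v)) =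
      (\<Union>x\<in>cls (\<Phi> u). \<Union>y\<in>cls (\<Phi> v). cls (\<Phi> (u \<otimes>\<^bsub>P\<^esub> v)))"
    unfolding rcoset_mult_def by simp
  also have "\<dots> = cls (\<Phi> (u \<otimes>\<^bsub>P\<^esub> v))"
    using uv by blast
  finally show ?thesis
    by (simp add: tensor_algebra_def quotient_algebra_def)
qed

lemma T_smult: "c \<in> carrier K \<Longrightarrow> u \<in> carrier P \<Longrightarrow>
  c \<odot>\<^bsub>T\<^esub> cls (\<Phi> u) = cls (\<Phi> (c \<odot>\<^bsub>P\<^esub> u))"
proof -
  assume u: "c \<in> carrier K" "u \<in> carrier P"
  have "I +>\<^bsub>P\<^esub> (c \<odot>\<^bsub>P\<^esub> x) = cls (\<Phi> (c \<odot>\<^bsub>P\<^esub> u))" if "x \<in> cls (\<Phi> u)" for x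
    using that u by (simp add: coset_eq \<Phi>_smult)
  then have "(\<Union>x\<in>cls (\<Phi> u). I +>\<^bsub>P\<^esub> (c \<odot>\<^bsub>P\<^esub> x)) = (\<Union>x\<in>cls (\<Phi> u). cls (\<Phi> (c \<odot>\<^bsub>P\<^esub> u)))"
    by simp
  also have "\<dots> = cls (\<Phi> (c \<odot>\<^bsub>P\<^esub> u))"
    using u by blast
  finally show ?thesis
    by (simp add: tensor_algebra_def quotient_algebra_def)
qed

text \<open>The tensor algebra consists of the classes of the congruence given by the kernel, so that it is isomorphic to the image.
  All properties of \<open>F \<otimes>\<^sub>K A\<close>, even the axioms of algebras, are obtained in \<open>R\<close>.\<close>

theorem tensor_algebra_embeds:
  obtains h where "nonassoc_algebra K T" "inj_on h (carrier T)" "\<And>x. x \<in> carrier T \<Longrightarrow> h x \<in> carrier R"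
    "h \<zero>\<^bsub>T\<^esub> = \<zero>\<^bsub>R\<^esub>"
    "\<And>x y. x \<in> carrier T \<Longrightarrow> y \<in> carrier T \<Longrightarrow> h (x \<oplus>\<^bsub>T\<^esub> y) = h x \<oplus>\<^bsub>R\<^esub> h y"
    "\<And>x y. x \<in> carrier T \<Longrightarrow> y \<in> carrier T \<Longrightarrow> h (x \<otimes>\<^bsub>T\<^esub> y) = h x \<otimes>\<^bsub>R\<^esub> h y"
    "\<And>c x. c \<in> carrier K \<Longrightarrow> x \<in> carrier T \<Longrightarrow> h (c \<odot>\<^bsub>T\<^esub> x) = c \<odot>\<^bsub>R\<^esub> h x"
    "\<And>L. set L \<subseteq> X \<Longrightarrow> \<exists>x\<in>carrier T. h x = lsum R \<Psi> L"
proof -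
  define h where "h x = \<Phi> (SOME u. u \<in> x)" for x
  have h: "h (cls (\<Phi> u)) = \<Phi> u" if "u \<in> carrier P" for u
  proof -
    have "(SOME v. v \<in> cls (\<Phi> u)) \<in> cls (\<Phi> u)"
      by (rule someI[of _ u]) (use that in simp)
    then show ?thesis
      by (simp add: h_def)
  qed
  have inj: "inj_on h (carrier T)"
    by (rule inj_onI) (auto simp: T_carrier h)
  have cl: "x \<in> carrier T \<Longrightarrow> h x \<in> carrier R" for x
    by (auto simp: T_carrier h \<Phi>_closed)
  have T0: "\<zero>\<^bsub>T\<^esub> = cls (\<Phi> \<zero>\<^bsub>P\<^esub>)"
    by (simp add: T_zero \<Phi>_zero)
  have zero: "\<zero>\<^bsub>T\<^esub> \<in> carrier T" "h \<zero>\<^bsub>T\<^esub> = \<zero>\<^bsub>R\<^esub>"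
    unfolding T_carrier T0 using h[OF P.M.zero_closed] \<Phi>_zero by (blast, metis P.M.zero_closed)
  have add: "x \<oplus>\<^bsub>T\<^esub> y \<in> carrier T" "h (x \<oplus>\<^bsub>T\<^esub> y) = h x \<oplus>\<^bsub>R\<^esub> h y"
    if xy: "x \<in> carrier T" "y \<in> carrier T" for x y
  proof -
    obtain u v where uv: "u \<in> carrier P" "v \<in> carrier P" "x = cls (\<Phi> u)" "y = cls (\<Phi> v)"
      using xy unfolding T_carrier by blast
    have eq: "x \<oplus>\<^bsub>T\<^esub> y = cls (\<Phi> (u \<oplus>\<^bsub>P\<^esub> v))"
      unfolding uv(3,4) by (rule T_add[OF uv(1,2)])
    have cl: "u \<oplus>\<^bsub>P\<^esub> v \<in> carrier P"
      by (rule P.M.a_closed[OF uv(1,2)])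
    show "x \<oplus>\<^bsub>T\<^esub> y \<in> carrier T"
      unfolding eq T_carrier using cl by blast
    have "h (x \<oplus>\<^bsub>T\<^esub> y) = \<Phi> (u \<oplus>\<^bsub>P\<^esub> v)"
      unfolding eq by (rule h[OF cl])
    also have "\<dots> = h x \<oplus>\<^bsub>R\<^esub> h y"
      unfolding uv(3,4) h[OF uv(1)] h[OF uv(2)] by (rule \<Phi>_add[OF uv(1,2)])
    finally show "h (x \<oplus>\<^bsub>T\<^esub> y) = h x \<oplus>\<^bsub>R\<^esub> h y" .
  qed
  have mult: "x \<otimes>\<^bsub>T\<^esub> y \<in> carrier T" "h (x \<otimes>\<^bsub>T\<^esub> y) = h x \<otimes>\<^bsub>R\<^esub> h y"
    if xy: "x \<in> carrier T" "y \<in> carrier T" for x y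
  proof -
    obtain u v where uv: "u \<in> carrier P" "v \<in> carrier P" "x = cls (\<Phi> u)" "y = cls (\<Phi> v)"
      using xy unfolding T_carrier by blast
    have eq: "x \<otimes>\<^bsub>T\<^esub> y = cls (\<Phi> (u \<otimes>\<^bsub>P\<^esub> v))"
      unfolding uv(3,4) by (rule T_mult[OF uv(1,2)])
    have cl: "u \<otimes>\<^bsub>P\<^esub> v \<in> carrier P"
      by (rule P_mult_closed[OF uv(1,2)])
    show "x \<otimes>\<^bsub>T\<^esub> y \<in> carrier T"
      unfolding eq T_carrier using cl by blast
    have "h (x \<otimes>\<^bsub>T\<^esub> y) = \<Phi> (u \<otimes>\<^bsub>P\<^esub> v)"
      unfolding eq by (rule h[OF cl])
    also have "\<dots> = h x \<otimes>\<^bsub>R\<^esub> h y"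
      unfolding uv(3,4) h[OF uv(1)] h[OF uv(2)] by (rule \<Phi>_mult[OF uv(1,2)])
    finally show "h (x \<otimes>\<^bsub>T\<^esub> y) = h x \<otimes>\<^bsub>R\<^esub> h y" .
  qed
  have smult: "c \<odot>\<^bsub>T\<^esub> x \<in> carrier T" "h (c \<odot>\<^bsub>T\<^esub> x) = c \<odot>\<^bsub>R\<^esub> h x"
    if cx: "c \<in> carrier K" "x \<in> carrier T" for c x
  proof -
    obtain u where u: "u \<in> carrier P" "x = cls (\<Phi> u)"
      using cx unfolding T_carrier by blast
    have eq: "c \<odot>\<^bsub>T\<^esub> x = cls (\<Phi> (c \<odot>\<^bsub>P\<^esub> u))"
      unfolding u(2) by (rule T_smult[OF cx(1) u(1)])
    have cl: "c \<odot>\<^bsub>P\<^esub> u \<in> carrier P"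
      by (rule P.smult_closed[OF cx(1) u(1)])
    show "c \<odot>\<^bsub>T\<^esub> x \<in> carrier T"
      unfolding eq T_carrier using cl by blast
    have "h (c \<odot>\<^bsub>T\<^esub> x) = \<Phi> (c \<odot>\<^bsub>P\<^esub> u)"
      unfolding eq by (rule h[OF cl])
    also have "\<dots> = c \<odot>\<^bsub>R\<^esub> h x"
      unfolding u(2) h[OF u(1)] by (rule \<Phi>_smult[OF cx(1) u(1)])
    finally show "h (c \<odot>\<^bsub>T\<^esub> x) = c \<odot>\<^bsub>R\<^esub> h x" .
  qed
  have alg: "nonassoc_algebra K T"
    by (rule algebra_pullback[OF R.nonassoc_algebra_axioms inj cl])
      (assumption | rule zero | rule add | rule mult | rule smult)+
  have ex: "\<exists>x\<in>carrier T. h x = lsum R \<Psi> L" if "set L \<subseteq> X" for L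
  proof -
    have L: "\<Phi> (lsum P e L) = lsum R \<Psi> L \<and> lsum P e L \<in> carrier P"
      using that by (induction L) (auto simp: \<Phi>_zero \<Phi>_add e_closed \<Phi>_e)
    have "h (cls (\<Phi> (lsum P e L))) = \<Phi> (lsum P e L)"
      by (rule h) (use L in blast)
    then show ?thesis
      unfolding T_carrier bex_simps(7) by (intro bexI[of _ "lsum P e L"]) (simp_all only: L)
  qed
  show thesis
    by (rule that[OF alg inj cl zero(2) add(2) mult(2) smult(2) ex])
qed

end


section \<open>Laurent series and an extension of transcendence degree two\<close>

definition laurent :: "'k ring \<Rightarrow> (int \<Rightarrow> 'k) ring" where
  "laurent K =
     \<lparr>carrier = {f. (\<forall>i. f i \<in> carrier K) \<and> (\<exists>n. \<forall>i<n. f i = \<zero>\<^bsub>K\<^esub>)},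
      monoid.mult = \<lambda>f g k. finsum K (\<lambda>i. f i \<otimes>\<^bsub>K\<^esub> g (k - i)) {i. f i \<noteq> \<zero>\<^bsub>K\<^esub> \<and> g (k - i) \<noteq> \<zero>\<^bsub>K\<^esub>},
      one = \<lambda>i. if i = 0 then \<one>\<^bsub>K\<^esub> else \<zero>\<^bsub>K\<^esub>,
      zero = \<lambda>_. \<zero>\<^bsub>K\<^esub>,
      add = \<lambda>f g i. f i \<oplus>\<^bsub>K\<^esub> g i\<rparr>"

definition monom :: "'k ring \<Rightarrow> 'k \<Rightarrow> int \<Rightarrow> int \<Rightarrow> 'k" where
  "monom K c n = (\<lambda>i. if i = n then c else \<zero>\<^bsub>K\<^esub>)"

lemma (in abelian_monoid) finsum_swap:
  assumes "finite A" "finite B" "\<And>i j. i \<in> A \<Longrightarrow> j \<in> B \<Longrightarrow> f i j \<in> carrier G"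
  shows "finsum G (\<lambda>i. finsum G (f i) B) A = finsum G (\<lambda>j. finsum G (\<lambda>i. f i j) A) B"
  using assms(1,3)
proof (induction A)
  case (insert a A)
  have "finsum G (f i) B \<in> carrier G" if "i \<in> insert a A" for i
    using insert.prems that by (intro finsum_closed) auto
  then have "finsum G (\<lambda>i. finsum G (f i) B) (insert a A) =
      finsum G (f a) B \<oplus> finsum G (\<lambda>j. finsum G (\<lambda>i. f i j) A) B"
    using insert by (subst finsum_insert) auto
  also have "\<dots> = finsum G (\<lambda>j. f a j \<oplus> finsum G (\<lambda>i. f i j) A) B"
    using insert.prems by (intro finsum_addf[symmetric]) (auto intro!: finsum_closed)
  also have "\<dots> = finsum G (\<lambda>j. finsum G (\<lambda>i. f i j) (insert a A)) B"
    using insert.prems insert.hyps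
    by (intro finsum_cong') (auto intro!: finsum_closed simp: Pi_def)
  finally show ?case .
qed simp

context kfield
begin

abbreviation "L \<equiv> laurent K"

lemma laurent_simps:
  "f \<in> carrier L \<longleftrightarrow> (\<forall>i. f i \<in> carrier K) \<and> (\<exists>n. \<forall>i<n. f i = \<zero>)"
  "\<one>\<^bsub>L\<^esub> = (\<lambda>i. if i = 0 then \<one> else \<zero>)" "\<zero>\<^bsub>L\<^esub> = (\<lambda>_. \<zero>)" "f \<oplus>\<^bsub>L\<^esub> g = (\<lambda>i. f i \<oplus> g i)"
  by (auto simp: laurent_def)

lemma laurent_coeff: "f \<in> carrier L \<Longrightarrow> f i \<in> carrier K"
  by (simp add: laurent_simps)

lemma laurent_mult:
  assumes "f \<in> carrier L" "g \<in> carrier L" "finite Z" "\<And>i. f i \<noteq> \<zero> \<Longrightarrow> g (k - i) \<noteq> \<zero> \<Longrightarrow> i \<in> Z"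
  shows "(f \<otimes>\<^bsub>L\<^esub> g) k = finsum K (\<lambda>i. f i \<otimes> g (k - i)) Z"
proof -
  have c: "f i \<in> carrier K" "g i \<in> carrier K" for i
    using assms laurent_coeff by auto
  have "(f \<otimes>\<^bsub>L\<^esub> g) k = finsum K (\<lambda>i. f i \<otimes> g (k - i)) {i. f i \<noteq> \<zero> \<and> g (k - i) \<noteq> \<zero>}"
    by (simp add: laurent_def)
  also have "\<dots> = finsum K (\<lambda>i. f i \<otimes> g (k - i)) Z"
  proof (rule add.finprod_mono_neutral_cong_left)
    show "f i \<otimes> g (k - i) = \<zero>" if "i \<in> Z - {i. f i \<noteq> \<zero> \<and> g (k - i) \<noteq> \<zero>}" for i
      using that c[of i] c[of "k - i"] by (cases "f i = \<zero>") auto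
  qed (use assms c in auto)
  finally show ?thesis .
qed

lemma laurent_mult_shift:
  assumes "f \<in> carrier L" "g \<in> carrier L" "finite Z" "\<And>j. f (j - i) \<noteq> \<zero> \<Longrightarrow> g (k - j) \<noteq> \<zero> \<Longrightarrow> j \<in> Z"
  shows "(f \<otimes>\<^bsub>L\<^esub> g) (k - i) = finsum K (\<lambda>j. f (j - i) \<otimes> g (k - j)) Z"
proof -
  have "(f \<otimes>\<^bsub>L\<^esub> g) (k - i) = finsum K (\<lambda>j. f j \<otimes> g (k - i - j)) ((\<lambda>j. j - i) ` Z)"
  proof (rule laurent_mult)
    fix j assume "f j \<noteq> \<zero>" "g (k - i - j) \<noteq> \<zero>"
    then have "j + i \<in> Z"
      by (intro assms(4)) (auto simp: algebra_simps)
    then show "j \<in> (\<lambda>j. j - i) ` Z"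
      by force
  qed (use assms in auto)
  also have "\<dots> = finsum K (\<lambda>j. f (j - i) \<otimes> g (k - i - (j - i))) Z"
    by (rule finsum_reindex) (use assms laurent_coeff in \<open>auto simp: inj_on_def\<close>)
  finally show ?thesis
    by simp
qed

lemma laurent_mult_closed:
  assumes "f \<in> carrier L" "g \<in> carrier L"
  shows "f \<otimes>\<^bsub>L\<^esub> g \<in> carrier L"
    and "\<forall>i<a. f i = \<zero> \<Longrightarrow> \<forall>i<b. g i = \<zero> \<Longrightarrow> k < a + b \<Longrightarrow> (f \<otimes>\<^bsub>L\<^esub> g) k = \<zero>"
proof -
  have c: "f i \<in> carrier K" "g i \<in> carrier K" for i
    using assms laurent_coeff by auto
  show *: "(f \<otimes>\<^bsub>L\<^esub> g) k = \<zero>" if "\<forall>i<a. f i = \<zero>" "\<forall>i<b. g i = \<zero>" "k < a + b" for a b k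
  proof -
    have "i \<in> {}" if fg: "f i \<noteq> \<zero>" "g (k - i) \<noteq> \<zero>" for i
    proof -
      have "\<not> i < a" "\<not> k - i < b"
        using fg \<open>\<forall>i<a. f i = \<zero>\<close> \<open>\<forall>i<b. g i = \<zero>\<close> by auto
      then show ?thesis
        using \<open>k < a + b\<close> by linarith
    qed
    then show ?thesis
      by (subst laurent_mult[OF assms, of "{}"]) auto
  qed
  obtain a b where "\<forall>i<a. f i = \<zero>" "\<forall>i<b. g i = \<zero>"
    using assms by (auto simp: laurent_simps)
  then have "\<forall>k<a + b. (f \<otimes>\<^bsub>L\<^esub> g) k = \<zero>"
    using * by blast
  moreover have "(f \<otimes>\<^bsub>L\<^esub> g) k \<in> carrier K" for k
    using c by (auto simp: laurent_def intro!: finsum_closed)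
  ultimately show "f \<otimes>\<^bsub>L\<^esub> g \<in> carrier L"
    by (auto simp: laurent_simps)
qed

lemma laurent_comm:
  assumes "f \<in> carrier L" "g \<in> carrier L"
  shows "f \<otimes>\<^bsub>L\<^esub> g = g \<otimes>\<^bsub>L\<^esub> f"
proof
  fix k
  obtain a b where ab: "\<forall>i<a. f i = \<zero>" "\<forall>i<b. g i = \<zero>"
    using assms by (auto simp: laurent_simps)
  have c: "f i \<in> carrier K" "g i \<in> carrier K" for i
    using assms laurent_coeff by auto
  have r: "(\<lambda>i. k - i) ` {b..k - a} = {a..k - b}"
    by (auto simp: image_iff intro: bexI[of _ "k - x" for x])
  have "(f \<otimes>\<^bsub>L\<^esub> g) k = finsum K (\<lambda>i. f i \<otimes> g (k - i)) ((\<lambda>i. k - i) ` {b..k - a})"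
    unfolding r by (rule laurent_mult[OF assms]) (use ab in \<open>auto simp: not_less[symmetric]\<close>)
  also have "\<dots> = finsum K (\<lambda>i. f (k - i) \<otimes> g (k - (k - i))) {b..k - a}"
    by (rule finsum_reindex) (use c in \<open>auto simp: inj_on_def\<close>)
  also have "\<dots> = finsum K (\<lambda>i. g i \<otimes> f (k - i)) {b..k - a}"
    by (rule finsum_cong') (use c in \<open>auto simp: m_comm\<close>)
  also have "\<dots> = (g \<otimes>\<^bsub>L\<^esub> f) k"
    by (rule laurent_mult[OF assms(2,1), symmetric]) (use ab in \<open>auto simp: not_less[symmetric]\<close>)
  finally show "(f \<otimes>\<^bsub>L\<^esub> g) k = (g \<otimes>\<^bsub>L\<^esub> f) k" .
qed

lemma laurent_assoc:
  assumes "f \<in> carrier L" "g \<in> carrier L" "h \<in> carrier L"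
  shows "f \<otimes>\<^bsub>L\<^esub> g \<otimes>\<^bsub>L\<^esub> h = f \<otimes>\<^bsub>L\<^esub> (g \<otimes>\<^bsub>L\<^esub> h)"
proof
  fix k
  obtain a b c where abc: "\<forall>i<a. f i = \<zero>" "\<forall>i<b. g i = \<zero>" "\<forall>i<c. h i = \<zero>"
    using assms by (auto simp: laurent_simps)
  have cl: "f i \<in> carrier K" "g i \<in> carrier K" "h i \<in> carrier K" for i
    using assms laurent_coeff by auto
  let ?Zi = "{a..k - b - c}" and ?Zj = "{a + b..k - c}"
  have "(f \<otimes>\<^bsub>L\<^esub> g \<otimes>\<^bsub>L\<^esub> h) k = finsum K (\<lambda>j. (f \<otimes>\<^bsub>L\<^esub> g) j \<otimes> h (k - j)) ?Zj"
  proof (rule laurent_mult[OF laurent_mult_closed(1)[OF assms(1,2)] assms(3)])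
    fix j assume "(f \<otimes>\<^bsub>L\<^esub> g) j \<noteq> \<zero>" "h (k - j) \<noteq> \<zero>"
    then have "\<not> j < a + b" "\<not> k - j < c"
      using laurent_mult_closed(2)[OF assms(1,2) abc(1,2)] abc(3) by auto
    then show "j \<in> ?Zj" by auto
  qed simp
  also have "\<dots> = finsum K (\<lambda>j. finsum K (\<lambda>i. f i \<otimes> g (j - i) \<otimes> h (k - j)) ?Zi) ?Zj"
  proof (rule finsum_cong'[OF refl])
    fix j assume j: "j \<in> ?Zj"
    have "(f \<otimes>\<^bsub>L\<^esub> g) j = finsum K (\<lambda>i. f i \<otimes> g (j - i)) ?Zi"
    proof (rule laurent_mult[OF assms(1,2)])
      fix i assume "f i \<noteq> \<zero>" "g (j - i) \<noteq> \<zero>"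
      then have "\<not> i < a" "\<not> j - i < b"
        using abc by auto
      then show "i \<in> ?Zi" using j by auto
    qed simp
    then show "(f \<otimes>\<^bsub>L\<^esub> g) j \<otimes> h (k - j) = finsum K (\<lambda>i. f i \<otimes> g (j - i) \<otimes> h (k - j)) ?Zi"
      using cl by (simp add: finsum_ldistr Pi_def)
  qed (use cl in \<open>auto intro!: finsum_closed\<close>)
  also have "\<dots> = finsum K (\<lambda>i. finsum K (\<lambda>j. f i \<otimes> g (j - i) \<otimes> h (k - j)) ?Zj) ?Zi"
    by (rule finsum_swap) (use cl in auto)
  also have "\<dots> = finsum K (\<lambda>i. f i \<otimes> (g \<otimes>\<^bsub>L\<^esub> h) (k - i)) ?Zi"
  proof (rule finsum_cong'[OF refl])
    fix i assume i: "i \<in> ?Zi"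
    have "(g \<otimes>\<^bsub>L\<^esub> h) (k - i) = finsum K (\<lambda>j. g (j - i) \<otimes> h (k - j)) ?Zj"
    proof (rule laurent_mult_shift[OF assms(2,3)])
      fix j assume "g (j - i) \<noteq> \<zero>" "h (k - j) \<noteq> \<zero>"
      then have "\<not> j - i < b" "\<not> k - j < c"
        using abc by auto
      then show "j \<in> ?Zj" using i by auto
    qed simp
    then show "finsum K (\<lambda>j. f i \<otimes> g (j - i) \<otimes> h (k - j)) ?Zj = f i \<otimes> (g \<otimes>\<^bsub>L\<^esub> h) (k - i)"
      using cl by (simp add: finsum_rdistr Pi_def m_assoc)
  qed (use cl laurent_coeff[OF laurent_mult_closed(1)[OF assms(2,3)]] in auto)
  also have "\<dots> = (f \<otimes>\<^bsub>L\<^esub> (g \<otimes>\<^bsub>L\<^esub> h)) k"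
  proof (rule laurent_mult[OF assms(1) laurent_mult_closed(1)[OF assms(2,3)], symmetric])
    fix i assume "f i \<noteq> \<zero>" "(g \<otimes>\<^bsub>L\<^esub> h) (k - i) \<noteq> \<zero>"
    then have "\<not> i < a" "\<not> k - i < b + c"
      using laurent_mult_closed(2)[OF assms(2,3) abc(2,3)] abc(1) by auto
    then show "i \<in> ?Zi" by auto
  qed simp
  finally show "(f \<otimes>\<^bsub>L\<^esub> g \<otimes>\<^bsub>L\<^esub> h) k = (f \<otimes>\<^bsub>L\<^esub> (g \<otimes>\<^bsub>L\<^esub> h)) k" .
qed

lemma monom_closed: "c \<in> carrier K \<Longrightarrow> monom K c n \<in> carrier L"
  by (auto simp: laurent_simps monom_def intro!: exI[of _ n])

lemma monom_mult:
  assumes "c \<in> carrier K" "f \<in> carrier L"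
  shows "(monom K c n \<otimes>\<^bsub>L\<^esub> f) k = c \<otimes> f (k - n)"
proof -
  have "(monom K c n \<otimes>\<^bsub>L\<^esub> f) k = finsum K (\<lambda>i. monom K c n i \<otimes> f (k - i)) {n}"
    by (rule laurent_mult[OF monom_closed[OF assms(1)] assms(2)]) (auto simp: monom_def split: if_splits)
  then show ?thesis
    using assms laurent_coeff by (simp add: monom_def)
qed

lemma laurent_cring: "cring L"
proof (rule cringI)
  show "abelian_group L"
  proof (rule abelian_groupI)
    fix f g assume f: "f \<in> carrier L" and "g \<in> carrier L"
    then obtain a b where "\<forall>i<a. f i = \<zero>" "\<forall>i<b. g i = \<zero>"
      by (auto simp: laurent_simps)
    then have "\<forall>i<min a b. f i \<oplus> g i = \<zero>"
      by auto
    then show "f \<oplus>\<^bsub>L\<^esub> g \<in> carrier L"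
      using \<open>f \<in> carrier L\<close> \<open>g \<in> carrier L\<close> unfolding laurent_simps
      by (intro conjI exI[of _ "min a b"]) auto
  next
    fix f assume f: "f \<in> carrier L"
    then have "(\<lambda>i. \<ominus> f i) \<in> carrier L"
      by (auto simp: laurent_simps)
    moreover have "(\<lambda>i. \<ominus> f i) \<oplus>\<^bsub>L\<^esub> f = \<zero>\<^bsub>L\<^esub>"
      using f by (simp add: laurent_simps l_neg)
    ultimately show "\<exists>g\<in>carrier L. g \<oplus>\<^bsub>L\<^esub> f = \<zero>\<^bsub>L\<^esub>"
      by blast
  qed (auto simp: laurent_simps a_ac)
  have one: "\<one>\<^bsub>L\<^esub> = monom K \<one> 0"
    by (simp add: laurent_simps monom_def)
  show "comm_monoid L"
    by (rule comm_monoidI)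
      (auto simp: laurent_mult_closed laurent_assoc one monom_closed fun_eq_iff monom_mult
        laurent_coeff intro: laurent_comm[THEN fun_cong])
  show "(f \<oplus>\<^bsub>L\<^esub> g) \<otimes>\<^bsub>L\<^esub> h = f \<otimes>\<^bsub>L\<^esub> h \<oplus>\<^bsub>L\<^esub> g \<otimes>\<^bsub>L\<^esub> h"
    if fgh: "f \<in> carrier L" "g \<in> carrier L" "h \<in> carrier L" for f g h
  proof
    fix k
    obtain a b c where abc: "\<forall>i<a. f i = \<zero>" "\<forall>i<b. g i = \<zero>" "\<forall>i<c. h i = \<zero>"
      using fgh by (auto simp: laurent_simps)
    have cl: "f i \<in> carrier K" "g i \<in> carrier K" "h i \<in> carrier K" for i
      using fgh laurent_coeff by auto
    have fg: "f \<oplus>\<^bsub>L\<^esub> g \<in> carrier L"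
      using abc cl unfolding laurent_simps by (intro conjI exI[of _ "min a b"]) auto
    let ?Z = "{min a b..k - c}"
    have s: "i \<in> ?Z" if "f i \<noteq> \<zero> \<or> g i \<noteq> \<zero>" "h (k - i) \<noteq> \<zero>" for i
    proof -
      have "\<not> i < min a b" "\<not> k - i < c"
        using that abc by auto
      then show ?thesis by auto
    qed
    have "((f \<oplus>\<^bsub>L\<^esub> g) \<otimes>\<^bsub>L\<^esub> h) k = finsum K (\<lambda>i. (f \<oplus>\<^bsub>L\<^esub> g) i \<otimes> h (k - i)) ?Z"
    proof (rule laurent_mult[OF fg fgh(3)])
      fix i assume "(f \<oplus>\<^bsub>L\<^esub> g) i \<noteq> \<zero>" and h: "h (k - i) \<noteq> \<zero>"
      then have "f i \<noteq> \<zero> \<or> g i \<noteq> \<zero>"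
        by (auto simp: laurent_simps)
      then show "i \<in> ?Z"
        using h by (rule s)
    qed simp
    also have "\<dots> = finsum K (\<lambda>i. f i \<otimes> h (k - i) \<oplus> g i \<otimes> h (k - i)) ?Z"
      by (rule finsum_cong') (use cl in \<open>auto simp: laurent_simps l_distr\<close>)
    also have "\<dots> = finsum K (\<lambda>i. f i \<otimes> h (k - i)) ?Z \<oplus> finsum K (\<lambda>i. g i \<otimes> h (k - i)) ?Z"
      by (rule finsum_addf) (use cl in auto)
    also have "\<dots> = (f \<otimes>\<^bsub>L\<^esub> h \<oplus>\<^bsub>L\<^esub> g \<otimes>\<^bsub>L\<^esub> h) k"
      using laurent_mult[OF fgh(1,3), of ?Z k] laurent_mult[OF fgh(2,3), of ?Z k] s
      by (simp add: laurent_simps)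
    finally show "((f \<oplus>\<^bsub>L\<^esub> g) \<otimes>\<^bsub>L\<^esub> h) k = (f \<otimes>\<^bsub>L\<^esub> h \<oplus>\<^bsub>L\<^esub> g \<otimes>\<^bsub>L\<^esub> h) k" .
  qed
qed

text \<open>The coefficients of an inverse are determined one after the other, starting at \<open>-m\<close>, where \<open>m\<close>
  is the order of the series; \<open>inv_coeffs f m n\<close> contains the first \<open>n\<close> of them.\<close>

primrec inv_coeffs :: "(int \<Rightarrow> 'k) \<Rightarrow> int \<Rightarrow> nat \<Rightarrow> int \<Rightarrow> 'k" where
  "inv_coeffs f m 0 = (\<lambda>_. \<zero>)"
| "inv_coeffs f m (Suc n) = (inv_coeffs f m n)(int n - m := inv (f m) \<otimes>
     ((if n = 0 then \<one> else \<zero>) \<ominus> finsum K (\<lambda>i. f i \<otimes> inv_coeffs f m n (int n - i)) {m + 1..m + int n}))"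

lemma laurent_inverse:
  assumes f: "f \<in> carrier L" "f \<noteq> \<zero>\<^bsub>L\<^esub>"
  shows "\<exists>g\<in>carrier L. f \<otimes>\<^bsub>L\<^esub> g = \<one>\<^bsub>L\<^esub>"
proof -
  obtain a where a: "\<forall>i<a. f i = \<zero>"
    using f by (auto simp: laurent_simps)
  obtain j where "f j \<noteq> \<zero>"
    using f by (auto simp: laurent_simps fun_eq_iff)
  then have ex: "f (a + int (nat (j - a))) \<noteq> \<zero>"
    using a by (cases "j < a") auto
  define m where "m = a + int (LEAST n. f (a + int n) \<noteq> \<zero>)"
  have fm: "f m \<noteq> \<zero>"
    unfolding m_def by (rule LeastI) (rule ex)
  have below: "f i = \<zero>" if "i < m" for i
  proof (cases "i < a")
    case False
    then have "nat (i - a) < (LEAST n. f (a + int n) \<noteq> \<zero>)"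
      using that by (auto simp: m_def)
    from not_less_Least[OF this] show ?thesis
      using False by simp
  qed (use a in auto)
  have fc: "f i \<in> carrier K" for i
    using f laurent_coeff by auto
  have fi: "inv (f m) \<in> carrier K" "f m \<otimes> inv (f m) = \<one>"
    using fm fc[of m] field_Units by auto
  have Gc: "inv_coeffs f m n i \<in> carrier K" for n i
    by (induction n arbitrary: i) (use fi fc in \<open>auto intro!: finsum_closed minus_closed\<close>)
  define g where "g = (\<lambda>j. inv_coeffs f m (nat (j + m + 1)) j)"
  have stable: "inv_coeffs f m n j = g j" if "n \<ge> nat (j + m + 1)" for n j
    using that
  proof (induction n rule: dec_induct)
    case (step n)
    then have "j \<noteq> int n - m"
      by auto
    then show ?case
      using step by simp
  qed (simp add: g_def)
  have g0: "g j = \<zero>" if "j < - m" for j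
    using that by (simp add: g_def)
  have gc: "g i \<in> carrier K" for i
    by (simp add: g_def Gc)
  have gL: "g \<in> carrier L"
    using g0 gc by (auto simp: laurent_simps)
  have "(f \<otimes>\<^bsub>L\<^esub> g) k = \<one>\<^bsub>L\<^esub> k" for k
  proof (cases "k < 0")
    case True
    then have "(f \<otimes>\<^bsub>L\<^esub> g) k = \<zero>"
      using laurent_mult_closed(2)[OF f(1) gL, of m "- m" k] below g0 by auto
    then show ?thesis
      using True by (simp add: laurent_simps)
  next
    case False
    then obtain n where k: "k = int n"
      by (metis nat_0_le not_less)
    let ?s = "finsum K (\<lambda>i. f i \<otimes> g (k - i)) {m + 1..m + k}"
    have s: "?s \<in> carrier K"
      using fc gc by (auto intro!: finsum_closed)
    have "(f \<otimes>\<^bsub>L\<^esub> g) k = finsum K (\<lambda>i. f i \<otimes> g (k - i)) {m..m + k}"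
    proof (rule laurent_mult[OF f(1) gL])
      fix i assume "f i \<noteq> \<zero>" "g (k - i) \<noteq> \<zero>"
      then have "\<not> i < m" "\<not> k - i < - m"
        using below g0 by auto
      then show "i \<in> {m..m + k}" by auto
    qed simp
    also have "{m..m + k} = insert m {m + 1..m + k}"
      using False by auto
    also have "finsum K (\<lambda>i. f i \<otimes> g (k - i)) \<dots> = f m \<otimes> g (k - m) \<oplus> ?s"
      using fc gc by (subst finsum_insert) auto
    also have "g (k - m) = inv_coeffs f m (Suc n) (k - m)"
      by (rule stable[symmetric]) (simp add: k)
    also have "\<dots> = inv (f m) \<otimes> ((if n = 0 then \<one> else \<zero>) \<ominus>
        finsum K (\<lambda>i. f i \<otimes> inv_coeffs f m n (k - i)) {m + 1..m + k})"
      by (simp add: k)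
    also have "finsum K (\<lambda>i. f i \<otimes> inv_coeffs f m n (k - i)) {m + 1..m + k} = ?s"
      by (rule finsum_cong') (use fc gc in \<open>auto simp: k intro!: arg_cong2[where f = "(\<otimes>)"] stable\<close>)
    also have "f m \<otimes> (inv (f m) \<otimes> ((if n = 0 then \<one> else \<zero>) \<ominus> ?s)) = (if n = 0 then \<one> else \<zero>) \<ominus> ?s"
      using fi fc s by (simp flip: m_assoc)
    also have "\<dots> \<oplus> ?s = \<one>\<^bsub>L\<^esub> k"
      using s by (simp add: k laurent_simps a_minus_def a_assoc l_neg)
    finally show ?thesis .
  qed
  then show ?thesis
    using gL by blast
qed

lemma laurent_field: "field L"
proof -
  interpret L: cring L by (rule laurent_cring)
  have "\<zero>\<^bsub>L\<^esub> \<noteq> \<one>\<^bsub>L\<^esub>"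
    by (auto simp: laurent_simps fun_eq_iff intro!: exI[of _ 0])
  then show ?thesis
    by (rule L.cring_fieldI2) (rule laurent_inverse)
qed

lemma monom_hom: "(\<lambda>c. monom K c 0) \<in> ring_hom K L"
  by (rule ring_hom_memI)
    (auto simp: monom_closed fun_eq_iff monom_mult laurent_simps(2-) , auto simp: monom_def)

lemma monom_mult_monom:
  assumes "c \<in> carrier K" "d \<in> carrier K"
  shows "monom K c m \<otimes>\<^bsub>L\<^esub> monom K d n = monom K (c \<otimes> d) (m + n)"
proof
  fix k
  show "(monom K c m \<otimes>\<^bsub>L\<^esub> monom K d n) k = monom K (c \<otimes> d) (m + n) k"
    unfolding monom_mult[OF assms(1) monom_closed[OF assms(2)]]
    using assms by (auto simp: monom_def)
qed

lemma monom_pow: "monom K \<one> 1 [^]\<^bsub>L\<^esub> (n :: nat) = monom K \<one> (int n)"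
proof (induction n)
  case 0
  then show ?case by (simp add: laurent_simps monom_def)
next
  case (Suc n)
  interpret L: cring L by (rule laurent_cring)
  have "monom K \<one> 1 [^]\<^bsub>L\<^esub> Suc n = monom K \<one> 1 \<otimes>\<^bsub>L\<^esub> monom K \<one> (int n)"
    using Suc L.m_comm monom_closed[OF one_closed] by simp
  also have "\<dots> = monom K \<one> (int (Suc n))"
    by (simp add: monom_mult_monom)
  finally show ?case .
qed

lemma lsum_laurent: "lsum L f xs i = lsum K (\<lambda>x. f x i) xs"
  by (induction xs) (auto simp: laurent_simps)

end

lemma surj_int_pair: "\<exists>d :: int \<Rightarrow> int \<times> int. surj d"
proof -
  have "surj (\<lambda>n. map_prod int_decode int_decode (prod_decode (int_encode n)))"
    by (intro surjI[of _ "\<lambda>p. int_decode (prod_encode (map_prod int_encode int_encode p))"]) (simp add: prod.map_comp comp_def prod.map_ident)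
  then show ?thesis by blast
qed

text \<open>Linear independence of the monomials \<open>s\<^sup>a t\<^sup>b\<close> over \<open>K\<close>, in the form of the box \<open>a, b < g\<close> that the
  construction of functionals uses.\<close>

definition independent_pair :: "'k ring \<Rightarrow> 'f ring \<Rightarrow> ('k \<Rightarrow> 'f) \<Rightarrow> 'f \<Rightarrow> 'f \<Rightarrow> bool" where
  "independent_pair K F \<phi> s t \<longleftrightarrow> s \<in> carrier F \<and> t \<in> carrier F \<and>
     (\<forall>g c. (\<forall>p. c p \<in> carrier K) \<and>
        lsum F (\<lambda>p. \<phi> (c p) \<otimes>\<^bsub>F\<^esub> (s [^]\<^bsub>F\<^esub> fst p \<otimes>\<^bsub>F\<^esub> t [^]\<^bsub>F\<^esub> snd p)) (List.product [0..<g] [0..<g]) = \<zero>\<^bsub>F\<^esub> \<longrightarrow>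
        (\<forall>p\<in>{..<g} \<times> {..<g}. c p = \<zero>\<^bsub>K\<^esub>))"

text \<open>The field is \<open>K((s))((t))\<close>, carried over to functions on \<open>int\<close> by an injection of functions of two
  integers, since a Laurent series in \<open>t\<close> over \<open>K((s))\<close> is such a function.\<close>

theorem exists_extension:
  fixes K :: "'k ring"
  assumes "field K"
  shows "\<exists>(F :: (int \<Rightarrow> 'k) ring) \<phi> s t. field F \<and> \<phi> \<in> ring_hom K F \<and> independent_pair K F \<phi> s t"
proof -
  interpret K: kfield K by (rule kfield.intro) fact
  interpret L: kfield "laurent K" by (rule kfield.intro) (rule K.laurent_field)
  let ?L = "laurent K" and ?M = "laurent (laurent K)"
  interpret M: field ?M by (rule L.laurent_field)
  obtain d :: "int \<Rightarrow> int \<times> int" where d: "surj d"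
    using surj_int_pair by blast
  define \<tau> where "\<tau> = (\<lambda>(f :: int \<Rightarrow> int \<Rightarrow> 'k) n. f (fst (d n)) (snd (d n)))"
  have inj: "inj \<tau>"
  proof (rule injI, intro ext)
    fix f g x y assume eq: "\<tau> f = \<tau> g"
    obtain n where "d n = (x, y)"
      using d by (metis surj_def)
    then show "f x y = g x y"
      using fun_cong[OF eq, of n] by (simp add: \<tau>_def)
  qed
  define F where "F = image_ring \<tau> ?M"
  have F: "field F"
    unfolding F_def by (rule M.inj_imp_image_ring_is_field) (use inj in \<open>auto intro: inj_on_subset\<close>)
  interpret F: field F by (rule F)
  have \<tau>: "\<tau> \<in> ring_hom ?M F"
    using inj_imp_image_ring_iso[of \<tau>] inj unfolding F_def ring_iso_def by (auto intro: inj_on_subset)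
  have inner: "(\<lambda>c. monom K c 0) \<in> ring_hom K ?L"
    by (rule K.monom_hom)
  have outer: "(\<lambda>c. monom ?L c 0) \<in> ring_hom ?L ?M"
    by (rule L.monom_hom)
  define \<psi> where "\<psi> = (\<lambda>c. monom ?L (monom K c 0) 0)"
  have \<psi>: "\<psi> \<in> ring_hom K ?M"
    using ring_hom_trans[OF inner outer] by (simp add: \<psi>_def comp_def)
  have \<phi>: "\<tau> \<circ> \<psi> \<in> ring_hom K F"
    by (rule ring_hom_trans[OF \<psi> \<tau>])
  define s where "s = monom ?L (monom K \<one>\<^bsub>K\<^esub> 1) 0"
  define t where "t = monom ?L \<one>\<^bsub>?L\<^esub> 1"
  have m1: "monom K \<one>\<^bsub>K\<^esub> n \<in> carrier ?L" for n
    by (rule K.monom_closed) simp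
  have s: "s \<in> carrier ?M" and t: "t \<in> carrier ?M"
    by (auto simp: s_def t_def intro!: L.monom_closed m1)
  have hrc: "ring_hom_ring ?L ?M (\<lambda>c. monom ?L c 0)"
    by (rule ring_hom_ringI2[OF L.ring_axioms M.ring_axioms outer])
  have sp: "s [^]\<^bsub>?M\<^esub> n = monom ?L (monom K \<one>\<^bsub>K\<^esub> (int n)) 0" for n :: nat
    using ring_hom_ring.hom_nat_pow[OF hrc m1[of 1], of n] by (simp add: s_def K.monom_pow)
  have summand: "\<psi> c \<otimes>\<^bsub>?M\<^esub> (s [^]\<^bsub>?M\<^esub> a \<otimes>\<^bsub>?M\<^esub> t [^]\<^bsub>?M\<^esub> b) = monom ?L (monom K c (int a)) (int b)"
    if c: "c \<in> carrier K" for c and a b :: nat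
  proof -
    have "\<psi> c \<otimes>\<^bsub>?M\<^esub> s [^]\<^bsub>?M\<^esub> a = monom ?L (monom K c 0 \<otimes>\<^bsub>?L\<^esub> monom K \<one>\<^bsub>K\<^esub> (int a)) 0"
      unfolding \<psi>_def sp
      using ring_hom_mult[OF outer K.monom_closed[OF c] m1] by simp
    also have "monom K c 0 \<otimes>\<^bsub>?L\<^esub> monom K \<one>\<^bsub>K\<^esub> (int a) = monom K c (int a)"
      using c by (simp add: K.monom_mult_monom)
    finally have "\<psi> c \<otimes>\<^bsub>?M\<^esub> (s [^]\<^bsub>?M\<^esub> a \<otimes>\<^bsub>?M\<^esub> t [^]\<^bsub>?M\<^esub> b) = monom ?L (monom K c (int a)) 0 \<otimes>\<^bsub>?M\<^esub> t [^]\<^bsub>?M\<^esub> b"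
      using s t ring_hom_closed[OF \<psi> c] by (simp flip: M.m_assoc)
    also have "\<dots> = monom ?L (monom K c (int a)) (int b)"
    proof -
      have "t [^]\<^bsub>?M\<^esub> b = monom ?L \<one>\<^bsub>?L\<^esub> (int b)"
        unfolding t_def by (rule L.monom_pow)
      then show ?thesis
        by (simp add: L.monom_mult_monom K.monom_closed[OF c])
    qed
    finally show ?thesis .
  qed
  have "independent_pair K F (\<tau> \<circ> \<psi>) (\<tau> s) (\<tau> t)"
    unfolding independent_pair_def
  proof (intro conjI allI impI ballI)
    show "\<tau> s \<in> carrier F" "\<tau> t \<in> carrier F"
      using ring_hom_closed[OF \<tau>] s t by auto
    fix g c p0
    assume c: "(\<forall>p. c p \<in> carrier K) \<and> lsum F (\<lambda>p. (\<tau> \<circ> \<psi>) (c p) \<otimes>\<^bsub>F\<^esub>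
      (\<tau> s [^]\<^bsub>F\<^esub> fst p \<otimes>\<^bsub>F\<^esub> \<tau> t [^]\<^bsub>F\<^esub> snd p)) (List.product [0..<g] [0..<g]) = \<zero>\<^bsub>F\<^esub>"
      and p0: "p0 \<in> {..<g} \<times> {..<g}"
    let ?ps = "List.product [0..<g] [0..<g]"
    let ?m = "\<lambda>p :: nat \<times> nat. monom ?L (monom K (c p) (int (fst p))) (int (snd p))"
    have hr: "ring_hom_ring ?M F \<tau>"
      by (rule ring_hom_ringI2[OF M.ring_axioms F.ring_axioms \<tau>])
    have m: "?m p \<in> carrier ?M" for p
      by (intro L.monom_closed K.monom_closed) (rule c[THEN conjunct1, rule_format])
    have "(\<tau> \<circ> \<psi>) (c p) \<otimes>\<^bsub>F\<^esub> (\<tau> s [^]\<^bsub>F\<^esub> fst p \<otimes>\<^bsub>F\<^esub> \<tau> t [^]\<^bsub>F\<^esub> snd p) = \<tau> (?m p)" for p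
      unfolding summand[symmetric, OF c[THEN conjunct1, rule_format]]
      using c[THEN conjunct1, rule_format, of p] ring_hom_closed[OF \<psi>, of "c p"] s t
      by (simp add: ring_hom_mult[OF \<tau>] ring_hom_ring.hom_nat_pow[OF hr])
    then have "\<zero>\<^bsub>F\<^esub> = lsum F (\<lambda>p. \<tau> (?m p)) ?ps"
      using c by simp
    also have "\<dots> = \<tau> (lsum ?M ?m ?ps)"
      by (rule lsum_hom[where h = \<tau> and G = ?M and H = F and f = ?m, symmetric])
        (use M.abelian_monoid_axioms m ring_hom_zero[OF \<tau> M.ring_axioms F.ring_axioms] ring_hom_add[OF \<tau>] in auto)
    finally have "\<tau> (lsum ?M ?m ?ps) = \<tau> \<zero>\<^bsub>?M\<^esub>"
      using ring_hom_zero[OF \<tau> M.ring_axioms F.ring_axioms] by simp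
    then have z: "lsum ?M ?m ?ps = \<zero>\<^bsub>?M\<^esub>"
      using inj by (simp add: inj_eq)
    have "lsum ?M ?m ?ps (int (snd p0)) (int (fst p0)) =
        lsum K (\<lambda>p. ?m p (int (snd p0)) (int (fst p0))) ?ps"
      by (simp add: L.lsum_laurent K.lsum_laurent)
    also have "\<dots> = lsum K (\<lambda>p. if p = p0 then c p else \<zero>\<^bsub>K\<^esub>) ?ps"
      by (rule lsum_cong) (auto simp: monom_def K.laurent_simps prod_eq_iff)
    also have "\<dots> = c p0"
      by (rule K.lsum_delta) (use p0 c in \<open>auto simp: distinct_product\<close>)
    finally show "c p0 = \<zero>\<^bsub>K\<^esub>"
      unfolding z by (simp add: K.laurent_simps L.laurent_simps)
  qed
  then show ?thesis
    using F \<phi> by blast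
qed


section \<open>Criteria for free subalgebras\<close>

lemma na_eval_carrier_update [simp]: "na_eval (A\<lparr>carrier := S\<rparr>) \<sigma> t = na_eval A \<sigma> t"
  by (induction t) auto

text \<open>A family freely generates a subalgebra of an algebra of the variety if all relations between its
  members are identities of the variety.\<close>

theorem contains_freeI:
  fixes K :: "'k ring" and A :: "('k, 'a) module"
  assumes var: "in_variety K V A" and sc: "\<And>t. t \<in> V \<Longrightarrow> scalars t \<subseteq> carrier K"
    and \<sigma>: "\<And>i :: nat. \<sigma> i \<in> carrier A" and ne: "\<sigma> 0 \<noteq> \<sigma> 1"
    and free: "\<And>t (B :: ('k, 'a list \<Rightarrow> 'k) module) \<tau>. scalars t \<subseteq> carrier K \<Longrightarrow> na_eval A \<sigma> t = \<zero>\<^bsub>A\<^esub> \<Longrightarrow>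
      in_variety K V B \<Longrightarrow> (\<And>i. \<tau> i \<in> carrier B) \<Longrightarrow> na_eval B \<tau> t = \<zero>\<^bsub>B\<^esub>"
  shows "contains_free K V A"
proof -
  have nA: "nonassoc_algebra K A"
    using var by (simp add: in_variety_def)
  interpret na_algebra K A
    by (rule na_algebra.intro) (rule nA)
  define S where "S = {na_eval A \<sigma> t | t. scalars t \<subseteq> carrier K}"
  have S: "x \<in> carrier A" if "x \<in> S" for x
    using that na_eval_closed[of _ \<sigma>] \<sigma> by (auto simp: S_def)
  have S_intro: "na_eval A \<sigma> t \<in> S" if "scalars t \<subseteq> carrier K" for t
    using that by (auto simp: S_def)
  have S_smult: "c \<odot>\<^bsub>A\<^esub> x \<in> S" if "c \<in> carrier K" "x \<in> S" for c x
    using that S_intro[of "Scale c t" for t] by (auto simp: S_def)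
  have S_add: "x \<oplus>\<^bsub>A\<^esub> y \<in> S" if "x \<in> S" "y \<in> S" for x y
    using that S_intro[of "Add t t'" for t t'] by (auto simp: S_def)
  have S_mult: "x \<otimes>\<^bsub>A\<^esub> y \<in> S" if "x \<in> S" "y \<in> S" for x y
    using that S_intro[of "Mult t t'" for t t'] by (auto simp: S_def)
  have S_\<sigma>: "\<sigma> i \<in> S" for i
    using S_intro[of "Var i"] by simp
  have S_zero: "\<zero>\<^bsub>A\<^esub> \<in> S"
    using S_smult[OF R.zero_closed S_\<sigma>] \<sigma> by simp
  have sub: "submodule S K A"
  proof (rule submoduleI)
    show "\<ominus>\<^bsub>A\<^esub> x \<in> S" if "x \<in> S" for x
      using S_smult[of "\<ominus>\<^bsub>K\<^esub> \<one>\<^bsub>K\<^esub>" x] that S by (simp add: smult_l_minus)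
  qed (use S S_zero S_add S_smult in auto)
  have subalg: "is_subalgebra K S A"
    using sub S_mult by (simp add: is_subalgebra_def)
  let ?S = "A\<lparr>carrier := S\<rparr>"
  have SA: "nonassoc_algebra K ?S"
    by (rule algebra_pullback[OF nA, where h = "\<lambda>x. x"])
      (use S S_zero S_add S_mult S_smult in auto)
  have "satisfies_identity ?S t" if "t \<in> V" for t
    by (rule identity_pullback[OF SA, where h = "\<lambda>x. x" and R = A])
      (use S sc var that in \<open>auto simp: in_variety_def\<close>)
  then have varS: "in_variety K V ?S"
    using SA by (simp add: in_variety_def)
  have "\<exists>!h. h \<in> alg_hom K ?S B \<and> h \<in> extensional (carrier ?S) \<and> (\<forall>y\<in>range \<sigma>. h y = f y)"
    if B: "in_variety K V B" and f: "f \<in> range \<sigma> \<rightarrow> carrier B"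
    for B :: "('k, 'a list \<Rightarrow> 'k) module" and f
  proof -
    have nB: "nonassoc_algebra K B"
      using B by (simp add: in_variety_def)
    interpret B: na_algebra K B
      by (rule na_algebra.intro) (rule nB)
    define \<tau> where "\<tau> = (\<lambda>i. f (\<sigma> i))"
    have \<tau>: "\<tau> i \<in> carrier B" for i
      using f by (auto simp: \<tau>_def)
    have eq: "na_eval B \<tau> t = na_eval B \<tau> t'"
      if "na_eval A \<sigma> t = na_eval A \<sigma> t'" "scalars t \<subseteq> carrier K" "scalars t' \<subseteq> carrier K" for t t'
    proof -
      let ?d = "Add t (Scale (\<ominus>\<^bsub>K\<^esub> \<one>\<^bsub>K\<^esub>) t')"
      have cl: "na_eval B \<tau> t \<in> carrier B" "na_eval B \<tau> t' \<in> carrier B" "na_eval A \<sigma> t' \<in> carrier A"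
        using B.na_eval_closed[OF that(2) \<tau>] B.na_eval_closed[OF that(3) \<tau>] na_eval_closed[OF that(3) \<sigma>] by auto
      have "na_eval A \<sigma> ?d = \<zero>\<^bsub>A\<^esub>"
        using that cl by (simp add: smult_l_minus M.r_neg)
      then have "na_eval B \<tau> ?d = \<zero>\<^bsub>B\<^esub>"
        using that by (intro free[OF _ _ B \<tau>]) auto
      then have "na_eval B \<tau> t \<oplus>\<^bsub>B\<^esub> \<ominus>\<^bsub>B\<^esub> na_eval B \<tau> t' = \<zero>\<^bsub>B\<^esub>"
        using cl by (simp add: B.smult_l_minus)
      then show ?thesis
        using cl by (metis B.M.add.inv_closed B.M.add.inv_inv B.M.minus_equality B.M.a_comm)
    qed
    define h where "h = (\<lambda>s\<in>S. na_eval B \<tau> (SOME t. scalars t \<subseteq> carrier K \<and> na_eval A \<sigma> t = s))"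
    have h: "h (na_eval A \<sigma> t) = na_eval B \<tau> t" if t: "scalars t \<subseteq> carrier K" for t
    proof -
      let ?t = "SOME t'. scalars t' \<subseteq> carrier K \<and> na_eval A \<sigma> t' = na_eval A \<sigma> t"
      have "scalars ?t \<subseteq> carrier K \<and> na_eval A \<sigma> ?t = na_eval A \<sigma> t"
        by (rule someI[of _ t]) (use t in simp)
      then show ?thesis
        using eq[of ?t t] t S_intro[OF t] by (simp add: h_def)
    qed
    have h1: "h \<in> alg_hom K ?S B"
      unfolding alg_hom_def
    proof (intro CollectI conjI ballI funcsetI)
      fix x assume "x \<in> carrier ?S"
      then obtain t where "scalars t \<subseteq> carrier K" "x = na_eval A \<sigma> t"
        by (auto simp: S_def)
      then show "h x \<in> carrier B"
        using B.na_eval_closed[OF _ \<tau>] by (simp add: h)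
    next
      fix x y assume "x \<in> carrier ?S" "y \<in> carrier ?S"
      then obtain t t' where t: "scalars t \<subseteq> carrier K" "x = na_eval A \<sigma> t" "scalars t' \<subseteq> carrier K" "y = na_eval A \<sigma> t'"
        by (auto simp: S_def)
      show "h (x \<oplus>\<^bsub>?S\<^esub> y) = h x \<oplus>\<^bsub>B\<^esub> h y"
        using h[of "Add t t'"] t by (simp add: h)
      show "h (x \<otimes>\<^bsub>?S\<^esub> y) = h x \<otimes>\<^bsub>B\<^esub> h y"
        using h[of "Mult t t'"] t by (simp add: h)
    next
      fix c x assume c: "c \<in> carrier K" and "x \<in> carrier ?S"
      then obtain t where t: "scalars t \<subseteq> carrier K" "x = na_eval A \<sigma> t"
        by (auto simp: S_def)
      show "h (c \<odot>\<^bsub>?S\<^esub> x) = c \<odot>\<^bsub>B\<^esub> h x"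
        using h[of "Scale c t"] t c by (simp add: h)
    qed
    have h2: "h (\<sigma> i) = f (\<sigma> i)" for i
      using h[of "Var i"] by (simp add: \<tau>_def)
    have h3: "h \<in> extensional S"
      by (simp add: h_def)
    have uniq: "h' = h" if h': "h' \<in> alg_hom K ?S B" "h' \<in> extensional S" "\<And>i. h' (\<sigma> i) = f (\<sigma> i)" for h'
    proof (rule extensionalityI[OF h'(2) h3])
      fix x assume "x \<in> S"
      then obtain t where t: "scalars t \<subseteq> carrier K" "x = na_eval A \<sigma> t"
        by (auto simp: S_def)
      have "h' (na_eval ?S \<sigma> t) = na_eval B (\<lambda>i. h' (\<sigma> i)) t"
        by (rule na_eval_hom[OF SA t(1)]) (use h'(1) S_\<sigma> in \<open>auto simp: alg_hom_def\<close>)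
      then show "h' x = h x"
        using t h'(3) by (simp add: h \<tau>_def)
    qed
    show ?thesis
    proof (rule ex1I[of _ h])
      show "h \<in> alg_hom K ?S B \<and> h \<in> extensional (carrier ?S) \<and> (\<forall>y\<in>range \<sigma>. h y = f y)"
        using h1 h2 h3 by simp
    next
      fix h' assume "h' \<in> alg_hom K ?S B \<and> h' \<in> extensional (carrier ?S) \<and> (\<forall>y\<in>range \<sigma>. h' y = f y)"
      then show "h' = h"
        by (intro uniq) (simp_all add: rangeI)
    qed
  qed
  then have "free_in_variety K V ?S (range \<sigma>)"
    unfolding free_in_variety_def using varS S_\<sigma> by auto
  then show ?thesis
    unfolding contains_free_def using subalg ne by blast
qed

text \<open>Two free generators can be mapped anywhere, so a relation between them holds in all algebras of the variety.\<close>

theorem not_contains_freeI: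
  fixes K :: "'k ring" and A :: "('k, 'a) module"
  assumes rel: "\<And>p q. p \<in> carrier A \<Longrightarrow> q \<in> carrier A \<Longrightarrow> \<exists>t. scalars t \<subseteq> carrier K \<and>
      na_eval A (\<lambda>i. if i = 0 then p else q) t = \<zero>\<^bsub>A\<^esub> \<and>
      (\<exists>(B :: ('k, 'a list \<Rightarrow> 'k) module) u v. in_variety K V B \<and> u \<in> carrier B \<and> v \<in> carrier B \<and>
        na_eval B (\<lambda>i. if i = 0 then u else v) t \<noteq> \<zero>\<^bsub>B\<^esub>)"
  shows "\<not> contains_free K V A"
proof
  assume "contains_free K V A"
  then obtain S Y y z where S: "is_subalgebra K S A" "free_in_variety K V (A\<lparr>carrier := S\<rparr>) Y"
    and yz: "y \<in> Y" "z \<in> Y" "y \<noteq> z"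
    unfolding contains_free_def by blast
  let ?S = "A\<lparr>carrier := S\<rparr>"
  have Y: "Y \<subseteq> S" and SA: "nonassoc_algebra K ?S"
    using S(2) by (auto simp: free_in_variety_def in_variety_def)
  have "S \<subseteq> carrier A"
    using S(1) subgroup.subset[OF submodule.axioms(1)] by (fastforce simp: is_subalgebra_def)
  then have yz': "y \<in> carrier A" "z \<in> carrier A"
    using yz Y by auto
  obtain t and B :: "('k, 'a list \<Rightarrow> 'k) module" and u v where t: "scalars t \<subseteq> carrier K"
      "na_eval A (\<lambda>i. if i = 0 then y else z) t = \<zero>\<^bsub>A\<^esub>"
    and B: "in_variety K V B" "u \<in> carrier B" "v \<in> carrier B"
      "na_eval B (\<lambda>i. if i = 0 then u else v) t \<noteq> \<zero>\<^bsub>B\<^esub>"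
    using rel[OF yz'] by (elim exE conjE)
  interpret B: na_algebra K B
    by (rule na_algebra.intro) (use B in \<open>simp add: in_variety_def\<close>)
  interpret S: na_algebra K ?S
    by (rule na_algebra.intro) (rule SA)
  let ?f = "\<lambda>x. if x = y then u else v"
  have "?f \<in> Y \<rightarrow> carrier B"
    using B by simp
  then have "\<exists>!h. h \<in> alg_hom K ?S B \<and> h \<in> extensional (carrier ?S) \<and> (\<forall>x\<in>Y. h x = ?f x)"
    using S(2) B(1) unfolding free_in_variety_def by blast
  then obtain h where h: "h \<in> alg_hom K ?S B" "\<forall>x\<in>Y. h x = ?f x"
    by (elim ex1E conjE)
  have "h (na_eval ?S (\<lambda>i. if i = 0 then y else z) t) = na_eval B (\<lambda>i. h (if i = 0 then y else z)) t"
    by (rule na_eval_hom[OF SA t(1)]) (use h(1) yz Y in \<open>auto simp: alg_hom_def\<close>)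
  also have "(\<lambda>i. h (if i = 0 then y else z)) = (\<lambda>i :: nat. if i = 0 then u else v)"
    using h(2) yz by auto
  finally have "h \<zero>\<^bsub>?S\<^esub> \<noteq> \<zero>\<^bsub>B\<^esub>"
    using t B by simp
  moreover have "h (\<zero>\<^bsub>K\<^esub> \<odot>\<^bsub>?S\<^esub> \<zero>\<^bsub>?S\<^esub>) = \<zero>\<^bsub>K\<^esub> \<odot>\<^bsub>B\<^esub> h \<zero>\<^bsub>?S\<^esub>" "h \<zero>\<^bsub>?S\<^esub> \<in> carrier B"
  proof -
    have "\<zero>\<^bsub>K\<^esub> \<in> carrier K" "\<zero>\<^bsub>?S\<^esub> \<in> carrier ?S"
      using S.M.zero_closed by simp_all
    then show "h (\<zero>\<^bsub>K\<^esub> \<odot>\<^bsub>?S\<^esub> \<zero>\<^bsub>?S\<^esub>) = \<zero>\<^bsub>K\<^esub> \<odot>\<^bsub>B\<^esub> h \<zero>\<^bsub>?S\<^esub>" "h \<zero>\<^bsub>?S\<^esub> \<in> carrier B"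
      using h(1) unfolding alg_hom_def by blast+
  qed
  ultimately show False
    using S.smult_l_null[OF S.M.zero_closed] by simp
qed


section \<open>Nil algebras contain no free subalgebras\<close>

primrec iterated :: "nat \<Rightarrow> 'k na_poly" where
  "iterated 0 = Var 1"
| "iterated (Suc n) = Mult (Var 0) (iterated n)"

primrec iterated_tree :: "nat \<Rightarrow> tree" where
  "iterated_tree 0 = Leaf 1"
| "iterated_tree (Suc n) = Node (Leaf 0) (iterated_tree n)"

lemma scalars_iterated [simp]: "scalars (iterated n) = {}"
  by (induction n) auto

lemma (in kfield) word_poly_iterated:
  assumes "\<alpha> \<in> carrier K" "\<beta> \<in> carrier K"
  shows "set (word_poly K \<alpha> \<beta> (iterated n)) \<subseteq>
    carrier K \<times> {replicate i 0 @ [1] @ replicate (n - i) 0 | i. i \<le> n}"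
proof -
  have m: "set (monomials K (iterated n)) \<subseteq> carrier K \<times> {iterated_tree n}"
    by (induction n) (auto simp: lprod_def)
  have w: "set (words K \<alpha> \<beta> (iterated_tree n)) \<subseteq>
    carrier K \<times> {replicate i 0 @ [1] @ replicate (n - i) 0 | i. i \<le> n}" for n
  proof (induction n)
    case (Suc n)
    have l: "set [(\<one>, [0 :: nat])] \<subseteq> carrier K \<times> {[0]}"
      by simp
    have "set (lprod K (@) [(\<one>, [0])] (words K \<alpha> \<beta> (iterated_tree n))) \<subseteq>
      carrier K \<times> {replicate i 0 @ [1] @ replicate (Suc n - i) 0 | i. i \<le> Suc n}"
    proof (rule lprod_set[OF l Suc])
      fix x y :: "nat list"
      assume "x \<in> {[0]}" "y \<in> {replicate i 0 @ [1] @ replicate (n - i) 0 | i. i \<le> n}"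
      then obtain i where "i \<le> n" "y = replicate i 0 @ [1] @ replicate (n - i) 0" "x = [0]"
        by auto
      then show "x @ y \<in> {replicate i 0 @ [1] @ replicate (Suc n - i) 0 | i. i \<le> Suc n}"
        by (intro CollectI exI[of _ "Suc i"]) auto
    qed
    moreover have "set (lprod K (@) (words K \<alpha> \<beta> (iterated_tree n)) [(\<one>, [0])]) \<subseteq>
      carrier K \<times> {replicate i 0 @ [1] @ replicate (Suc n - i) 0 | i. i \<le> Suc n}"
    proof (rule lprod_set[OF Suc l])
      fix x y :: "nat list"
      assume "x \<in> {replicate i 0 @ [1] @ replicate (n - i) 0 | i. i \<le> n}" "y \<in> {[0]}"
      then obtain i where "i \<le> n" "x = replicate i 0 @ [1] @ replicate (n - i) 0" "y = [0]"
        by auto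
      then show "x @ y \<in> {replicate i 0 @ [1] @ replicate (Suc n - i) 0 | i. i \<le> Suc n}"
        by (auto intro!: exI[of _ i] simp: Suc_diff_le replicate_append_same)
    qed
    ultimately show ?case
      unfolding iterated_tree.simps words.simps set_append by (intro Un_least scl_set assms)
  qed simp
  show ?thesis
    unfolding word_poly_def by (rule lbind_set[OF m]) (use w in auto)
qed

lemma (in as_algebra) word_eval_factor_zero:
  assumes \<sigma>: "\<And>i. \<sigma> i \<in> carrier A" and v: "word_eval A \<sigma> v = \<zero>\<^bsub>A\<^esub>" "v \<noteq> []"
  shows "word_eval A \<sigma> (u @ v @ w) = \<zero>\<^bsub>A\<^esub>"
proof -
  have 1: "word_eval A \<sigma> (v @ w) = \<zero>\<^bsub>A\<^esub>"
    using v \<sigma> by (cases "w = []") (auto simp: word_eval_append mult_l_zero word_eval_closed)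
  then show ?thesis
    using v \<sigma> by (cases "u = []") (auto simp: word_eval_append mult_r_zero word_eval_closed)
qed

text \<open>Every word in the expansion has a single letter \<open>q\<close> among \<open>2 N\<close> letters \<open>p\<close>. One of the two blocks of \<open>p\<close> has
  length at least \<open>N\<close>.\<close>

lemma (in as_algebra) iterated_nil:
  assumes ab: "\<alpha> \<in> carrier K" "\<beta> \<in> carrier K" and pq: "p \<in> carrier A" "q \<in> carrier A"
    and N: "word_eval A (\<lambda>_. p) (replicate N 0) = \<zero>\<^bsub>A\<^esub>" "N > 0"
  shows "na_eval (twist \<alpha> \<beta> A) (\<lambda>i. if i = 0 then p else q) (iterated (2 * N)) = \<zero>\<^bsub>A\<^esub>"
proof -
  interpret kfield K by (rule kfield.intro) (rule field_axioms)
  let ?\<sigma> = "\<lambda>i. if i = 0 then p else q"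
  have \<sigma>: "?\<sigma> i \<in> carrier A" for i :: nat
    using pq by simp
  have e: "word_eval A ?\<sigma> (replicate n 0) = word_eval A (\<lambda>_. p) (replicate n 0)" for n
    by (induction n rule: induct_nat_012) auto
  have N': "word_eval A ?\<sigma> (replicate N 0) = \<zero>\<^bsub>A\<^esub>" "replicate N (0 :: nat) \<noteq> []"
    using N e by auto
  have "na_eval (twist \<alpha> \<beta> A) ?\<sigma> (iterated (2 * N)) =
      lcomb A (word_eval A ?\<sigma>) (word_poly K \<alpha> \<beta> (iterated (2 * N)))"
    by (rule na_eval_twist[OF ab \<sigma>]) simp
  also have "\<dots> = \<zero>\<^bsub>A\<^esub>"
  proof (rule lcomb_zero_fun[OF word_poly_iterated[OF ab]])
    fix w :: "nat list" assume "w \<in> {replicate i 0 @ [1] @ replicate (2 * N - i) 0 | i. i \<le> 2 * N}"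
    then obtain i where i: "i \<le> 2 * N" "w = replicate i 0 @ [1] @ replicate (2 * N - i) 0"
      by auto
    have split: "replicate n (0 :: nat) = replicate (n - N) 0 @ replicate N 0" if "n \<ge> N" for n
      using that by (simp flip: replicate_add)
    show "word_eval A ?\<sigma> w = \<zero>\<^bsub>A\<^esub>"
    proof (cases "i \<ge> N")
      case True
      then show ?thesis
        using word_eval_factor_zero[OF \<sigma> N', of "replicate (i - N) 0" "[1] @ replicate (2 * N - i) 0"]
        unfolding i(2) by (subst split) auto
    next
      case False
      then have "2 * N - i \<ge> N" by simp
      then show ?thesis
        using word_eval_factor_zero[OF \<sigma> N', of "replicate i 0 @ [1] @ replicate (2 * N - i - N) 0" "[]"]
        unfolding i(2) by (subst split[of "2 * N - i"]) auto
    qed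
  qed
  finally show ?thesis .
qed

text \<open>The associative product \<open>u v = u([]) v\<close> on functions, in which a function with value \<open>1\<close> at \<open>[]\<close> is
  a left identity. It lives on the types on which free algebras are tested.\<close>

definition left_algebra :: "'k ring \<Rightarrow> ('k, 'a list \<Rightarrow> 'k) module" where
  "left_algebra K =
     \<lparr>carrier = {u. \<forall>x. u x \<in> carrier K}, monoid.mult = \<lambda>u v x. u [] \<otimes>\<^bsub>K\<^esub> v x, one = undefined,
      zero = \<lambda>_. \<zero>\<^bsub>K\<^esub>, add = \<lambda>u v x. u x \<oplus>\<^bsub>K\<^esub> v x, smult = \<lambda>c u x. c \<otimes>\<^bsub>K\<^esub> u x\<rparr>"

context kfield
begin

lemma left_algebra_simps:
  "u \<in> carrier (left_algebra K) \<longleftrightarrow> (\<forall>x. u x \<in> carrier K)"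
  "u \<otimes>\<^bsub>left_algebra K\<^esub> v = (\<lambda>x. u [] \<otimes> v x)" "\<zero>\<^bsub>left_algebra K\<^esub> = (\<lambda>_. \<zero>)"
  "u \<oplus>\<^bsub>left_algebra K\<^esub> v = (\<lambda>x. u x \<oplus> v x)" "c \<odot>\<^bsub>left_algebra K\<^esub> u = (\<lambda>x. c \<otimes> u x)"
  by (auto simp: left_algebra_def)

lemma left_algebra: "assoc_algebra K (left_algebra K :: ('k, 'a list \<Rightarrow> 'k) module)" (is "assoc_algebra K ?B")
proof -
  have ab: "abelian_group ?B"
  proof (rule abelian_groupI)
    fix u assume "u \<in> carrier ?B"
    then show "\<exists>v\<in>carrier ?B. v \<oplus>\<^bsub>?B\<^esub> u = \<zero>\<^bsub>?B\<^esub>"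
      by (intro bexI[of _ "\<lambda>x. \<ominus> u x"]) (auto simp: left_algebra_simps l_neg)
  qed (auto simp: left_algebra_simps a_ac)
  have md: "module K ?B"
    by (rule moduleI[OF is_cring ab]) (auto simp: left_algebra_simps l_distr r_distr m_assoc)
  show ?thesis
    by (intro assoc_algebra.intro assoc_algebra_axioms.intro nonassoc_algebra.intro
      nonassoc_algebra_axioms.intro md field_axioms)
      (auto simp: left_algebra_simps l_distr r_distr m_assoc m_lcomm)
qed

text \<open>With \<open>u = 1\<close> and \<open>v([]) = 0\<close> only the products \<open>u v\<close> survive, each of them with the factor \<open>\<alpha>\<close>.\<close>

lemma iterated_nonzero:
  assumes "\<alpha> \<in> carrier K" "\<beta> \<in> carrier K" "\<alpha> \<noteq> \<zero>"
  shows "\<exists>u v :: 'a list \<Rightarrow> 'k. u \<in> carrier (left_algebra K) \<and> v \<in> carrier (left_algebra K) \<and>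
    na_eval (twist \<alpha> \<beta> (left_algebra K)) (\<lambda>i. if i = 0 then u else v) (iterated n) \<noteq> \<zero>\<^bsub>left_algebra K\<^esub>"
proof -
  let ?u = "\<lambda>x :: 'a list. \<one>" and ?v = "\<lambda>x :: 'a list. if x = [] then \<zero> else \<one>"
  have "na_eval (twist \<alpha> \<beta> (left_algebra K)) (\<lambda>i. if i = 0 then ?u else ?v) (iterated n) =
    (\<lambda>x. if x = [] then \<zero> else \<alpha> [^] n)"
    by (induction n) (use assms in \<open>auto simp: left_algebra_simps fun_eq_iff m_comm\<close>)
  moreover have "\<alpha> [^] n \<noteq> \<zero>"
    using assms by (induction n) (auto simp: integral_iff)
  then have "(\<lambda>x :: 'a list. if x = [] then \<zero> else \<alpha> [^] n) \<noteq> \<zero>\<^bsub>left_algebra K\<^esub>"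
    by (auto simp: left_algebra_simps fun_eq_iff intro!: exI[of _ "[undefined]"])
  moreover have "?u \<in> carrier (left_algebra K)" "?v \<in> carrier (left_algebra K)"
    by (auto simp: left_algebra_simps)
  ultimately show ?thesis
    by metis
qed

end

lemma in_variety_twist:
  fixes B :: "('k, 'b) module"
  assumes "assoc_algebra K B" "\<alpha> \<in> carrier K" "\<beta> \<in> carrier K"
    and V: "\<And>t. t \<in> V \<Longrightarrow> scalars t \<subseteq> carrier K \<and> (\<forall>w. cf K (word_poly K \<alpha> \<beta> t) w = \<zero>\<^bsub>K\<^esub>)"
  shows "in_variety K V (twist \<alpha> \<beta> B)"
proof -
  interpret as_algebra K B by (rule as_algebra.intro) fact
  show ?thesis
    unfolding in_variety_def satisfies_identity_def
    using twist_algebra[OF assms(2,3)] V na_eval_twist_zero[OF assms(2,3)] by auto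
qed


section \<open>Special Jordan algebras\<close>

context kfield
begin

lemma free_word_eval:
  "w \<noteq> [] \<Longrightarrow> word_eval (magma_algebra K UNIV (@)) (\<lambda>i. cf K [(\<one>, [i])]) w = cf K [(\<one>, w)]"
proof (induction w rule: induct_list012)
  case (3 i j w)
  have "cf K [(\<one>, [i])] \<otimes>\<^bsub>magma_algebra K UNIV (@)\<^esub> cf K [(\<one>, j # w)] = cf K [(\<one>, i # j # w)]"
    by (subst magma_mult_cf[where X = UNIV]) auto
  then show ?case
    using 3 by simp
qed simp_all

lemma lcomb_magma_basis:
  "set l \<subseteq> carrier K \<times> UNIV \<Longrightarrow> lcomb (magma_algebra K UNIV m) (\<lambda>w. cf K [(\<one>, w)]) l = cf K l"
proof (induction l)
  case Nil
  then show ?case by (simp add: magma_algebra_simps cf_def)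
next
  case (Cons p l)
  then show ?case
    by (cases p) (auto simp: magma_algebra_simps cf_Cons fun_eq_iff)
qed

lemma na_eval_free:
  assumes ab: "\<alpha> \<in> carrier K" "\<beta> \<in> carrier K" and t: "scalars t \<subseteq> carrier K"
  shows "na_eval (twist \<alpha> \<beta> (magma_algebra K UNIV (@))) (\<lambda>i. cf K [(\<one>, [i])]) t = cf K (word_poly K \<alpha> \<beta> t)"
proof -
  let ?F = "magma_algebra K (UNIV :: nat list set) (@)"
  interpret F: as_algebra K ?F
    by (rule as_algebra.intro) (rule magma_assoc_algebra, auto)
  have "na_eval (twist \<alpha> \<beta> ?F) (\<lambda>i. cf K [(\<one>, [i])]) t =
      lcomb ?F (word_eval ?F (\<lambda>i. cf K [(\<one>, [i])])) (word_poly K \<alpha> \<beta> t)"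
    by (rule F.na_eval_twist[OF ab _ t]) (auto intro!: cf_in_magma)
  also have "\<dots> = lcomb ?F (\<lambda>w. cf K [(\<one>, w)]) (word_poly K \<alpha> \<beta> t)"
    by (rule lcomb_cong) (use word_poly_set[OF ab t] in \<open>auto simp: free_word_eval\<close>)
  also have "\<dots> = cf K (word_poly K \<alpha> \<beta> t)"
    by (rule lcomb_magma_basis) (use word_poly_set[OF ab t] in auto)
  finally show ?thesis .
qed

abbreviation "half \<equiv> inv (\<one> \<oplus> \<one>)"

lemma half: "\<one> \<oplus> \<one> \<noteq> \<zero> \<Longrightarrow> half \<in> carrier K" "\<one> \<oplus> \<one> \<noteq> \<zero> \<Longrightarrow> half \<noteq> \<zero>"
  using field_Units Units_inv_closed[of "\<one> \<oplus> \<one>"] Units_r_inv[of "\<one> \<oplus> \<one>"] by auto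

lemma na_eval_jordan_plus:
  fixes B :: "('k, 'b) module"
  assumes B: "assoc_algebra K B" and c: "\<one> \<oplus> \<one> \<noteq> \<zero>" and \<sigma>: "\<And>i. \<sigma> i \<in> carrier B"
    and t: "scalars t \<subseteq> carrier K"
  shows "na_eval (jordan_plus K B) \<sigma> t = na_eval (twist half half B) \<sigma> t"
proof -
  interpret B: as_algebra K B by (rule as_algebra.intro) fact
  interpret T: na_algebra K "twist half half B"
    by (rule na_algebra.intro) (rule B.twist_algebra; rule half[OF c])
  have cl: "na_eval (twist half half B) \<sigma> t \<in> carrier B" if "scalars t \<subseteq> carrier K" for t
    using T.na_eval_closed[OF that, of \<sigma>] \<sigma> by simp
  show ?thesis
    using t by (induction t)
      (auto simp: jordan_plus_def cl B.smult_r_distr half c B.mult_closed)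
qed

lemma special_jordan_identities_iff:
  assumes c: "\<one> \<oplus> \<one> \<noteq> \<zero>"
  shows "t \<in> special_jordan_identities K \<longleftrightarrow>
    scalars t \<subseteq> carrier K \<and> (\<forall>w. cf K (word_poly K half half t) w = \<zero>)"
proof (intro iffI conjI allI)
  assume t: "t \<in> special_jordan_identities K"
  then show s: "scalars t \<subseteq> carrier K"
    by (simp add: special_jordan_identities_def)
  let ?F = "magma_algebra K (UNIV :: nat list set) (@)"
  let ?J = "jordan_plus K ?F"
  have F: "assoc_algebra K ?F"
    by (rule magma_assoc_algebra) auto
  interpret F: as_algebra K ?F
    by (rule as_algebra.intro) (rule F)
  have g: "cf K [(\<one>, [i])] \<in> carrier ?F" for i
    by (rule cf_in_magma) auto
  have sm: "submodule (carrier ?F) K ?J"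
  proof -
    have "add_monoid ?J = add_monoid ?F"
      by (simp add: jordan_plus_def)
    then show ?thesis
      using F.carrier_is_submodule
      by (simp add: submodule_def submodule_axioms_def jordan_plus_def)
  qed
  have "is_subalgebra K (carrier ?F) ?J"
    unfolding is_subalgebra_def using sm half(1)[OF c]
    by (auto simp: jordan_plus_def F.mult_closed)
  then have "special_jordan K ?J"
    unfolding special_jordan_def using F
    by (intro exI[of _ ?F] exI[of _ "carrier ?F"]) (simp add: jordan_plus_def)
  then have "satisfies_identity ?J t"
    using t by (simp add: special_jordan_identities_def)
  then have "na_eval ?J (\<lambda>i. cf K [(\<one>, [i])]) t = \<zero>\<^bsub>?J\<^esub>"
    unfolding satisfies_identity_def using g by (simp add: jordan_plus_def)
  then have "cf K (word_poly K half half t) = (\<lambda>_. \<zero>)"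
    using na_eval_jordan_plus[OF F c g s] na_eval_free[OF half(1)[OF c] half(1)[OF c] s]
    by (simp add: jordan_plus_def magma_algebra_simps)
  then show "cf K (word_poly K half half t) w = \<zero>" for w
    by simp
next
  assume t: "scalars t \<subseteq> carrier K \<and> (\<forall>w. cf K (word_poly K half half t) w = \<zero>)"
  have "satisfies_identity J t" if J: "special_jordan K J" for J :: "('k, nat list \<Rightarrow> 'k) module"
  proof -
    obtain B S where B: "assoc_algebra K B" and S: "is_subalgebra K S (jordan_plus K B)"
      and J: "J = (jordan_plus K B)\<lparr>carrier := S\<rparr>"
      using J unfolding special_jordan_def by blast
    interpret B: as_algebra K B by (rule as_algebra.intro) (rule B)
    have "S \<subseteq> carrier (jordan_plus K B)"
      using S subgroup.subset[OF submodule.axioms(1)] by (fastforce simp: is_subalgebra_def)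
    then have SB: "S \<subseteq> carrier B"
      by (simp add: jordan_plus_def)
    show ?thesis
      unfolding satisfies_identity_def J
    proof (intro allI impI)
      fix \<sigma> :: "nat \<Rightarrow> nat list \<Rightarrow> 'k"
      assume "\<forall>i. \<sigma> i \<in> carrier ((jordan_plus K B)\<lparr>carrier := S\<rparr>)"
      then have \<sigma>: "\<sigma> i \<in> carrier B" for i
        using SB by auto
      have "na_eval (jordan_plus K B) \<sigma> t = \<zero>\<^bsub>B\<^esub>"
        using na_eval_jordan_plus[OF B c \<sigma>] B.na_eval_twist_zero[OF half(1)[OF c] half(1)[OF c] \<sigma>] t by simp
      then show "na_eval ((jordan_plus K B)\<lparr>carrier := S\<rparr>) \<sigma> t = \<zero>\<^bsub>(jordan_plus K B)\<lparr>carrier := S\<rparr>\<^esub>"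
        by (simp add: jordan_plus_def)
    qed
  qed
  then show "t \<in> special_jordan_identities K"
    using t by (simp add: special_jordan_identities_def)
qed

end


section \<open>Lie algebras\<close>

context kfield
begin

abbreviation "lie_word_poly l \<equiv> lbind K l (words K \<one> (\<ominus> \<one>))"

lemma lie_identities_words:
  assumes "t \<in> lie_identities"
  shows "scalars t \<subseteq> carrier K \<and> (\<forall>w. cf K (word_poly K \<one> (\<ominus> \<one>) t) w = \<zero>)"
proof -
  let ?q = "Mult (Var 0) (Var 0)"
  let ?j = "Add (Mult (Var 0) (Mult (Var 1) (Var 2)))
        (Add (Mult (Var 1) (Mult (Var 2) (Var 0))) (Mult (Var 2) (Mult (Var 0) (Var 1))))"
  have mm: "\<ominus> \<one> \<otimes> \<ominus> \<one> = \<one>"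
    by (simp add: l_minus)
  have q: "word_poly K \<one> (\<ominus> \<one>) ?q = [(\<one>, [0, 0]), (\<ominus> \<one>, [0, 0])]"
    by (simp add: word_poly_def)
  have j: "word_poly K \<one> (\<ominus> \<one>) ?j =
    [(\<one>, [0, 1, 2]), (\<ominus> \<one>, [0, 2, 1]), (\<ominus> \<one>, [1, 2, 0]), (\<one>, [2, 1, 0]),
     (\<one>, [1, 2, 0]), (\<ominus> \<one>, [1, 0, 2]), (\<ominus> \<one>, [2, 0, 1]), (\<one>, [0, 2, 1]),
     (\<one>, [2, 0, 1]), (\<ominus> \<one>, [2, 1, 0]), (\<ominus> \<one>, [0, 1, 2]), (\<one>, [1, 0, 2])]"
    by (simp add: word_poly_def mm)
  have "cf K (word_poly K \<one> (\<ominus> \<one>) ?q) w = \<zero>" for w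
    unfolding q by (cases "w = [0, 0]") (auto simp: cf_Cons r_neg)
  moreover have "cf K (word_poly K \<one> (\<ominus> \<one>) ?j) w = \<zero>" for w
  proof -
    consider "w = [0, 1, 2]" | "w = [0, 2, 1]" | "w = [1, 2, 0]" | "w = [2, 1, 0]" | "w = [1, 0, 2]" | "w = [2, 0, 1]"
      | "w \<notin> {[0, 1, 2], [0, 2, 1], [1, 2, 0], [2, 1, 0], [1, 0, 2], [2, 0, 1]}"
      by blast
    then show ?thesis
      unfolding j by cases (simp_all add: cf_Cons r_neg l_neg eq_commute[of _ w])
  qed
  ultimately show ?thesis
    using assms unfolding lie_identities_def by auto
qed

end

locale lie_algebra = na_algebra +
  assumes square: "x \<in> carrier A \<Longrightarrow> x \<otimes>\<^bsub>A\<^esub> x = \<zero>\<^bsub>A\<^esub>"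
    and jacobi: "\<lbrakk>x \<in> carrier A; y \<in> carrier A; z \<in> carrier A\<rbrakk> \<Longrightarrow>
      x \<otimes>\<^bsub>A\<^esub> (y \<otimes>\<^bsub>A\<^esub> z) \<oplus>\<^bsub>A\<^esub> (y \<otimes>\<^bsub>A\<^esub> (z \<otimes>\<^bsub>A\<^esub> x) \<oplus>\<^bsub>A\<^esub> z \<otimes>\<^bsub>A\<^esub> (x \<otimes>\<^bsub>A\<^esub> y)) = \<zero>\<^bsub>A\<^esub>"

lemma lie_algebraI:
  fixes K :: "'k ring" and A :: "('k, 'a) module"
  shows "in_variety K lie_identities A \<Longrightarrow> lie_algebra K A"
  unfolding in_lie_variety_iff
  by (intro lie_algebra.intro lie_algebra_axioms.intro na_algebra.intro) auto

context lie_algebra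
begin

lemma anticommute: "x \<in> carrier A \<Longrightarrow> y \<in> carrier A \<Longrightarrow> y \<otimes>\<^bsub>A\<^esub> x = \<ominus>\<^bsub>A\<^esub> (x \<otimes>\<^bsub>A\<^esub> y)"
proof -
  assume xy: "x \<in> carrier A" "y \<in> carrier A"
  then have "(x \<oplus>\<^bsub>A\<^esub> y) \<otimes>\<^bsub>A\<^esub> (x \<oplus>\<^bsub>A\<^esub> y) = y \<otimes>\<^bsub>A\<^esub> x \<oplus>\<^bsub>A\<^esub> x \<otimes>\<^bsub>A\<^esub> y"
    by (simp add: mult_l_distr mult_r_distr mult_closed square[of x] square[of y])
  then have "y \<otimes>\<^bsub>A\<^esub> x \<oplus>\<^bsub>A\<^esub> x \<otimes>\<^bsub>A\<^esub> y = \<zero>\<^bsub>A\<^esub>"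
    using xy square[of "x \<oplus>\<^bsub>A\<^esub> y"] by simp
  then show ?thesis
    using xy by (intro M.minus_equality[symmetric]) (auto simp: mult_closed)
qed

lemma mult_uminus_r: "x \<in> carrier A \<Longrightarrow> y \<in> carrier A \<Longrightarrow> x \<otimes>\<^bsub>A\<^esub> (\<ominus>\<^bsub>A\<^esub> y) = \<ominus>\<^bsub>A\<^esub> (x \<otimes>\<^bsub>A\<^esub> y)"
  using smult_mult_r[of "\<ominus> \<one>" x y] by (simp add: smult_l_minus mult_closed)

lemma leibniz:
  assumes "x \<in> carrier A" "y \<in> carrier A" "z \<in> carrier A"
  shows "x \<otimes>\<^bsub>A\<^esub> (y \<otimes>\<^bsub>A\<^esub> z) = (x \<otimes>\<^bsub>A\<^esub> y) \<otimes>\<^bsub>A\<^esub> z \<oplus>\<^bsub>A\<^esub> y \<otimes>\<^bsub>A\<^esub> (x \<otimes>\<^bsub>A\<^esub> z)"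
proof -
  note cl = assms mult_closed
  have 1: "y \<otimes>\<^bsub>A\<^esub> (z \<otimes>\<^bsub>A\<^esub> x) = \<ominus>\<^bsub>A\<^esub> (y \<otimes>\<^bsub>A\<^esub> (x \<otimes>\<^bsub>A\<^esub> z))"
    using cl by (simp add: anticommute[of x z] mult_uminus_r)
  have 2: "z \<otimes>\<^bsub>A\<^esub> (x \<otimes>\<^bsub>A\<^esub> y) = \<ominus>\<^bsub>A\<^esub> ((x \<otimes>\<^bsub>A\<^esub> y) \<otimes>\<^bsub>A\<^esub> z)"
    using cl by (simp add: anticommute[of "x \<otimes>\<^bsub>A\<^esub> y" z])
  have "x \<otimes>\<^bsub>A\<^esub> (y \<otimes>\<^bsub>A\<^esub> z) \<oplus>\<^bsub>A\<^esub> \<ominus>\<^bsub>A\<^esub> ((x \<otimes>\<^bsub>A\<^esub> y) \<otimes>\<^bsub>A\<^esub> z \<oplus>\<^bsub>A\<^esub> y \<otimes>\<^bsub>A\<^esub> (x \<otimes>\<^bsub>A\<^esub> z)) = \<zero>\<^bsub>A\<^esub>"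
    using jacobi[OF assms] cl by (simp add: 1 2 M.minus_add M.a_comm)
  then show ?thesis
    using cl M.minus_equality[of "x \<otimes>\<^bsub>A\<^esub> (y \<otimes>\<^bsub>A\<^esub> z)"
        "\<ominus>\<^bsub>A\<^esub> ((x \<otimes>\<^bsub>A\<^esub> y) \<otimes>\<^bsub>A\<^esub> z \<oplus>\<^bsub>A\<^esub> y \<otimes>\<^bsub>A\<^esub> (x \<otimes>\<^bsub>A\<^esub> z))"] by simp
qed

end

text \<open>Lazard elimination of a letter \<open>x\<close>: the Lie polynomials in all letters are the multiples of \<open>x\<close>
  plus the Lie polynomials in new letters, where \<open>prod_encode (i, s)\<close> stands for \<open>ad(x)\<^sup>i s\<close> with \<open>s \<noteq> x\<close>.
  Bracketing with \<open>x\<close> becomes the derivation that increments \<open>i\<close>.\<close>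

definition incr :: "nat \<Rightarrow> nat" where
  "incr y = (let (i, s) = prod_decode y in prod_encode (Suc i, s))"

primrec derivation :: "'k ring \<Rightarrow> tree \<Rightarrow> ('k \<times> tree) list" where
  "derivation K (Leaf y) = [(\<one>\<^bsub>K\<^esub>, Leaf (incr y))]"
| "derivation K (Node s t) = lprod K Node (derivation K s) [(\<one>\<^bsub>K\<^esub>, t)] @ lprod K Node [(\<one>\<^bsub>K\<^esub>, s)] (derivation K t)"

primrec elim :: "'k ring \<Rightarrow> nat \<Rightarrow> tree \<Rightarrow> ('k \<times> tree) list" where
  "elim K x (Leaf s) = (if s = x then [] else [(\<one>\<^bsub>K\<^esub>, Leaf (prod_encode (0, s)))])"
| "elim K x (Node s t) = lprod K Node (elim K x s) (elim K x t) @
     (if s = Leaf x then lbind K (elim K x t) (derivation K) else []) @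
     (if t = Leaf x then scl K (\<ominus>\<^bsub>K\<^esub> \<one>\<^bsub>K\<^esub>) (lbind K (elim K x s) (derivation K)) else [])"

context kfield
begin

lemma derivation_set: "set (derivation K t) \<subseteq> carrier K \<times> {t'. size (leaves t') = size (leaves t)}"
proof (induction t)
  case (Node s t)
  have "set (lprod K Node (derivation K s) [(\<one>, t)]) \<subseteq> carrier K \<times> {t'. size (leaves t') = size (leaves (Node s t))}"
    by (rule lprod_set[OF Node.IH(1), where Y = "{t}"]) auto
  moreover have "set (lprod K Node [(\<one>, s)] (derivation K t)) \<subseteq> carrier K \<times> {t'. size (leaves t') = size (leaves (Node s t))}"
    by (rule lprod_set[OF _ Node.IH(2), where X = "{s}"]) auto
  ultimately show ?case
    by simp
qed simp

lemma lbind_derive_set: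
  assumes "set l \<subseteq> carrier K \<times> {t'. size (leaves t') = n}"
  shows "set (lbind K l (derivation K)) \<subseteq> carrier K \<times> {t'. size (leaves t') = n}"
  by (rule lbind_set[OF assms]) (use derivation_set in auto)

lemma elim_set:
  "set (elim K x t) \<subseteq> carrier K \<times> {t'. size (leaves t') = size (filter_mset (\<lambda>y. y \<noteq> x) (leaves t))}"
proof (induction t)
  case (Node s t)
  let ?X = "{t'. size (leaves t') = size (filter_mset (\<lambda>y. y \<noteq> x) (leaves (Node s t)))}"
  have "set (lprod K Node (elim K x s) (elim K x t)) \<subseteq> carrier K \<times> ?X"
    by (rule lprod_set[OF Node.IH]) auto
  moreover have "set (lbind K (elim K x t) (derivation K)) \<subseteq> carrier K \<times> ?X" if "s = Leaf x"
    using lbind_derive_set[OF Node.IH(2)] that by simp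
  moreover have "set (scl K (\<ominus> \<one>) (lbind K (elim K x s) (derivation K))) \<subseteq> carrier K \<times> ?X" if "t = Leaf x"
    using lbind_derive_set[OF Node.IH(1)] that by (intro scl_set) auto
  ultimately show ?case
    by auto
qed simp

end

context lie_algebra
begin

lemma derivation_eval:
  assumes x: "x \<in> carrier A" and \<tau>: "\<And>y. \<tau> y \<in> carrier A" "\<And>y. \<tau> (incr y) = x \<otimes>\<^bsub>A\<^esub> \<tau> y"
  shows "lcomb A (tree_eval A \<tau>) (derivation K t) = x \<otimes>\<^bsub>A\<^esub> tree_eval A \<tau> t"
proof (induction t)
  case (Leaf y)
  then show ?case
    using x \<tau> by (simp add: mult_closed)
next
  case (Node s t)
  interpret kfield K by (rule kfield.intro) (rule field_axioms)
  let ?e = "tree_eval A \<tau>"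
  have e: "?e t \<in> carrier A" for t
    by (rule tree_eval_closed) (rule \<tau>)
  have d: "set (derivation K t) \<subseteq> carrier K \<times> UNIV" for t
    using derivation_set[of t] by auto
  have 1: "lcomb A ?e (lprod K Node (derivation K s) [(\<one>, t)]) = lcomb A ?e (derivation K s) \<otimes>\<^bsub>A\<^esub> lcomb A ?e [(\<one>, t)]"
    by (rule lcomb_lprod[OF d, where Y = UNIV]) (use e in auto)
  have 2: "lcomb A ?e (lprod K Node [(\<one>, s)] (derivation K t)) = lcomb A ?e [(\<one>, s)] \<otimes>\<^bsub>A\<^esub> lcomb A ?e (derivation K t)"
    by (rule lcomb_lprod[OF _ d, where X = UNIV]) (use e in auto)
  have "lcomb A ?e (derivation K (Node s t)) =
      lcomb A ?e (lprod K Node (derivation K s) [(\<one>, t)]) \<oplus>\<^bsub>A\<^esub> lcomb A ?e (lprod K Node [(\<one>, s)] (derivation K t))"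
    unfolding derivation.simps
  proof (rule lcomb_append[where X = UNIV])
    show "set (lprod K Node (derivation K s) [(\<one>, t)]) \<subseteq> carrier K \<times> UNIV"
      by (rule lprod_set[OF d, where Y = UNIV]) auto
    show "set (lprod K Node [(\<one>, s)] (derivation K t)) \<subseteq> carrier K \<times> UNIV"
      by (rule lprod_set[OF _ d, where X = UNIV]) auto
  qed (rule e)
  then show ?case
    using Node x e by (simp add: 1 2 leibniz[OF x e e] del: lprod_Cons)
qed

lemma elim_eval:
  assumes x: "\<sigma> x \<in> carrier A" and \<tau>: "\<And>y. \<tau> y \<in> carrier A" "\<And>y. \<tau> (incr y) = \<sigma> x \<otimes>\<^bsub>A\<^esub> \<tau> y"
    and \<sigma>: "\<And>s. s \<noteq> x \<Longrightarrow> \<sigma> s = \<tau> (prod_encode (0, s))"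
  shows "tree_eval A \<sigma> t =
    (if t = Leaf x then \<one> else \<zero>) \<odot>\<^bsub>A\<^esub> \<sigma> x \<oplus>\<^bsub>A\<^esub> lcomb A (tree_eval A \<tau>) (elim K x t)"
proof (induction t)
  case (Leaf s)
  then show ?case
    using x \<tau> \<sigma> by auto
next
  case (Node s t)
  interpret kfield K by (rule kfield.intro) (rule field_axioms)
  let ?e = "tree_eval A \<tau>"
  have e: "?e t \<in> carrier A" for t
    by (rule tree_eval_closed) (rule \<tau>)
  have d: "set (elim K x t) \<subseteq> carrier K \<times> UNIV" for t
    using elim_set[of x t] by auto
  have dd: "set (derivation K t) \<subseteq> carrier K \<times> UNIV" for t
    using derivation_set[of t] by auto
  have ld: "set (lbind K (elim K x t) (derivation K)) \<subseteq> carrier K \<times> UNIV" for t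
    by (rule lbind_set[OF d dd])
  define u where "u = lcomb A ?e (elim K x s)"
  define v where "v = lcomb A ?e (elim K x t)"
  have uv: "u \<in> carrier A" "v \<in> carrier A"
    unfolding u_def v_def using e by (auto intro!: lcomb_closed[OF d])
  have D: "lcomb A ?e (lbind K (elim K x t) (derivation K)) = \<sigma> x \<otimes>\<^bsub>A\<^esub> lcomb A ?e (elim K x t)" for t
  proof -
    have "lcomb A ?e (lbind K (elim K x t) (derivation K)) = lcomb A (\<lambda>t. lcomb A ?e (derivation K t)) (elim K x t)"
      by (rule lcomb_lbind[OF d dd]) (rule e)
    also have "\<dots> = lcomb A (\<lambda>t. \<sigma> x \<otimes>\<^bsub>A\<^esub> ?e t) (elim K x t)"
      using derivation_eval[where x = "\<sigma> x" and \<tau> = \<tau>, OF x \<tau>] by simp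
    also have "\<dots> = \<sigma> x \<otimes>\<^bsub>A\<^esub> lcomb A ?e (elim K x t)"
      by (rule lcomb_hom[OF module_axioms d e, symmetric])
        (use x in \<open>auto simp: mult_r_zero mult_r_distr smult_mult_r\<close>)
    finally show ?thesis .
  qed
  have 1: "lcomb A ?e (lprod K Node (elim K x s) (elim K x t)) = u \<otimes>\<^bsub>A\<^esub> v"
    unfolding u_def v_def by (rule lcomb_lprod[OF d d]) (use e in auto)
  let ?b = "if s = Leaf x then lbind K (elim K x t) (derivation K) else []"
  let ?c = "if t = Leaf x then scl K (\<ominus> \<one>) (lbind K (elim K x s) (derivation K)) else []"
  have sets: "set (lprod K Node (elim K x s) (elim K x t)) \<subseteq> carrier K \<times> UNIV"
    "set ?b \<subseteq> carrier K \<times> UNIV" "set ?c \<subseteq> carrier K \<times> UNIV"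
  proof -
    have "\<ominus> \<one> \<in> carrier K"
      by simp
    then show "set ?c \<subseteq> carrier K \<times> UNIV"
      using scl_set[OF _ ld] by (cases "t = Leaf x") (simp_all only: if_True if_False simp_thms list.set empty_subsetI)
    show "set ?b \<subseteq> carrier K \<times> UNIV"
      using ld by (cases "s = Leaf x") (simp_all only: if_True if_False simp_thms list.set empty_subsetI)
    show "set (lprod K Node (elim K x s) (elim K x t)) \<subseteq> carrier K \<times> UNIV"
      by (rule lprod_set[OF d d]) simp
  qed
  have 2: "lcomb A ?e ?b = (if s = Leaf x then \<sigma> x \<otimes>\<^bsub>A\<^esub> v else \<zero>\<^bsub>A\<^esub>)"
    by (simp add: D v_def)
  have 3: "lcomb A ?e ?c = (if t = Leaf x then u \<otimes>\<^bsub>A\<^esub> \<sigma> x else \<zero>\<^bsub>A\<^esub>)"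
  proof -
    have "lcomb A ?e (scl K (\<ominus> \<one>) (lbind K (elim K x s) (derivation K))) =
      \<ominus> \<one> \<odot>\<^bsub>A\<^esub> lcomb A ?e (lbind K (elim K x s) (derivation K))"
      by (rule lcomb_scl[OF _ ld]) (use e in auto)
    also have "\<dots> = u \<otimes>\<^bsub>A\<^esub> \<sigma> x"
      using uv x by (simp add: D smult_l_minus mult_closed anticommute[of "\<sigma> x" u] flip: u_def)
    finally show ?thesis
      by simp
  qed
  have "set (?b @ ?c) \<subseteq> carrier K \<times> UNIV"
    using sets by auto
  then have E: "lcomb A ?e (elim K x (Node s t)) = u \<otimes>\<^bsub>A\<^esub> v \<oplus>\<^bsub>A\<^esub>
     ((if s = Leaf x then \<sigma> x \<otimes>\<^bsub>A\<^esub> v else \<zero>\<^bsub>A\<^esub>) \<oplus>\<^bsub>A\<^esub> (if t = Leaf x then u \<otimes>\<^bsub>A\<^esub> \<sigma> x else \<zero>\<^bsub>A\<^esub>))"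
    unfolding elim.simps
    using lcomb_append[OF sets(1), of "?b @ ?c" ?e] lcomb_append[OF sets(2,3), of ?e] e 1 2 3 by simp
  have u0: "s = Leaf x \<Longrightarrow> u = \<zero>\<^bsub>A\<^esub>" and v0: "t = Leaf x \<Longrightarrow> v = \<zero>\<^bsub>A\<^esub>"
    by (simp_all add: u_def v_def)
  have IH: "tree_eval A \<sigma> s = (if s = Leaf x then \<one> else \<zero>) \<odot>\<^bsub>A\<^esub> \<sigma> x \<oplus>\<^bsub>A\<^esub> u"
    "tree_eval A \<sigma> t = (if t = Leaf x then \<one> else \<zero>) \<odot>\<^bsub>A\<^esub> \<sigma> x \<oplus>\<^bsub>A\<^esub> v"
    using Node by (simp_all add: u_def v_def)
  show ?case
    unfolding E using uv x u0 v0
    by (cases "s = Leaf x"; cases "t = Leaf x")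
      (simp_all add: IH square mult_l_zero mult_r_zero mult_closed)
qed

end

text \<open>The test algebra for the elimination: functions on words in the new letters, on which a new
  letter acts by the left quotient and \<open>x\<close> by the transpose of the derivation.\<close>

primrec incr_sum :: "'k ring \<Rightarrow> nat list \<Rightarrow> (nat list \<Rightarrow> 'k) \<Rightarrow> 'k" where
  "incr_sum K [] g = \<zero>\<^bsub>K\<^esub>"
| "incr_sum K (y # v) g = g (incr y # v) \<oplus>\<^bsub>K\<^esub> incr_sum K v (\<lambda>u. g (y # u))"

definition left_quotient :: "('x list \<Rightarrow> 'f) set \<Rightarrow> 'x \<Rightarrow> ('x list \<Rightarrow> 'f) \<Rightarrow> 'x list \<Rightarrow> 'f" where
  "left_quotient S y = (\<lambda>g\<in>S. \<lambda>v. g (y # v))"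

context kfield
begin

abbreviation "FS \<equiv> {g :: nat list \<Rightarrow> 'k. \<forall>w. g w \<in> carrier K}"

lemma function_space_all: "function_space K K (\<lambda>c. c) FS"
  by unfold_locales (auto simp: ring_hom_def)

interpretation FS: function_space K K "\<lambda>c. c" FS
  by (rule function_space_all)

(* For the identity these rules have their conclusions as premises. *)
declare FS.\<phi>_simps [simp del] FS.\<phi>_minus [simp del]

lemma incr_sum_closed: "g \<in> FS \<Longrightarrow> incr_sum K v g \<in> carrier K"
  by (induction v arbitrary: g) auto

lemma incr_sum_linear:
  "g \<in> FS \<Longrightarrow> h \<in> FS \<Longrightarrow> incr_sum K v (\<lambda>x. g x \<oplus> h x) = incr_sum K v g \<oplus> incr_sum K v h"
  "c \<in> carrier K \<Longrightarrow> g \<in> FS \<Longrightarrow> incr_sum K v (\<lambda>x. c \<otimes> g x) = c \<otimes> incr_sum K v g"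
proof (induction v arbitrary: g h)
  case (Cons y v)
  {
    case 1
    then show ?case
      using Cons(1)[of "\<lambda>u. g (y # u)" "\<lambda>u. h (y # u)"] incr_sum_closed[of "\<lambda>u. g (y # u)" v]
        incr_sum_closed[of "\<lambda>u. h (y # u)" v] by (simp add: a_ac)
  next
    case 2
    then show ?case
      using Cons(2)[of "\<lambda>u. g (y # u)"] incr_sum_closed[of "\<lambda>u. g (y # u)" v] by (simp add: r_distr)
  }
qed auto

abbreviation "D \<equiv> (\<lambda>g\<in>FS. \<lambda>v. incr_sum K v g)"

lemma D_closed: "D \<in> carrier FS.E"
  using incr_sum_closed by (auto simp: FS.operators_simps incr_sum_linear)

lemma Q_closed: "left_quotient FS y \<in> carrier FS.E"
  by (auto simp: FS.operators_simps left_quotient_def)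

lemma word_eval_Q:
  "w \<noteq> [] \<Longrightarrow> g \<in> FS \<Longrightarrow> word_eval FS.E (left_quotient FS) w g = (\<lambda>v. g (w @ v))"
  by (induction w arbitrary: g rule: induct_list012) (auto simp: FS.operators_simps(2) left_quotient_def)

abbreviation "TE \<equiv> twist \<one> (\<ominus> \<one>) FS.E"

lemma TE_lie: "lie_algebra K TE"
proof (rule lie_algebraI)
  have ops: "assoc_algebra K FS.E"
    by (rule FS.operators_algebra)
  have c: "\<one> \<in> carrier K" "\<ominus> \<one> \<in> carrier K"
    by (rule one_closed, rule a_inv_closed, rule one_closed)
  show "in_variety K lie_identities TE"
    by (rule in_variety_twist[OF ops c lie_identities_words])
qed

lemma commutator_D_Q: "D \<otimes>\<^bsub>TE\<^esub> left_quotient FS y = left_quotient FS (incr y)"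
proof (rule FS.operator_eqI)
  fix g :: "nat list \<Rightarrow> 'k" and v assume g: "g \<in> FS"
  have g': "(\<lambda>v. incr_sum K v g) \<in> FS" "(\<lambda>v. g (y # v)) \<in> FS"
    using g incr_sum_closed by auto
  have "(D \<otimes>\<^bsub>TE\<^esub> left_quotient FS y) g v =
      \<one> \<otimes> incr_sum K (y # v) g \<oplus> \<ominus> \<one> \<otimes> incr_sum K v (\<lambda>u. g (y # u))"
    using g g' by (simp add: FS.operators_simps(2-) left_quotient_def)
  also have "\<dots> = left_quotient FS (incr y) g v"
    using g incr_sum_closed[OF g'(2), of v] by (simp add: l_minus a_assoc r_neg left_quotient_def)
  finally show "(D \<otimes>\<^bsub>TE\<^esub> left_quotient FS y) g v = left_quotient FS (incr y) g v" .
qed (auto simp: FS.operators_simps(2-) left_quotient_def)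

lemma filter_words:
  assumes l: "set l \<subseteq> carrier K \<times> UNIV"
  shows "cf K (lie_word_poly (filter (\<lambda>p. P (leaves (snd p))) l)) w = (if P (mset w) then cf K (lie_word_poly l) w else \<zero>)"
  using l
proof (induction l)
  case (Cons p l)
  obtain c t where p: "p = (c, t)" by force
  have l: "set l \<subseteq> carrier K \<times> UNIV" and c: "c \<in> carrier K"
    using Cons.prems by (auto simp: p)
  have W: "set (words K \<one> (\<ominus> \<one>) t) \<subseteq> carrier K \<times> {w. mset w = leaves t}" for t
    by (rule words_set) auto
  have W': "set (words K \<one> (\<ominus> \<one>) t) \<subseteq> carrier K \<times> UNIV" for t
    using W[of t] by auto
  have S: "set (scl K c (words K \<one> (\<ominus> \<one>) t)) \<subseteq> carrier K \<times> UNIV"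
    by (rule scl_set[OF c W'])
  have B: "set (lie_word_poly l) \<subseteq> carrier K \<times> UNIV" if "set l \<subseteq> carrier K \<times> UNIV" for l
    by (rule lbind_set[OF that W'])
  have z: "cf K (words K \<one> (\<ominus> \<one>) t) w = \<zero>" if "mset w \<noteq> leaves t"
    unfolding cf_def by (rule lsum_zero) (use W[of t] that in auto)
  have fl: "set (filter Q l) \<subseteq> carrier K \<times> UNIV" for Q
    using l by auto
  have cl: "cf K (lie_word_poly l) w \<in> carrier K" "cf K (words K \<one> (\<ominus> \<one>) t) w \<in> carrier K"
    using cf_closed[OF B[OF l]] cf_closed[OF W'] by auto
  have "cf K (lie_word_poly (p # l)) w = c \<otimes> cf K (words K \<one> (\<ominus> \<one>) t) w \<oplus> cf K (lie_word_poly l) w"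
    using cf_append[OF S B[OF l], where w = w] cf_scl[OF c W'] by (simp add: p)
  moreover have "cf K (lie_word_poly (p # filter Q l)) w =
      c \<otimes> cf K (words K \<one> (\<ominus> \<one>) t) w \<oplus> cf K (lie_word_poly (filter Q l)) w" for Q
    using cf_append[OF S B[OF fl], where w = w] cf_scl[OF c W'] by (simp add: p)
  ultimately show ?case
    using Cons.IH[OF l] z cl c by (cases "mset w = leaves t") (auto simp: p)
qed simp

text \<open>The associative algebra decides whether a Lie polynomial vanishes in all Lie algebras. Polynomials
  are split by their multisets of letters; eliminating a letter that occurs decreases the number of leaves.\<close>

theorem lie_tree_zero:
  fixes B :: "('k, 'b) module"
  assumes B: "lie_algebra K B"
  shows "set l \<subseteq> carrier K \<times> {t. size (leaves t) \<le> n} \<Longrightarrow> (\<And>w. cf K (lie_word_poly l) w = \<zero>) \<Longrightarrow>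
    (\<And>i. \<sigma> i \<in> carrier B) \<Longrightarrow> lcomb B (tree_eval B \<sigma>) l = \<zero>\<^bsub>B\<^esub>"
proof (induction n arbitrary: l \<sigma>)
  case 0
  have "l = []"
  proof (rule ccontr)
    assume "l \<noteq> []"
    then obtain c t where "(c, t) \<in> set l"
      by (cases l) auto
    then show False
      using 0(1) leaves_nonempty[of t] by auto
  qed
  then show ?case by simp
next
  case (Suc n)
  interpret B: lie_algebra K B by (rule B)
  interpret TE: lie_algebra K TE by (rule TE_lie)
  from Suc.prems show ?case
  proof (induction "length l" arbitrary: l rule: less_induct)
    case less
    show ?case
    proof (cases l)
      case (Cons p l0)
      let ?\<mu> = "leaves (snd p)"
      let ?P = "\<lambda>q. leaves (snd q) = ?\<mu>"
      define l1 where "l1 = filter ?P l"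
      define l2 where "l2 = filter (\<lambda>q. \<not> ?P q) l"
      have lU: "set l \<subseteq> carrier K \<times> UNIV"
        using less.prems(1) by auto
      have l1: "set l1 \<subseteq> carrier K \<times> {t. leaves t = ?\<mu>}" and l2: "set l2 \<subseteq> carrier K \<times> {t. size (leaves t) \<le> Suc n}"
        using less.prems(1) by (auto simp: l1_def l2_def)
      have l1U: "set l1 \<subseteq> carrier K \<times> UNIV"
        using l1 by auto
      have H1: "cf K (lie_word_poly l1) w = \<zero>" for w
        unfolding l1_def using filter_words[OF lU, of "\<lambda>m. m = ?\<mu>"] less.prems(2) by simp
      have H2: "cf K (lie_word_poly l2) w = \<zero>" for w
        unfolding l2_def using filter_words[OF lU, of "\<lambda>m. m \<noteq> ?\<mu>"] less.prems(2) by simp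
      have te: "tree_eval B \<sigma> t \<in> carrier B" for t
        by (rule B.tree_eval_closed) (rule less.prems(3))
      have "lcomb B (tree_eval B \<sigma>) l = lcomb B (tree_eval B \<sigma>) l1 \<oplus>\<^bsub>B\<^esub> lcomb B (tree_eval B \<sigma>) l2"
        unfolding lcomb_def l1_def l2_def by (rule B.M.lsum_split) (use lU te in auto)
      also have "lcomb B (tree_eval B \<sigma>) l2 = \<zero>\<^bsub>B\<^esub>"
      proof (rule less.hyps[OF _ l2 H2 less.prems(3)])
        show "length l2 < length l"
          unfolding l2_def by (simp add: Cons le_imp_less_Suc)
      qed
      also have "lcomb B (tree_eval B \<sigma>) l1 = \<zero>\<^bsub>B\<^esub>"
      proof -
        obtain x where x: "x \<in># ?\<mu>"
          using leaves_nonempty[of "snd p"] by auto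
        have pl: "size ?\<mu> \<le> Suc n"
          using less.prems(1) Cons by auto
        have "filter_mset (\<lambda>y. y \<noteq> x) ?\<mu> \<subset># ?\<mu>"
          using x by (simp add: multiset_filter_subset subset_mset_def filter_mset_eq_conv) 
        then have sz: "size (filter_mset (\<lambda>y. y \<noteq> x) ?\<mu>) \<le> n"
          using mset_subset_size[of "filter_mset (\<lambda>y. y \<noteq> x) ?\<mu>" ?\<mu>] pl by simp
        define l' where "l' = lbind K l1 (elim K x)"
        have eU: "set (elim K x t) \<subseteq> carrier K \<times> UNIV" for t
          using elim_set[of x t] by auto
        have l': "set l' \<subseteq> carrier K \<times> {t. size (leaves t) \<le> n}"
          unfolding l'_def
        proof (rule lbind_set[OF l1])
          fix t assume "t \<in> {t. leaves t = ?\<mu>}"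
          then show "set (elim K x t) \<subseteq> carrier K \<times> {t. size (leaves t) \<le> n}"
            using elim_set[of x t] sz by auto
        qed
        have l'U: "set l' \<subseteq> carrier K \<times> UNIV"
          using l' by auto
        define k where "k = lcomb (self_mod K) (\<lambda>t. if t = Leaf x then \<one> else \<zero>) l1"
        have k: "k \<in> carrier K"
          unfolding k_def using module.lcomb_closed[OF self_module l1U] by simp
        have el: "lcomb C (tree_eval C \<upsilon>) l1 = k \<odot>\<^bsub>C\<^esub> \<upsilon> x \<oplus>\<^bsub>C\<^esub> lcomb C (tree_eval C \<tau>) l'"
          if C: "lie_algebra K C" and \<upsilon>: "\<upsilon> x \<in> carrier C" "\<And>s. s \<noteq> x \<Longrightarrow> \<upsilon> s = \<tau> (prod_encode (0, s))"
            and \<tau>: "\<And>y. \<tau> y \<in> carrier C" "\<And>y. \<tau> (incr y) = \<upsilon> x \<otimes>\<^bsub>C\<^esub> \<tau> y"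
          for C :: "('k, 'c) module" and \<upsilon> \<tau>
        proof -
          interpret C: lie_algebra K C by (rule C)
          have c: "tree_eval C \<tau> t \<in> carrier C" for t
            by (rule C.tree_eval_closed) (rule \<tau>)
          have "lcomb C (tree_eval C \<upsilon>) l1 = lcomb C (\<lambda>t. (if t = Leaf x then \<one> else \<zero>) \<odot>\<^bsub>C\<^esub> \<upsilon> x \<oplus>\<^bsub>C\<^esub>
              lcomb C (tree_eval C \<tau>) (elim K x t)) l1"
            by (rule lcomb_cong) (rule C.elim_eval[OF \<upsilon>(1) \<tau> \<upsilon>(2)])
          also have "\<dots> = lcomb C (\<lambda>t. (if t = Leaf x then \<one> else \<zero>) \<odot>\<^bsub>C\<^esub> \<upsilon> x) l1 \<oplus>\<^bsub>C\<^esub>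
              lcomb C (\<lambda>t. lcomb C (tree_eval C \<tau>) (elim K x t)) l1"
            by (rule C.lcomb_add_fun[OF l1U]) (use \<upsilon> C.lcomb_closed[OF eU] c in auto)
          also have "lcomb C (\<lambda>t. lcomb C (tree_eval C \<tau>) (elim K x t)) l1 = lcomb C (tree_eval C \<tau>) l'"
            unfolding l'_def by (rule C.lcomb_lbind[OF l1U eU c, symmetric])
          also have "lcomb C (\<lambda>t. (if t = Leaf x then \<one> else \<zero>) \<odot>\<^bsub>C\<^esub> \<upsilon> x) l1 = k \<odot>\<^bsub>C\<^esub> \<upsilon> x"
            unfolding k_def
            by (rule lcomb_hom[OF self_module l1U, symmetric])
              (use \<upsilon> in \<open>auto simp: C.smult_l_distr C.smult_assoc1\<close>)
          finally show ?thesis .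
        qed
        have wU: "set (words K \<one> (\<ominus> \<one>) t) \<subseteq> carrier K \<times> {w. w \<noteq> []}" for t
          by (rule words_set') auto
        have HE: "lcomb FS.E (tree_eval TE \<upsilon>) l1 = \<zero>\<^bsub>FS.E\<^esub>" if \<upsilon>: "\<And>i. \<upsilon> i \<in> carrier FS.E" for \<upsilon>
        proof -
          have "lcomb FS.E (tree_eval TE \<upsilon>) l1 = lcomb FS.E (word_eval FS.E \<upsilon>) (lie_word_poly l1)"
            by (rule FS.E.lcomb_tree_eval_twist) (use l1U \<upsilon> in auto)
          also have "\<dots> = \<zero>\<^bsub>FS.E\<^esub>"
            by (rule FS.E.lcomb_cf_zero[OF lbind_set[OF l1U wU]])
              (use H1 FS.E.word_eval_closed[OF \<upsilon>] in auto)
          finally show ?thesis .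
        qed
        define \<upsilon> where "\<upsilon> s = (if s = x then D else left_quotient FS (prod_encode (0, s)))" for s
        have \<upsilon>: "\<upsilon> s \<in> carrier FS.E" for s
          by (simp add: \<upsilon>_def D_closed Q_closed)
        have "lcomb TE (tree_eval TE \<upsilon>) l1 = k \<odot>\<^bsub>TE\<^esub> \<upsilon> x \<oplus>\<^bsub>TE\<^esub> lcomb TE (tree_eval TE (left_quotient FS)) l'"
          by (rule el[OF TE_lie]) (simp_all only: twist_simps(1) \<upsilon> Q_closed, simp_all only: \<upsilon>_def commutator_D_Q if_True if_False simp_thms)
        then have sum0: "k \<odot>\<^bsub>FS.E\<^esub> D \<oplus>\<^bsub>FS.E\<^esub> lcomb FS.E (tree_eval TE (left_quotient FS)) l' = \<zero>\<^bsub>FS.E\<^esub>"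
          using HE[OF \<upsilon>] by (simp only: lcomb_twist twist_simps \<upsilon>_def if_True simp_thms)
        have lie': "lcomb FS.E (tree_eval TE (left_quotient FS)) l' =
            lcomb FS.E (word_eval FS.E (left_quotient FS)) (lie_word_poly l')"
          by (rule FS.E.lcomb_tree_eval_twist) (use l'U Q_closed in auto)
        have LW: "set (lie_word_poly l') \<subseteq> carrier K \<times> {w. w \<noteq> []}"
          by (rule lbind_set[OF l'U wU])
        have ev: "lcomb FS.E (word_eval FS.E (left_quotient FS)) (lie_word_poly l') g v =
            lsum K (\<lambda>q. fst q \<otimes> g (snd q @ v)) (lie_word_poly l')" if g: "g \<in> FS" for g v
        proof -
          have "lcomb FS.E (word_eval FS.E (left_quotient FS)) (lie_word_poly l') g v =
            lsum K (\<lambda>q. fst q \<otimes> word_eval FS.E (left_quotient FS) (snd q) g v) (lie_word_poly l')"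
            by (rule FS.lcomb_operator[OF LW _ g])
              (rule FS.E.word_eval_closed, rule Q_closed)
          also have "\<dots> = lsum K (\<lambda>q. fst q \<otimes> g (snd q @ v)) (lie_word_poly l')"
            using LW by (intro lsum_cong) (auto simp: word_eval_Q[OF _ g])
          finally show ?thesis .
        qed
        have H': "cf K (lie_word_poly l') w = \<zero>" for w
        proof -
          let ?g = "\<lambda>u :: nat list. if u = w then \<one> else \<zero>"
          have g: "?g \<in> FS" by simp
          have "cf K (lie_word_poly l') w = lsum K (\<lambda>q. fst q \<otimes> ?g (snd q @ [])) (lie_word_poly l')"
            unfolding cf_def using LW by (intro lsum_cong) auto
          also have "\<dots> = \<zero>"
            using fun_cong[OF fun_cong[OF sum0, of ?g], of "[]"] ev[OF g, of "[]"] k g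
              lsum_closed[of "lie_word_poly l'" "\<lambda>q. fst q \<otimes> ?g (snd q @ [])"] LW
            by (force simp: FS.operators_simps(2-) lie' simp del: append_Nil2)
          finally show ?thesis .
        qed
        have "lcomb FS.E (tree_eval TE (left_quotient FS)) l' = \<zero>\<^bsub>FS.E\<^esub>"
          unfolding lie'
          by (rule FS.E.lcomb_cf_zero[OF LW])
            (use H' FS.E.word_eval_closed[of "left_quotient FS"] Q_closed in auto)
        then have "k \<odot>\<^bsub>FS.E\<^esub> D = \<zero>\<^bsub>FS.E\<^esub>"
          using sum0 FS.E.smult_closed[OF k D_closed] by simp
        from fun_cong[OF fun_cong[OF this, of "\<lambda>_. \<one>"], of "[0]"] have k0: "k = \<zero>"
          using k by (simp add: FS.operators_simps(2-))
        define \<tau> where "\<tau> y = ((\<lambda>b. \<sigma> x \<otimes>\<^bsub>B\<^esub> b) ^^ fst (prod_decode y)) (\<sigma> (snd (prod_decode y)))" for y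
        have \<tau>: "\<tau> y \<in> carrier B" for y
        proof -
          have "((\<lambda>b. \<sigma> x \<otimes>\<^bsub>B\<^esub> b) ^^ i) (\<sigma> s) \<in> carrier B" for i s
            by (induction i) (use less.prems(3) B.mult_closed in auto)
          then show ?thesis by (simp add: \<tau>_def)
        qed
        have "lcomb B (tree_eval B \<sigma>) l1 = k \<odot>\<^bsub>B\<^esub> \<sigma> x \<oplus>\<^bsub>B\<^esub> lcomb B (tree_eval B \<tau>) l'"
          by (rule el[OF B]) (use less.prems(3) \<tau> in \<open>auto simp: \<tau>_def incr_def Let_def case_prod_beta'\<close>)
        also have "lcomb B (tree_eval B \<tau>) l' = \<zero>\<^bsub>B\<^esub>"
          by (rule Suc.IH[OF l' H' \<tau>])
        finally show ?thesis
          using k0 less.prems(3) by simp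
      qed
      finally show ?thesis by simp
    qed simp
  qed
qed

theorem lie_identity:
  fixes B :: "('k, 'b) module"
  assumes B: "in_variety K lie_identities B" and t: "scalars t \<subseteq> carrier K"
    and z: "\<And>w. cf K (word_poly K \<one> (\<ominus> \<one>) t) w = \<zero>" and \<tau>: "\<And>i. \<tau> i \<in> carrier B"
  shows "na_eval B \<tau> t = \<zero>\<^bsub>B\<^esub>"
proof -
  interpret B: lie_algebra K B by (rule lie_algebraI[OF B])
  let ?n = "Max ((\<lambda>p. size (leaves (snd p))) ` set (monomials K t))"
  have "size (leaves (snd p)) \<le> ?n" if "p \<in> set (monomials K t)" for p
    using that by (intro Max_ge) auto
  then have "set (monomials K t) \<subseteq> carrier K \<times> {s. size (leaves s) \<le> ?n}"
    using monomials_set[OF t] by (force simp: subset_iff)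
  then show ?thesis
    unfolding B.na_eval_monomials[OF t \<tau>]
    by (rule lie_tree_zero[OF B.lie_algebra_axioms]) (use z \<tau> in \<open>auto simp: word_poly_def\<close>)
qed

end


section \<open>Homogeneous linear systems\<close>

text \<open>Fewer equations than unknowns; the proof uses one equation to eliminate one unknown.\<close>

lemma (in kfield) homogeneous_system:
  assumes "finite J" "distinct I" "card J < length I" "\<And>j i. j \<in> J \<Longrightarrow> i \<in> set I \<Longrightarrow> M j i \<in> carrier K"
  shows "\<exists>c. (\<forall>i. c i \<in> carrier K) \<and> (\<exists>i\<in>set I. c i \<noteq> \<zero>) \<and> (\<forall>j\<in>J. lsum K (\<lambda>i. c i \<otimes> M j i) I = \<zero>)"
  using assms
proof (induction J arbitrary: I M rule: finite_induct)
  case empty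
  then have "hd I \<in> set I"
    by (cases I) auto
  then show ?case
    by (intro exI[of _ "\<lambda>_. \<one>"]) auto
next
  case (insert j J)
  show ?case
  proof (cases "\<forall>i\<in>set I. M j i = \<zero>")
    case True
    obtain c where c: "\<forall>i. c i \<in> carrier K" "\<exists>i\<in>set I. c i \<noteq> \<zero>" "\<forall>j\<in>J. lsum K (\<lambda>i. c i \<otimes> M j i) I = \<zero>"
      using insert.IH[of I M] insert.prems insert.hyps by auto
    moreover have "lsum K (\<lambda>i. c i \<otimes> M j i) I = \<zero>"
      by (rule lsum_zero) (use True c in auto)
    ultimately show ?thesis
      by blast
  next
    case False
    then obtain i0 where i0: "i0 \<in> set I" "M j i0 \<noteq> \<zero>" by blast
    define d where "d = inv (M j i0)"
    have M: "M j' i \<in> carrier K" if "j' \<in> insert j J" "i \<in> set I" for j' i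
      using insert.prems(3) that by blast
    have Mj0: "M j i0 \<in> carrier K"
      using M i0 by blast
    have d: "d \<in> carrier K" "d \<otimes> M j i0 = \<one>"
      using i0 Mj0 field_Units by (auto simp: d_def)
    define I' where "I' = remove1 i0 I"
    have I': "distinct I'" "set I' = set I - {i0}" "card J < length I'"
      using insert.prems insert.hyps i0 by (auto simp: I'_def length_remove1)
    define M' where "M' = (\<lambda>j' i. M j' i \<ominus> M j i \<otimes> d \<otimes> M j' i0)"
    have M': "M' j' i \<in> carrier K" if "j' \<in> J" "i \<in> set I'" for j' i
      unfolding M'_def using M that I' i0 d by auto
    obtain c where c: "\<forall>i. c i \<in> carrier K" "\<exists>i\<in>set I'. c i \<noteq> \<zero>" "\<forall>j\<in>J. lsum K (\<lambda>i. c i \<otimes> M' j i) I' = \<zero>"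
      using insert.IH[OF I'(1,3), of M'] M' by blast
    define e where "e = lsum K (\<lambda>i. c i \<otimes> (M j i \<otimes> d)) I'"
    have e: "e \<in> carrier K"
      unfolding e_def using c M I' d by (intro lsum_closed) auto
    define c' where "c' = c(i0 := \<ominus> e)"
    have c': "\<forall>i. c' i \<in> carrier K"
      using c e by (auto simp: c'_def)
    have split: "lsum K (\<lambda>i. c' i \<otimes> M j' i) I = \<ominus> e \<otimes> M j' i0 \<oplus> lsum K (\<lambda>i. c i \<otimes> M j' i) I'"
      if "j' \<in> insert j J" for j'
    proof -
      have "lsum K (\<lambda>i. c' i \<otimes> M j' i) I = c' i0 \<otimes> M j' i0 \<oplus> lsum K (\<lambda>i. c' i \<otimes> M j' i) (remove1 i0 I)"
        by (rule lsum_remove1) (use c' M that i0 in auto)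
      also have "lsum K (\<lambda>i. c' i \<otimes> M j' i) (remove1 i0 I) = lsum K (\<lambda>i. c i \<otimes> M j' i) I'"
        unfolding I'_def[symmetric] by (rule lsum_cong) (use I' in \<open>auto simp: c'_def\<close>)
      finally show ?thesis
        by (simp add: c'_def)
    qed
    have "lsum K (\<lambda>i. c' i \<otimes> M j i) I = \<zero>"
    proof -
      have "e \<otimes> M j i0 = lsum K (\<lambda>i. c i \<otimes> (M j i \<otimes> d) \<otimes> M j i0) I'"
        unfolding e_def by (rule lsum_ldistr) (use Mj0 c M I' d in auto)
      also have "\<dots> = lsum K (\<lambda>i. c i \<otimes> M j i) I'"
        by (rule lsum_cong) (use Mj0 c M I' d in \<open>auto simp: m_assoc\<close>)
      finally have eq: "e \<otimes> M j i0 = lsum K (\<lambda>i. c i \<otimes> M j i) I'" .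
      show ?thesis
        using split[of j] e Mj0 by (simp add: l_minus l_neg eq[symmetric])
    qed
    moreover have "lsum K (\<lambda>i. c' i \<otimes> M j' i) I = \<zero>" if j': "j' \<in> J" for j'
    proof -
      have m: "M j' i0 \<in> carrier K"
        using M j' i0 by blast
      have eq: "e \<otimes> M j' i0 = lsum K (\<lambda>i. c i \<otimes> (M j i \<otimes> d) \<otimes> M j' i0) I'"
        unfolding e_def by (rule lsum_ldistr) (use m c M I' d in auto)
      have "lsum K (\<lambda>i. c i \<otimes> M j' i) I' =
          lsum K (\<lambda>i. c i \<otimes> M' j' i \<oplus> c i \<otimes> (M j i \<otimes> d) \<otimes> M j' i0) I'"
        by (rule lsum_cong)
          (use m c M I' d j' in \<open>auto simp: M'_def a_minus_def r_distr r_minus m_assoc a_assoc l_neg\<close>)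
      also have "\<dots> = lsum K (\<lambda>i. c i \<otimes> M' j' i) I' \<oplus> lsum K (\<lambda>i. c i \<otimes> (M j i \<otimes> d) \<otimes> M j' i0) I'"
        by (rule lsum_add) (use m c M M' I' d j' in auto)
      finally have "lsum K (\<lambda>i. c i \<otimes> M j' i) I' = e \<otimes> M j' i0"
        using c(3) j' e m by (simp add: eq[symmetric])
      then show ?thesis
        using split[of j'] j' e m by (simp add: l_minus l_neg)
    qed
    moreover have "\<exists>i\<in>set I. c' i \<noteq> \<zero>"
      using c(2) I' by (auto simp: c'_def)
    ultimately show ?thesis
      using c' by (intro exI[of _ c']) auto
  qed
qed


section \<open>Functionals that annihilate powers\<close>

text \<open>The value of a functional \<open>g\<close> on the \<open>j\<close>-th power of a polynomial; \<open>g\<close> is given by its values on words.\<close>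

primrec pow_eval :: "'k ring \<Rightarrow> ('k \<times> 'x list) list \<Rightarrow> nat \<Rightarrow> ('x list \<Rightarrow> 'k) \<Rightarrow> 'k" where
  "pow_eval K l 0 g = g []"
| "pow_eval K l (Suc j) g = lsum K (\<lambda>p. fst p \<otimes>\<^bsub>K\<^esub> pow_eval K l j (\<lambda>m. g (snd p @ m))) l"

definition conv :: "'k ring \<Rightarrow> nat \<Rightarrow> ('x list \<Rightarrow> 'k) \<Rightarrow> ('x list \<Rightarrow> 'k) \<Rightarrow> 'x list \<Rightarrow> 'k" where
  "conv K n f g = (\<lambda>w. f (take n w) \<otimes>\<^bsub>K\<^esub> g (drop n w))"

primrec blocks :: "'k ring \<Rightarrow> nat \<Rightarrow> ('b \<Rightarrow> 'x list \<Rightarrow> 'k) \<Rightarrow> 'b list \<Rightarrow> 'x list \<Rightarrow> 'k" where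
  "blocks K n F [] = (\<lambda>w. if w = [] then \<one>\<^bsub>K\<^esub> else \<zero>\<^bsub>K\<^esub>)"
| "blocks K n F (b # bs) = conv K n (F b) (blocks K n F bs)"

locale poly_powers = kfield K for K :: "'k ring" (structure) +
  fixes l :: "('k \<times> 'x list) list"
  assumes l: "set l \<subseteq> carrier K \<times> {w. w \<noteq> []}"
begin

lemma l_coeff: "p \<in> set l \<Longrightarrow> fst p \<in> carrier K"
  and l_word: "p \<in> set l \<Longrightarrow> snd p \<noteq> []"
  using l by auto

lemma pow_eval_closed: "(\<And>m. g m \<in> carrier K) \<Longrightarrow> pow_eval K l j g \<in> carrier K"
  by (induction j arbitrary: g) (simp_all add: lsum_closed l_coeff)

lemma pow_eval_cong:
  "(\<And>m. length m \<ge> j \<Longrightarrow> g m = h m) \<Longrightarrow> pow_eval K l j g = pow_eval K l j h"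
proof (induction j arbitrary: g h)
  case (Suc j)
  have "pow_eval K l j (\<lambda>m. g (snd p @ m)) = pow_eval K l j (\<lambda>m. h (snd p @ m))" if "p \<in> set l" for p
  proof (rule Suc.IH)
    fix m :: "'x list" assume "length m \<ge> j"
    moreover have "length (snd p) > 0"
      using l_word[OF that] by simp
    ultimately have "length (snd p @ m) \<ge> Suc j"
      unfolding length_append by linarith
    then show "g (snd p @ m) = h (snd p @ m)"
      by (rule Suc.prems)
  qed
  then show ?case
    unfolding pow_eval.simps by (intro lsum_cong) simp
qed simp

lemma pow_eval_zero: "(\<And>m. length m \<ge> j \<Longrightarrow> g m = \<zero>) \<Longrightarrow> pow_eval K l j g = \<zero>"
proof -
  assume "\<And>m. length m \<ge> j \<Longrightarrow> g m = \<zero>"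
  then have "pow_eval K l j g = pow_eval K l j (\<lambda>_. \<zero>)"
    by (rule pow_eval_cong)
  also have "\<dots> = \<zero>"
    by (induction j) (simp_all add: lsum_zero l_coeff)
  finally show ?thesis .
qed

lemma pow_eval_add:
  "(\<And>m. g m \<in> carrier K) \<Longrightarrow> (\<And>m. h m \<in> carrier K) \<Longrightarrow>
    pow_eval K l j (\<lambda>m. g m \<oplus> h m) = pow_eval K l j g \<oplus> pow_eval K l j h"
proof (induction j arbitrary: g h)
  case (Suc j)
  have "pow_eval K l (Suc j) (\<lambda>m. g m \<oplus> h m) = lsum K (\<lambda>p. fst p \<otimes> pow_eval K l j (\<lambda>m. g (snd p @ m)) \<oplus>
      fst p \<otimes> pow_eval K l j (\<lambda>m. h (snd p @ m))) l"
    unfolding pow_eval.simps using Suc by (intro lsum_cong) (simp add: r_distr l_coeff pow_eval_closed)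
  also have "\<dots> = pow_eval K l (Suc j) g \<oplus> pow_eval K l (Suc j) h"
    using Suc by (simp add: lsum_add l_coeff pow_eval_closed)
  finally show ?case .
qed simp

lemma pow_eval_smult:
  "c \<in> carrier K \<Longrightarrow> (\<And>m. g m \<in> carrier K) \<Longrightarrow> pow_eval K l j (\<lambda>m. c \<otimes> g m) = c \<otimes> pow_eval K l j g"
proof (induction j arbitrary: g)
  case (Suc j)
  have "pow_eval K l (Suc j) (\<lambda>m. c \<otimes> g m) = lsum K (\<lambda>p. c \<otimes> (fst p \<otimes> pow_eval K l j (\<lambda>m. g (snd p @ m)))) l"
    unfolding pow_eval.simps using Suc by (intro lsum_cong) (simp add: m_lcomm l_coeff pow_eval_closed)
  also have "\<dots> = c \<otimes> pow_eval K l (Suc j) g"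
    using Suc by (simp add: lsum_rdistr l_coeff pow_eval_closed)
  finally show ?case .
qed simp

lemma pow_eval_lsum:
  "(\<And>x m. x \<in> set xs \<Longrightarrow> f x m \<in> carrier K) \<Longrightarrow>
    pow_eval K l j (\<lambda>m. lsum K (\<lambda>x. f x m) xs) = lsum K (\<lambda>x. pow_eval K l j (f x)) xs"
proof (induction xs)
  case Nil
  then show ?case by (simp add: pow_eval_zero)
next
  case (Cons x xs)
  then show ?case
    using pow_eval_add[of "f x" "\<lambda>m. lsum K (\<lambda>x. f x m) xs" j] lsum_closed[of xs "\<lambda>x. f x m" for m] by simp
qed

lemma pow_eval_right:
  "(\<And>m. g m \<in> carrier K) \<Longrightarrow>
    pow_eval K l (Suc j) g = lsum K (\<lambda>p. fst p \<otimes> pow_eval K l j (\<lambda>m. g (m @ snd p))) l"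
proof (induction j arbitrary: g)
  case (Suc j)
  have "pow_eval K l (Suc (Suc j)) g = lsum K (\<lambda>p. fst p \<otimes> pow_eval K l (Suc j) (\<lambda>m. g (snd p @ m))) l"
    by simp
  also have "\<dots> = lsum K (\<lambda>p. fst p \<otimes> lsum K (\<lambda>q. fst q \<otimes> pow_eval K l j (\<lambda>m. g (snd p @ m @ snd q))) l) l"
    by (rule lsum_cong) (simp only: Suc.IH[of "\<lambda>m. g (snd p @ m)" for p, OF Suc.prems])
  also have "\<dots> = lsum K (\<lambda>p. lsum K (\<lambda>q. fst q \<otimes> (fst p \<otimes> pow_eval K l j (\<lambda>m. g (snd p @ m @ snd q)))) l) l"
  proof (rule lsum_cong)
    fix p assume p: "p \<in> set l"
    have "fst p \<otimes> lsum K (\<lambda>q. fst q \<otimes> pow_eval K l j (\<lambda>m. g (snd p @ m @ snd q))) l =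
        lsum K (\<lambda>q. fst p \<otimes> (fst q \<otimes> pow_eval K l j (\<lambda>m. g (snd p @ m @ snd q)))) l"
      by (rule lsum_rdistr) (simp_all add: p l_coeff pow_eval_closed Suc.prems)
    also have "\<dots> = lsum K (\<lambda>q. fst q \<otimes> (fst p \<otimes> pow_eval K l j (\<lambda>m. g (snd p @ m @ snd q)))) l"
      by (intro lsum_cong m_lcomm) (simp_all add: p l_coeff pow_eval_closed Suc.prems)
    finally show "fst p \<otimes> lsum K (\<lambda>q. fst q \<otimes> pow_eval K l j (\<lambda>m. g (snd p @ m @ snd q))) l =
        lsum K (\<lambda>q. fst q \<otimes> (fst p \<otimes> pow_eval K l j (\<lambda>m. g (snd p @ m @ snd q)))) l" .
  qed
  also have "\<dots> = lsum K (\<lambda>q. lsum K (\<lambda>p. fst q \<otimes> (fst p \<otimes> pow_eval K l j (\<lambda>m. g (snd p @ m @ snd q)))) l) l"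
    using Suc.prems by (intro lsum_swap) (simp add: l_coeff pow_eval_closed)
  also have "\<dots> = lsum K (\<lambda>q. fst q \<otimes> pow_eval K l (Suc j) (\<lambda>m. g (m @ snd q))) l"
    unfolding pow_eval.simps using Suc.prems
    by (intro lsum_cong) (simp add: lsum_rdistr l_coeff pow_eval_closed)
  finally show ?case .
qed simp

text \<open>Let the functional \<open>\<kappa>\<close> of degree \<open>M\<close> annihilate all powers of the polynomial, also when a piece of
  one of its words is added on either side. A power that covers a segment on which \<open>\<kappa>\<close> is
  evaluated starts and ends within this segment with a power of this kind, up to such pieces.\<close>

context
  fixes M :: nat and \<kappa> :: "'x list \<Rightarrow> 'k"
  assumes \<kappa>: "\<And>w. \<kappa> w \<in> carrier K" "\<And>w. length w \<noteq> M \<Longrightarrow> \<kappa> w = \<zero>"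
    and kill: "\<And>p q i b j. p \<in> set l \<Longrightarrow> q \<in> set l \<Longrightarrow> pow_eval K l j (\<lambda>m. \<kappa> (drop i (snd p) @ m @ take b (snd q))) = \<zero>"
    and M: "\<And>p. p \<in> set l \<Longrightarrow> length (snd p) < M" and M_pos: "M > 0"
begin

text \<open>Follows the power from the left until its length reaches \<open>M\<close>. There the factor \<open>\<kappa>\<close> sees a power followed by
  a prefix of one more word, and it annihilates this.\<close>

lemma kill_start:
  assumes p: "p \<in> set l" and u: "u = drop i (snd p)" and g: "\<And>w. g w \<in> carrier K"
  shows "pow_eval K l j (\<lambda>m. if length (u @ m) \<ge> M then conv K M \<kappa> g (u @ m @ w) else \<zero>) = \<zero>"
proof (induction j arbitrary: w)
  case 0
  have "length u < M"
    using M[OF p] by (simp add: u)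
  then show ?case by simp
next
  case (Suc j)
  let ?h = "\<lambda>w m. if length (u @ m) \<ge> M then conv K M \<kappa> g (u @ m @ w) else \<zero>"
  have h: "?h w m \<in> carrier K" for w m
    using \<kappa> g by (simp add: conv_def)
  have split: "?h w (m @ y) = ?h (y @ w) m \<oplus>
      lsum K (\<lambda>b. \<kappa> (u @ m @ take b y) \<otimes> g (drop b y @ w)) [1..<Suc (length y)]" (is "_ = _ \<oplus> ?s") for m y
  proof -
    have z: "\<kappa> (u @ m @ take b y) \<otimes> g (drop b y @ w) = \<zero>"
      if "b \<in> set [1..<Suc (length y)]" "length (u @ m) + b \<noteq> M" for b
    proof -
      have "b \<le> length y"
        using that by auto
      then have "length (u @ m @ take b y) \<noteq> M"
        using that by (simp add: min_absorb2 add.assoc)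
      then show ?thesis
        using \<kappa>(2) g by simp
    qed
    show ?thesis
    proof (cases "length (u @ m) < M \<and> M \<le> length (u @ m @ y)")
      case True
      define b0 where "b0 = M - length (u @ m)"
      have b0: "b0 \<in> set [1..<Suc (length y)]" "length (u @ m) + b0 = M"
        using True by (auto simp: b0_def)
      have "?s = lsum K (\<lambda>b. if b = b0 then \<kappa> (u @ m @ take b y) \<otimes> g (drop b y @ w) else \<zero>) [1..<Suc (length y)]"
        by (rule lsum_cong) (use z b0 in auto)
      also have "\<dots> = \<kappa> (u @ m @ take b0 y) \<otimes> g (drop b0 y @ w)"
        by (rule lsum_delta) (use b0 \<kappa> g in auto)
      also have "\<dots> = conv K M \<kappa> g (u @ m @ y @ w)"
      proof -
        have "take M (u @ m @ y @ w) = u @ m @ take b0 y" "drop M (u @ m @ y @ w) = drop b0 y @ w"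
          using b0 True by (auto simp: b0_def)
        then show ?thesis
          by (simp add: conv_def)
      qed
      finally show ?thesis
        using True \<kappa> g by (simp add: conv_def)
    next
      case False
      have "?s = \<zero>"
        by (rule lsum_zero, rule z) (use False in auto)
      then show ?thesis
        using False \<kappa> g by (auto simp: conv_def)
    qed
  qed
  have "pow_eval K l j (\<lambda>m. ?h w (m @ snd q)) = \<zero>" if q: "q \<in> set l" for q
  proof -
    have "pow_eval K l j (\<lambda>m. ?h w (m @ snd q)) = pow_eval K l j (?h (snd q @ w)) \<oplus>
       pow_eval K l j (\<lambda>m. lsum K (\<lambda>b. \<kappa> (u @ m @ take b (snd q)) \<otimes> g (drop b (snd q) @ w)) [1..<Suc (length (snd q))])"
      unfolding split by (rule pow_eval_add) (use h \<kappa> g in \<open>auto intro!: lsum_closed\<close>)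
    also have "pow_eval K l j (?h (snd q @ w)) = \<zero>"
      by (rule Suc.IH)
    also have "pow_eval K l j (\<lambda>m. lsum K (\<lambda>b. \<kappa> (u @ m @ take b (snd q)) \<otimes> g (drop b (snd q) @ w)) [1..<Suc (length (snd q))])
      = lsum K (\<lambda>b. pow_eval K l j (\<lambda>m. g (drop b (snd q) @ w) \<otimes> \<kappa> (u @ m @ take b (snd q)))) [1..<Suc (length (snd q))]"
      using \<kappa> g by (simp add: pow_eval_lsum m_comm)
    also have "\<dots> = \<zero>"
      by (rule lsum_zero) (use \<kappa> g kill[OF p q] in \<open>simp add: pow_eval_smult u\<close>)
    finally show ?thesis by simp
  qed
  then show ?case
    unfolding pow_eval_right[of "?h w", OF h] by (intro lsum_zero) (simp add: l_coeff)
qed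

text \<open>The part of the power that lies in the first block is split off, word by word, until a word crosses the border of the
  block; the rest of this word is the piece on the left in \<open>kill_start\<close>.\<close>

lemma kill_later:
  assumes f: "\<And>w. f w \<in> carrier K" and g: "\<And>w. g w \<in> carrier K"
  shows "length u \<le> n \<Longrightarrow>
    pow_eval K l j (\<lambda>m. if length (u @ m) \<ge> n + M then conv K n f (conv K M \<kappa> g) (u @ m @ w) else \<zero>) = \<zero>"
proof (induction j arbitrary: u)
  case 0
  then show ?case
    using M_pos by simp
next
  case (Suc j)
  have cg: "conv K M \<kappa> g w \<in> carrier K" for w
    using \<kappa> g by (simp add: conv_def)
  let ?h = "\<lambda>u m. if length (u @ m) \<ge> n + M then conv K n f (conv K M \<kappa> g) (u @ m @ w) else \<zero>"
  have "pow_eval K l j (\<lambda>m. ?h u (snd p @ m)) = \<zero>" if p: "p \<in> set l" for p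
  proof (cases "length (u @ snd p) \<le> n")
    case True
    from Suc.IH[OF this] show ?thesis by (simp cong: if_cong)
  next
    case False
    define i where "i = n - length u"
    have i: "take n (u @ snd p @ v) = u @ take i (snd p)" "drop n (u @ snd p @ v) = drop i (snd p) @ v" for v
      using False Suc.prems by (auto simp: i_def)
    have len: "length (u @ snd p @ m) \<ge> n + M \<longleftrightarrow> length (drop i (snd p) @ m) \<ge> M" for m
      using False Suc.prems by (auto simp: i_def)
    have "pow_eval K l j (\<lambda>m. ?h u (snd p @ m)) = pow_eval K l j (\<lambda>m. f (u @ take i (snd p)) \<otimes>
        (if length (drop i (snd p) @ m) \<ge> M then conv K M \<kappa> g (drop i (snd p) @ m @ w) else \<zero>))"
      unfolding len using f by (intro pow_eval_cong) (simp only: conv_def[of K n] append_assoc i, simp)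
    also have "\<dots> = f (u @ take i (snd p)) \<otimes> pow_eval K l j (\<lambda>m.
        if length (drop i (snd p) @ m) \<ge> M then conv K M \<kappa> g (drop i (snd p) @ m @ w) else \<zero>)"
      by (rule pow_eval_smult) (use f cg in auto)
    also have "\<dots> = \<zero>"
      using kill_start[OF p refl g] f by simp
    finally show ?thesis .
  qed
  then show ?case
    unfolding pow_eval.simps by (intro lsum_zero) (simp add: l_coeff)
qed

end

end

text \<open>One stage of the construction: all functionals of the new stage are concatenations of a
  functional that annihilates the powers of the given polynomial, and a functional of the old stage.\<close>

definition linear_closed :: "'k ring \<Rightarrow> ('x \<Rightarrow> 'k) set \<Rightarrow> bool" where
  "linear_closed K Z \<longleftrightarrow> (\<lambda>_. \<zero>\<^bsub>K\<^esub>) \<in> Z \<and> (\<forall>f\<in>Z. \<forall>g\<in>Z. (\<lambda>w. f w \<oplus>\<^bsub>K\<^esub> g w) \<in> Z) \<and>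
    (\<forall>c\<in>carrier K. \<forall>f\<in>Z. (\<lambda>w. c \<otimes>\<^bsub>K\<^esub> f w) \<in> Z)"

lemma linear_closed_lsum:
  "linear_closed K Z \<Longrightarrow> (\<And>x. x \<in> set xs \<Longrightarrow> c x \<in> carrier K \<and> f x \<in> Z) \<Longrightarrow>
    (\<lambda>w. lsum K (\<lambda>x. c x \<otimes>\<^bsub>K\<^esub> f x w) xs) \<in> Z"
  by (induction xs) (auto simp: linear_closed_def)

context kfield
begin

lemma blocks_closed: "(\<And>b w. F b w \<in> carrier K) \<Longrightarrow> blocks K n F bs w \<in> carrier K"
  by (induction bs arbitrary: w) (auto simp: conv_def)

lemma blocks_length:
  assumes "\<And>b w. F b w \<in> carrier K" "\<And>b w. length w \<noteq> n \<Longrightarrow> F b w = \<zero>"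
  shows "length w \<noteq> length bs * n \<Longrightarrow> blocks K n F bs w = \<zero>"
proof (induction bs arbitrary: w)
  case (Cons b bs)
  show ?case
  proof (cases "length w < n")
    case True
    then have "F b (take n w) = \<zero>"
      by (intro assms(2)) simp
    then show ?thesis
      using blocks_closed[of F, OF assms(1)] by (simp add: conv_def)
  next
    case False
    then have "length (drop n w) \<noteq> length bs * n"
      using Cons.prems by auto
    then show ?thesis
      using Cons.IH assms(1) by (simp add: conv_def)
  qed
qed auto

lemma conv_assoc:
  fixes f g h :: "'x list \<Rightarrow> 'k"
  assumes "\<And>w. f w \<in> carrier K" "\<And>w. g w \<in> carrier K" "\<And>w. h w \<in> carrier K"
  shows "conv K (m + n) (conv K m f g) h = conv K m f (conv K n g h)"
proof
  fix w :: "'x list"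
  have "take m (take (m + n) w) = take m w" "drop m (take (m + n) w) = take n (drop m w)"
    "drop (m + n) w = drop n (drop m w)"
    by (simp_all add: drop_take add.commute)
  then show "conv K (m + n) (conv K m f g) h w = conv K m f (conv K n g h) w"
    using assms by (simp add: conv_def m_assoc)
qed

lemma blocks_append:
  assumes "\<And>b w. F b w \<in> carrier K" "\<And>b w. length w \<noteq> n \<Longrightarrow> F b w = \<zero>"
  shows "blocks K n F (bs @ cs) = conv K (length bs * n) (blocks K n F bs) (blocks K n F cs)"
proof (induction bs)
  case Nil
  then show ?case
    using blocks_closed[of F, OF assms(1)] by (simp add: conv_def)
next
  case (Cons b bs)
  then show ?case
    using conv_assoc[of "F b" "blocks K n F bs" "blocks K n F cs" n "length bs * n"] blocks_closed[of F, OF assms(1)] assms(1)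
    by simp
qed

end

locale stage = poly_powers K l for K :: "'k ring" (structure) and l :: "('k \<times> 'x list) list" +
  fixes n M :: nat and F :: "'b \<Rightarrow> 'x list \<Rightarrow> 'k" and F' :: "'c \<Rightarrow> 'x list \<Rightarrow> 'k"
    and \<kappa> :: "'c \<Rightarrow> 'x list \<Rightarrow> 'k" and last_block :: "'c \<Rightarrow> 'b"
    and I :: "'i list" and coeff :: "'c \<Rightarrow> 'i \<Rightarrow> 'k" and blk :: "'c \<Rightarrow> 'i \<Rightarrow> 'b list" and g :: nat
  assumes F: "\<And>b w. F b w \<in> carrier K" "\<And>b w. length w \<noteq> n \<Longrightarrow> F b w = \<zero>"
    and coeff: "\<And>b i. coeff b i \<in> carrier K" and blk: "\<And>b i. i \<in> set I \<Longrightarrow> length (blk b i) = g"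
    and \<kappa>_eq: "\<And>b. \<kappa> b = (\<lambda>w. lsum K (\<lambda>i. coeff b i \<otimes> blocks K n F (blk b i) w) I)"
    and F'_eq: "\<And>b. F' b = conv K M (\<kappa> b) (F (last_block b))"
    and M_eq: "M = g * n"
    and kill: "\<And>b p q i k j. p \<in> set l \<Longrightarrow> q \<in> set l \<Longrightarrow>
      pow_eval K l j (\<lambda>m. \<kappa> b (drop i (snd p) @ m @ take k (snd q))) = \<zero>"
    and long: "\<And>p. p \<in> set l \<Longrightarrow> length (snd p) < M" and pos: "M > 0"
begin

lemma F_append: "blocks K n F (bs @ cs) = conv K (length bs * n) (blocks K n F bs) (blocks K n F cs)"
  by (rule blocks_append) (rule F(1), erule F(2))

lemma F_length: "length w \<noteq> length bs * n \<Longrightarrow> blocks K n F bs w = \<zero>"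
  by (rule blocks_length) (rule F(1), erule F(2))

lemma \<kappa>_closed: "\<kappa> b w \<in> carrier K"
  unfolding \<kappa>_eq using coeff blocks_closed[of F, OF F(1)] by (intro lsum_closed) simp

lemma \<kappa>_length: "length w \<noteq> M \<Longrightarrow> \<kappa> b w = \<zero>"
  unfolding \<kappa>_eq
  by (rule lsum_zero) (use F_length coeff blk in \<open>simp add: M_eq\<close>)

lemma F'_closed: "F' b w \<in> carrier K"
  using \<kappa>_closed F by (simp add: F'_eq conv_def)

lemma F'_length: "length w \<noteq> M + n \<Longrightarrow> F' b w = \<zero>"
proof -
  assume w: "length w \<noteq> M + n"
  show ?thesis
  proof (cases "length w < M")
    case True
    then have "\<kappa> b (take M w) = \<zero>"
      by (intro \<kappa>_length) simp
    then show ?thesis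
      using F by (simp add: F'_eq conv_def)
  next
    case False
    then have "F (last_block b) (drop M w) = \<zero>"
      using w by (intro F(2)) auto
    then show ?thesis
      using \<kappa>_closed by (simp add: F'_eq conv_def)
  qed
qed

text \<open>Products of new functionals are linear combinations of products of old ones. Hence what was achieved in earlier
  stages remains true.\<close>

lemma blocks_linear_closed:
  assumes Z: "linear_closed K Z" and bs: "\<And>bs. blocks K n F bs \<in> Z"
  shows "conv K (length bs * n) (blocks K n F bs) (blocks K (M + n) F' cs) \<in> Z"
proof (induction cs arbitrary: bs)
  case Nil
  have "blocks K (M + n) F' [] = blocks K n F []"
    by simp
  then show ?case
    using bs[of "bs @ []"] F_append[of bs "[]"] by (simp only:)
next
  case (Cons c cs)
  let ?G = "blocks K (M + n) F' cs"
  have G: "?G w \<in> carrier K" for w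
    by (rule blocks_closed) (rule F'_closed)
  have B: "blocks K n F bs w \<in> carrier K" for bs w
    by (rule blocks_closed) (rule F(1))
  let ?X = "\<lambda>i. blocks K n F (bs @ blk c i @ [last_block c])"
  have eq: "conv K (length bs * n) (blocks K n F bs) (blocks K (M + n) F' (c # cs)) =
    (\<lambda>w. lsum K (\<lambda>i. coeff c i \<otimes> conv K (length (bs @ blk c i @ [last_block c]) * n) (?X i) ?G w) I)"
  proof
    fix w
    let ?b = "blocks K n F bs (take (length bs * n) w)" and ?w = "drop (length bs * n) w"
    have X: "conv K (length (bs @ blk c i @ [last_block c]) * n) (?X i) ?G w =
        ?b \<otimes> (blocks K n F (blk c i) (take M ?w) \<otimes> (F (last_block c) (take n (drop M ?w)) \<otimes> ?G (drop n (drop M ?w))))"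
      if i: "i \<in> set I" for i
    proof -
      have last: "blocks K n F [last_block c] = F (last_block c)"
      proof
        fix v
        show "blocks K n F [last_block c] v = F (last_block c) v"
          using F by (cases "length v \<le> n") (auto simp: conv_def)
      qed
      have "conv K (length (bs @ blk c i @ [last_block c]) * n) (?X i) ?G =
          conv K (length bs * n) (blocks K n F bs) (conv K M (blocks K n F (blk c i)) (conv K n (F (last_block c)) ?G))"
        using conv_assoc[of "blocks K n F bs" "conv K M (blocks K n F (blk c i)) (F (last_block c))" ?G "length bs * n" "M + n"]
          conv_assoc[of "blocks K n F (blk c i)" "F (last_block c)" ?G M n] blk[OF i] B G F(1)
        by (simp only: F_append last)
          (simp add: M_eq conv_def add.assoc distrib_right add.commute[of n])
      from fun_cong[OF this, of w] show ?thesis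
        unfolding conv_def .
    qed
    have "conv K (length bs * n) (blocks K n F bs) (blocks K (M + n) F' (c # cs)) w =
        ?b \<otimes> (\<kappa> c (take M ?w) \<otimes> (F (last_block c) (take n (drop M ?w)) \<otimes> ?G (drop n (drop M ?w))))"
    proof -
      have "conv K (M + n) (F' c) ?G = conv K M (\<kappa> c) (conv K n (F (last_block c)) ?G)"
        unfolding F'_eq[of c] by (rule conv_assoc) (use \<kappa>_closed F G in auto)
      then show ?thesis
        by (simp add: conv_def add.assoc)
    qed
    also have "\<dots> = lsum K (\<lambda>i. coeff c i \<otimes> (?b \<otimes> (blocks K n F (blk c i) (take M ?w) \<otimes>
        (F (last_block c) (take n (drop M ?w)) \<otimes> ?G (drop n (drop M ?w)))))) I"
      unfolding \<kappa>_eq using coeff B F(1) G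
      by (simp add: lsum_ldistr lsum_rdistr m_assoc m_lcomm)
    also have "\<dots> = lsum K (\<lambda>i. coeff c i \<otimes> conv K (length (bs @ blk c i @ [last_block c]) * n) (?X i) ?G w) I"
      by (rule lsum_cong) (simp only: X)
    finally show "conv K (length bs * n) (blocks K n F bs) (blocks K (M + n) F' (c # cs)) w =
      lsum K (\<lambda>i. coeff c i \<otimes> conv K (length (bs @ blk c i @ [last_block c]) * n) (?X i) ?G w) I" .
  qed
  show ?case
    unfolding eq by (rule linear_closed_lsum[OF Z]) (use coeff Cons.IH in blast)
qed

lemma blocks_transfer:
  assumes "linear_closed K Z" "\<And>bs. blocks K n F bs \<in> Z"
  shows "blocks K (M + n) F' cs \<in> Z"
proof -
  have "conv K (length [] * n) (blocks K n F []) (blocks K (M + n) F' cs) = blocks K (M + n) F' cs"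
    using blocks_closed[of F' "M + n" cs, OF F'_closed] by (auto simp: conv_def)
  then show ?thesis
    using blocks_linear_closed[OF assms, of "[]" cs] by simp
qed

text \<open>A power of length at least \<open>M + n + M\<close> covers a whole segment of \<open>\<kappa>\<close>, unless it starts after the first
  block, where induction applies.\<close>

lemma blocks_dead:
  assumes N: "N \<ge> M + n + M"
  shows "pow_eval K l N (\<lambda>m. blocks K (M + n) F' bs (u @ m @ w)) = \<zero>"
proof (induction bs arbitrary: u)
  case Nil
  show ?case
    by (rule pow_eval_zero) (use N pos in auto)
next
  case (Cons b bs)
  have G: "blocks K (M + n) F' bs w \<in> carrier K" for bs w
    by (rule blocks_closed) (rule F'_closed)
  show ?case
  proof (cases "length u \<ge> M + n")
    case True
    then have "pow_eval K l N (\<lambda>m. blocks K (M + n) F' (b # bs) (u @ m @ w)) =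
      pow_eval K l N (\<lambda>m. F' b (take (M + n) u) \<otimes> blocks K (M + n) F' bs (drop (M + n) u @ m @ w))"
      by (simp add: conv_def)
    also have "\<dots> = \<zero>"
      using Cons.IH F'_closed G by (simp add: pow_eval_smult)
    finally show ?thesis .
  next
    case False
    show ?thesis
    proof (cases bs)
      case Nil
      show ?thesis
      proof (rule pow_eval_zero)
        fix m :: "'x list" assume m: "length m \<ge> N"
        have "length (u @ m @ w) \<noteq> length (b # bs) * (M + n)"
          using m N pos Nil by simp
        then show "blocks K (M + n) F' (b # bs) (u @ m @ w) = \<zero>"
          by (intro blocks_length F'_closed F'_length)
      qed
    next
      case (Cons c cs)
      let ?g = "conv K n (F (last_block c)) (blocks K (M + n) F' cs)"
      have eq: "blocks K (M + n) F' (b # bs) = conv K (M + n) (F' b) (conv K M (\<kappa> c) ?g)"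
        using conv_assoc[of "\<kappa> c" "F (last_block c)" "blocks K (M + n) F' cs" M n] \<kappa>_closed F G
        by (simp add: Cons F'_eq[of c])
      have "pow_eval K l N (\<lambda>m. blocks K (M + n) F' (b # bs) (u @ m @ w)) =
        pow_eval K l N (\<lambda>m. if length (u @ m) \<ge> M + n + M
          then conv K (M + n) (F' b) (conv K M (\<kappa> c) ?g) (u @ m @ w) else \<zero>)"
        unfolding eq by (rule pow_eval_cong) (use N in simp)
      also have "\<dots> = \<zero>"
      proof (rule kill_later[where \<kappa> = "\<kappa> c"])
        show "?g v \<in> carrier K" for v
          using F G by (simp add: conv_def)
      qed (use \<kappa>_closed \<kappa>_length kill long pos F'_closed False in auto)
      finally show ?thesis .
    qed
  qed
qed

end


section \<open>Evaluation at generic combinations of letters\<close>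

text \<open>The letter \<open>3 \<kappa> + i\<close> has class \<open>\<kappa>\<close>. A functional is evaluated at the word with pattern \<open>\<rho>\<close> in the generic
  elements \<open>\<Sum>\<^sub>i \<tau> i x\<^bsub>3\<kappa>+i\<^esub>\<close>.\<close>

primrec generic_eval :: "'f ring \<Rightarrow> (nat \<Rightarrow> 'f) \<Rightarrow> (nat list \<Rightarrow> 'f) \<Rightarrow> nat list \<Rightarrow> 'f" where
  "generic_eval F \<tau> g [] = g []"
| "generic_eval F \<tau> g (k # \<rho>) =
     lsum F (\<lambda>i. \<tau> i \<otimes>\<^bsub>F\<^esub> generic_eval F \<tau> (\<lambda>v. g ((3 * k + i) # v)) \<rho>) [0, 1, 2]"

primrec chunks :: "nat \<Rightarrow> nat \<Rightarrow> 'x list \<Rightarrow> 'x list list" where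
  "chunks n 0 \<pi> = []"
| "chunks n (Suc k) \<pi> = take n \<pi> # chunks n k (drop n \<pi>)"

lemma length_chunks [simp]: "length (chunks n k \<pi>) = k"
  by (induction k arbitrary: \<pi>) auto

lemma chunks_concat: "concat (chunks n k \<pi>) = take (k * n) \<pi>"
  by (induction k arbitrary: \<pi>) (auto simp: take_add add.commute)

lemma chunks_length: "length \<pi> = k * n \<Longrightarrow> \<pi>' \<in> set (chunks n k \<pi>) \<Longrightarrow> length \<pi>' = n"
proof (induction k arbitrary: \<pi>)
  case (Suc k)
  have len: "length (drop n \<pi>) = k * n"
    using Suc.prems(1) by simp
  show ?case
  proof (cases "\<pi>' \<in> set (chunks n k (drop n \<pi>))")
    case True
    then show ?thesis by (rule Suc.IH[OF len])
  next
    case False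
    then show ?thesis using Suc.prems by simp
  qed
qed simp

text \<open>Weights for \<open>2 g\<close> blocks whose product is \<open>s\<^sup>a t\<^sup>b\<close> for the pair \<open>(a, b)\<close>: the block indices \<open>1\<close> and \<open>2\<close> carry
  \<open>s\<close> and \<open>t\<close>, the others the weight \<open>1\<close>.\<close>

definition choices :: "nat \<Rightarrow> nat \<times> nat \<Rightarrow> nat list" where
  "choices g p = replicate (fst p) 1 @ replicate (g - fst p) 0 @ replicate (snd p) 2 @ replicate (g - snd p) 0"

lemma length_choices: "fst p \<le> g \<Longrightarrow> snd p \<le> g \<Longrightarrow> length (choices g p) = 2 * g"
  by (simp add: choices_def)

lemma choices_less: "i \<in> set (choices g p) \<Longrightarrow> i < 3"
  by (auto simp: choices_def)

locale independent_ext = field_ext +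
  fixes s t :: 'b
  assumes indep: "independent_pair K F \<phi> s t"
begin

lemma st [simp]: "s \<in> carrier F" "t \<in> carrier F"
  using indep by (auto simp: independent_pair_def)

definition weight :: "nat \<Rightarrow> 'b" where
  "weight i = (if i = 0 then \<one>\<^bsub>F\<^esub> else if i = 1 then s else t)"

lemma weight_closed [simp]: "weight i \<in> carrier F"
  by (simp add: weight_def)

abbreviation "Ev \<equiv> generic_eval F weight"

lemma Ev_closed: "(\<And>w. g w \<in> carrier F) \<Longrightarrow> Ev g \<rho> \<in> carrier F"
  by (induction \<rho> arbitrary: g) simp_all

lemma Ev_cong: "(\<And>w. length w = length \<rho> \<Longrightarrow> g w = h w) \<Longrightarrow> Ev g \<rho> = Ev h \<rho>"
proof (induction \<rho> arbitrary: g h)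
  case (Cons k \<rho>)
  have "Ev (\<lambda>v. g ((3 * k + i) # v)) \<rho> = Ev (\<lambda>v. h ((3 * k + i) # v)) \<rho>" for i
    by (rule Cons.IH) (rule Cons.prems, simp)
  then show ?case by (simp only: generic_eval.simps)
qed simp

lemma Ev_smult:
  "a \<in> carrier F \<Longrightarrow> (\<And>w. g w \<in> carrier F) \<Longrightarrow> Ev (\<lambda>w. a \<otimes>\<^bsub>F\<^esub> g w) \<rho> = a \<otimes>\<^bsub>F\<^esub> Ev g \<rho>"
proof (induction \<rho> arbitrary: g)
  case (Cons k \<rho>)
  then show ?case
    by (simp add: F.r_distr Ev_closed F.m_lcomm[of "weight i" for i])
qed simp

lemma Ev_zero: "(\<And>w. length w = length \<rho> \<Longrightarrow> g w = \<zero>\<^bsub>F\<^esub>) \<Longrightarrow> Ev g \<rho> = \<zero>\<^bsub>F\<^esub>"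
proof -
  assume "\<And>w. length w = length \<rho> \<Longrightarrow> g w = \<zero>\<^bsub>F\<^esub>"
  then have "Ev g \<rho> = Ev (\<lambda>w. \<zero>\<^bsub>F\<^esub>) \<rho>"
    by (rule Ev_cong)
  also have "\<dots> = \<zero>\<^bsub>F\<^esub>"
    by (induction \<rho>) simp_all
  finally show ?thesis .
qed

lemma Ev_add:
  "(\<And>w. g w \<in> carrier F) \<Longrightarrow> (\<And>w. h w \<in> carrier F) \<Longrightarrow> Ev (\<lambda>w. g w \<oplus>\<^bsub>F\<^esub> h w) \<rho> = Ev g \<rho> \<oplus>\<^bsub>F\<^esub> Ev h \<rho>"
proof (induction \<rho> arbitrary: g h)
  case (Cons k \<rho>)
  then show ?case
    by (simp add: F.r_distr Ev_closed F.a_ac)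
qed simp

lemma Ev_lsum:
  "(\<And>x w. x \<in> set xs \<Longrightarrow> f x w \<in> carrier F) \<Longrightarrow> Ev (\<lambda>w. lsum F (\<lambda>x. f x w) xs) \<rho> = lsum F (\<lambda>x. Ev (f x) \<rho>) xs"
proof (induction xs)
  case Nil
  then show ?case by (simp add: Ev_zero)
next
  case (Cons x xs)
  then show ?case
    by (simp add: Ev_add F.lsum_closed)
qed

text \<open>Evaluation in generic elements is multiplicative, because it is a substitution.\<close>

lemma Ev_conv:
  assumes "\<And>w. f w \<in> carrier F" "\<And>w. g w \<in> carrier F" "\<And>w. length w \<noteq> n \<Longrightarrow> f w = \<zero>\<^bsub>F\<^esub>"
  shows "Ev (\<lambda>w. f (take n w) \<otimes>\<^bsub>F\<^esub> g (drop n w)) \<rho> = Ev f (take n \<rho>) \<otimes>\<^bsub>F\<^esub> Ev g (drop n \<rho>)"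
  using assms
proof (induction n arbitrary: f \<rho>)
  case 0
  then show ?case
    by (simp add: Ev_smult)
next
  case (Suc n)
  show ?case
  proof (cases \<rho>)
    case Nil
    then show ?thesis
      using Suc.prems by simp
  next
    case (Cons k \<rho>')
    have "Ev (\<lambda>v. f ((3 * k + i) # take n v) \<otimes>\<^bsub>F\<^esub> g (drop n v)) \<rho>' =
        Ev (\<lambda>v. f ((3 * k + i) # v)) (take n \<rho>') \<otimes>\<^bsub>F\<^esub> Ev g (drop n \<rho>')" for i
      by (rule Suc.IH) (use Suc.prems in auto)
    then show ?thesis
      using Suc.prems by (simp add: Cons F.l_distr F.m_assoc Ev_closed)
  qed
qed

text \<open>The functional indexed by the pattern \<open>\<pi>\<close> and \<open>i\<close> detects \<open>\<pi>\<close>, with a value that depends on \<open>i\<close> through a weight only. The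
  index \<open>i\<close> is what gives the next stage different monomials in \<open>s\<close> and \<open>t\<close> on one pattern.\<close>

definition good :: "nat \<Rightarrow> (nat list \<times> nat \<Rightarrow> nat list \<Rightarrow> 'a) \<Rightarrow> (nat list \<Rightarrow> 'b) \<Rightarrow> bool" where
  "good n G f \<longleftrightarrow> n > 0 \<and> (\<forall>b w. G b w \<in> carrier K \<and> (length w \<noteq> n \<longrightarrow> G b w = \<zero>\<^bsub>K\<^esub>)) \<and>
     (\<forall>\<pi>. length \<pi> = n \<longrightarrow> f \<pi> \<in> carrier F \<and> f \<pi> \<noteq> \<zero>\<^bsub>F\<^esub> \<and>
       (\<forall>i<3. \<forall>\<rho>. Ev (\<lambda>w. \<phi> (G (\<pi>, i) w)) \<rho> = (if \<rho> = \<pi> then f \<pi> \<otimes>\<^bsub>F\<^esub> weight i else \<zero>\<^bsub>F\<^esub>)))"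

lemma goodD:
  assumes "good n G f"
  shows "n > 0" "G b w \<in> carrier K" "length w \<noteq> n \<Longrightarrow> G b w = \<zero>\<^bsub>K\<^esub>"
    "length \<pi> = n \<Longrightarrow> f \<pi> \<in> carrier F" "length \<pi> = n \<Longrightarrow> f \<pi> \<noteq> \<zero>\<^bsub>F\<^esub>"
    "length \<pi> = n \<Longrightarrow> i < 3 \<Longrightarrow>
      Ev (\<lambda>w. \<phi> (G (\<pi>, i) w)) \<rho> = (if \<rho> = \<pi> then f \<pi> \<otimes>\<^bsub>F\<^esub> weight i else \<zero>\<^bsub>F\<^esub>)"
  using assms unfolding good_def by blast+

interpretation KK: kfield K
  by (rule kfield.intro) (rule K.field_axioms)

lemma Ev_blocks:
  assumes good: "good n G f" and bs: "\<And>b. b \<in> set bs \<Longrightarrow> length (fst b) = n \<and> snd b < 3"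
  shows "Ev (\<lambda>w. \<phi> (blocks K n G bs w)) \<rho> = (if \<rho> = concat (map fst bs)
    then foldr (\<lambda>b x. (f (fst b) \<otimes>\<^bsub>F\<^esub> weight (snd b)) \<otimes>\<^bsub>F\<^esub> x) bs \<one>\<^bsub>F\<^esub> else \<zero>\<^bsub>F\<^esub>)"
  using bs
proof (induction bs arbitrary: \<rho>)
  case Nil
  show ?case
    by (cases \<rho>) (simp_all add: Ev_zero del: generic_eval.simps(2), simp add: Ev_zero)
next
  case (Cons b bs)
  have G: "G b w \<in> carrier K" "length w \<noteq> n \<Longrightarrow> G b w = \<zero>\<^bsub>K\<^esub>" for b w
    using goodD(2,3)[OF good] by blast+
  have B: "blocks K n G bs w \<in> carrier K" for w
    by (rule KK.blocks_closed) (rule G)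
  obtain \<pi> i where b: "b = (\<pi>, i)" by force
  have pi: "length \<pi> = n" "i < 3"
    using Cons.prems[of b] by (auto simp: b)
  have f: "f \<pi> \<in> carrier F"
    and ev: "Ev (\<lambda>w. \<phi> (G (\<pi>, i) w)) \<rho> = (if \<rho> = \<pi> then f \<pi> \<otimes>\<^bsub>F\<^esub> weight i else \<zero>\<^bsub>F\<^esub>)" for \<rho>
    by (rule goodD(4)[OF good pi(1)]) (rule goodD(6)[OF good pi])
  have "Ev (\<lambda>w. \<phi> (blocks K n G (b # bs) w)) \<rho> =
      Ev (\<lambda>w. \<phi> (G b (take n w)) \<otimes>\<^bsub>F\<^esub> \<phi> (blocks K n G bs (drop n w))) \<rho>"
    using G B by (simp add: conv_def)
  also have "\<dots> = Ev (\<lambda>w. \<phi> (G b w)) (take n \<rho>) \<otimes>\<^bsub>F\<^esub> Ev (\<lambda>w. \<phi> (blocks K n G bs w)) (drop n \<rho>)"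
    by (rule Ev_conv) (use G B in auto)
  also have "Ev (\<lambda>w. \<phi> (blocks K n G bs w)) (drop n \<rho>) = (if drop n \<rho> = concat (map fst bs)
    then foldr (\<lambda>b x. (f (fst b) \<otimes>\<^bsub>F\<^esub> weight (snd b)) \<otimes>\<^bsub>F\<^esub> x) bs \<one>\<^bsub>F\<^esub> else \<zero>\<^bsub>F\<^esub>)"
    by (rule Cons.IH) (use Cons.prems in auto)
  finally have e: "Ev (\<lambda>w. \<phi> (blocks K n G (b # bs) w)) \<rho> = Ev (\<lambda>w. \<phi> (G b w)) (take n \<rho>) \<otimes>\<^bsub>F\<^esub> \<dots>" .
  have fo: "foldr (\<lambda>b x. (f (fst b) \<otimes>\<^bsub>F\<^esub> weight (snd b)) \<otimes>\<^bsub>F\<^esub> x) cs \<one>\<^bsub>F\<^esub> \<in> carrier F"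
    if "\<And>b. b \<in> set cs \<Longrightarrow> length (fst b) = n" for cs
    using that goodD(4)[OF good] by (induction cs) auto
  have fo': "foldr (\<lambda>b x. (f (fst b) \<otimes>\<^bsub>F\<^esub> weight (snd b)) \<otimes>\<^bsub>F\<^esub> x) bs \<one>\<^bsub>F\<^esub> \<in> carrier F"
    by (rule fo) (use Cons.prems in auto)
  have "\<rho> = \<pi> @ concat (map fst bs) \<longleftrightarrow> take n \<rho> = \<pi> \<and> drop n \<rho> = concat (map fst bs)"
    using pi by (metis append_eq_conv_conj append_take_drop_id)
  then show ?case
    unfolding e using f fo' by (auto simp: b ev)
qed

lemma foldr_zip:
  assumes "length \<pi>s = length cs" "\<And>\<pi>. \<pi> \<in> set \<pi>s \<Longrightarrow> f \<pi> \<in> carrier F"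
  shows "foldr (\<lambda>b x. (f (fst b) \<otimes>\<^bsub>F\<^esub> weight (snd b)) \<otimes>\<^bsub>F\<^esub> x) (zip \<pi>s cs) \<one>\<^bsub>F\<^esub> =
    foldr (\<lambda>\<pi> x. f \<pi> \<otimes>\<^bsub>F\<^esub> x) \<pi>s \<one>\<^bsub>F\<^esub> \<otimes>\<^bsub>F\<^esub> foldr (\<lambda>i x. weight i \<otimes>\<^bsub>F\<^esub> x) cs \<one>\<^bsub>F\<^esub>"
  using assms
proof (induction \<pi>s cs rule: list_induct2)
  case (Cons \<pi> \<pi>s c cs)
  have "foldr (\<lambda>\<pi> x. f \<pi> \<otimes>\<^bsub>F\<^esub> x) \<pi>s \<one>\<^bsub>F\<^esub> \<in> carrier F"
    using Cons.prems by (induction \<pi>s) auto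
  moreover have "foldr (\<lambda>i x. weight i \<otimes>\<^bsub>F\<^esub> x) cs \<one>\<^bsub>F\<^esub> \<in> carrier F"
    by (induction cs) auto
  ultimately show ?case
    using Cons by (simp add: F.m_ac)
qed simp

lemma foldr_choices:
  "foldr (\<lambda>i x. weight i \<otimes>\<^bsub>F\<^esub> x) (choices g p) \<one>\<^bsub>F\<^esub> = s [^]\<^bsub>F\<^esub> fst p \<otimes>\<^bsub>F\<^esub> t [^]\<^bsub>F\<^esub> snd p"
proof -
  have cl: "foldr (\<lambda>i x. weight i \<otimes>\<^bsub>F\<^esub> x) cs \<one>\<^bsub>F\<^esub> \<in> carrier F" for cs
    by (induction cs) auto
  have rep: "foldr (\<lambda>i x. weight i \<otimes>\<^bsub>F\<^esub> x) (replicate k i @ cs) \<one>\<^bsub>F\<^esub> =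
      weight i [^]\<^bsub>F\<^esub> k \<otimes>\<^bsub>F\<^esub> foldr (\<lambda>i x. weight i \<otimes>\<^bsub>F\<^esub> x) cs \<one>\<^bsub>F\<^esub>" for k i cs
  proof (induction k)
    case (Suc k)
    then show ?case
      using cl[of cs] by (simp add: F.m_ac del: foldr_append)
  qed (use cl[of cs] in simp)
  have base: "foldr (\<lambda>i x. weight i \<otimes>\<^bsub>F\<^esub> x) (replicate k i) \<one>\<^bsub>F\<^esub> = weight i [^]\<^bsub>F\<^esub> k" for k i
    using rep[of k i "[]"] by (simp del: foldr_replicate)
  show ?thesis
    unfolding choices_def rep base by (simp add: weight_def)
qed

text \<open>The new stage. There are \<open>g\<^sup>2\<close> unknown coefficients, and their number exceeds the number of
  conditions for large \<open>g\<close>, because only the exponents \<open>j \<le> M = 2 g n\<close> matter. A nontrivial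
  solution has a nonzero generic value, because its coefficients become the coefficients of the
  different monomials in \<open>s\<close> and \<open>t\<close>. The last block is left untouched, so that the freedom
  of choosing among the weights \<open>1, s, t\<close> is inherited.\<close>

theorem stage_exists:
  assumes good: "good n G f" and l: "set l \<subseteq> carrier K \<times> {w :: nat list. w \<noteq> []}"
  shows "\<exists>n' G' f'. n < n' \<and> good n' G' f' \<and>
    (\<forall>Z cs. linear_closed K Z \<longrightarrow> (\<forall>bs. blocks K n G bs \<in> Z) \<longrightarrow> blocks K n' G' cs \<in> Z) \<and>
    (\<exists>N0. \<forall>N\<ge>N0. \<forall>bs u w. pow_eval K l N (\<lambda>m. blocks K n' G' bs (u @ m @ w)) = \<zero>\<^bsub>K\<^esub>)"
proof -
  interpret pp: poly_powers K l
    by unfold_locales (rule l)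
  have G: "G b w \<in> carrier K" "length w \<noteq> n \<Longrightarrow> G b w = \<zero>\<^bsub>K\<^esub>" for b w
    using goodD(2,3)[OF good] by blast+
  have n: "n > 0"
    by (rule goodD(1)[OF good])
  define U where "U = (\<Union>p\<in>set l. (\<lambda>i. drop i (snd p)) ` {..length (snd p)})"
  define V where "V = (\<Union>p\<in>set l. (\<lambda>i. take i (snd p)) ` {..length (snd p)})"
  have UV: "finite U" "finite V"
    by (auto simp: U_def V_def)
  define C where "C = card U * card V"
  define d where "d = Max (insert 0 ((\<lambda>p. length (snd p)) ` set l))"
  define g where "g = C * (2 * n + 1) + d + 1"
  define M where "M = 2 * g * n"
  have g: "g > 0" "C * (2 * n + 1) < g" "d < g"
    unfolding g_def by linarith+
  have long: "length (snd p) < M" if "p \<in> set l" for p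
  proof -
    have "length (snd p) \<le> d"
      unfolding d_def using that by (intro Max_ge) simp_all
    also have "\<dots> < g" by (rule g)
    also have "g \<le> M"
      using n by (simp add: M_def)
    finally show ?thesis .
  qed
  have M: "M > 0"
    using g n by (simp add: M_def)
  let ?I = "List.product [0..<g] [0..<g]"
  let ?blk = "\<lambda>\<pi> p. zip (chunks n (2 * g) \<pi>) (choices g p)"
  have blk: "length (?blk \<pi> p) = 2 * g" if "p \<in> set ?I" for \<pi> p
    using that by (auto simp: length_choices)
  let ?J = "(U \<times> V) \<times> {..M}"
  have "card ?J < length ?I"
  proof -
    have "card ?J = C * (2 * g * n + 1)"
      by (simp add: card_cartesian_product C_def M_def)
    also have "\<dots> \<le> C * (g * (2 * n + 1))"
      using g(1) by (intro mult_left_mono) (auto simp: algebra_simps)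
    also have "\<dots> = C * (2 * n + 1) * g"
      by (simp add: algebra_simps)
    also have "\<dots> < g * g"
      using g by (intro mult_strict_right_mono) auto
    also have "\<dots> = length ?I"
      by simp
    finally show ?thesis .
  qed
  let ?E = "\<lambda>\<pi> x p. pow_eval K l (snd x) (\<lambda>m. blocks K n G (?blk \<pi> p) (fst (fst x) @ m @ snd (fst x)))"
  have E: "?E \<pi> x p \<in> carrier K" for \<pi> x p
    by (rule pp.pow_eval_closed, rule KK.blocks_closed, rule G(1))
  define solves where "solves = (\<lambda>\<pi> c. (\<forall>p. c p \<in> carrier K) \<and> (\<exists>p\<in>set ?I. c p \<noteq> \<zero>\<^bsub>K\<^esub>) \<and>
      (\<forall>x\<in>?J. lsum K (\<lambda>p. c p \<otimes>\<^bsub>K\<^esub> ?E \<pi> x p) ?I = \<zero>\<^bsub>K\<^esub>))"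
  have "\<exists>c. solves \<pi> c" for \<pi>
    unfolding solves_def
  proof (rule KK.homogeneous_system[where M = "?E \<pi>" and I = ?I and J = ?J])
    show "finite ?J" using UV by simp
    show "distinct ?I" by (simp add: distinct_product)
  qed (rule \<open>card ?J < length ?I\<close>, rule E)
  then have some: "solves \<pi> (SOME c. solves \<pi> c)" for \<pi>
    by (rule someI_ex)
  define c where "c = (\<lambda>\<pi>. SOME c. solves \<pi> c)"
  have sol: "solves \<pi> (c \<pi>)" for \<pi>
    unfolding c_def by (rule some)
  have c: "\<And>\<pi> p. c \<pi> p \<in> carrier K" "\<And>\<pi>. \<exists>p\<in>set ?I. c \<pi> p \<noteq> \<zero>\<^bsub>K\<^esub>"
    "\<And>\<pi> x. x \<in> ?J \<Longrightarrow> lsum K (\<lambda>p. c \<pi> p \<otimes>\<^bsub>K\<^esub> ?E \<pi> x p) ?I = \<zero>\<^bsub>K\<^esub>"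
    using sol unfolding solves_def by blast+
  define kap where "kap = (\<lambda>\<pi> w. lsum K (\<lambda>p. c \<pi> p \<otimes>\<^bsub>K\<^esub> blocks K n G (?blk \<pi> p) w) ?I)"
  have B: "blocks K n G bs w \<in> carrier K" for bs w
    by (rule KK.blocks_closed) (rule G)
  have kap_closed: "kap \<pi> w \<in> carrier K" for \<pi> w
    unfolding kap_def using c B by (intro K.lsum_closed) auto
  have kap_length: "kap \<pi> w = \<zero>\<^bsub>K\<^esub>" if "length w \<noteq> M" for \<pi> w
    unfolding kap_def
  proof (rule K.lsum_zero)
    fix p assume "p \<in> set ?I"
    then have "blocks K n G (?blk \<pi> p) w = \<zero>\<^bsub>K\<^esub>"
      using that blk[of p \<pi>] by (intro KK.blocks_length) (auto simp: G M_def)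
    then show "c \<pi> p \<otimes>\<^bsub>K\<^esub> blocks K n G (?blk \<pi> p) w = \<zero>\<^bsub>K\<^esub>"
      using c by simp
  qed
  have kill: "pow_eval K l j (\<lambda>m. kap \<pi> (u @ m @ v)) = \<zero>\<^bsub>K\<^esub>" if uv: "u \<in> U" "v \<in> V" for u v j \<pi>
  proof (cases "j \<le> M")
    case True
    have "pow_eval K l j (\<lambda>m. kap \<pi> (u @ m @ v)) =
        lsum K (\<lambda>p. pow_eval K l j (\<lambda>m. c \<pi> p \<otimes>\<^bsub>K\<^esub> blocks K n G (?blk \<pi> p) (u @ m @ v))) ?I"
      unfolding kap_def using c B by (intro pp.pow_eval_lsum) auto
    also have "\<dots> = lsum K (\<lambda>p. c \<pi> p \<otimes>\<^bsub>K\<^esub> ?E \<pi> ((u, v), j) p) ?I"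
      using c B by (simp add: pp.pow_eval_smult)
    also have "\<dots> = \<zero>\<^bsub>K\<^esub>"
      by (rule c(3)) (use uv True in auto)
    finally show ?thesis .
  next
    case False
    then show ?thesis
      by (intro pp.pow_eval_zero kap_length) auto
  qed
  define G' where "G' = (\<lambda>b :: nat list \<times> nat. conv K M (kap (take M (fst b))) (G (drop M (fst b), snd b)))"
  interpret st: stage K l n M G G' "\<lambda>b. kap (take M (fst b))" "\<lambda>b. (drop M (fst b), snd b)" ?I
    "\<lambda>b. c (take M (fst b))" "\<lambda>b. ?blk (take M (fst b))" "2 * g"
  proof unfold_locales
    fix b :: "nat list \<times> nat" and p q i k j
    assume pq: "p \<in> set l" "q \<in> set l"
    have "drop i (snd p) \<in> U"
      using pq by (cases "i \<le> length (snd p)") (auto simp: U_def intro!: bexI[of _ p] image_eqI[where x = "min i (length (snd p))"])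
    moreover have "take k (snd q) \<in> V"
      using pq by (cases "k \<le> length (snd q)") (auto simp: V_def intro!: bexI[of _ q] image_eqI[where x = "min k (length (snd q))"])
    ultimately show "pow_eval K l j (\<lambda>m. kap (take M (fst b)) (drop i (snd p) @ m @ take k (snd q))) = \<zero>\<^bsub>K\<^esub>"
      by (rule kill)
  qed (use G c blk long M in \<open>auto simp: kap_def G'_def M_def\<close>)
  define q where "q = (\<lambda>\<pi>. lsum F (\<lambda>p. \<phi> (c \<pi> p) \<otimes>\<^bsub>F\<^esub> (s [^]\<^bsub>F\<^esub> fst p \<otimes>\<^bsub>F\<^esub> t [^]\<^bsub>F\<^esub> snd p)) ?I)"
  have q: "q \<pi> \<in> carrier F" "q \<pi> \<noteq> \<zero>\<^bsub>F\<^esub>" for \<pi>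
  proof -
    show "q \<pi> \<in> carrier F"
      unfolding q_def using c by (intro F.lsum_closed) auto
    show "q \<pi> \<noteq> \<zero>\<^bsub>F\<^esub>"
    proof
      assume "q \<pi> = \<zero>\<^bsub>F\<^esub>"
      then have "\<forall>p\<in>{..<g} \<times> {..<g}. c \<pi> p = \<zero>\<^bsub>K\<^esub>"
        using indep c(1) unfolding independent_pair_def q_def by blast
      then show False
        using c(2)[of \<pi>] by auto
    qed
  qed
  define h where "h = (\<lambda>\<pi>. foldr (\<lambda>\<pi> x. f \<pi> \<otimes>\<^bsub>F\<^esub> x) (chunks n (2 * g) \<pi>) \<one>\<^bsub>F\<^esub>)"
  have f: "f \<pi>' \<in> carrier F" "f \<pi>' \<noteq> \<zero>\<^bsub>F\<^esub>" if "length \<pi> = M" "\<pi>' \<in> set (chunks n (2 * g) \<pi>)" for \<pi> \<pi>'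
    using goodD(4,5)[OF good chunks_length[of \<pi> "2 * g" n \<pi>']] that by (auto simp: M_def)
  have h: "h \<pi> \<in> carrier F \<and> h \<pi> \<noteq> \<zero>\<^bsub>F\<^esub>" if "length \<pi> = M" for \<pi>
  proof -
    have "(\<And>\<pi>'. \<pi>' \<in> set xs \<Longrightarrow> f \<pi>' \<in> carrier F \<and> f \<pi>' \<noteq> \<zero>\<^bsub>F\<^esub>) \<Longrightarrow>
      foldr (\<lambda>\<pi> x. f \<pi> \<otimes>\<^bsub>F\<^esub> x) xs \<one>\<^bsub>F\<^esub> \<in> carrier F \<and> foldr (\<lambda>\<pi> x. f \<pi> \<otimes>\<^bsub>F\<^esub> x) xs \<one>\<^bsub>F\<^esub> \<noteq> \<zero>\<^bsub>F\<^esub>" for xs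
      by (induction xs) (auto simp: F.integral_iff)
    then show ?thesis
      unfolding h_def using f[OF that] by blast
  qed
  have Ev_kap: "Ev (\<lambda>w. \<phi> (kap \<pi> w)) \<rho> = (if \<rho> = \<pi> then h \<pi> \<otimes>\<^bsub>F\<^esub> q \<pi> else \<zero>\<^bsub>F\<^esub>)" if len: "length \<pi> = M" for \<pi> \<rho>
  proof -
    have "Ev (\<lambda>w. \<phi> (kap \<pi> w)) \<rho> = Ev (\<lambda>w. lsum F (\<lambda>p. \<phi> (c \<pi> p) \<otimes>\<^bsub>F\<^esub> \<phi> (blocks K n G (?blk \<pi> p) w)) ?I) \<rho>"
      unfolding kap_def using c B by (simp add: lsum_\<phi>)
    also have "\<dots> = lsum F (\<lambda>p. \<phi> (c \<pi> p) \<otimes>\<^bsub>F\<^esub> Ev (\<lambda>w. \<phi> (blocks K n G (?blk \<pi> p) w)) \<rho>) ?I"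
      using c B by (simp add: Ev_lsum Ev_smult)
    also have "\<dots> = lsum F (\<lambda>p. if \<rho> = \<pi> then h \<pi> \<otimes>\<^bsub>F\<^esub> (\<phi> (c \<pi> p) \<otimes>\<^bsub>F\<^esub> (s [^]\<^bsub>F\<^esub> fst p \<otimes>\<^bsub>F\<^esub> t [^]\<^bsub>F\<^esub> snd p)) else \<zero>\<^bsub>F\<^esub>) ?I"
    proof (rule lsum_cong)
      fix p assume p: "p \<in> set ?I"
      have lc: "length (chunks n (2 * g) \<pi>) = length (choices g p)"
        using p by (auto simp: length_choices)
      have "Ev (\<lambda>w. \<phi> (blocks K n G (?blk \<pi> p) w)) \<rho> = (if \<rho> = concat (map fst (?blk \<pi> p))
        then foldr (\<lambda>b x. (f (fst b) \<otimes>\<^bsub>F\<^esub> weight (snd b)) \<otimes>\<^bsub>F\<^esub> x) (?blk \<pi> p) \<one>\<^bsub>F\<^esub> else \<zero>\<^bsub>F\<^esub>)"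
      proof (rule Ev_blocks[OF good])
        fix b assume "b \<in> set (?blk \<pi> p)"
        then have "fst b \<in> set (chunks n (2 * g) \<pi>)" "snd b \<in> set (choices g p)"
          by (metis prod.collapse set_zip_leftD) (metis \<open>b \<in> set (?blk \<pi> p)\<close> prod.collapse set_zip_rightD)
        then show "length (fst b) = n \<and> snd b < 3"
          using chunks_length[of \<pi> "2 * g" n "fst b"] choices_less len by (auto simp: M_def)
      qed
      also have "map fst (?blk \<pi> p) = chunks n (2 * g) \<pi>"
        using lc by simp
      also have "concat (chunks n (2 * g) \<pi>) = \<pi>"
        using len by (simp add: chunks_concat M_def)
      also have "foldr (\<lambda>b x. (f (fst b) \<otimes>\<^bsub>F\<^esub> weight (snd b)) \<otimes>\<^bsub>F\<^esub> x) (?blk \<pi> p) \<one>\<^bsub>F\<^esub> =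
          h \<pi> \<otimes>\<^bsub>F\<^esub> (s [^]\<^bsub>F\<^esub> fst p \<otimes>\<^bsub>F\<^esub> t [^]\<^bsub>F\<^esub> snd p)"
        unfolding h_def foldr_choices[of g, symmetric] by (rule foldr_zip[OF lc]) (use f[OF len] in auto)
      finally show "\<phi> (c \<pi> p) \<otimes>\<^bsub>F\<^esub> Ev (\<lambda>w. \<phi> (blocks K n G (?blk \<pi> p) w)) \<rho> =
          (if \<rho> = \<pi> then h \<pi> \<otimes>\<^bsub>F\<^esub> (\<phi> (c \<pi> p) \<otimes>\<^bsub>F\<^esub> (s [^]\<^bsub>F\<^esub> fst p \<otimes>\<^bsub>F\<^esub> t [^]\<^bsub>F\<^esub> snd p)) else \<zero>\<^bsub>F\<^esub>)"
        using c(1)[of \<pi> p] h[OF len] by (auto simp: F.m_lcomm)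
    qed
    also have "\<dots> = (if \<rho> = \<pi> then h \<pi> \<otimes>\<^bsub>F\<^esub> q \<pi> else \<zero>\<^bsub>F\<^esub>)"
      unfolding q_def using c(1)[of \<pi>] h[OF len] by (simp add: F.lsum_rdistr F.lsum_zero)
    finally show ?thesis .
  qed
  define f' where "f' = (\<lambda>\<pi>. h (take M \<pi>) \<otimes>\<^bsub>F\<^esub> q (take M \<pi>) \<otimes>\<^bsub>F\<^esub> f (drop M \<pi>))"
  have "good (M + n) G' f'"
    unfolding good_def
  proof (intro conjI allI impI)
    fix \<pi> :: "nat list" assume len: "length \<pi> = M + n"
    have l1: "length (take M \<pi>) = M" "length (drop M \<pi>) = n"
      using len by auto
    have fd: "f (drop M \<pi>) \<in> carrier F" "f (drop M \<pi>) \<noteq> \<zero>\<^bsub>F\<^esub>"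
      using goodD(4,5)[OF good l1(2)] by blast+
    note hh = h[OF l1(1)]
    show "f' \<pi> \<in> carrier F" "f' \<pi> \<noteq> \<zero>\<^bsub>F\<^esub>"
      using hh fd q[of "take M \<pi>"] by (auto simp: f'_def F.integral_iff)
    fix i \<rho> assume i: "i < (3 :: nat)"
    have "Ev (\<lambda>w. \<phi> (G' (\<pi>, i) w)) \<rho> =
        Ev (\<lambda>w. \<phi> (kap (take M \<pi>) (take M w)) \<otimes>\<^bsub>F\<^esub> \<phi> (G (drop M \<pi>, i) (drop M w))) \<rho>"
      using kap_closed G by (simp add: G'_def conv_def)
    also have "\<dots> = Ev (\<lambda>w. \<phi> (kap (take M \<pi>) w)) (take M \<rho>) \<otimes>\<^bsub>F\<^esub> Ev (\<lambda>w. \<phi> (G (drop M \<pi>, i) w)) (drop M \<rho>)"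
      by (rule Ev_conv) (use kap_closed kap_length G in auto)
    also have "\<dots> = (if take M \<rho> = take M \<pi> then h (take M \<pi>) \<otimes>\<^bsub>F\<^esub> q (take M \<pi>) else \<zero>\<^bsub>F\<^esub>) \<otimes>\<^bsub>F\<^esub>
        (if drop M \<rho> = drop M \<pi> then f (drop M \<pi>) \<otimes>\<^bsub>F\<^esub> weight i else \<zero>\<^bsub>F\<^esub>)"
      by (simp only: Ev_kap[OF l1(1)] goodD(6)[OF good l1(2) i])
    also have "\<dots> = (if \<rho> = \<pi> then f' \<pi> \<otimes>\<^bsub>F\<^esub> weight i else \<zero>\<^bsub>F\<^esub>)"
    proof -
      have "\<rho> = \<pi> \<longleftrightarrow> take M \<rho> = take M \<pi> \<and> drop M \<rho> = drop M \<pi>"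
        by (metis append_take_drop_id)
      then show ?thesis
        using hh fd q[of "take M \<pi>"] by (auto simp: f'_def F.m_assoc)
    qed
    finally show "Ev (\<lambda>w. \<phi> (G' (\<pi>, i) w)) \<rho> = (if \<rho> = \<pi> then f' \<pi> \<otimes>\<^bsub>F\<^esub> weight i else \<zero>\<^bsub>F\<^esub>)" .
  qed (use M st.F'_closed st.F'_length in auto)
  moreover have "\<forall>Z cs. linear_closed K Z \<longrightarrow> (\<forall>bs. blocks K n G bs \<in> Z) \<longrightarrow> blocks K (M + n) G' cs \<in> Z"
    using st.blocks_transfer by blast
  moreover have "\<exists>N0. \<forall>N\<ge>N0. \<forall>bs u w. pow_eval K l N (\<lambda>m. blocks K (M + n) G' bs (u @ m @ w)) = \<zero>\<^bsub>K\<^esub>"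
    using st.blocks_dead by blast
  ultimately show ?thesis
    using M by (intro exI[of _ "M + n"] exI[of _ G'] exI[of _ f']) auto
qed

lemma first_stage:
  "good 1 (\<lambda>b w. if w = [3 * hd (fst b) + snd b] then \<one>\<^bsub>K\<^esub> else \<zero>\<^bsub>K\<^esub>) (\<lambda>_. \<one>\<^bsub>F\<^esub>)"
  unfolding good_def
proof (intro conjI allI impI)
  fix \<pi> \<rho> :: "nat list" and i :: nat assume "length \<pi> = 1" and i: "i < 3"
  then obtain k where pi: "\<pi> = [k]"
    by (auto simp: length_Suc_conv)
  let ?g = "\<lambda>w. \<phi> (if w = [3 * hd (fst (\<pi>, i)) + snd (\<pi>, i)] then \<one>\<^bsub>K\<^esub> else \<zero>\<^bsub>K\<^esub>)"
  show "Ev ?g \<rho> = (if \<rho> = \<pi> then \<one>\<^bsub>F\<^esub> \<otimes>\<^bsub>F\<^esub> weight i else \<zero>\<^bsub>F\<^esub>)"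
  proof (cases "length \<rho> = 1")
    case True
    then obtain k' where rho: "\<rho> = [k']"
      by (auto simp: length_Suc_conv)
    have digit: "[3 * k' + j] = [3 * k + i] \<longleftrightarrow> k' = k \<and> j = i" if "j < 3" for j
    proof
      assume "[3 * k' + j] = [3 * k + i]"
      then have e: "3 * k' + j = 3 * k + i" by simp
      have "(3 * k' + j) div 3 = k'" "(3 * k' + j) mod 3 = j" "(3 * k + i) div 3 = k" "(3 * k + i) mod 3 = i"
        using that i by auto
      then show "k' = k \<and> j = i" using e by metis
    qed simp
    have "Ev ?g \<rho> = lsum F (\<lambda>j. weight j \<otimes>\<^bsub>F\<^esub> \<phi> (if [3 * k' + j] = [3 * k + i] then \<one>\<^bsub>K\<^esub> else \<zero>\<^bsub>K\<^esub>)) [0, 1, 2]"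
      by (simp only: rho pi generic_eval.simps fst_conv snd_conv list.sel)
    also have "\<dots> = lsum F (\<lambda>j. if j = i then if k' = k then weight i else \<zero>\<^bsub>F\<^esub> else \<zero>\<^bsub>F\<^esub>) [0, 1, 2]"
    proof (rule lsum_cong)
      fix j assume "j \<in> set [0 :: nat, 1, 2]"
      then have "j < 3" by auto
      then show "weight j \<otimes>\<^bsub>F\<^esub> \<phi> (if [3 * k' + j] = [3 * k + i] then \<one>\<^bsub>K\<^esub> else \<zero>\<^bsub>K\<^esub>) =
          (if j = i then if k' = k then weight i else \<zero>\<^bsub>F\<^esub> else \<zero>\<^bsub>F\<^esub>)"
        unfolding digit[OF \<open>j < 3\<close>] by simp
    qed
    also have "\<dots> = (if k' = k then weight i else \<zero>\<^bsub>F\<^esub>)"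
    proof -
      consider "i = 0" | "i = 1" | "i = 2"
        using i by linarith
      then show ?thesis
        by cases simp_all
    qed
    finally show ?thesis
      by (simp add: rho pi)
  next
    case False
    then show ?thesis
      using pi by (subst Ev_zero) auto
  qed
qed auto

text \<open>The stages treat the polynomials one after the other. For a functional of a stage \<open>k' \<le> k\<close> the power of the \<open>k\<close>-th
  polynomial vanishes for reasons of degree, for those of later stages by the choice of the \<open>k\<close>-th stage.\<close>

theorem functionals_exist:
  assumes ls: "\<And>k :: nat. set (ls k) \<subseteq> carrier K \<times> {w :: nat list. w \<noteq> []}"
  shows "\<exists>\<Lambda> :: nat \<Rightarrow> nat list \<Rightarrow> nat list \<Rightarrow> 'a. (\<forall>k \<pi> w. \<Lambda> k \<pi> w \<in> carrier K) \<and>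
    (\<forall>k. \<exists>N>0. \<forall>k' \<pi> u w. pow_eval K (ls k) N (\<lambda>m. \<Lambda> k' \<pi> (u @ m @ w)) = \<zero>\<^bsub>K\<^esub>) \<and>
    (\<forall>d. \<exists>k n. n \<ge> d \<and> (\<forall>\<pi>. length \<pi> = n \<longrightarrow> (\<exists>e\<in>carrier F. e \<noteq> \<zero>\<^bsub>F\<^esub> \<and>
      (\<forall>\<rho>. Ev (\<lambda>w. \<phi> (\<Lambda> k \<pi> w)) \<rho> = (if \<rho> = \<pi> then e else \<zero>\<^bsub>F\<^esub>)))))"
proof -
  let ?good = "\<lambda>x. good (fst x) (fst (snd x)) (snd (snd x))"
  let ?step = "\<lambda>k x y. fst x < fst y \<and>
    (\<forall>Z cs. linear_closed K Z \<longrightarrow> (\<forall>bs. blocks K (fst x) (fst (snd x)) bs \<in> Z) \<longrightarrow>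
      blocks K (fst y) (fst (snd y)) cs \<in> Z) \<and>
    (\<exists>N0. \<forall>N\<ge>N0. \<forall>bs u w. pow_eval K (ls k) N (\<lambda>m. blocks K (fst y) (fst (snd y)) bs (u @ m @ w)) = \<zero>\<^bsub>K\<^esub>)"
  have "\<exists>X. \<forall>k. ?good (X k) \<and> ?step k (X k) (X (Suc k))"
  proof (rule dependent_nat_choice)
    show "\<exists>x. ?good x"
      using first_stage by (intro exI[of _ "(_, _, _)"]) simp
    show "\<exists>y. ?good y \<and> ?step k x y" if x: "?good x" for x k
    proof -
      obtain n' G' f' where st: "fst x < n'" "good n' G' f'"
        "\<forall>Z cs. linear_closed K Z \<longrightarrow> (\<forall>bs. blocks K (fst x) (fst (snd x)) bs \<in> Z) \<longrightarrow> blocks K n' G' cs \<in> Z"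
        "\<exists>N0. \<forall>N\<ge>N0. \<forall>bs u w. pow_eval K (ls k) N (\<lambda>m. blocks K n' G' bs (u @ m @ w)) = \<zero>\<^bsub>K\<^esub>"
        using stage_exists[OF x ls[of k]] by metis
      have "?good (n', G', f') \<and> ?step k x (n', G', f')"
        unfolding fst_conv snd_conv by (rule conjI[OF st(2) conjI[OF st(1) conjI[OF st(3) st(4)]]])
      then show ?thesis by (rule exI[where P = "\<lambda>y. ?good y \<and> ?step k x y"])
    qed
  qed
  then obtain X where XX: "\<forall>k. ?good (X k) \<and> ?step k (X k) (X (Suc k))"
    by (rule exE)
  have X1: "?good (X k)" for k
    by (rule conjunct1[OF spec[OF XX]])
  have X2: "?step k (X k) (X (Suc k))" for k
    by (rule conjunct2[OF spec[OF XX]])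
  define n where "n = (\<lambda>k. fst (X k))"
  define G where "G = (\<lambda>k. fst (snd (X k)))"
  define f where "f = (\<lambda>k. snd (snd (X k)))"
  have good: "good (n k) (G k) (f k)" for k
    unfolding n_def G_def f_def by (rule X1)
  have GK: "G k b w \<in> carrier K" "length w \<noteq> n k \<Longrightarrow> G k b w = \<zero>\<^bsub>K\<^esub>" for k b w
    using goodD(2,3)[OF good[of k]] by blast+
  have less: "n k < n (Suc k)" for k
    using conjunct1[OF X2[of k]] unfolding n_def .
  have closed: "blocks K (n (Suc k)) (G (Suc k)) cs \<in> Z"
    if "linear_closed K Z" "\<And>bs. blocks K (n k) (G k) bs \<in> Z" for k Z cs
    using conjunct1[OF conjunct2[OF X2[of k]]] that unfolding n_def G_def by blast
  have late: "\<exists>N0. \<forall>N\<ge>N0. \<forall>bs u w. pow_eval K (ls k) N (\<lambda>m. blocks K (n (Suc k)) (G (Suc k)) bs (u @ m @ w)) = \<zero>\<^bsub>K\<^esub>" for k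
    using conjunct2[OF conjunct2[OF X2[of k]]] unfolding n_def G_def .
  have transfer: "blocks K (n k') (G k') cs \<in> Z"
    if "linear_closed K Z" "\<And>bs. blocks K (n k) (G k) bs \<in> Z" "k \<le> k'" for Z k k' cs
    using that(3)
  proof (induction arbitrary: cs rule: dec_induct)
    case base
    then show ?case by (rule that(2))
  next
    case (step m)
    show ?case
      by (rule closed[OF that(1) step.IH])
  qed
  define \<Lambda> where "\<Lambda> = (\<lambda>k \<pi>. G k (\<pi>, 0))"
  have dead: "\<exists>N>0. \<forall>k' \<pi> u w. pow_eval K (ls k) N (\<lambda>m. \<Lambda> k' \<pi> (u @ m @ w)) = \<zero>\<^bsub>K\<^esub>" for k
  proof -
    interpret pp: poly_powers K "ls k"
      by unfold_locales (rule ls)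
    obtain N0 where N0: "\<And>N bs u w. N \<ge> N0 \<Longrightarrow>
        pow_eval K (ls k) N (\<lambda>m. blocks K (n (Suc k)) (G (Suc k)) bs (u @ m @ w)) = \<zero>\<^bsub>K\<^esub>"
      using late[of k] by blast
    define N where "N = Max (insert N0 (n ` {..k})) + 1"
    have N: "N > 0" "N \<ge> N0" "k' \<le> k \<Longrightarrow> n k' < N" for k'
    proof -
      show "N > 0" by (simp add: N_def)
      have "N0 \<le> Max (insert N0 (n ` {..k}))" by (rule Max_ge) simp_all
      then show "N \<ge> N0" by (simp add: N_def)
      assume "k' \<le> k"
      then have "n k' \<le> Max (insert N0 (n ` {..k}))" by (intro Max_ge) simp_all
      then show "n k' < N" by (simp add: N_def)
    qed
    have "pow_eval K (ls k) N (\<lambda>m. \<Lambda> k' \<pi> (u @ m @ w)) = \<zero>\<^bsub>K\<^esub>" for k' \<pi> u w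
    proof (cases "k' \<le> k")
      case True
      show ?thesis
      proof (rule pp.pow_eval_zero)
        fix m :: "nat list" assume "length m \<ge> N"
        then have "length (u @ m @ w) \<noteq> n k'"
          using N(3)[OF True] by simp
        then show "\<Lambda> k' \<pi> (u @ m @ w) = \<zero>\<^bsub>K\<^esub>"
          unfolding \<Lambda>_def by (rule GK(2))
      qed
    next
      case False
      define Z where "Z = {g. (\<forall>w. g w \<in> carrier K) \<and>
        (\<forall>u w. pow_eval K (ls k) N (\<lambda>m. g (u @ m @ w)) = \<zero>\<^bsub>K\<^esub>)}"
      have Z: "linear_closed K Z"
        unfolding linear_closed_def Z_def
        by (auto simp: pp.pow_eval_zero pp.pow_eval_add pp.pow_eval_smult)
      have "blocks K (n (Suc k)) (G (Suc k)) bs \<in> Z" for bs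
        unfolding Z_def using N0[OF N(2)] KK.blocks_closed[of "G (Suc k)", OF GK(1)] by blast
      then have "blocks K (n k') (G k') [(\<pi>, 0)] \<in> Z"
        by (rule transfer[OF Z]) (use False in simp)
      moreover have "blocks K (n k') (G k') [(\<pi>, 0)] v = \<Lambda> k' \<pi> v" for v
        using GK(1)[of k'] GK(2)[of v k'] GK(2)[of "take (n k') v" k']
        by (cases "length v \<le> n k'") (auto simp: conv_def \<Lambda>_def)
      ultimately show ?thesis
        by (simp add: Z_def)
    qed
    then show ?thesis
      using N(1) by blast
  qed
  have "k \<le> n k" for k
  proof (induction k)
    case (Suc k)
    then show ?case
      using less[of k] by linarith
  qed simp
  moreover have "\<exists>e\<in>carrier F. e \<noteq> \<zero>\<^bsub>F\<^esub> \<and> (\<forall>\<rho>. Ev (\<lambda>w. \<phi> (\<Lambda> k \<pi> w)) \<rho> = (if \<rho> = \<pi> then e else \<zero>\<^bsub>F\<^esub>))"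
    if "length \<pi> = n k" for k \<pi>
  proof (rule bexI[of _ "f k \<pi>"])
    show "f k \<pi> \<in> carrier F"
      by (rule goodD(4)[OF good that])
    show "f k \<pi> \<noteq> \<zero>\<^bsub>F\<^esub> \<and> (\<forall>\<rho>. Ev (\<lambda>w. \<phi> (\<Lambda> k \<pi> w)) \<rho> = (if \<rho> = \<pi> then f k \<pi> else \<zero>\<^bsub>F\<^esub>))"
      using goodD(4,5)[OF good that] goodD(6)[OF good that, of 0] by (simp add: \<Lambda>_def weight_def)
  qed
  ultimately have free: "\<exists>k n. n \<ge> d \<and> (\<forall>\<pi>. length \<pi> = n \<longrightarrow> (\<exists>e\<in>carrier F. e \<noteq> \<zero>\<^bsub>F\<^esub> \<and>
      (\<forall>\<rho>. Ev (\<lambda>w. \<phi> (\<Lambda> k \<pi> w)) \<rho> = (if \<rho> = \<pi> then e else \<zero>\<^bsub>F\<^esub>))))" for d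
    by (intro exI[of _ d] exI[of _ "n d"] conjI) blast+
  show ?thesis
  proof (intro exI[of _ \<Lambda>] conjI allI)
    show "\<Lambda> k \<pi> w \<in> carrier K" for k \<pi> w
      unfolding \<Lambda>_def by (rule GK(1))
  qed (rule dead, rule free)
qed

end


section \<open>The algebra\<close>

text \<open>Polynomials without constant term are identified when the functionals \<open>\<Lambda> j\<close>, shifted on both sides, do not
  distinguish them. They are stored as lists of coefficients and words.\<close>

locale functional_algebra = field_ext K F \<phi> for K :: "'k ring" and F :: "'f ring" and \<phi> :: "'k \<Rightarrow> 'f" +
  fixes \<Lambda> :: "nat \<times> nat list \<Rightarrow> nat list \<Rightarrow> 'k" and \<alpha> \<beta> :: 'k
  assumes \<Lambda> [simp]: "\<Lambda> j w \<in> carrier K" and ab: "\<alpha> \<in> carrier K" "\<beta> \<in> carrier K"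
begin

definition polys :: "('k \<times> nat list) list set" where
  "polys = {l. set l \<subseteq> carrier K \<times> {w. w \<noteq> []}}"

definition val :: "('k \<times> nat list) list \<Rightarrow> (nat \<times> nat list) \<times> nat list \<times> nat list \<Rightarrow> 'k" where
  "val l i = lsum K (\<lambda>p. fst p \<otimes>\<^bsub>K\<^esub> \<Lambda> (fst i) (fst (snd i) @ snd p @ snd (snd i))) l"

definition rels :: "('k \<times> nat list) list set" where
  "rels = {l \<in> polys. \<forall>i. val l i = \<zero>\<^bsub>K\<^esub>}"

definition S :: "(nat list \<Rightarrow> 'f) set" where
  "S = {g. (\<forall>w. g w \<in> carrier F) \<and> (\<forall>l\<in>rels. lsum F (\<lambda>p. \<phi> (fst p) \<otimes>\<^bsub>F\<^esub> g (snd p)) l = \<zero>\<^bsub>F\<^esub>)}"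

lemma coeff: "l \<in> polys \<Longrightarrow> p \<in> set l \<Longrightarrow> fst p \<in> carrier K" "l \<in> polys \<Longrightarrow> p \<in> set l \<Longrightarrow> snd p \<noteq> []"
  unfolding polys_def by (cases p, auto)+

lemma polysD: "l \<in> polys \<Longrightarrow> set l \<subseteq> carrier K \<times> {w. w \<noteq> []}"
  by (simp add: polys_def)

lemma val_closed: "l \<in> polys \<Longrightarrow> val l i \<in> carrier K"
  unfolding val_def by (rule K.lsum_closed) (simp add: coeff)

lemma rels_polys: "l \<in> rels \<Longrightarrow> l \<in> polys"
  by (simp add: rels_def)

lemma rels_val: "l \<in> rels \<Longrightarrow> val l i = \<zero>\<^bsub>K\<^esub>"
  unfolding rels_def by blast

lemma rels_left: "l \<in> rels \<Longrightarrow> map (\<lambda>p. (fst p, x # snd p)) l \<in> rels"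
proof -
  assume l: "l \<in> rels"
  have "val (map (\<lambda>p. (fst p, x # snd p)) l) i = val l (fst i, fst (snd i) @ [x], snd (snd i))" for i
    by (simp add: val_def lsum_map)
  then have "val (map (\<lambda>p. (fst p, x # snd p)) l) i = \<zero>\<^bsub>K\<^esub>" for i
    by (simp only: rels_val[OF l])
  moreover have "map (\<lambda>p. (fst p, x # snd p)) l \<in> polys"
    using rels_polys[OF l] by (auto simp: polys_def)
  ultimately show ?thesis
    unfolding rels_def by blast
qed

lemma rels_right: "l \<in> rels \<Longrightarrow> map (\<lambda>p. (fst p, snd p @ v)) l \<in> rels"
proof -
  assume l: "l \<in> rels"
  have "val (map (\<lambda>p. (fst p, snd p @ v)) l) i = val l (fst i, fst (snd i), v @ snd (snd i))" for i
    by (simp add: val_def lsum_map)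
  then have "val (map (\<lambda>p. (fst p, snd p @ v)) l) i = \<zero>\<^bsub>K\<^esub>" for i
    by (simp only: rels_val[OF l])
  moreover have "map (\<lambda>p. (fst p, snd p @ v)) l \<in> polys"
    using rels_polys[OF l] by (auto simp: polys_def)
  ultimately show ?thesis
    unfolding rels_def by blast
qed

lemma S_range: "g \<in> S \<Longrightarrow> g w \<in> carrier F"
  by (simp add: S_def)

lemma S_rels: "g \<in> S \<Longrightarrow> l \<in> rels \<Longrightarrow> lsum F (\<lambda>p. \<phi> (fst p) \<otimes>\<^bsub>F\<^esub> g (snd p)) l = \<zero>\<^bsub>F\<^esub>"
  by (simp add: S_def)

lemma SI:
  assumes "\<And>w. g w \<in> carrier F" "\<And>l. l \<in> rels \<Longrightarrow> lsum F (\<lambda>p. \<phi> (fst p) \<otimes>\<^bsub>F\<^esub> g (snd p)) l = \<zero>\<^bsub>F\<^esub>"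
  shows "g \<in> S"
  unfolding S_def using assms by blast

lemma S_shift: "g \<in> S \<Longrightarrow> (\<lambda>v. g (x # v)) \<in> S"
proof (rule SI)
  fix l assume g: "g \<in> S" and l: "l \<in> rels"
  show "lsum F (\<lambda>p. \<phi> (fst p) \<otimes>\<^bsub>F\<^esub> g (x # snd p)) l = \<zero>\<^bsub>F\<^esub>"
    using S_rels[OF g rels_left[OF l, of x]] by (simp add: lsum_map)
qed (rule S_range)

lemma lsum_val:
  assumes "l \<in> polys"
  shows "lsum F (\<lambda>p. \<phi> (fst p) \<otimes>\<^bsub>F\<^esub> \<phi> (\<Lambda> j (u @ snd p @ v))) l = \<phi> (val l (j, u, v))"
proof -
  have "\<phi> (val l (j, u, v)) = lsum F (\<lambda>p. \<phi> (fst p \<otimes>\<^bsub>K\<^esub> \<Lambda> j (u @ snd p @ v))) l"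
    unfolding val_def fst_conv snd_conv by (rule lsum_\<phi>) (simp add: coeff[OF assms])
  also have "\<dots> = lsum F (\<lambda>p. \<phi> (fst p) \<otimes>\<^bsub>F\<^esub> \<phi> (\<Lambda> j (u @ snd p @ v))) l"
    by (rule lsum_cong) (simp add: coeff[OF assms])
  finally show ?thesis by simp
qed

lemma functional_in_S: "(\<lambda>w. \<phi> (\<Lambda> j (u @ w))) \<in> S"
proof (rule SI)
  fix l assume l: "l \<in> rels"
  show "lsum F (\<lambda>p. \<phi> (fst p) \<otimes>\<^bsub>F\<^esub> \<phi> (\<Lambda> j (u @ snd p))) l = \<zero>\<^bsub>F\<^esub>"
    using lsum_val[OF rels_polys[OF l], of j u "[]"] rels_val[OF l] by simp
qed simp

sublocale FS: function_space K F \<phi> S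
proof
  show "g \<in> S \<Longrightarrow> g x \<in> carrier F" for g x
    by (rule S_range)
  show "(\<lambda>x. \<zero>\<^bsub>F\<^esub>) \<in> S"
  proof (rule SI)
    fix l assume l: "l \<in> rels"
    show "lsum F (\<lambda>p. \<phi> (fst p) \<otimes>\<^bsub>F\<^esub> \<zero>\<^bsub>F\<^esub>) l = \<zero>\<^bsub>F\<^esub>"
      by (rule F.lsum_zero) (simp add: coeff[OF rels_polys[OF l]])
  qed simp
  show "(\<lambda>x. g x \<oplus>\<^bsub>F\<^esub> h x) \<in> S" if g: "g \<in> S" and h: "h \<in> S" for g h
  proof (rule SI)
    fix l assume l: "l \<in> rels"
    note c = coeff(1)[OF rels_polys[OF l]]
    have "lsum F (\<lambda>p. \<phi> (fst p) \<otimes>\<^bsub>F\<^esub> (g (snd p) \<oplus>\<^bsub>F\<^esub> h (snd p))) l =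
        lsum F (\<lambda>p. \<phi> (fst p) \<otimes>\<^bsub>F\<^esub> g (snd p) \<oplus>\<^bsub>F\<^esub> \<phi> (fst p) \<otimes>\<^bsub>F\<^esub> h (snd p)) l"
      by (rule lsum_cong) (simp add: F.r_distr c S_range[OF g] S_range[OF h])
    also have "\<dots> = lsum F (\<lambda>p. \<phi> (fst p) \<otimes>\<^bsub>F\<^esub> g (snd p)) l \<oplus>\<^bsub>F\<^esub> lsum F (\<lambda>p. \<phi> (fst p) \<otimes>\<^bsub>F\<^esub> h (snd p)) l"
      by (rule F.lsum_add) (simp_all add: c S_range[OF g] S_range[OF h])
    finally show "lsum F (\<lambda>p. \<phi> (fst p) \<otimes>\<^bsub>F\<^esub> (g (snd p) \<oplus>\<^bsub>F\<^esub> h (snd p))) l = \<zero>\<^bsub>F\<^esub>"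
      by (simp add: S_rels[OF g l] S_rels[OF h l])
  qed (simp add: S_range[OF g] S_range[OF h])
  show "(\<lambda>x. a \<otimes>\<^bsub>F\<^esub> g x) \<in> S" if a: "a \<in> carrier F" and g: "g \<in> S" for a g
  proof (rule SI)
    fix l assume l: "l \<in> rels"
    note c = coeff(1)[OF rels_polys[OF l]]
    have "lsum F (\<lambda>p. \<phi> (fst p) \<otimes>\<^bsub>F\<^esub> (a \<otimes>\<^bsub>F\<^esub> g (snd p))) l =
        lsum F (\<lambda>p. a \<otimes>\<^bsub>F\<^esub> (\<phi> (fst p) \<otimes>\<^bsub>F\<^esub> g (snd p))) l"
      by (rule lsum_cong) (simp add: F.m_lcomm c a S_range[OF g])
    also have "\<dots> = a \<otimes>\<^bsub>F\<^esub> lsum F (\<lambda>p. \<phi> (fst p) \<otimes>\<^bsub>F\<^esub> g (snd p)) l"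
      by (rule F.lsum_rdistr[symmetric]) (simp_all add: c a S_range[OF g])
    finally show "lsum F (\<lambda>p. \<phi> (fst p) \<otimes>\<^bsub>F\<^esub> (a \<otimes>\<^bsub>F\<^esub> g (snd p))) l = \<zero>\<^bsub>F\<^esub>"
      by (simp add: S_rels[OF g l] a)
  qed (simp add: a S_range[OF g])
qed

lemma \<xi>_closed: "left_quotient S x \<in> carrier FS.E"
  by (auto simp: FS.operators_simps left_quotient_def S_shift)

lemma word_eval_\<xi>: "w \<noteq> [] \<Longrightarrow> g \<in> S \<Longrightarrow> word_eval FS.E (left_quotient S) w g = (\<lambda>v. g (w @ v))"
  by (induction w arbitrary: g rule: induct_list012) (auto simp: FS.operators_simps(2) left_quotient_def S_shift)

definition act :: "('k \<times> nat list) list \<Rightarrow> (nat list \<Rightarrow> 'f) \<Rightarrow> nat list \<Rightarrow> 'f" where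
  "act l = lcomb FS.E (word_eval FS.E (left_quotient S)) l"

lemma word_closed: "word_eval FS.E (left_quotient S) w \<in> carrier FS.E"
  by (rule FS.E.word_eval_closed) (rule \<xi>_closed)

lemma act_closed: "l \<in> polys \<Longrightarrow> act l \<in> carrier FS.E"
  unfolding act_def by (rule FS.E.lcomb_closed) (erule polysD, rule word_closed)

lemma act_eval:
  assumes l: "l \<in> polys" and g: "g \<in> S"
  shows "act l g v = lsum F (\<lambda>p. \<phi> (fst p) \<otimes>\<^bsub>F\<^esub> g (snd p @ v)) l"
proof -
  have "act l g v = lsum F (\<lambda>p. \<phi> (fst p) \<otimes>\<^bsub>F\<^esub> word_eval FS.E (left_quotient S) (snd p) g v) l"
    unfolding act_def by (rule FS.lcomb_operator[OF polysD[OF l] _ g]) (rule word_closed)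
  also have "\<dots> = lsum F (\<lambda>p. \<phi> (fst p) \<otimes>\<^bsub>F\<^esub> g (snd p @ v)) l"
    by (rule lsum_cong) (simp add: word_eval_\<xi>[OF coeff(2)[OF l] g])
  finally show ?thesis .
qed

lemma act_append: "l \<in> polys \<Longrightarrow> l' \<in> polys \<Longrightarrow> act (l @ l') = act l \<oplus>\<^bsub>FS.E\<^esub> act l'"
  unfolding act_def by (rule FS.E.lcomb_append) (erule polysD, erule polysD, rule word_closed)

lemma act_scl: "c \<in> carrier K \<Longrightarrow> l \<in> polys \<Longrightarrow> act (scl K c l) = c \<odot>\<^bsub>FS.E\<^esub> act l"
  unfolding act_def by (rule FS.E.lcomb_scl) (assumption, erule polysD, rule word_closed)

lemma act_lprod:
  assumes "l \<in> polys" "l' \<in> polys"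
  shows "act (lprod K (@) l l') = act l \<otimes>\<^bsub>FS.E\<^esub> act l'"
  unfolding act_def
proof (rule FS.E.lcomb_lprod[OF polysD[OF assms(1)] polysD[OF assms(2)]])
  show "word_eval FS.E (left_quotient S) (x @ y) =
      word_eval FS.E (left_quotient S) x \<otimes>\<^bsub>FS.E\<^esub> word_eval FS.E (left_quotient S) y"
    if "x \<in> {w. w \<noteq> []}" "y \<in> {w. w \<noteq> []}" for x y
    by (rule FS.E.word_eval_append) (use that \<xi>_closed in simp_all)
qed (rule word_closed)+

lemma polys_nil: "[] \<in> polys"
  by (simp add: polys_def)

lemma polys_append: "l \<in> polys \<Longrightarrow> l' \<in> polys \<Longrightarrow> l @ l' \<in> polys"
  by (simp add: polys_def)

lemma polys_scl: "c \<in> carrier K \<Longrightarrow> l \<in> polys \<Longrightarrow> scl K c l \<in> polys"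
  unfolding polys_def using K.scl_set[of c l "{w. w \<noteq> []}"] by blast

lemma polys_lprod: "l \<in> polys \<Longrightarrow> l' \<in> polys \<Longrightarrow> lprod K (@) l l' \<in> polys"
  unfolding polys_def
  using K.lprod_set[of l "{w. w \<noteq> []}" l' "{w. w \<noteq> []}" "(@)" "{w. w \<noteq> []}"] by simp

lemma val_append: "l \<in> polys \<Longrightarrow> l' \<in> polys \<Longrightarrow> val (l @ l') i = val l i \<oplus>\<^bsub>K\<^esub> val l' i"
  unfolding val_def by (rule K.lsum_append) (auto dest: coeff(1))

lemma val_scl:
  assumes c: "c \<in> carrier K" and l: "l \<in> polys"
  shows "val (scl K c l) i = c \<otimes>\<^bsub>K\<^esub> val l i"
proof -
  let ?G = "\<lambda>p. \<Lambda> (fst i) (fst (snd i) @ snd p @ snd (snd i))"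
  have "val (scl K c l) i = lsum K (\<lambda>p. c \<otimes>\<^bsub>K\<^esub> fst p \<otimes>\<^bsub>K\<^esub> ?G p) l"
    by (simp add: val_def scl_def lsum_map)
  also have "\<dots> = lsum K (\<lambda>p. c \<otimes>\<^bsub>K\<^esub> (fst p \<otimes>\<^bsub>K\<^esub> ?G p)) l"
    by (rule lsum_cong) (simp add: K.m_assoc c coeff[OF l])
  also have "\<dots> = c \<otimes>\<^bsub>K\<^esub> val l i"
    unfolding val_def by (rule K.lsum_rdistr[symmetric]) (simp_all add: c coeff[OF l])
  finally show ?thesis .
qed

lemma act_functional: "l \<in> polys \<Longrightarrow> act l (\<lambda>w. \<phi> (\<Lambda> j (u @ w))) v = \<phi> (val l (j, u, v))"
  by (simp only: act_eval[OF _ functional_in_S] lsum_val)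

lemma act_rels: "l \<in> rels \<Longrightarrow> act l = \<zero>\<^bsub>FS.E\<^esub>"
proof (rule FS.operator_eqI)
  assume l: "l \<in> rels"
  show "act l \<in> extensional S"
    using act_closed[OF rels_polys[OF l]] by (simp add: FS.operators_simps(1))
  show "\<zero>\<^bsub>FS.E\<^esub> \<in> extensional S"
    by (simp add: FS.operators_simps(3))
  fix g v assume g: "g \<in> S"
  have "act l g v = \<zero>\<^bsub>F\<^esub>"
    using S_rels[OF g rels_right[OF l, of v]] by (simp add: lsum_map act_eval[OF rels_polys[OF l] g])
  then show "act l g v = \<zero>\<^bsub>FS.E\<^esub> g v"
    using g by (simp add: FS.operators_simps(3))
qed

text \<open>The action is faithful, for every \<open>F\<close>: the functionals themselves are among the functions acted upon.\<close>

lemma act_eq_iff: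
  assumes l: "l \<in> polys" "l' \<in> polys"
  shows "act l = act l' \<longleftrightarrow> (\<forall>i. val l i = val l' i)"
proof
  assume eq: "act l = act l'"
  show "\<forall>i. val l i = val l' i"
  proof
    fix i :: "(nat \<times> nat list) \<times> nat list \<times> nat list"
    obtain j u v where i: "i = (j, u, v)"
      by (cases i) auto
    have "\<phi> (val l i) = \<phi> (val l' i)"
      using act_functional[OF l(1), of j u v] act_functional[OF l(2), of j u v] eq i by simp
    then have "\<phi> (val l i \<oplus>\<^bsub>K\<^esub> \<ominus>\<^bsub>K\<^esub> val l' i) = \<zero>\<^bsub>F\<^esub>"
      using val_closed[OF l(1), of i] val_closed[OF l(2), of i] by (simp add: F.r_neg)
    then have "val l i \<oplus>\<^bsub>K\<^esub> \<ominus>\<^bsub>K\<^esub> val l' i = \<zero>\<^bsub>K\<^esub>"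
      using val_closed[OF l(1), of i] val_closed[OF l(2), of i] by (intro \<phi>_eq_zero) simp_all
    then show "val l i = val l' i"
      using val_closed[OF l(1), of i] val_closed[OF l(2), of i]
      by (metis K.add.inv_closed K.add.inv_inv K.minus_equality K.a_comm)
  qed
next
  assume eq: "\<forall>i. val l i = val l' i"
  let ?m = "scl K (\<ominus>\<^bsub>K\<^esub> \<one>\<^bsub>K\<^esub>) l'"
  have m: "?m \<in> polys"
    by (rule polys_scl) (simp_all add: l)
  have "val l i = val l' i" for i
    using eq by blast
  then have "val (l @ ?m) i = \<zero>\<^bsub>K\<^esub>" for i
    using val_closed[OF l(2), of i] by (simp add: val_append[OF l(1) m] val_scl l K.l_minus K.r_neg)
  then have "l @ ?m \<in> rels"
    unfolding rels_def using polys_append[OF l(1) m] by blast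
  then have "act l \<oplus>\<^bsub>FS.E\<^esub> act ?m = \<zero>\<^bsub>FS.E\<^esub>"
    using act_rels act_append[OF l(1) m] by simp
  moreover have "act ?m = \<ominus>\<^bsub>FS.E\<^esub> act l'"
    using act_closed[OF l(2)] by (simp add: act_scl l FS.E.smult_l_minus)
  ultimately have "act l \<oplus>\<^bsub>FS.E\<^esub> \<ominus>\<^bsub>FS.E\<^esub> act l' = \<zero>\<^bsub>FS.E\<^esub>"
    by simp
  then show "act l = act l'"
    using act_closed[OF l(1)] act_closed[OF l(2)]
    by (metis FS.E.M.add.inv_closed FS.E.M.add.inv_inv FS.E.M.minus_equality FS.E.M.a_comm)
qed

text \<open>The class of a list is encoded by the values of all functionals, through an enumeration of their indices.\<close>

definition cls :: "('k \<times> nat list) list \<Rightarrow> (nat list \<Rightarrow> 'k) set" where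
  "cls l = {\<lambda>x. val l (from_nat (hd x))}"

definition rep :: "(nat list \<Rightarrow> 'k) set \<Rightarrow> ('k \<times> nat list) list" where
  "rep a = (SOME l. l \<in> polys \<and> cls l = a)"

definition tw :: "('k \<times> nat list) list \<Rightarrow> ('k \<times> nat list) list \<Rightarrow> ('k \<times> nat list) list" where
  "tw l l' = scl K \<alpha> (lprod K (@) l l') @ scl K \<beta> (lprod K (@) l' l)"

definition A :: "('k, (nat list \<Rightarrow> 'k) set) module" where
  "A = \<lparr>carrier = cls ` polys, monoid.mult = \<lambda>a b. cls (tw (rep a) (rep b)), one = undefined,
     zero = cls [], add = \<lambda>a b. cls (rep a @ rep b), smult = \<lambda>c a. cls (scl K c (rep a))\<rparr>"

abbreviation "R \<equiv> twist \<alpha> \<beta> FS.E"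

lemma A_simps:
  "carrier A = cls ` polys" "a \<otimes>\<^bsub>A\<^esub> b = cls (tw (rep a) (rep b))" "\<zero>\<^bsub>A\<^esub> = cls []"
  "a \<oplus>\<^bsub>A\<^esub> b = cls (rep a @ rep b)" "c \<odot>\<^bsub>A\<^esub> a = cls (scl K c (rep a))"
  by (simp_all add: A_def)

lemma cls_eq_iff: "cls l = cls l' \<longleftrightarrow> (\<forall>i. val l i = val l' i)"
proof
  assume "cls l = cls l'"
  then have e: "(\<lambda>x. val l (from_nat (hd x))) = (\<lambda>x. val l' (from_nat (hd x)))"
    unfolding cls_def by simp
  show "\<forall>i. val l i = val l' i"
  proof
    fix i :: "(nat \<times> nat list) \<times> nat list \<times> nat list"
    show "val l i = val l' i"
      using fun_cong[OF e, of "[to_nat i]"] by simp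
  qed
next
  assume "\<forall>i. val l i = val l' i"
  then show "cls l = cls l'"
    by (simp only: cls_def)
qed

lemma rep: "a \<in> carrier A \<Longrightarrow> rep a \<in> polys" "a \<in> carrier A \<Longrightarrow> cls (rep a) = a"
proof -
  assume "a \<in> carrier A"
  then have "\<exists>l. l \<in> polys \<and> cls l = a"
    by (auto simp: A_simps)
  then have "rep a \<in> polys \<and> cls (rep a) = a"
    unfolding rep_def by (rule someI_ex)
  then show "rep a \<in> polys" "cls (rep a) = a"
    by auto
qed

lemma cls_closed: "l \<in> polys \<Longrightarrow> cls l \<in> carrier A"
  by (simp add: A_simps)

lemma val_rep_cls: "l \<in> polys \<Longrightarrow> val (rep (cls l)) i = val l i"
  using rep(2)[OF cls_closed, of l] cls_eq_iff by blast

lemma tw_polys: "l \<in> polys \<Longrightarrow> l' \<in> polys \<Longrightarrow> tw l l' \<in> polys"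
  unfolding tw_def by (intro polys_append polys_scl polys_lprod ab)

lemma act_tw: "l \<in> polys \<Longrightarrow> l' \<in> polys \<Longrightarrow> act (tw l l') = act l \<otimes>\<^bsub>R\<^esub> act l'"
  by (simp add: tw_def act_append act_scl act_lprod polys_scl polys_lprod ab)

definition h :: "(nat list \<Rightarrow> 'k) set \<Rightarrow> (nat list \<Rightarrow> 'f) \<Rightarrow> nat list \<Rightarrow> 'f" where
  "h a = act (rep a)"

lemma h_cls: "l \<in> polys \<Longrightarrow> h (cls l) = act l"
  unfolding h_def using act_eq_iff[OF rep(1)[OF cls_closed]] val_rep_cls by blast

lemma h_closed: "a \<in> carrier A \<Longrightarrow> h a \<in> carrier FS.E"
  unfolding h_def by (rule act_closed) (rule rep)

lemma h_hom:
  "h \<zero>\<^bsub>A\<^esub> = \<zero>\<^bsub>R\<^esub>"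
  "a \<in> carrier A \<Longrightarrow> b \<in> carrier A \<Longrightarrow> h (a \<oplus>\<^bsub>A\<^esub> b) = h a \<oplus>\<^bsub>R\<^esub> h b"
  "a \<in> carrier A \<Longrightarrow> b \<in> carrier A \<Longrightarrow> h (a \<otimes>\<^bsub>A\<^esub> b) = h a \<otimes>\<^bsub>R\<^esub> h b"
  "c \<in> carrier K \<Longrightarrow> a \<in> carrier A \<Longrightarrow> h (c \<odot>\<^bsub>A\<^esub> a) = c \<odot>\<^bsub>R\<^esub> h a"
proof -
  show "h \<zero>\<^bsub>A\<^esub> = \<zero>\<^bsub>R\<^esub>"
    by (simp add: A_simps(3) h_cls polys_nil act_def)
  assume a: "a \<in> carrier A"
  show "h (c \<odot>\<^bsub>A\<^esub> a) = c \<odot>\<^bsub>R\<^esub> h a" if "c \<in> carrier K"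
    using rep(1)[OF a] that by (simp add: A_simps(5) h_cls polys_scl act_scl h_def[of a])
  assume b: "b \<in> carrier A"
  show "h (a \<oplus>\<^bsub>A\<^esub> b) = h a \<oplus>\<^bsub>R\<^esub> h b"
    using rep(1)[OF a] rep(1)[OF b] by (simp add: A_simps(4) h_cls polys_append act_append h_def[of a] h_def[of b])
  show "h (a \<otimes>\<^bsub>A\<^esub> b) = h a \<otimes>\<^bsub>R\<^esub> h b"
    unfolding A_simps(2) h_cls[OF tw_polys[OF rep(1)[OF a] rep(1)[OF b]]] h_def[of a] h_def[of b]
    by (rule act_tw[OF rep(1)[OF a] rep(1)[OF b]])
qed

lemma h_inj: "inj_on h (carrier A)"
proof (rule inj_onI)
  fix a b assume a: "a \<in> carrier A" and b: "b \<in> carrier A" and e: "h a = h b"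
  from e have "cls (rep a) = cls (rep b)"
    unfolding h_def act_eq_iff[OF rep(1)[OF a] rep(1)[OF b]] cls_eq_iff .
  then show "a = b"
    using rep(2) a b by simp
qed

lemma R_algebra: "nonassoc_algebra K R"
  by (rule FS.E.twist_algebra) (rule ab)+

lemma A_closed:
  "\<zero>\<^bsub>A\<^esub> \<in> carrier A" "a \<in> carrier A \<Longrightarrow> b \<in> carrier A \<Longrightarrow> a \<oplus>\<^bsub>A\<^esub> b \<in> carrier A"
  "a \<in> carrier A \<Longrightarrow> b \<in> carrier A \<Longrightarrow> a \<otimes>\<^bsub>A\<^esub> b \<in> carrier A"
  "c \<in> carrier K \<Longrightarrow> a \<in> carrier A \<Longrightarrow> c \<odot>\<^bsub>A\<^esub> a \<in> carrier A"
  unfolding A_simps(2-5)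
  by (rule cls_closed, intro polys_nil polys_append polys_scl tw_polys rep; assumption)+

lemma A_algebra: "nonassoc_algebra K A"
  by (rule algebra_pullback[OF R_algebra h_inj]) 
    (simp add: h_closed, rule A_closed, (rule A_closed(2); assumption), (rule A_closed(3); assumption),
      (rule A_closed(4); assumption), rule h_hom, (rule h_hom(2); assumption), (rule h_hom(3); assumption),
      (rule h_hom(4); assumption))

lemma A_variety:
  assumes V: "\<And>t. t \<in> V \<Longrightarrow> scalars t \<subseteq> carrier K \<and> (\<forall>w. cf K (word_poly K \<alpha> \<beta> t) w = \<zero>\<^bsub>K\<^esub>)"
  shows "in_variety K V A"
  unfolding in_variety_def
proof (intro conjI ballI)
  show "nonassoc_algebra K A"
    by (rule A_algebra)
  fix t assume t: "t \<in> V"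
  have "in_variety K V R"
    by (rule in_variety_twist[OF FS.operators_algebra ab]) (rule V)
  then have "satisfies_identity R t"
    using t by (simp add: in_variety_def)
  moreover have "scalars t \<subseteq> carrier K"
    using V[OF t] by blast
  ultimately show "satisfies_identity A t"
    by (intro identity_pullback[OF A_algebra h_inj, where R = R])
      (simp add: h_closed, rule h_hom, (rule h_hom(2); assumption), (rule h_hom(3); assumption),
        (rule h_hom(4); assumption))
qed

text \<open>All functionals vanish on the \<open>N\<close>-th power of the polynomial, which is therefore a relation of the algebra.\<close>

lemma algebraic_pow_zero:
  assumes l: "l \<in> polys" and N: "N > 0"
    and z: "\<And>j u v. pow_eval K l N (\<lambda>m. \<Lambda> j (u @ m @ v)) = \<zero>\<^bsub>K\<^esub>"
  shows "word_eval FS.E (\<lambda>_. act l) (replicate N 0) = \<zero>\<^bsub>FS.E\<^esub>"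
proof -
  define pw where "pw n = (lprod K (@) l ^^ n) [(\<one>\<^bsub>K\<^esub>, [])]" for n
  have pw_Suc: "pw (Suc n) = lprod K (@) l (pw n)" for n
    by (simp add: pw_def)
  have pw1: "pw (Suc 0) = l"
    using coeff(1)[OF l] by (simp add: pw_def lprod_def) (induction l, simp_all)
  have P: "pw (Suc n) \<in> polys" for n
  proof (induction n)
    case 0
    then show ?case by (simp only: pw1 l)
  next
    case (Suc n)
    then show ?case by (subst pw_Suc) (rule polys_lprod[OF l])
  qed
  have act_pw: "word_eval FS.E (\<lambda>_. act l) (replicate (Suc n) 0) = act (pw (Suc n))" for n
  proof (induction n)
    case 0
    then show ?case by (simp only: pw1 replicate.simps word_eval.simps)
  next
    case (Suc n)
    have "word_eval FS.E (\<lambda>_. act l) (replicate (Suc (Suc n)) 0) =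
        act l \<otimes>\<^bsub>FS.E\<^esub> word_eval FS.E (\<lambda>_. act l) (replicate (Suc n) 0)"
      by (simp add: word_eval_Cons)
    also have "\<dots> = act (pw (Suc (Suc n)))"
      unfolding Suc.IH by (subst pw_Suc[of "Suc n"]) (rule act_lprod[OF l P, symmetric])
    finally show ?case .
  qed
  have C: "fst p \<in> carrier K" if "p \<in> set (pw n)" for p n
    using that coeff(1)[OF P] by (cases n) (auto simp: pw_def[of 0])
  have lp: "lsum K (\<lambda>p. fst p \<otimes>\<^bsub>K\<^esub> f (snd p)) (lprod K (@) l' l'') =
      lsum K (\<lambda>p. fst p \<otimes>\<^bsub>K\<^esub> lsum K (\<lambda>q. fst q \<otimes>\<^bsub>K\<^esub> f (snd p @ snd q)) l'') l'"
    if l': "\<And>p. p \<in> set l' \<Longrightarrow> fst p \<in> carrier K" and l'': "\<And>p. p \<in> set l'' \<Longrightarrow> fst p \<in> carrier K"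
      and f: "\<And>w. f w \<in> carrier K"
    for l' l'' :: "('k \<times> nat list) list" and f
    using l'
  proof (induction l')
    case (Cons p l')
    obtain c x where p: "p = (c, x)" by force
    have c: "c \<in> carrier K"
      using Cons.prems[of p] by (simp add: p)
    have "lsum K (\<lambda>p. fst p \<otimes>\<^bsub>K\<^esub> f (snd p)) (lprod K (@) (p # l') l'') =
        lsum K (\<lambda>p. fst p \<otimes>\<^bsub>K\<^esub> f (snd p)) (map (\<lambda>q. (c \<otimes>\<^bsub>K\<^esub> fst q, x @ snd q)) l'') \<oplus>\<^bsub>K\<^esub>
        lsum K (\<lambda>p. fst p \<otimes>\<^bsub>K\<^esub> f (snd p)) (lprod K (@) l' l'')"
      unfolding p lprod_Cons
    proof (rule K.lsum_append)
      fix y assume "y \<in> set (map (\<lambda>q. (c \<otimes>\<^bsub>K\<^esub> fst q, x @ snd q)) l'') \<union> set (lprod K (@) l' l'')"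
      then have "fst y \<in> carrier K"
        using c Cons.prems l'' by (fastforce simp: lprod_def)
      then show "fst y \<otimes>\<^bsub>K\<^esub> f (snd y) \<in> carrier K"
        using f by simp
    qed
    also have "lsum K (\<lambda>p. fst p \<otimes>\<^bsub>K\<^esub> f (snd p)) (map (\<lambda>q. (c \<otimes>\<^bsub>K\<^esub> fst q, x @ snd q)) l'') =
        lsum K (\<lambda>q. c \<otimes>\<^bsub>K\<^esub> (fst q \<otimes>\<^bsub>K\<^esub> f (x @ snd q))) l''"
      unfolding lsum_map by (rule lsum_cong) (simp add: K.m_assoc c l'' f)
    also have "\<dots> = c \<otimes>\<^bsub>K\<^esub> lsum K (\<lambda>q. fst q \<otimes>\<^bsub>K\<^esub> f (x @ snd q)) l''"
      by (rule K.lsum_rdistr[symmetric]) (simp_all add: c l'' f)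
    also have "lsum K (\<lambda>p. fst p \<otimes>\<^bsub>K\<^esub> f (snd p)) (lprod K (@) l' l'') =
        lsum K (\<lambda>p. fst p \<otimes>\<^bsub>K\<^esub> lsum K (\<lambda>q. fst q \<otimes>\<^bsub>K\<^esub> f (snd p @ snd q)) l'') l'"
      by (rule Cons.IH) (simp add: Cons.prems)
    finally show ?case
      by (simp add: p)
  qed simp
  have ev: "lsum K (\<lambda>p. fst p \<otimes>\<^bsub>K\<^esub> f (snd p)) (pw n) = pow_eval K l n f" if "\<And>w. f w \<in> carrier K" for f n
    using that
  proof (induction n arbitrary: f)
    case 0
    then show ?case by (simp add: pw_def)
  next
    case (Suc n)
    have "lsum K (\<lambda>p. fst p \<otimes>\<^bsub>K\<^esub> f (snd p)) (lprod K (@) l (pw n)) =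
        lsum K (\<lambda>p. fst p \<otimes>\<^bsub>K\<^esub> lsum K (\<lambda>q. fst q \<otimes>\<^bsub>K\<^esub> f (snd p @ snd q)) (pw n)) l"
      by (rule lp) (rule coeff(1)[OF l], assumption, rule C, assumption, rule Suc.prems)
    also have "\<dots> = lsum K (\<lambda>p. fst p \<otimes>\<^bsub>K\<^esub> pow_eval K l n (\<lambda>m. f (snd p @ m))) l"
    proof (rule lsum_cong)
      fix p :: "'k \<times> nat list"
      have "lsum K (\<lambda>q. fst q \<otimes>\<^bsub>K\<^esub> f (snd p @ snd q)) (pw n) = pow_eval K l n (\<lambda>m. f (snd p @ m))"
        by (rule Suc.IH) (rule Suc.prems)
      then show "fst p \<otimes>\<^bsub>K\<^esub> lsum K (\<lambda>q. fst q \<otimes>\<^bsub>K\<^esub> f (snd p @ snd q)) (pw n) =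
          fst p \<otimes>\<^bsub>K\<^esub> pow_eval K l n (\<lambda>m. f (snd p @ m))"
        by simp
    qed
    finally show ?case
      unfolding pw_Suc pow_eval.simps .
  qed
  obtain n where n: "N = Suc n"
    using N by (cases N) auto
  have "val (pw N) i = \<zero>\<^bsub>K\<^esub>" for i
    unfolding val_def using z[of "fst i" "fst (snd i)" "snd (snd i)"]
    by (subst ev[of "\<lambda>w. \<Lambda> (fst i) (fst (snd i) @ w @ snd (snd i))"]) simp_all
  then have "pw N \<in> rels"
    unfolding rels_def using P[of n] n by blast
  then show ?thesis
    using act_pw[of n] act_rels n by simp
qed

text \<open>In \<open>F \<otimes>\<^sub>K A\<close> the scalars from \<open>F\<close> act on the values of the functions.\<close>

definition fscale :: "'f \<Rightarrow> ((nat list \<Rightarrow> 'f) \<Rightarrow> nat list \<Rightarrow> 'f) \<Rightarrow> (nat list \<Rightarrow> 'f) \<Rightarrow> nat list \<Rightarrow> 'f" where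
  "fscale f T = (\<lambda>g\<in>S. \<lambda>x. f \<otimes>\<^bsub>F\<^esub> T g x)"

lemma fscale_closed: "f \<in> carrier F \<Longrightarrow> T \<in> carrier FS.E \<Longrightarrow> fscale f T \<in> carrier FS.E"
  unfolding fscale_def by (rule FS.operator_smult)

lemma operator_F: "T \<in> carrier FS.E \<Longrightarrow> g \<in> S \<Longrightarrow> f \<in> carrier F \<Longrightarrow> T (\<lambda>x. f \<otimes>\<^bsub>F\<^esub> g x) = (\<lambda>x. f \<otimes>\<^bsub>F\<^esub> T g x)"
  by (simp add: FS.operators_simps(1))

lemma operator_S: "T \<in> carrier FS.E \<Longrightarrow> g \<in> S \<Longrightarrow> T g \<in> S"
  by (simp add: FS.operators_simps(1))

lemma fscale_simps:
  assumes T: "T \<in> carrier FS.E" and U: "U \<in> carrier FS.E" and f: "f \<in> carrier F" "f' \<in> carrier F" and c: "c \<in> carrier K"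
  shows "fscale (f \<oplus>\<^bsub>F\<^esub> f') T = fscale f T \<oplus>\<^bsub>R\<^esub> fscale f' T"
    "fscale f (T \<oplus>\<^bsub>R\<^esub> U) = fscale f T \<oplus>\<^bsub>R\<^esub> fscale f U"
    "fscale (\<phi> c \<otimes>\<^bsub>F\<^esub> f) T = c \<odot>\<^bsub>R\<^esub> fscale f T"
    "fscale f (c \<odot>\<^bsub>R\<^esub> T) = c \<odot>\<^bsub>R\<^esub> fscale f T"
    "fscale (f \<otimes>\<^bsub>F\<^esub> f') (T \<otimes>\<^bsub>R\<^esub> U) = fscale f T \<otimes>\<^bsub>R\<^esub> fscale f' U"
proof -
  note rng = FS.operator_range[OF T] FS.operator_range[OF U]
  note ops = twist_simps FS.operators_simps(2-) fscale_def
  show "fscale (f \<oplus>\<^bsub>F\<^esub> f') T = fscale f T \<oplus>\<^bsub>R\<^esub> fscale f' T"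
    by (rule FS.operator_eqI) (simp_all add: ops F.l_distr f rng)
  show "fscale f (T \<oplus>\<^bsub>R\<^esub> U) = fscale f T \<oplus>\<^bsub>R\<^esub> fscale f U"
    by (rule FS.operator_eqI) (simp_all add: ops F.r_distr f rng)
  show "fscale (\<phi> c \<otimes>\<^bsub>F\<^esub> f) T = c \<odot>\<^bsub>R\<^esub> fscale f T"
    by (rule FS.operator_eqI) (simp_all add: ops F.m_assoc f c rng)
  show "fscale f (c \<odot>\<^bsub>R\<^esub> T) = c \<odot>\<^bsub>R\<^esub> fscale f T"
    by (rule FS.operator_eqI) (simp_all add: ops F.m_lcomm f c rng)
  have TU: "T g \<in> S" "U g \<in> S" if "g \<in> S" for g
    using that operator_S T U by auto
  have prod: "fscale f T \<otimes>\<^bsub>FS.E\<^esub> fscale f' U = fscale (f \<otimes>\<^bsub>F\<^esub> f') (T \<otimes>\<^bsub>FS.E\<^esub> U)"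
    if "T \<in> carrier FS.E" "U \<in> carrier FS.E" "f \<in> carrier F" "f' \<in> carrier F" for f f' T U
  proof (rule FS.operator_eqI)
    fix g x assume g: "g \<in> S"
    have "(\<lambda>x. f \<otimes>\<^bsub>F\<^esub> T g x) \<in> S"
      using that g operator_S by simp
    then show "(fscale f T \<otimes>\<^bsub>FS.E\<^esub> fscale f' U) g x = fscale (f \<otimes>\<^bsub>F\<^esub> f') (T \<otimes>\<^bsub>FS.E\<^esub> U) g x"
      using g that operator_S[of T g] FS.operator_range[of U "T g" x]
      by (simp add: FS.operators_simps(2) fscale_def operator_F F.m_assoc F.m_comm F.m_lcomm)
  qed (simp_all add: FS.operators_simps(2) fscale_def)
  let ?P = "T \<otimes>\<^bsub>FS.E\<^esub> U" and ?Q = "U \<otimes>\<^bsub>FS.E\<^esub> T"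
  have P: "?P \<in> carrier FS.E" "?Q \<in> carrier FS.E"
    using T U by (simp_all add: FS.E.mult_closed)
  have ff: "f \<otimes>\<^bsub>F\<^esub> f' \<in> carrier F" "f' \<otimes>\<^bsub>F\<^esub> f = f \<otimes>\<^bsub>F\<^esub> f'"
    using f F.m_comm by auto
  have "fscale f T \<otimes>\<^bsub>R\<^esub> fscale f' U = \<alpha> \<odot>\<^bsub>FS.E\<^esub> fscale (f \<otimes>\<^bsub>F\<^esub> f') ?P \<oplus>\<^bsub>FS.E\<^esub> \<beta> \<odot>\<^bsub>FS.E\<^esub> fscale (f \<otimes>\<^bsub>F\<^esub> f') ?Q"
    using prod[OF T U f] prod[OF U T f(2,1)] ff by (simp add: twist_simps(5))
  also have "\<dots> = fscale (f \<otimes>\<^bsub>F\<^esub> f') (\<alpha> \<odot>\<^bsub>FS.E\<^esub> ?P \<oplus>\<^bsub>FS.E\<^esub> \<beta> \<odot>\<^bsub>FS.E\<^esub> ?Q)"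
    by (rule FS.operator_eqI)
      (simp_all add: FS.operators_simps(4,5) fscale_def F.r_distr F.m_lcomm ff(1) ab
        FS.operator_range[OF P(1)] FS.operator_range[OF P(2)])
  finally show "fscale (f \<otimes>\<^bsub>F\<^esub> f') (T \<otimes>\<^bsub>R\<^esub> U) = fscale f T \<otimes>\<^bsub>R\<^esub> fscale f' U"
    by (simp add: twist_simps(5))
qed

definition \<Psi> :: "'f \<times> (nat list \<Rightarrow> 'k) set \<Rightarrow> (nat list \<Rightarrow> 'f) \<Rightarrow> nat list \<Rightarrow> 'f" where
  "\<Psi> p = fscale (fst p) (h (snd p))"

lemma \<Psi>_closed: "p \<in> carrier F \<times> carrier A \<Longrightarrow> \<Psi> p \<in> carrier FS.E"
  unfolding \<Psi>_def by (rule fscale_closed) (auto intro: h_closed)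

text \<open>Coordinates on \<open>A\<close> are the values of the shifted functionals. A sum of tensors that acts as zero has vanishing coordinates, since
  the functionals themselves are acted upon.\<close>

lemma extension_embedding: "tensor_embedding K F \<phi> A R \<Psi> (\<lambda>a. val (rep a))"
proof (intro tensor_embedding.intro field_ext_axioms na_algebra.intro A_algebra R_algebra tensor_embedding_axioms.intro)
  fix f f' a a' c i
  assume f: "f \<in> carrier F" and a: "a \<in> carrier A"
  have ha: "h a \<in> carrier FS.E"
    by (rule h_closed[OF a])
  show "\<Psi> (f, a) \<in> carrier R"
    using \<Psi>_closed[of "(f, a)"] f a by simp
  show "\<Psi> (f, c \<odot>\<^bsub>A\<^esub> a) = c \<odot>\<^bsub>R\<^esub> \<Psi> (f, a)" if c: "c \<in> carrier K"
    unfolding \<Psi>_def fst_conv snd_conv h_hom(4)[OF c a] by (rule fscale_simps(4)[OF ha ha f f c])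
  show "\<Psi> (\<phi> c \<otimes>\<^bsub>F\<^esub> f, a) = c \<odot>\<^bsub>R\<^esub> \<Psi> (f, a)" if c: "c \<in> carrier K"
    unfolding \<Psi>_def fst_conv snd_conv by (rule fscale_simps(3)[OF ha ha f f c])
  show "\<Psi> (f \<oplus>\<^bsub>F\<^esub> f', a) = \<Psi> (f, a) \<oplus>\<^bsub>R\<^esub> \<Psi> (f', a)" if f': "f' \<in> carrier F"
    unfolding \<Psi>_def fst_conv snd_conv by (rule fscale_simps(1)[OF ha ha f f' ab(1)])
  show "\<Psi> (f, a \<oplus>\<^bsub>A\<^esub> a') = \<Psi> (f, a) \<oplus>\<^bsub>R\<^esub> \<Psi> (f, a')" if a': "a' \<in> carrier A"
    unfolding \<Psi>_def fst_conv snd_conv h_hom(2)[OF a a'] by (rule fscale_simps(2)[OF ha h_closed[OF a'] f f ab(1)])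
  show "\<Psi> (f \<otimes>\<^bsub>F\<^esub> f', a \<otimes>\<^bsub>A\<^esub> a') = \<Psi> (f, a) \<otimes>\<^bsub>R\<^esub> \<Psi> (f', a')" if f': "f' \<in> carrier F" and a': "a' \<in> carrier A"
    unfolding \<Psi>_def fst_conv snd_conv h_hom(3)[OF a a'] by (rule fscale_simps(5)[OF ha h_closed[OF a'] f f' ab(1)])
next
  fix a a' c i
  assume a: "a \<in> carrier A"
  note ra = rep(1)[OF a]
  show "val (rep a) i \<in> carrier K"
    by (rule val_closed[OF ra])
  show "val (rep (c \<odot>\<^bsub>A\<^esub> a)) i = c \<otimes>\<^bsub>K\<^esub> val (rep a) i" if c: "c \<in> carrier K"
    unfolding A_simps(5) val_rep_cls[OF polys_scl[OF c ra]] by (rule val_scl[OF c ra])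
  show "val (rep (a \<oplus>\<^bsub>A\<^esub> a')) i = val (rep a) i \<oplus>\<^bsub>K\<^esub> val (rep a') i" if a': "a' \<in> carrier A"
    unfolding A_simps(4) val_rep_cls[OF polys_append[OF ra rep(1)[OF a']]] by (rule val_append[OF ra rep(1)[OF a']])
  assume z: "\<And>i. val (rep a) i = \<zero>\<^bsub>K\<^esub>"
  have "cls (rep a) = cls []"
    unfolding cls_eq_iff using z by (simp only: val_def lsum.simps) blast
  then show "a = \<zero>\<^bsub>A\<^esub>"
    using rep(2)[OF a] by (simp add: A_simps(3))
next
  fix L and i :: "(nat \<times> nat list) \<times> nat list \<times> nat list"
  assume L: "set L \<subseteq> carrier F \<times> carrier A" and z: "lsum R \<Psi> L = \<zero>\<^bsub>R\<^esub>"
  obtain j u v where i: "i = (j, u, v)"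
    by (cases i) auto
  let ?g = "\<lambda>w. \<phi> (\<Lambda> j (u @ w))"
  have zE: "lsum FS.E \<Psi> L = \<zero>\<^bsub>FS.E\<^esub>"
    using z by (simp add: lsum_record[of R FS.E])
  have "lsum F (\<lambda>p. fst p \<otimes>\<^bsub>F\<^esub> \<phi> (val (rep (snd p)) i)) L = lsum F (\<lambda>p. \<Psi> p ?g v) L"
  proof (rule lsum_cong)
    fix p assume "p \<in> set L"
    then have "snd p \<in> carrier A"
      using L by auto
    then show "fst p \<otimes>\<^bsub>F\<^esub> \<phi> (val (rep (snd p)) i) = \<Psi> p ?g v"
      using functional_in_S[of j u] by (simp add: \<Psi>_def fscale_def h_def i act_functional rep)
  qed
  also have "\<dots> = lsum FS.E \<Psi> L ?g v"
    by (rule FS.lsum_operator[OF _ functional_in_S, symmetric]) (use L \<Psi>_closed in blast)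
  also have "\<dots> = \<zero>\<^bsub>F\<^esub>"
    unfolding zE using functional_in_S[of j u] by (simp add: FS.operators_simps(3))
  finally show "lsum F (\<lambda>p. fst p \<otimes>\<^bsub>F\<^esub> \<phi> (val (rep (snd p)) i)) L = \<zero>\<^bsub>F\<^esub>" .
qed

end


section \<open>The generic elements\<close>

text \<open>The functionals \<open>\<Lambda> (k, \<pi>)\<close> are those of the \<open>k\<close>-th stage. They vanish on high powers of each polynomial,
  and over \<open>F\<close> they detect single patterns of arbitrary length.\<close>

locale generic_algebra = independent_ext K F \<phi> s t + functional_algebra K F \<phi> \<Lambda> \<alpha> \<beta>
  for K :: "'k ring" and F :: "'f ring" and \<phi> :: "'k \<Rightarrow> 'f" and s t \<Lambda> \<alpha> \<beta> +
  assumes nil: "l \<in> polys \<Longrightarrow> \<exists>N>0. \<forall>j u v. pow_eval K l N (\<lambda>m. \<Lambda> j (u @ m @ v)) = \<zero>\<^bsub>K\<^esub>"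
    and generic: "\<exists>k n. n \<ge> d \<and> (\<forall>\<pi>. length \<pi> = n \<longrightarrow> (\<exists>e\<in>carrier F. e \<noteq> \<zero>\<^bsub>F\<^esub> \<and>
      (\<forall>\<rho>. Ev (\<lambda>w. \<phi> (\<Lambda> (k, \<pi>) w)) \<rho> = (if \<rho> = \<pi> then e else \<zero>\<^bsub>F\<^esub>))))"
    and \<alpha>_nonzero: "\<alpha> \<noteq> \<zero>\<^bsub>K\<^esub>"
begin

definition gens :: "nat \<Rightarrow> ('f \<times> (nat list \<Rightarrow> 'k) set) list" where
  "gens \<kappa> = map (\<lambda>i. (weight i, cls [(\<one>\<^bsub>K\<^esub>, [3 * \<kappa> + i])])) [0, 1, 2]"

definition X :: "nat \<Rightarrow> (nat list \<Rightarrow> 'f) \<Rightarrow> nat list \<Rightarrow> 'f" where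
  "X \<kappa> = lsum R \<Psi> (gens \<kappa>)"

lemma letter_polys: "[(\<one>\<^bsub>K\<^esub>, [x])] \<in> polys"
  by (simp add: polys_def)

lemma gens_set: "set (gens \<kappa>) \<subseteq> carrier F \<times> carrier A"
  by (auto simp: gens_def intro: cls_closed letter_polys)

lemma X_E: "X \<kappa> = lsum FS.E \<Psi> (gens \<kappa>)"
  unfolding X_def by (rule lsum_record) simp_all

lemma X_closed: "X \<kappa> \<in> carrier FS.E"
  unfolding X_E using gens_set \<Psi>_closed by (intro FS.E.M.lsum_closed) blast

lemma X_eval:
  assumes g: "g \<in> S"
  shows "X \<kappa> g v = lsum F (\<lambda>i. weight i \<otimes>\<^bsub>F\<^esub> g ((3 * \<kappa> + i) # v)) [0, 1, 2]"
proof -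
  have "X \<kappa> g v = lsum F (\<lambda>p. \<Psi> p g v) (gens \<kappa>)"
    unfolding X_E by (rule FS.lsum_operator[OF _ g]) (use gens_set \<Psi>_closed in blast)
  also have "\<dots> = lsum F (\<lambda>i. weight i \<otimes>\<^bsub>F\<^esub> g ((3 * \<kappa> + i) # v)) [0, 1, 2]"
    unfolding gens_def lsum_map
  proof (rule lsum_cong)
    fix i
    show "\<Psi> (weight i, cls [(\<one>\<^bsub>K\<^esub>, [3 * \<kappa> + i])]) g v = weight i \<otimes>\<^bsub>F\<^esub> g ((3 * \<kappa> + i) # v)"
      using g S_range[OF g] by (simp add: \<Psi>_def fscale_def h_cls[OF letter_polys] act_eval[OF letter_polys])
  qed
  finally show ?thesis .
qed

lemma Ev_X:
  assumes g: "g \<in> S"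
  shows "Ev (X \<kappa> g) \<rho> = Ev g (\<kappa> # \<rho>)"
proof -
  have "Ev (X \<kappa> g) \<rho> = Ev (\<lambda>v. lsum F (\<lambda>i. weight i \<otimes>\<^bsub>F\<^esub> g ((3 * \<kappa> + i) # v)) [0, 1, 2]) \<rho>"
    by (rule Ev_cong) (rule X_eval[OF g])
  also have "\<dots> = lsum F (\<lambda>i. Ev (\<lambda>v. weight i \<otimes>\<^bsub>F\<^esub> g ((3 * \<kappa> + i) # v)) \<rho>) [0, 1, 2]"
    by (rule Ev_lsum) (simp add: S_range[OF g])
  also have "\<dots> = lsum F (\<lambda>i. weight i \<otimes>\<^bsub>F\<^esub> Ev (\<lambda>v. g ((3 * \<kappa> + i) # v)) \<rho>) [0, 1, 2]"
    by (rule lsum_cong) (rule Ev_smult, simp, rule S_range[OF g])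
  finally show ?thesis
    by (simp only: generic_eval.simps)
qed

lemma Ev_word_X: "w \<noteq> [] \<Longrightarrow> g \<in> S \<Longrightarrow> Ev (word_eval FS.E X w g) \<rho> = Ev g (w @ \<rho>)"
proof (induction w arbitrary: g rule: induct_list012)
  case (2 i)
  then show ?case by (simp only: word_eval.simps Ev_X append.simps)
next
  case (3 i j w)
  have "word_eval FS.E X (i # j # w) g = word_eval FS.E X (j # w) (X i g)"
    using 3 by (simp add: FS.operators_simps(2))
  then have "Ev (word_eval FS.E X (i # j # w) g) \<rho> = Ev (X i g) ((j # w) @ \<rho>)"
    using "3.IH"(2)[of "X i g"] operator_S[OF X_closed] 3 by simp
  then show ?case
    using 3 by (simp only: Ev_X append.simps)
qed simp

text \<open>Relations between the generic elements are read off from the functionals whose generic values single out one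
  pattern.\<close>

lemma relation_cf_zero:
  assumes t: "scalars p \<subseteq> carrier K" and z: "na_eval R X p = \<zero>\<^bsub>R\<^esub>"
  shows "cf K (word_poly K \<alpha> \<beta> p) \<pi> = \<zero>\<^bsub>K\<^esub>"
proof -
  let ?W = "word_poly K \<alpha> \<beta> p"
  have W: "set ?W \<subseteq> carrier K \<times> {w. w \<noteq> []}"
    by (rule K.word_poly_set[OF ab t])
  then have Wc: "fst q \<in> carrier K" "snd q \<noteq> []" if "q \<in> set ?W" for q
    using that by auto
  have z': "lcomb FS.E (word_eval FS.E X) ?W = \<zero>\<^bsub>FS.E\<^esub>"
    using z FS.E.na_eval_twist[OF ab X_closed t] by simp
  obtain k n where n: "n \<ge> length \<pi>" and ev: "\<And>\<pi>'. length \<pi>' = n \<Longrightarrow> \<exists>e\<in>carrier F. e \<noteq> \<zero>\<^bsub>F\<^esub> \<and>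
      (\<forall>\<rho>. Ev (\<lambda>w. \<phi> (\<Lambda> (k, \<pi>') w)) \<rho> = (if \<rho> = \<pi>' then e else \<zero>\<^bsub>F\<^esub>))"
    using generic[of "length \<pi>"] by blast
  define \<sigma> where "\<sigma> = replicate (n - length \<pi>) (0 :: nat)"
  have "length (\<pi> @ \<sigma>) = n"
    using n by (simp add: \<sigma>_def)
  then obtain e where e: "e \<in> carrier F" "e \<noteq> \<zero>\<^bsub>F\<^esub>"
    and evl: "\<And>\<rho>. Ev (\<lambda>w. \<phi> (\<Lambda> (k, \<pi> @ \<sigma>) w)) \<rho> = (if \<rho> = \<pi> @ \<sigma> then e else \<zero>\<^bsub>F\<^esub>)"
    using ev by blast
  define g where "g = (\<lambda>w. \<phi> (\<Lambda> (k, \<pi> @ \<sigma>) w))"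
  have g: "g \<in> S"
    unfolding g_def using functional_in_S[of "(k, \<pi> @ \<sigma>)" "[]"] by simp
  have wc: "word_eval FS.E X w \<in> carrier FS.E" for w
    by (rule FS.E.word_eval_closed) (rule X_closed)
  have "\<zero>\<^bsub>F\<^esub> = Ev (lcomb FS.E (word_eval FS.E X) ?W g) \<sigma>"
    unfolding z' using g by (subst Ev_zero) (simp_all add: FS.operators_simps(3))
  also have "\<dots> = Ev (\<lambda>v. lsum F (\<lambda>q. \<phi> (fst q) \<otimes>\<^bsub>F\<^esub> word_eval FS.E X (snd q) g v) ?W) \<sigma>"
    by (rule Ev_cong) (rule FS.lcomb_operator[OF W wc g])
  also have "\<dots> = lsum F (\<lambda>q. Ev (\<lambda>v. \<phi> (fst q) \<otimes>\<^bsub>F\<^esub> word_eval FS.E X (snd q) g v) \<sigma>) ?W"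
    by (rule Ev_lsum) (simp add: Wc FS.operator_range[OF wc g])
  also have "\<dots> = lsum F (\<lambda>q. \<phi> (if snd q = \<pi> then fst q else \<zero>\<^bsub>K\<^esub>) \<otimes>\<^bsub>F\<^esub> e) ?W"
  proof (rule lsum_cong)
    fix q assume q: "q \<in> set ?W"
    have "Ev (\<lambda>v. \<phi> (fst q) \<otimes>\<^bsub>F\<^esub> word_eval FS.E X (snd q) g v) \<sigma> =
        \<phi> (fst q) \<otimes>\<^bsub>F\<^esub> Ev (word_eval FS.E X (snd q) g) \<sigma>"
      by (rule Ev_smult) (simp_all add: Wc[OF q] FS.operator_range[OF wc g])
    also have "Ev (word_eval FS.E X (snd q) g) \<sigma> = Ev g (snd q @ \<sigma>)"
      by (rule Ev_word_X[OF Wc(2)[OF q] g])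
    also have "\<dots> = (if snd q = \<pi> then e else \<zero>\<^bsub>F\<^esub>)"
      unfolding g_def evl by simp
    finally show "Ev (\<lambda>v. \<phi> (fst q) \<otimes>\<^bsub>F\<^esub> word_eval FS.E X (snd q) g v) \<sigma> =
        \<phi> (if snd q = \<pi> then fst q else \<zero>\<^bsub>K\<^esub>) \<otimes>\<^bsub>F\<^esub> e"
      using Wc[OF q] e by simp
  qed
  also have "\<dots> = lsum F (\<lambda>q. \<phi> (if snd q = \<pi> then fst q else \<zero>\<^bsub>K\<^esub>)) ?W \<otimes>\<^bsub>F\<^esub> e"
    by (rule F.lsum_ldistr[symmetric]) (simp_all add: Wc e)
  also have "lsum F (\<lambda>q. \<phi> (if snd q = \<pi> then fst q else \<zero>\<^bsub>K\<^esub>)) ?W = \<phi> (cf K ?W \<pi>)"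
    unfolding cf_def by (rule lsum_\<phi>[symmetric]) (simp add: Wc)
  finally have "\<phi> (cf K ?W \<pi>) \<otimes>\<^bsub>F\<^esub> e = \<zero>\<^bsub>F\<^esub>"
    by simp
  then have "\<phi> (cf K ?W \<pi>) = \<zero>\<^bsub>F\<^esub>"
    using e K.cf_closed[OF W, of \<pi>] by (simp add: F.integral_iff)
  then show ?thesis
    using K.cf_closed[OF W, of \<pi>] by (rule \<phi>_eq_zero[rotated])
qed

theorem not_free_before:
  assumes V: "\<And>p. p \<in> V \<Longrightarrow> scalars p \<subseteq> carrier K \<and> (\<forall>w. cf K (word_poly K \<alpha> \<beta> p) w = \<zero>\<^bsub>K\<^esub>)"
  shows "\<not> contains_free K V A"
proof (rule not_contains_freeI)
  interpret KK: kfield K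
    by (rule kfield.intro) (rule K.field_axioms)
  fix a b assume a: "a \<in> carrier A" and b: "b \<in> carrier A"
  let ?\<sigma> = "\<lambda>i :: nat. if i = 0 then a else b"
  obtain N where N: "N > 0" "\<And>j u v. pow_eval K (rep a) N (\<lambda>m. \<Lambda> j (u @ m @ v)) = \<zero>\<^bsub>K\<^esub>"
    using nil[OF rep(1)[OF a]] by blast
  have "word_eval FS.E (\<lambda>_. h a) (replicate N 0) = \<zero>\<^bsub>FS.E\<^esub>"
    unfolding h_def by (rule algebraic_pow_zero[OF rep(1)[OF a] N])
  then have zero: "na_eval R (\<lambda>i. if i = 0 then h a else h b) (iterated (2 * N)) = \<zero>\<^bsub>FS.E\<^esub>"
    by (rule FS.E.iterated_nil[OF ab h_closed[OF a] h_closed[OF b] _ N(1)])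
  interpret A: na_algebra K A
    by (rule na_algebra.intro) (rule A_algebra)
  have \<sigma>: "?\<sigma> i \<in> carrier A" for i
    using a b by simp
  have cl: "na_eval A ?\<sigma> (iterated (2 * N)) \<in> carrier A"
    by (rule A.na_eval_closed) (use \<sigma> in simp_all)
  have "h (na_eval A ?\<sigma> (iterated (2 * N))) = na_eval R (\<lambda>i. h (?\<sigma> i)) (iterated (2 * N))"
    by (rule na_eval_hom[OF A_algebra]) (simp, rule \<sigma>, (rule h_hom(2); assumption), (rule h_hom(3); assumption),
        (rule h_hom(4); assumption))
  also have "(\<lambda>i. h (?\<sigma> i)) = (\<lambda>i. if i = 0 then h a else h b)"
    by auto
  finally have "h (na_eval A ?\<sigma> (iterated (2 * N))) = h \<zero>\<^bsub>A\<^esub>"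
    unfolding zero h_hom(1) by simp
  then have "na_eval A ?\<sigma> (iterated (2 * N)) = \<zero>\<^bsub>A\<^esub>"
    by (rule inj_onD[OF h_inj _ cl A_closed(1)])
  moreover obtain u v :: "(nat list \<Rightarrow> 'k) set list \<Rightarrow> 'k" where uv: "u \<in> carrier (left_algebra K)" "v \<in> carrier (left_algebra K)"
    "na_eval (twist \<alpha> \<beta> (left_algebra K)) (\<lambda>i. if i = 0 then u else v) (iterated (2 * N)) \<noteq> \<zero>\<^bsub>left_algebra K\<^esub>"
    using KK.iterated_nonzero[OF ab \<alpha>_nonzero, of "2 * N"] by blast
  moreover have "in_variety K V (twist \<alpha> \<beta> (left_algebra K :: ('k, (nat list \<Rightarrow> 'k) set list \<Rightarrow> 'k) module))"
    by (rule in_variety_twist[OF KK.left_algebra ab]) (rule V)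
  ultimately show "\<exists>p. scalars p \<subseteq> carrier K \<and> na_eval A ?\<sigma> p = \<zero>\<^bsub>A\<^esub> \<and>
      (\<exists>(B :: ('k, (nat list \<Rightarrow> 'k) set list \<Rightarrow> 'k) module) u v. in_variety K V B \<and> u \<in> carrier B \<and> v \<in> carrier B \<and>
        na_eval B (\<lambda>i. if i = 0 then u else v) p \<noteq> \<zero>\<^bsub>B\<^esub>)"
    by (intro exI[of _ "iterated (2 * N)"] exI[of _ "twist \<alpha> \<beta> (left_algebra K)"] exI[of _ u] exI[of _ v] conjI) simp_all
qed

theorem free_after:
  assumes V: "\<And>p. p \<in> V \<Longrightarrow> scalars p \<subseteq> carrier K \<and> (\<forall>w. cf K (word_poly K \<alpha> \<beta> p) w = \<zero>\<^bsub>K\<^esub>)"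
    and V': "\<And>p (B :: ('k, ('f \<times> (nat list \<Rightarrow> 'k) set \<Rightarrow> 'k) set list \<Rightarrow> 'k) module) \<tau>. scalars p \<subseteq> carrier K \<Longrightarrow>
      (\<And>w. cf K (word_poly K \<alpha> \<beta> p) w = \<zero>\<^bsub>K\<^esub>) \<Longrightarrow> in_variety K V B \<Longrightarrow> (\<And>i. \<tau> i \<in> carrier B) \<Longrightarrow>
      na_eval B \<tau> p = \<zero>\<^bsub>B\<^esub>"
  shows "contains_free K V (tensor_algebra K (extension_algebra F \<phi>) A)" (is "contains_free K V ?T")
proof -
  interpret te: tensor_embedding K F \<phi> A R \<Psi> "\<lambda>a. val (rep a)"
    by (rule extension_embedding)
  show ?thesis
  proof (rule te.tensor_algebra_embeds)
    fix hT
    assume T: "nonassoc_algebra K ?T" and inj: "inj_on hT (carrier ?T)"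
    and cl: "\<And>x. x \<in> carrier ?T \<Longrightarrow> hT x \<in> carrier R" and zero: "hT \<zero>\<^bsub>?T\<^esub> = \<zero>\<^bsub>R\<^esub>"
    and add: "\<And>x y. x \<in> carrier ?T \<Longrightarrow> y \<in> carrier ?T \<Longrightarrow> hT (x \<oplus>\<^bsub>?T\<^esub> y) = hT x \<oplus>\<^bsub>R\<^esub> hT y"
    and mult: "\<And>x y. x \<in> carrier ?T \<Longrightarrow> y \<in> carrier ?T \<Longrightarrow> hT (x \<otimes>\<^bsub>?T\<^esub> y) = hT x \<otimes>\<^bsub>R\<^esub> hT y"
    and smult: "\<And>c x. c \<in> carrier K \<Longrightarrow> x \<in> carrier ?T \<Longrightarrow> hT (c \<odot>\<^bsub>?T\<^esub> x) = c \<odot>\<^bsub>R\<^esub> hT x"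
    and ex: "\<And>L. set L \<subseteq> carrier F \<times> carrier A \<Longrightarrow> \<exists>x\<in>carrier ?T. hT x = lsum R \<Psi> L"
    have "\<exists>x. x \<in> carrier ?T \<and> hT x = X \<kappa>" for \<kappa>
      using ex[OF gens_set[of \<kappa>]] unfolding X_def by blast
    then obtain \<sigma> where \<sigma>: "\<And>\<kappa>. \<sigma> \<kappa> \<in> carrier ?T" "\<And>\<kappa>. hT (\<sigma> \<kappa>) = X \<kappa>"
      by metis
    have rel: "cf K (word_poly K \<alpha> \<beta> p) \<pi> = \<zero>\<^bsub>K\<^esub>"
      if p: "scalars p \<subseteq> carrier K" "na_eval ?T \<sigma> p = \<zero>\<^bsub>?T\<^esub>" for p \<pi>
    proof (rule relation_cf_zero[OF p(1)])
      have "hT (na_eval ?T \<sigma> p) = na_eval R (\<lambda>i. hT (\<sigma> i)) p"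
        by (rule na_eval_hom[OF T p(1)]) (rule \<sigma>, (rule add; assumption), (rule mult; assumption), (rule smult; assumption))
      then show "na_eval R X p = \<zero>\<^bsub>R\<^esub>"
        unfolding p(2) zero \<sigma>(2) by simp
    qed
    show ?thesis
    proof (rule contains_freeI[where \<sigma> = \<sigma>])
      show "in_variety K V ?T"
        unfolding in_variety_def
      proof (intro conjI ballI T)
        fix p assume p: "p \<in> V"
        have "in_variety K V R"
          by (rule in_variety_twist[OF FS.operators_algebra ab]) (rule V)
        then have R: "satisfies_identity R p"
          using p by (simp add: in_variety_def)
        have sc: "scalars p \<subseteq> carrier K"
          using V[OF p] by blast
        show "satisfies_identity ?T p"
          by (rule identity_pullback[OF T inj cl zero add mult smult sc R])
      qed
      show "scalars p \<subseteq> carrier K" if "p \<in> V" for p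
        using V[OF that] by blast
      show "\<sigma> 0 \<noteq> \<sigma> 1"
      proof
        assume eq: "\<sigma> 0 = \<sigma> 1"
        interpret T: na_algebra K ?T
          by (rule na_algebra.intro) (rule T)
        let ?p = "Add (Var 0) (Scale (\<ominus>\<^bsub>K\<^esub> \<one>\<^bsub>K\<^esub>) (Var 1))"
        have "na_eval ?T \<sigma> ?p = \<zero>\<^bsub>?T\<^esub>"
          using \<sigma>(1)[of 1] by (simp add: eq[simplified] T.smult_l_minus T.M.r_neg)
        then have "cf K (word_poly K \<alpha> \<beta> ?p) [0] = \<zero>\<^bsub>K\<^esub>"
          by (intro rel) simp_all
        then show False
          by (simp add: word_poly_def lbind_def scl_def cf_def)
      qed
      fix p and B :: "('k, ('f \<times> (nat list \<Rightarrow> 'k) set \<Rightarrow> 'k) set list \<Rightarrow> 'k) module" and \<tau> :: "nat \<Rightarrow> _"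
      assume p: "scalars p \<subseteq> carrier K" "na_eval ?T \<sigma> p = \<zero>\<^bsub>?T\<^esub>" and B: "in_variety K V B" "\<And>i. \<tau> i \<in> carrier B"
      show "na_eval B \<tau> p = \<zero>\<^bsub>B\<^esub>"
        by (rule V'[OF p(1) rel[OF p] B])
    qed (rule \<sigma>)
  qed
qed

end


section \<open>The theorem\<close>

text \<open>The common form of both cases. The last hypothesis says that a polynomial whose expansion into words vanishes is an identity of
  the variety.\<close>

theorem twisted_example:
  fixes K :: "'k ring" and V :: "'k na_poly set"
  assumes K: "field K" and countable: "countable (carrier K)"
    and scal: "\<alpha> \<in> carrier K" "\<beta> \<in> carrier K" "\<alpha> \<noteq> \<zero>\<^bsub>K\<^esub>"
    and V: "\<And>p. p \<in> V \<Longrightarrow> scalars p \<subseteq> carrier K \<and> (\<forall>w. cf K (word_poly K \<alpha> \<beta> p) w = \<zero>\<^bsub>K\<^esub>)"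
    and V': "\<And>p (B :: ('k, ((int \<Rightarrow> 'k) \<times> (nat list \<Rightarrow> 'k) set \<Rightarrow> 'k) set list \<Rightarrow> 'k) module) \<tau>. scalars p \<subseteq> carrier K \<Longrightarrow>
      (\<And>w. cf K (word_poly K \<alpha> \<beta> p) w = \<zero>\<^bsub>K\<^esub>) \<Longrightarrow> in_variety K V B \<Longrightarrow> (\<And>i. \<tau> i \<in> carrier B) \<Longrightarrow>
      na_eval B \<tau> p = \<zero>\<^bsub>B\<^esub>"
  shows "\<exists>(A :: ('k, (nat list \<Rightarrow> 'k) set) module) (F :: (int \<Rightarrow> 'k) ring) \<phi>.
           in_variety K V A \<and> field F \<and> \<phi> \<in> ring_hom K F \<and> \<not> contains_free K V A \<and>
           contains_free K V (tensor_algebra K (extension_algebra F \<phi>) A)"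
proof -
  obtain F :: "(int \<Rightarrow> 'k) ring" and \<phi> s t where F: "field F" and \<phi>: "\<phi> \<in> ring_hom K F"
    and st: "independent_pair K F \<phi> s t"
    using exists_extension[OF K] by blast
  interpret field_ext K F \<phi>
    by (intro field_ext.intro field_ext_axioms.intro K F \<phi>)
  interpret independent_ext K F \<phi> s t
    by (intro independent_ext.intro independent_ext_axioms.intro field_ext_axioms st)
  let ?P = "{l. set l \<subseteq> carrier K \<times> {w :: nat list. w \<noteq> []}}"
  have "?P = lists (carrier K \<times> {w. w \<noteq> []})"
    by auto
  then have cP: "countable ?P"
    using countable by (simp add: countable_SIGMA)
  have "[] \<in> ?P"
    by simp
  then have ne: "?P \<noteq> {}"
    by blast
  define ls where "ls = from_nat_into ?P"
  have ls: "set (ls k) \<subseteq> carrier K \<times> {w. w \<noteq> []}" for k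
    using from_nat_into[OF ne, of k] by (simp add: ls_def)
  obtain \<Lambda> :: "nat \<Rightarrow> nat list \<Rightarrow> nat list \<Rightarrow> 'k" where \<Lambda>: "\<And>k \<pi> w. \<Lambda> k \<pi> w \<in> carrier K"
    and nil: "\<And>k. \<exists>N>0. \<forall>k' \<pi> u w. pow_eval K (ls k) N (\<lambda>m. \<Lambda> k' \<pi> (u @ m @ w)) = \<zero>\<^bsub>K\<^esub>"
    and gen: "\<And>d. \<exists>k n. n \<ge> d \<and> (\<forall>\<pi>. length \<pi> = n \<longrightarrow> (\<exists>e\<in>carrier F. e \<noteq> \<zero>\<^bsub>F\<^esub> \<and>
      (\<forall>\<rho>. Ev (\<lambda>w. \<phi> (\<Lambda> k \<pi> w)) \<rho> = (if \<rho> = \<pi> then e else \<zero>\<^bsub>F\<^esub>))))"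
    using functionals_exist[of ls, OF ls] by metis
  define L where "L = (\<lambda>j. \<Lambda> (fst j) (snd j))"
  interpret functional_algebra K F \<phi> L \<alpha> \<beta>
    by (intro functional_algebra.intro functional_algebra_axioms.intro field_ext_axioms scal) (simp add: L_def \<Lambda>)
  interpret generic_algebra K F \<phi> s t L \<alpha> \<beta>
  proof (intro generic_algebra.intro generic_algebra_axioms.intro independent_ext_axioms functional_algebra_axioms scal(3))
    fix l assume "l \<in> polys"
    then have "l \<in> ?P"
      by (simp add: polys_def)
    then obtain k where k: "l = ls k"
      using from_nat_into_surj[OF cP, of l] unfolding ls_def by blast
    show "\<exists>N>0. \<forall>j u v. pow_eval K l N (\<lambda>m. L j (u @ m @ v)) = \<zero>\<^bsub>K\<^esub>"
      using nil[of k] unfolding k L_def by blast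
  next
    fix d
    show "\<exists>k n. n \<ge> d \<and> (\<forall>\<pi>. length \<pi> = n \<longrightarrow> (\<exists>e\<in>carrier F. e \<noteq> \<zero>\<^bsub>F\<^esub> \<and>
      (\<forall>\<rho>. Ev (\<lambda>w. \<phi> (L (k, \<pi>) w)) \<rho> = (if \<rho> = \<pi> then e else \<zero>\<^bsub>F\<^esub>))))"
      using gen[of d] unfolding L_def fst_conv snd_conv .
  qed
  have "in_variety K V A"
    by (rule A_variety) (rule V)
  moreover have "\<not> contains_free K V A"
    by (rule not_free_before) (rule V)
  moreover have "contains_free K V (tensor_algebra K (extension_algebra F \<phi>) A)"
    by (rule free_after) (erule V, rule V')
  ultimately show ?thesis
    using F \<phi> by blast
qed

theorem mainTheorem2:
  fixes K :: "'k ring" and V :: "'k na_poly set"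
  assumes "field K" and "countable (carrier K)"
    and "V = lie_identities \<or>
         \<one>\<^bsub>K\<^esub> \<oplus>\<^bsub>K\<^esub> \<one>\<^bsub>K\<^esub> \<noteq> \<zero>\<^bsub>K\<^esub> \<and> V = special_jordan_identities K"
  shows "\<exists>(A :: ('k, (nat list \<Rightarrow> 'k) set) module) (F :: (int \<Rightarrow> 'k) ring) \<phi>.
           in_variety K V A \<and>
           field F \<and> \<phi> \<in> ring_hom K F \<and>
           \<not> contains_free K V A \<and>
           contains_free K V (tensor_algebra K (extension_algebra F \<phi>) A)"
proof -
  interpret kfield K
    by (rule kfield.intro) fact
  from assms(3) show ?thesis
  proof (elim disjE conjE)
    assume V: "V = lie_identities"
    show ?thesis
    proof (rule twisted_example[OF assms(1,2), of "\<one>\<^bsub>K\<^esub>" "\<ominus>\<^bsub>K\<^esub> \<one>\<^bsub>K\<^esub>"])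
      show "scalars p \<subseteq> carrier K \<and> (\<forall>w. cf K (word_poly K \<one>\<^bsub>K\<^esub> (\<ominus>\<^bsub>K\<^esub> \<one>\<^bsub>K\<^esub>) p) w = \<zero>\<^bsub>K\<^esub>)" if "p \<in> V" for p
        by (rule lie_identities_words) (use that V in simp)
      fix p and \<tau> :: "nat \<Rightarrow> _" and B :: "('k, ((int \<Rightarrow> 'k) \<times> (nat list \<Rightarrow> 'k) set \<Rightarrow> 'k) set list \<Rightarrow> 'k) module"
      assume p: "scalars p \<subseteq> carrier K" "\<And>w. cf K (word_poly K \<one>\<^bsub>K\<^esub> (\<ominus>\<^bsub>K\<^esub> \<one>\<^bsub>K\<^esub>) p) w = \<zero>\<^bsub>K\<^esub>"
        and B: "in_variety K V B" "\<And>i. \<tau> i \<in> carrier B"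
      show "na_eval B \<tau> p = \<zero>\<^bsub>B\<^esub>"
        by (rule lie_identity[OF B(1)[unfolded V] p B(2)])
    qed simp_all
  next
    assume c: "\<one>\<^bsub>K\<^esub> \<oplus>\<^bsub>K\<^esub> \<one>\<^bsub>K\<^esub> \<noteq> \<zero>\<^bsub>K\<^esub>" and V: "V = special_jordan_identities K"
    show ?thesis
    proof (rule twisted_example[OF assms(1,2) half(1)[OF c] half(1)[OF c] half(2)[OF c]])
      show "scalars p \<subseteq> carrier K \<and> (\<forall>w. cf K (word_poly K half half p) w = \<zero>\<^bsub>K\<^esub>)" if "p \<in> V" for p
        using that unfolding V special_jordan_identities_iff[OF c] .
      fix p and \<tau> :: "nat \<Rightarrow> _" and B :: "('k, ((int \<Rightarrow> 'k) \<times> (nat list \<Rightarrow> 'k) set \<Rightarrow> 'k) set list \<Rightarrow> 'k) module"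
      assume p: "scalars p \<subseteq> carrier K" "\<And>w. cf K (word_poly K half half p) w = \<zero>\<^bsub>K\<^esub>"
        and B: "in_variety K V B" "\<And>i. \<tau> i \<in> carrier B"
      have "p \<in> V"
        unfolding V special_jordan_identities_iff[OF c] using p by blast
      then show "na_eval B \<tau> p = \<zero>\<^bsub>B\<^esub>"
        using B by (simp add: in_variety_def satisfies_identity_def)
    qed
  qed
qed

end
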